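(* Let $T>0$, $Q_T=(0,T)\times(0,1)$, and let $a,b,\lambda$ satisfy the Carleman hypothesis (C) stated in the context, with $K_1<2$. Let $\Theta,\psi,\varphi$ be the weight functions of the context. Then there exist two positive constants $C$ and $s_0$ such that, for every $h\in L^2(Q_T)$, every solution $v$ of $$\begin{cases} v_t+(av_x)_x+\dfrac{\lambda}{b(x)}v=h(t,x), & (t,x)\in Q_T,\\ v(t,0)=v(t,1)=0, & t\in(0,T),\\ v(T,x)=v_T(x), & x\in(0,1),\end{cases}$$ belonging to $$\mathcal V:=L^2\big(0,T;H^2_{a,b}(0,1)\big)\cap H^1\big(0,T;\mathcal H\big)$$ satisfies, for all $s\ge s_0$, $$\int_{Q_T}\Big(s\Theta a(v_x)^2+s^3\Theta^3\frac{(x-x_0)^2}{a}v^2\Big)e^{2s\varphi}\,dx\,dt\le C\Big(\int_{Q_T}h^2e^{2s\varphi}\,dx\,dt+sc_1\int_0^T\Big[a\Theta e^{2s\varphi(t,x)}(x-x_0)(v_x)^2\Big]_{x=0}^{x=1}dt\Big).$$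
   Context: Degeneracy hypotheses. Each of the following assumes that there is $x_0\in(0,1)$ with $a(x_0)=b(x_0)=0$, $a,b>0$ on $[0,1]\setminus\{x_0\}$, and constants $K_1,K_2$ with $(x-x_0)a'\le K_1a$ and $(x-x_0)b'\le K_2b$ a.e. in $[0,1]$. In addition: (WWD) $a,b\in W^{1,1}(0,1)$, $K_1,K_2\in(0,1)$; (WSD) $a\in W^{1,1}(0,1)$, $b\in W^{1,\infty}(0,1)$, $K_1\in(0,1)$, $K_2\ge1$; (SWD) $a\in W^{1,\infty}(0,1)$, $b\in W^{1,1}(0,1)$, $K_1\ge1$, $K_2\in(0,1)$; (SSD) $a,b\in W^{1,\infty}(0,1)$, $K_1,K_2\ge1$. Spaces. $H^1_a(0,1)=\{u\in W^{1,1}_0(0,1):\sqrt a\,u'\in L^2(0,1)\}$; $\mathcal H=H^1_{a,b}(0,1)=\{u\in H^1_a(0,1): u/\sqrt b\in L^2(0,1)\}$ with inner product $\int_0^1 au'v'\,dx+\int_0^1uv\,dx+\int_0^1\frac{uv}{b}\,dx$; $H^2_{a,b}(0,1)=\{u\in H^1_a(0,1): au'\in H^1(0,1),\ (au')'+\frac{\lambda}{b}u\in L^2(0,1)\}$. Constant $C^*$: whenever it exists, the best (smallest) constant $C$ such that $\int_0^1\frac{u^2}{b}dx\le C\int_0^1a(u')^2dx$ for all $u\in\mathcal H$ (such a $C$ exists under (WWD), (WSD) or (SWD) with $K_1+K_2\le2$). Basic hypothesis (B): either (1) one of (WWD), (WSD), (SWD) holds with $K_1+K_2\le2$ and $\lambda\in(0,1/C^*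 )$; or (2) one of (WWD), (WSD), (SWD), (SSD) holds and $\lambda<0$. Carleman hypothesis (C): (B) holds. Moreover, if $K_1>\frac43$, there is $\theta\in(0,K_1]$ such that $x\mapsto\frac{a(x)}{|x-x_0|^\theta}$ is non increasing on the left of $x_0$ and non decreasing on the right of $x_0$. In addition, when $K_1>\frac32$, this function is bounded below away from $0$ and there is $\Sigma>0$ with $|a'(x)|\le\Sigma|x-x_0|^{2\theta-3}$ for a.e. $x\in[0,1]$. Moreover, if $\lambda<0$, then $(x-x_0)b'(x)\ge0$ in $[0,1]$. Weights. $\varphi(t,x)=\Theta(t)\psi(x)$, with $\Theta(t)=\frac{1}{[t(T-t)]^4}$ and $\psi(x)=c_1\Big[\int_{x_0}^x\frac{y-x_0}{a(y)}dy-c_2\Big]$, where $c_1>0$ and $c_2>\sup_{x\in[0,1]}\int_{x_0}^x\frac{y-x_0}{a(y)}dy$ are fixed. *)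

theory Defs
  imports "HOL-Analysis.Analysis"
begin

section \<open>Lebesgue and Sobolev spaces\<close>

definition L1 :: "'a::euclidean_space set \<Rightarrow> ('a \<Rightarrow> real) set" where
  "L1 S = {f. integrable (lebesgue_on S) f}"

definition L2 :: "'a::euclidean_space set \<Rightarrow> ('a \<Rightarrow> real) set" where
  "L2 S = {f. f \<in> borel_measurable (lebesgue_on S) \<and> integrable (lebesgue_on S) (\<lambda>x. (f x)\<^sup>2)}"

definition Linf :: "'a::euclidean_space set \<Rightarrow> ('a \<Rightarrow> real) set" where
  "Linf S = {f. f \<in> borel_measurable (lebesgue_on S) \<and> (\<exists>M. AE x in lebesgue_on S. \<bar>f x\<bar> \<le> M)}"

text \<open>\<open>C\<^sup>1\<close> functions with compact support in the open interval \<open>(c,d)\<close>. As in Brezis' treatment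
  of Sobolev spaces in one variable, they serve as test functions for weak derivatives and
  their closure is \<open>W\<^sup>1\<^sup>,\<^sup>1\<^sub>0\<close>.\<close>

definition C1c :: "real \<Rightarrow> real \<Rightarrow> (real \<Rightarrow> real) set" where
  "C1c c d = {\<phi>. \<phi> differentiable_on UNIV \<and> continuous_on UNIV (deriv \<phi>) \<and>
     (\<exists>K. compact K \<and> K \<subseteq> {c<..<d} \<and> (\<forall>x. x \<notin> K \<longrightarrow> \<phi> x = 0))}"

definition has_weak_deriv :: "(real \<Rightarrow> real) \<Rightarrow> (real \<Rightarrow> real) \<Rightarrow> bool" where
  "has_weak_deriv u g \<longleftrightarrow> u \<in> L1 {0<..<1} \<and> g \<in> L1 {0<..<1} \<and>
     (\<forall>\<phi>\<in>C1c 0 1. (LINT x|lebesgue_on {0<..<1}. u x * deriv \<phi> x)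
                  = - (LINT x|lebesgue_on {0<..<1}. g x * \<phi> x))"

text \<open>Weak derivatives are unique almost everywhere; \<open>wderiv u\<close> is some representative.\<close>

definition wderiv :: "(real \<Rightarrow> real) \<Rightarrow> real \<Rightarrow> real" where
  "wderiv u = (SOME g. has_weak_deriv u g)"

definition W11 :: "(real \<Rightarrow> real) set" where
  "W11 = {u. \<exists>g. has_weak_deriv u g}"

definition W1inf :: "(real \<Rightarrow> real) set" where
  "W1inf = {u \<in> Linf {0<..<1}. \<exists>g \<in> Linf {0<..<1}. has_weak_deriv u g}"

definition H1 :: "(real \<Rightarrow> real) set" where
  "H1 = {u \<in> L2 {0<..<1}. \<exists>g \<in> L2 {0<..<1}. has_weak_deriv u g}"

definition W11_0 :: "(real \<Rightarrow> real) set" where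
  "W11_0 = {u \<in> W11. \<forall>\<epsilon>>0. \<exists>\<phi>\<in>C1c 0 1.
     (LINT x|lebesgue_on {0<..<1}. \<bar>u x - \<phi> x\<bar>)
     + (LINT x|lebesgue_on {0<..<1}. \<bar>wderiv u x - deriv \<phi> x\<bar>) < \<epsilon>}"

section \<open>The weighted spaces\<close>

definition H1a :: "(real \<Rightarrow> real) \<Rightarrow> (real \<Rightarrow> real) set" where
  "H1a a = {u \<in> W11_0. (\<lambda>x. sqrt (a x) * wderiv u x) \<in> L2 {0<..<1}}"

definition H1ab :: "(real \<Rightarrow> real) \<Rightarrow> (real \<Rightarrow> real) \<Rightarrow> (real \<Rightarrow> real) set" where
  "H1ab a b = {u \<in> H1a a. (\<lambda>x. u x / sqrt (b x)) \<in> L2 {0<..<1}}"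

definition inner_H1ab ::
    "(real \<Rightarrow> real) \<Rightarrow> (real \<Rightarrow> real) \<Rightarrow> (real \<Rightarrow> real) \<Rightarrow> (real \<Rightarrow> real) \<Rightarrow> real" where
  "inner_H1ab a b u v =
     (LINT x|lebesgue_on {0<..<1}. a x * wderiv u x * wderiv v x)
     + (LINT x|lebesgue_on {0<..<1}. u x * v x)
     + (LINT x|lebesgue_on {0<..<1}. u x * v x / b x)"

definition norm_H1ab :: "(real \<Rightarrow> real) \<Rightarrow> (real \<Rightarrow> real) \<Rightarrow> (real \<Rightarrow> real) \<Rightarrow> real" where
  "norm_H1ab a b u = sqrt (inner_H1ab a b u u)"

definition flux_deriv :: "(real \<Rightarrow> real) \<Rightarrow> (real \<Rightarrow> real) \<Rightarrow> real \<Rightarrow> real" where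
  "flux_deriv a u = wderiv (\<lambda>x. a x * wderiv u x)"

definition H2ab :: "(real \<Rightarrow> real) \<Rightarrow> (real \<Rightarrow> real) \<Rightarrow> real \<Rightarrow> (real \<Rightarrow> real) set" where
  "H2ab a b lam = {u \<in> H1a a. (\<lambda>x. a x * wderiv u x) \<in> H1 \<and>
     (\<lambda>x. flux_deriv a u x + lam / b x * u x) \<in> L2 {0<..<1}}"

text \<open>The Hilbert norm given by all the quantities that occur in the definition of
  \<open>H2ab\<close>. By the closed graph theorem, every complete norm on \<open>H2ab\<close> that controls
  the \<open>L2\<close> norm is equivalent to it.\<close>

definition norm_H2ab :: "(real \<Rightarrow> real) \<Rightarrow> (real \<Rightarrow> real) \<Rightarrow> real \<Rightarrow> (real \<Rightarrow> real) \<Rightarrow> real" where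
  "norm_H2ab a b lam u = sqrt (
     (LINT x|lebesgue_on {0<..<1}. (u x)\<^sup>2)
     + (LINT x|lebesgue_on {0<..<1}. a x * (wderiv u x)\<^sup>2)
     + (LINT x|lebesgue_on {0<..<1}. (a x * wderiv u x)\<^sup>2)
     + (LINT x|lebesgue_on {0<..<1}. (flux_deriv a u x)\<^sup>2)
     + (LINT x|lebesgue_on {0<..<1}. (flux_deriv a u x + lam / b x * u x)\<^sup>2))"

section \<open>Bochner spaces over \<open>(0,T)\<close>\<close>

text \<open>The library's Bochner integral needs a Banach space that is a type. Here the values lie in a
  set \<open>X\<close> of functions of \<open>x\<close> (representatives of classes modulo null sets)
  with norm \<open>N\<close>.\<close>

definition simple_valued ::
    "real \<Rightarrow> (real \<Rightarrow> real) set \<Rightarrow> (real \<Rightarrow> real \<Rightarrow> real) \<Rightarrow> bool" where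
  "simple_valued T X s \<longleftrightarrow>
     simple_function (lebesgue_on {0<..<T}) s \<and> (\<forall>t\<in>{0<..<T}. s t \<in> X)"

definition strongly_measurable ::
    "real \<Rightarrow> (real \<Rightarrow> real) set \<Rightarrow> ((real \<Rightarrow> real) \<Rightarrow> real) \<Rightarrow> (real \<Rightarrow> real \<Rightarrow> real) \<Rightarrow> bool" where
  "strongly_measurable T X N f \<longleftrightarrow>
     (\<exists>s. (\<forall>n::nat. simple_valued T X (s n)) \<and>
       (AE t in lebesgue_on {0<..<T}.
          f t \<in> X \<and> (\<lambda>n. N (\<lambda>x. f t x - s n t x)) \<longlonglongrightarrow> 0))"

definition bochner_L2 ::
    "real \<Rightarrow> (real \<Rightarrow> real) set \<Rightarrow> ((real \<Rightarrow> real) \<Rightarrow> real) \<Rightarrow> (real \<Rightarrow> real \<Rightarrow> real) set" where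
  "bochner_L2 T X N = {f. strongly_measurable T X N f \<and>
     integrable (lebesgue_on {0<..<T}) (\<lambda>t. (N (f t))\<^sup>2)}"

definition simple_bochner ::
    "real \<Rightarrow> (real \<Rightarrow> real \<Rightarrow> real) \<Rightarrow> real \<Rightarrow> real" where
  "simple_bochner T s x =
     (\<Sum>g \<in> s ` {0<..<T}. measure lebesgue {t \<in> {0<..<T}. s t = g} * g x)"

definition has_X_integral ::
    "real \<Rightarrow> (real \<Rightarrow> real) set \<Rightarrow> ((real \<Rightarrow> real) \<Rightarrow> real)
      \<Rightarrow> (real \<Rightarrow> real \<Rightarrow> real) \<Rightarrow> (real \<Rightarrow> real) \<Rightarrow> bool" where
  "has_X_integral T X N f J \<longleftrightarrow> J \<in> X \<and> strongly_measurable T X N f \<and>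
     (\<exists>s. (\<forall>n::nat. simple_valued T X (s n)) \<and>
       (\<lambda>n. \<integral>\<^sup>+ t. ennreal (N (\<lambda>x. f t x - s n t x)) \<partial>(lebesgue_on {0<..<T})) \<longlonglongrightarrow> 0 \<and>
       (\<lambda>n. N (\<lambda>x. simple_bochner T (s n) x - J x)) \<longlonglongrightarrow> 0)"

definition weak_time_deriv ::
    "real \<Rightarrow> (real \<Rightarrow> real) set \<Rightarrow> ((real \<Rightarrow> real) \<Rightarrow> real)
      \<Rightarrow> (real \<Rightarrow> real \<Rightarrow> real) \<Rightarrow> (real \<Rightarrow> real \<Rightarrow> real) \<Rightarrow> bool" where
  "weak_time_deriv T X N f g \<longleftrightarrow>
     (\<forall>\<phi>\<in>C1c 0 T. \<exists>J. has_X_integral T X N (\<lambda>t x. deriv \<phi> t * f t x) J \<and>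
                       has_X_integral T X N (\<lambda>t x. - (\<phi> t * g t x)) J)"

definition bochner_H1 ::
    "real \<Rightarrow> (real \<Rightarrow> real) set \<Rightarrow> ((real \<Rightarrow> real) \<Rightarrow> real) \<Rightarrow> (real \<Rightarrow> real \<Rightarrow> real) set" where
  "bochner_H1 T X N =
     {f \<in> bochner_L2 T X N. \<exists>g \<in> bochner_L2 T X N. weak_time_deriv T X N f g}"

definition V_space ::
    "real \<Rightarrow> (real \<Rightarrow> real) \<Rightarrow> (real \<Rightarrow> real) \<Rightarrow> real \<Rightarrow> (real \<Rightarrow> real \<Rightarrow> real) set" where
  "V_space T a b lam =
     bochner_L2 T (H2ab a b lam) (norm_H2ab a b lam) \<inter> bochner_H1 T (H1ab a b) (norm_H1ab a b)"

section \<open>Hypotheses on the coefficients\<close>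

text \<open>The continuity clauses select the continuous representatives of the Sobolev functions
  \<open>a\<close> and \<open>b\<close>, to which the pointwise conditions refer.\<close>

definition degenerate ::
    "(real \<Rightarrow> real) \<Rightarrow> (real \<Rightarrow> real) \<Rightarrow> real \<Rightarrow> real \<Rightarrow> real \<Rightarrow> bool" where
  "degenerate a b x0 K1 K2 \<longleftrightarrow>
     continuous_on {0..1} a \<and> continuous_on {0..1} b \<and>
     x0 \<in> {0<..<1} \<and> a x0 = 0 \<and> b x0 = 0 \<and>
     (\<forall>x \<in> {0..1} - {x0}. a x > 0 \<and> b x > 0) \<and>
     (AE x in lebesgue_on {0..1}. (x - x0) * wderiv a x \<le> K1 * a x) \<and>
     (AE x in lebesgue_on {0..1}. (x - x0) * wderiv b x \<le> K2 * b x)"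

definition WWD :: "(real \<Rightarrow> real) \<Rightarrow> (real \<Rightarrow> real) \<Rightarrow> real \<Rightarrow> real \<Rightarrow> real \<Rightarrow> bool" where
  "WWD a b x0 K1 K2 \<longleftrightarrow> degenerate a b x0 K1 K2 \<and>
     a \<in> W11 \<and> b \<in> W11 \<and> K1 \<in> {0<..<1} \<and> K2 \<in> {0<..<1}"

definition WSD :: "(real \<Rightarrow> real) \<Rightarrow> (real \<Rightarrow> real) \<Rightarrow> real \<Rightarrow> real \<Rightarrow> real \<Rightarrow> bool" where
  "WSD a b x0 K1 K2 \<longleftrightarrow> degenerate a b x0 K1 K2 \<and>
     a \<in> W11 \<and> b \<in> W1inf \<and> K1 \<in> {0<..<1} \<and> K2 \<ge> 1"

definition SWD :: "(real \<Rightarrow> real) \<Rightarrow> (real \<Rightarrow> real) \<Rightarrow> real \<Rightarrow> real \<Rightarrow> real \<Rightarrow> bool" where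
  "SWD a b x0 K1 K2 \<longleftrightarrow> degenerate a b x0 K1 K2 \<and>
     a \<in> W1inf \<and> b \<in> W11 \<and> K1 \<ge> 1 \<and> K2 \<in> {0<..<1}"

definition SSD :: "(real \<Rightarrow> real) \<Rightarrow> (real \<Rightarrow> real) \<Rightarrow> real \<Rightarrow> real \<Rightarrow> real \<Rightarrow> bool" where
  "SSD a b x0 K1 K2 \<longleftrightarrow> degenerate a b x0 K1 K2 \<and>
     a \<in> W1inf \<and> b \<in> W1inf \<and> K1 \<ge> 1 \<and> K2 \<ge> 1"

definition hardy_constant :: "(real \<Rightarrow> real) \<Rightarrow> (real \<Rightarrow> real) \<Rightarrow> real \<Rightarrow> bool" where
  "hardy_constant a b C \<longleftrightarrow> (\<forall>u \<in> H1ab a b.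
     (LINT x|lebesgue_on {0<..<1}. (u x)\<^sup>2 / b x)
       \<le> C * (LINT x|lebesgue_on {0<..<1}. a x * (wderiv u x)\<^sup>2))"

definition best_hardy_constant :: "(real \<Rightarrow> real) \<Rightarrow> (real \<Rightarrow> real) \<Rightarrow> real \<Rightarrow> bool" where
  "best_hardy_constant a b C \<longleftrightarrow>
     hardy_constant a b C \<and> (\<forall>C'. hardy_constant a b C' \<longrightarrow> C \<le> C')"

definition basic_hyp ::
    "(real \<Rightarrow> real) \<Rightarrow> (real \<Rightarrow> real) \<Rightarrow> real \<Rightarrow> real \<Rightarrow> real \<Rightarrow> real \<Rightarrow> bool" where
  "basic_hyp a b lam x0 K1 K2 \<longleftrightarrow>
     ((WWD a b x0 K1 K2 \<or> WSD a b x0 K1 K2 \<or> SWD a b x0 K1 K2) \<and> K1 + K2 \<le> 2 \<and>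
        (\<exists>Cstar. best_hardy_constant a b Cstar \<and> lam \<in> {0<..<1 / Cstar}))
   \<or> ((WWD a b x0 K1 K2 \<or> WSD a b x0 K1 K2 \<or> SWD a b x0 K1 K2 \<or> SSD a b x0 K1 K2) \<and> lam < 0)"

definition carleman_hyp ::
    "(real \<Rightarrow> real) \<Rightarrow> (real \<Rightarrow> real) \<Rightarrow> real \<Rightarrow> real \<Rightarrow> real \<Rightarrow> real \<Rightarrow> bool" where
  "carleman_hyp a b lam x0 K1 K2 \<longleftrightarrow>
     basic_hyp a b lam x0 K1 K2 \<and>
     (K1 > 4/3 \<longrightarrow>
       (\<exists>\<theta>. 0 < \<theta> \<and> \<theta> \<le> K1 \<and>
          antimono_on {0..<x0} (\<lambda>x. a x / \<bar>x - x0\<bar> powr \<theta>) \<and>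
          mono_on {x0<..1} (\<lambda>x. a x / \<bar>x - x0\<bar> powr \<theta>) \<and>
          (K1 > 3/2 \<longrightarrow>
             (\<exists>c>0. \<forall>x \<in> {0..1} - {x0}. a x / \<bar>x - x0\<bar> powr \<theta> \<ge> c) \<and>
             (\<exists>\<Sigma>>0. AE x in lebesgue_on {0..1}.
                \<bar>wderiv a x\<bar> \<le> \<Sigma> * \<bar>x - x0\<bar> powr (2 * \<theta> - 3))))) \<and>
     (lam < 0 \<longrightarrow> (AE x in lebesgue_on {0..1}. (x - x0) * wderiv b x \<ge> 0))"

section \<open>Weights\<close>

definition Theta :: "real \<Rightarrow> real \<Rightarrow> real" where
  "Theta T t = 1 / (t * (T - t)) ^ 4"

definition psi_int :: "(real \<Rightarrow> real) \<Rightarrow> real \<Rightarrow> real \<Rightarrow> real" where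
  "psi_int a x0 x = (LBINT y=ereal x0..ereal x. (y - x0) / a y)"

definition psi :: "(real \<Rightarrow> real) \<Rightarrow> real \<Rightarrow> real \<Rightarrow> real \<Rightarrow> real \<Rightarrow> real" where
  "psi a x0 c1 c2 x = c1 * (psi_int a x0 x - c2)"

definition phi :: "real \<Rightarrow> (real \<Rightarrow> real) \<Rightarrow> real \<Rightarrow> real \<Rightarrow> real \<Rightarrow> real \<Rightarrow> real \<Rightarrow> real" where
  "phi T a x0 c1 c2 t x = Theta T t * psi a x0 c1 c2 x"

section \<open>The parabolic problem\<close>

text \<open>An element of \<open>V_space\<close> is a class of functions; the first two clauses select the
  representative that is continuous in \<open>t \<in> [0,T]\<close> with values in \<open>H1ab\<close> and, for each
  \<open>t\<close>, continuous in \<open>x \<in> [0,1]\<close>, so that the terminal and boundary values make sense.\<close>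

definition solves ::
    "real \<Rightarrow> (real \<Rightarrow> real) \<Rightarrow> (real \<Rightarrow> real) \<Rightarrow> real \<Rightarrow> (real \<times> real \<Rightarrow> real) \<Rightarrow> (real \<Rightarrow> real)
      \<Rightarrow> (real \<Rightarrow> real \<Rightarrow> real) \<Rightarrow> bool" where
  "solves T a b lam h vT v \<longleftrightarrow>
     (\<forall>t\<in>{0..T}. v t \<in> H1ab a b \<and>
        ((\<lambda>r. norm_H1ab a b (\<lambda>x. v r x - v t x)) \<longlongrightarrow> 0) (at t within {0..T})) \<and>
     (\<forall>t\<in>{0..T}. continuous_on {0..1} (v t)) \<and>
     (\<exists>vt \<in> bochner_L2 T (H1ab a b) (norm_H1ab a b).
        weak_time_deriv T (H1ab a b) (norm_H1ab a b) v vt \<and>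
        (AE t in lebesgue_on {0<..<T}. AE x in lebesgue_on {0<..<1}.
           vt t x + flux_deriv a (v t) x + lam / b x * v t x = h (t, x))) \<and>
     (\<forall>t\<in>{0<..<T}. v t 0 = 0 \<and> v t 1 = 0) \<and>
     (AE x in lebesgue_on {0<..<1}. v T x = vT x)"

text \<open>\<open>vx\<close> represents \<open>v\<^sub>x\<close>. For \<open>v \<in> L\<^sup>2(0,T;H2ab)\<close> and almost every \<open>t\<close>, the flux \<open>a v\<^sub>x\<close> lies in
  \<open>H\<^sup>1(0,1) \<subseteq> C[0,1]\<close>, hence \<open>v\<^sub>x\<close> has a unique representative on \<open>[0,1] - {x0}\<close> that is
  continuous there; its values at \<open>0\<close> and \<open>1\<close> are the boundary values of \<open>v\<^sub>x\<close>.
  Being continuous in \<open>x\<close> and measurable in \<open>t\<close>, such \<open>v\<close> and \<open>vx\<close> are jointly measurable.\<close>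

definition space_deriv ::
    "real \<Rightarrow> real \<Rightarrow> (real \<Rightarrow> real \<Rightarrow> real) \<Rightarrow> (real \<Rightarrow> real \<Rightarrow> real) \<Rightarrow> bool" where
  "space_deriv T x0 v vx \<longleftrightarrow>
     (AE t in lebesgue_on {0<..<T}.
        has_weak_deriv (v t) (vx t) \<and> continuous_on ({0..1} - {x0}) (vx t))"

end

theory Submission
  imports Defs
begin

text \<open>Put \<open>w = e\<^bsup>s\<phi>\<^esup> v\<close> and \<open>k = s c\<^sub>1 \<Theta>\<close>. Since \<open>a \<phi>\<^sub>x = c\<^sub>1 \<Theta> (x - x\<^sub>0)\<close>, the conjugated equation reads
  \<open>L + w\<^sub>t + R = e\<^bsup>s\<phi>\<^esup> h\<close> with \<open>L = (a w\<^sub>x)\<^sub>x + \<lambda> w / b + m w\<close>, \<open>R = - 2 k (x - x\<^sub>0) w\<^sub>x - k w\<close> and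
  \<open>m = - s \<phi>\<^sub>t + s\<^sup>2 a \<phi>\<^sub>x\<^sup>2\<close>, so \<open>2 \<langle>L, w\<^sub>t + R\<rangle> \<le> \<parallel>e\<^bsup>s\<phi>\<^esup> h\<parallel>\<^sup>2\<close> at almost every time. The product \<open>\<langle>L, w\<^sub>t\<rangle>\<close> is
  the time derivative of an energy that vanishes at \<open>t = 0, T\<close>, up to \<open>\<integral> m\<^sub>t w\<^sup>2\<close>. The product \<open>\<langle>L, R\<rangle>\<close>
  gives \<open>(2 - K\<^sub>1) (k \<integral> a w\<^sub>x\<^sup>2 + k\<^sup>3 \<integral> (x - x\<^sub>0)\<^sup>2 w\<^sup>2 / a)\<close>, the boundary terms, and a singular term controlled by
  the sign of \<open>(x - x\<^sub>0) b'\<close> or by the best constant \<open>C\<^sup>*\<close>. The remaining terms are absorbed for large \<open>s\<close>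
  with the uncertainty inequality \<open>\<integral> w\<^sup>2 = - 2 \<integral> (x - x\<^sub>0) w w\<^sub>x \<le> k\<^sup>-\<^sup>1 \<integral> a w\<^sub>x\<^sup>2 + k \<integral> (x - x\<^sub>0)\<^sup>2 w\<^sup>2 / a\<close>.\<close>

section \<open>Absolutely continuous functions\<close>

text \<open>Two obstacles shape the proof. In space nothing may be differentiated across x0, where
  1/a and 1/b blow up. The weight is built so that a psi' = c1 (x - x0) is affine. Then (a phi_x)_x
  = c1 Theta is constant in x, and derivatives of the coefficients enter only through (x - x0) a'/a
  and (x - x0) b'/b. Upper bounds on these quotients are enough, because both occur with a
  favourable sign; 2 - K1 is what the first one leaves. In time, v_t lies only in the energy space,
  so L itself has no usable time derivative. The energy identity is therefore derived weakly: every
  L2-valued curve is tested against fixed functions, which turns Bochner statements into statements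
  on absolutely continuous functions of t, and the product rule is rebuilt from there. For this
  reason absolute continuity is encoded by an integrable density and the integral formula, not by
  pointwise derivatives; weak derivatives, product rules and one-sided comparison then share one
  notion. The bounds |Theta'|, |Theta''| \<le> c Theta^2 balance the powers of s Theta and fix the
  threshold for s.\<close>

definition ac_on :: "real \<Rightarrow> real \<Rightarrow> (real \<Rightarrow> real) \<Rightarrow> (real \<Rightarrow> real) \<Rightarrow> bool" where
  "ac_on p q f f' \<longleftrightarrow> f' absolutely_integrable_on {p..q} \<and>
     (\<forall>x\<in>{p..q}. f x = f p + integral {p..x} f')"

lemma integrable_on_real_cmult: "f integrable_on S \<Longrightarrow> (\<lambda>x. c * f x :: real) integrable_on S"
  using integrable_cmul[of f S c] by simp

lemma ac_on_abs_int: "ac_on p q f f' \<Longrightarrow> f' absolutely_integrable_on {p..q}"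
  by (simp add: ac_on_def)

lemma ac_on_int: "ac_on p q f f' \<Longrightarrow> f' integrable_on {p..q}"
  by (simp add: ac_on_def absolutely_integrable_on_def)

lemma ac_on_eq: "ac_on p q f f' \<Longrightarrow> x \<in> {p..q} \<Longrightarrow> f x = f p + integral {p..x} f'"
  unfolding ac_on_def by blast

lemma abs_int_sub:
  fixes f :: "real \<Rightarrow> real"
  shows "f absolutely_integrable_on {p..q} \<Longrightarrow> p \<le> r \<Longrightarrow> t \<le> q \<Longrightarrow> f absolutely_integrable_on {r..t}"
  by (erule absolutely_integrable_on_subinterval) auto

lemma abs_int_sub_int:
  fixes f :: "real \<Rightarrow> real"
  shows "f absolutely_integrable_on {p..q} \<Longrightarrow> p \<le> r \<Longrightarrow> t \<le> q \<Longrightarrow> f integrable_on {r..t}"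
  using abs_int_sub absolutely_integrable_on_def by blast

lemma ac_on_diff:
  assumes "ac_on p q f f'" "p \<le> r" "r \<le> t" "t \<le> q"
  shows "integral {r..t} f' = f t - f r"
proof -
  have i: "f' integrable_on {p..t}"
    by (rule abs_int_sub_int[OF ac_on_abs_int[OF assms(1)]]) (use assms in auto)
  have "integral {p..r} f' + integral {r..t} f' = integral {p..t} f'"
    using assms by (intro Henstock_Kurzweil_Integration.integral_combine i) auto
  moreover have "f r = f p + integral {p..r} f'" "f t = f p + integral {p..t} f'"
    by (rule ac_on_eq[OF assms(1)], use assms in auto)+
  ultimately show ?thesis by simp
qed

lemma ac_on_cont:
  assumes "ac_on p q f f'"
  shows "continuous_on {p..q} f"
proof -
  have "continuous_on {p..q} (\<lambda>x. f p + integral {p..x} f')"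
    by (intro continuous_intros indefinite_integral_continuous_1 ac_on_int[OF assms])
  then show ?thesis
    by (rule continuous_on_eq) (simp add: ac_on_eq[OF assms, symmetric])
qed

lemma ac_onI:
  assumes "f' absolutely_integrable_on {p..q}"
    and "\<And>t. p \<le> t \<Longrightarrow> t \<le> q \<Longrightarrow> integral {p..t} f' = f t - f p"
  shows "ac_on p q f f'"
  unfolding ac_on_def using assms(1) by (simp add: assms(2))

lemma ac_on_sub:
  assumes "ac_on p q f f'" "p \<le> r" "t \<le> q"
  shows "ac_on r t f f'"
  using assms by (intro ac_onI ac_on_diff[OF assms(1)] abs_int_sub[OF ac_on_abs_int[OF assms(1)]]) auto

lemma ac_on_cong:
  assumes "ac_on p q f f'" "\<And>x. p \<le> x \<Longrightarrow> x \<le> q \<Longrightarrow> f x = g x"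
    and "negligible S" "\<And>x. p \<le> x \<Longrightarrow> x \<le> q \<Longrightarrow> x \<notin> S \<Longrightarrow> f' x = g' x"
  shows "ac_on p q g g'"
proof (rule ac_onI)
  show "g' absolutely_integrable_on {p..q}"
    using assms by (intro absolutely_integrable_spike[OF ac_on_abs_int[OF assms(1)] assms(3)]) auto
  fix t assume t: "p \<le> t" "t \<le> q"
  have "integral {p..t} g' = integral {p..t} f'"
    using t assms by (intro integral_spike[OF assms(3)]) auto
  then show "integral {p..t} g' = g t - g p"
    using ac_on_diff[OF assms(1), of p t] t assms(2)[of p] assms(2)[of t] by simp
qed

text \<open>The fundamental theorem of calculus from a local estimate of the increments. The product and
  chain rules, and all differentiations in time, are instances.\<close>

lemma ac_onI_partition:
  fixes E G N :: "real \<Rightarrow> real"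
  assumes G: "G absolutely_integrable_on {p..q}" and N: "N absolutely_integrable_on {p..q}"
    and N0: "\<And>x. x \<in> {p..q} \<Longrightarrow> 0 \<le> N x"
    and *: "\<And>\<epsilon>. \<epsilon> > 0 \<Longrightarrow> \<exists>\<delta>>0. \<forall>r t. p \<le> r \<longrightarrow> r \<le> t \<longrightarrow> t \<le> q \<longrightarrow> t - r < \<delta> \<longrightarrow>
              \<bar>E t - E r - integral {r..t} G\<bar> \<le> \<epsilon> * integral {r..t} N"
  shows "ac_on p q E G"
proof (rule ac_onI[OF G])
  fix x assume x: "p \<le> x" "x \<le> q"
  have comb: "integral {p..r} f + integral {r..t} f = integral {p..t} f"
    if "p \<le> r" "r \<le> t" "t \<le> q" "f absolutely_integrable_on {p..q}" for f :: "real \<Rightarrow> real" and r t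
    using that abs_int_sub_int[of p q f p t] by (intro Henstock_Kurzweil_Integration.integral_combine) auto
  have key: "\<bar>E x - E p - integral {p..x} G\<bar> \<le> \<epsilon> * integral {p..x} N" if e: "\<epsilon> > 0" for \<epsilon>
  proof -
    obtain d where d: "d > 0" and D: "\<And>r t. p \<le> r \<Longrightarrow> r \<le> t \<Longrightarrow> t \<le> q \<Longrightarrow> t - r < d \<Longrightarrow>
              \<bar>E t - E r - integral {r..t} G\<bar> \<le> \<epsilon> * integral {r..t} N"
      using *[OF e] by blast
    obtain n :: nat where n: "(x - p) / d < real n" using reals_Archimedean2 by blast
    have np: "real n > 0"
    proof -
    have "0 \<le> (x - p) / d" using x d by simp
    then show ?thesis using n by linarith
  qed
    \<comment> \<open>Cut \<open>{p..x}\<close> into n equal pieces shorter than d. The local errors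
      then add up to at most \<open>\<epsilon>\<close> times the full integral of N.\<close>
    define h where "h = (x - p) / n"
    have h0: "h \<ge> 0" using x np by (simp add: h_def)
    have hd: "h < d" using n np d by (simp add: h_def field_simps)
    have "\<bar>E (p + k * h) - E p - integral {p..p + k * h} G\<bar> \<le> \<epsilon> * integral {p..p + k * h} N"
      if "k \<le> n" for k :: nat
      using that
    proof (induction k)
      case (Suc k)
      let ?r = "p + k * h" and ?t = "p + Suc k * h"
      have "real (Suc k) * h \<le> real n * h" using Suc.prems h0 by (intro mult_right_mono) auto
      also have "\<dots> = x - p" using np by (simp add: h_def)
      finally have tx: "?t \<le> x" by simp
      have rt: "p \<le> ?r" "?r \<le> ?t" "?t \<le> q" "?t - ?r < d"
        using h0 hd tx x by (auto simp: algebra_simps)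
      note D[OF rt]
      moreover note Suc.IH comb[OF rt(1-3) G] comb[OF rt(1-3) N]
      moreover have "\<epsilon> * integral {p..?t} N = \<epsilon> * integral {p..?r} N + \<epsilon> * integral {?r..?t} N"
        using comb[OF rt(1-3) N] by (metis distrib_left)
      ultimately show ?case using Suc.prems by linarith
    qed simp
    from this[of n] np show ?thesis by (simp add: h_def)
  qed
  have N1: "integral {p..x} N \<ge> 0"
    using x N0 abs_int_sub_int[OF N, of p x] by (intro Henstock_Kurzweil_Integration.integral_nonneg) auto
  have "\<bar>E x - E p - integral {p..x} G\<bar> \<le> 0 + e" if "e > 0" for e
  proof -
    have "e / (integral {p..x} N + 1) * integral {p..x} N \<le> e"
      using that N1 by (simp add: field_simps)
    then show ?thesis using key[of "e / (integral {p..x} N + 1)"] that N1 by auto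
  qed
  then have "\<bar>E x - E p - integral {p..x} G\<bar> \<le> 0"
    by (rule field_le_epsilon)
  then show "integral {p..x} G = E x - E p" by simp
qed

section \<open>Calculus rules: linearity, products, composition, integration by parts\<close>

lemma ac_on_add:
  assumes "ac_on p q f f'" "ac_on p q g g'"
  shows "ac_on p q (\<lambda>x. f x + g x) (\<lambda>x. f' x + g' x)"
proof (rule ac_onI)
  show "(\<lambda>x. f' x + g' x) absolutely_integrable_on {p..q}"
    by (intro set_integral_add assms[THEN ac_on_abs_int])
  fix t assume t: "p \<le> t" "t \<le> q"
  then show "integral {p..t} (\<lambda>x. f' x + g' x) = f t + g t - (f p + g p)"
    using ac_on_diff[OF assms(1), of p t] ac_on_diff[OF assms(2), of p t]
      abs_int_sub_int[OF ac_on_abs_int[OF assms(1)], of p t] abs_int_sub_int[OF ac_on_abs_int[OF assms(2)], of p t]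
    by (simp add: Henstock_Kurzweil_Integration.integral_add)
qed

lemma ac_on_cmult:
  assumes "ac_on p q f f'"
  shows "ac_on p q (\<lambda>x. c * f x) (\<lambda>x. c * f' x)"
proof (rule ac_onI)
  show "(\<lambda>x. c * f' x) absolutely_integrable_on {p..q}"
    using ac_on_abs_int[OF assms] by simp
  fix t assume t: "p \<le> t" "t \<le> q"
  then show "integral {p..t} (\<lambda>x. c * f' x) = c * f t - c * f p"
    by (simp add: ac_on_diff[OF assms] right_diff_distrib)
qed

lemma ac_on_const: "ac_on p q (\<lambda>x. c) (\<lambda>x. 0)"
  by (rule ac_onI) auto

lemma ac_on_minus: "ac_on p q f f' \<Longrightarrow> ac_on p q (\<lambda>x. - f x) (\<lambda>x. - f' x)"
  using ac_on_cmult[of p q f f' "-1"] by simp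

lemma ac_on_sub_fun:
  "ac_on p q f f' \<Longrightarrow> ac_on p q g g' \<Longrightarrow> ac_on p q (\<lambda>x. f x - g x) (\<lambda>x. f' x - g' x)"
  using ac_on_add[of p q f f' "\<lambda>x. - g x" "\<lambda>x. - g' x"] ac_on_minus[of p q g g'] by simp

lemma abs_int_mult_cont:
  fixes f g :: "real \<Rightarrow> real"
  assumes "continuous_on {p..q} f" "g absolutely_integrable_on {p..q}"
  shows "(\<lambda>x. f x * g x) absolutely_integrable_on {p..q}"
proof (rule absolutely_integrable_bounded_measurable_product_real[OF _ _ _ assms(2)])
  show "f \<in> borel_measurable (lebesgue_on {p..q})"
    using assms(1) by (intro continuous_imp_measurable_on_sets_lebesgue) auto
  show "bounded (f ` {p..q})"
    using assms(1) by (intro compact_imp_bounded compact_continuous_image) auto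
qed auto

lemma abs_integral_le:
  fixes f g :: "real \<Rightarrow> real"
  assumes "f integrable_on S" "g integrable_on S" "\<And>x. x \<in> S \<Longrightarrow> \<bar>f x\<bar> \<le> g x"
  shows "\<bar>integral S f\<bar> \<le> integral S g"
  using integral_norm_bound_integral[OF assms(1,2)] assms(3) by simp

lemma unif_cont_Icc:
  fixes f :: "real \<Rightarrow> real"
  assumes "continuous_on {p..q} f" "e > 0"
  shows "\<exists>d>0. \<forall>x\<in>{p..q}. \<forall>y\<in>{p..q}. \<bar>x - y\<bar> < d \<longrightarrow> \<bar>f x - f y\<bar> < e"
proof -
  have "uniformly_continuous_on {p..q} f"
    using assms(1) by (intro compact_uniformly_continuous) auto
  then show ?thesis using assms(2) unfolding uniformly_continuous_on_def dist_real_def by metis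
qed

text \<open>With f frozen at the right end and g at the left end of a short interval, the increment
  of the product is an exact combination of the integrals of g' and f'. What remains is controlled
  by the oscillation of f and g, which is uniformly small.\<close>

lemma ac_on_mult:
  assumes f: "ac_on p q f f'" and g: "ac_on p q g g'"
  shows "ac_on p q (\<lambda>x. f x * g x) (\<lambda>x. f x * g' x + g x * f' x)"
proof (rule ac_onI_partition[where N = "\<lambda>x. \<bar>g' x\<bar> + \<bar>f' x\<bar>"])
  note fi = ac_on_abs_int[OF f] and gi = ac_on_abs_int[OF g]
  have A1: "(\<lambda>x. f x * g' x) absolutely_integrable_on {p..q}"
    by (rule abs_int_mult_cont[OF ac_on_cont[OF f] gi])
  have A2: "(\<lambda>x. g x * f' x) absolutely_integrable_on {p..q}"
    by (rule abs_int_mult_cont[OF ac_on_cont[OF g] fi])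
  show A: "(\<lambda>x. f x * g' x + g x * f' x) absolutely_integrable_on {p..q}"
    by (intro set_integral_add A1 A2)
  show N: "(\<lambda>x. \<bar>g' x\<bar> + \<bar>f' x\<bar>) absolutely_integrable_on {p..q}"
    by (intro set_integral_add set_integrable_abs fi gi)
  fix e :: real assume e: "e > 0"
  obtain d1 where d1: "d1 > 0" "\<And>x y. x \<in> {p..q} \<Longrightarrow> y \<in> {p..q} \<Longrightarrow> \<bar>x - y\<bar> < d1 \<Longrightarrow> \<bar>f x - f y\<bar> < e"
    using unif_cont_Icc[OF ac_on_cont[OF f] e] by blast
  obtain d2 where d2: "d2 > 0" "\<And>x y. x \<in> {p..q} \<Longrightarrow> y \<in> {p..q} \<Longrightarrow> \<bar>x - y\<bar> < d2 \<Longrightarrow> \<bar>g x - g y\<bar> < e"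
    using unif_cont_Icc[OF ac_on_cont[OF g] e] by blast
  show "\<exists>\<delta>>0. \<forall>r t. p \<le> r \<longrightarrow> r \<le> t \<longrightarrow> t \<le> q \<longrightarrow> t - r < \<delta> \<longrightarrow>
       \<bar>f t * g t - f r * g r - integral {r..t} (\<lambda>x. f x * g' x + g x * f' x)\<bar>
       \<le> e * integral {r..t} (\<lambda>x. \<bar>g' x\<bar> + \<bar>f' x\<bar>)"
  proof (intro exI[of _ "min d1 d2"] conjI allI impI)
    fix r t assume rt: "p \<le> r" "r \<le> t" "t \<le> q" "t - r < min d1 d2"
    note sub = abs_int_sub_int[OF _ rt(1) rt(3)]
    have "f t * g t - f r * g r = f t * integral {r..t} g' + g r * integral {r..t} f'"
      unfolding ac_on_diff[OF f rt(1-3)] ac_on_diff[OF g rt(1-3)] by (simp add: algebra_simps)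
    also have "\<dots> = integral {r..t} (\<lambda>x. f t * g' x + g r * f' x)"
      by (subst Henstock_Kurzweil_Integration.integral_add)
        (auto intro!: integrable_on_real_cmult sub[OF fi] sub[OF gi])
    finally have "f t * g t - f r * g r - integral {r..t} (\<lambda>x. f x * g' x + g x * f' x)
       = integral {r..t} (\<lambda>x. (f t * g' x + g r * f' x) - (f x * g' x + g x * f' x))"
      by (subst Henstock_Kurzweil_Integration.integral_diff)
        (auto intro!: integrable_add integrable_on_real_cmult sub[OF fi] sub[OF gi] sub[OF A])
    moreover have "\<bar>\<dots>\<bar> \<le> integral {r..t} (\<lambda>x. e * (\<bar>g' x\<bar> + \<bar>f' x\<bar>))"
    proof (rule abs_integral_le)
      show "(\<lambda>x. f t * g' x + g r * f' x - (f x * g' x + g x * f' x)) integrable_on {r..t}"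
        by (intro integrable_add integrable_diff integrable_on_real_cmult sub[OF fi] sub[OF gi] sub[OF A])
      show "(\<lambda>x. e * (\<bar>g' x\<bar> + \<bar>f' x\<bar>)) integrable_on {r..t}"
        by (intro integrable_on_real_cmult sub[OF N])
      fix x assume x: "x \<in> {r..t}"
      have 1: "\<bar>f t - f x\<bar> \<le> e" "\<bar>g r - g x\<bar> \<le> e"
        using x rt d1(2)[of t x] d2(2)[of r x] by auto
      have "\<bar>f t * g' x + g r * f' x - (f x * g' x + g x * f' x)\<bar> = \<bar>(f t - f x) * g' x + (g r - g x) * f' x\<bar>"
        by (simp add: algebra_simps)
      also have "\<dots> \<le> \<bar>f t - f x\<bar> * \<bar>g' x\<bar> + \<bar>g r - g x\<bar> * \<bar>f' x\<bar>"
        by (metis abs_mult abs_triangle_ineq)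
      also have "\<dots> \<le> e * \<bar>g' x\<bar> + e * \<bar>f' x\<bar>"
        by (intro add_mono mult_right_mono 1) auto
      finally show "\<bar>f t * g' x + g r * f' x - (f x * g' x + g x * f' x)\<bar> \<le> e * (\<bar>g' x\<bar> + \<bar>f' x\<bar>)"
        by (simp add: algebra_simps)
    qed
    ultimately show "\<bar>f t * g t - f r * g r - integral {r..t} (\<lambda>x. f x * g' x + g x * f' x)\<bar>
       \<le> e * integral {r..t} (\<lambda>x. \<bar>g' x\<bar> + \<bar>f' x\<bar>)" by simp
  qed (use d1 d2 in auto)
qed auto

text \<open>The mean value theorem writes the increment of the composition as
  \<open>\<Phi>' z\<close> times the increment of f, with z between two values of f. Uniform
  continuity of f and then of \<open>\<Phi>'\<close> lets \<open>\<Phi>' z\<close> be replaced by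
  \<open>\<Phi>' (f x)\<close> throughout the short interval.\<close>

lemma ac_on_compose:
  assumes f: "ac_on p q f f'"
    and der: "\<And>y. y \<in> {u..v} \<Longrightarrow> (\<Phi> has_real_derivative \<Phi>' y) (at y)"
    and cont: "continuous_on {u..v} \<Phi>'" and range: "\<And>x. x \<in> {p..q} \<Longrightarrow> f x \<in> {u..v}"
  shows "ac_on p q (\<lambda>x. \<Phi> (f x)) (\<lambda>x. \<Phi>' (f x) * f' x)"
proof (rule ac_onI_partition[where N = "\<lambda>x. \<bar>f' x\<bar>"])
  note fi = ac_on_abs_int[OF f] and fc = ac_on_cont[OF f]
  have c: "continuous_on {p..q} (\<lambda>x. \<Phi>' (f x))"
    by (rule continuous_on_compose2[OF cont fc]) (use range in auto)
  show A: "(\<lambda>x. \<Phi>' (f x) * f' x) absolutely_integrable_on {p..q}"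
    by (rule abs_int_mult_cont[OF c fi])
  show N: "(\<lambda>x. \<bar>f' x\<bar>) absolutely_integrable_on {p..q}"
    by (intro set_integrable_abs fi)
  fix e :: real assume e: "e > 0"
  obtain d1 where d1: "d1 > 0" "\<And>x y. x \<in> {u..v} \<Longrightarrow> y \<in> {u..v} \<Longrightarrow> \<bar>x - y\<bar> < d1 \<Longrightarrow> \<bar>\<Phi>' x - \<Phi>' y\<bar> < e"
    using unif_cont_Icc[OF cont e] by blast
  obtain d2 where d2: "d2 > 0" "\<And>x y. x \<in> {p..q} \<Longrightarrow> y \<in> {p..q} \<Longrightarrow> \<bar>x - y\<bar> < d2 \<Longrightarrow> \<bar>f x - f y\<bar> < d1 / 2"
    using unif_cont_Icc[OF fc, of "d1/2"] d1(1) by auto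
  have mvt: "\<exists>z. \<Phi> B - \<Phi> A = \<Phi>' z * (B - A) \<and> min A B \<le> z \<and> z \<le> max A B" if "A \<in> {u..v}" "B \<in> {u..v}" for A B
  proof (cases A B rule: linorder_cases)
    case less
    have "\<exists>z>A. z < B \<and> \<Phi> B - \<Phi> A = (B - A) * \<Phi>' z"
      by (rule MVT2[OF less]) (use der that in auto)
    then obtain z where "A < z" "z < B" "\<Phi> B - \<Phi> A = (B - A) * \<Phi>' z" by blast
    then show ?thesis by (intro exI[of _ z]) auto
  next
    case greater
    have "\<exists>z>B. z < A \<and> \<Phi> A - \<Phi> B = (A - B) * \<Phi>' z"
      by (rule MVT2[OF greater]) (use der that in auto)
    then obtain z where "B < z" "z < A" "\<Phi> A - \<Phi> B = (A - B) * \<Phi>' z" by blast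
    then show ?thesis by (intro exI[of _ z]) (auto simp: algebra_simps)
  qed auto
  show "\<exists>\<delta>>0. \<forall>r t. p \<le> r \<longrightarrow> r \<le> t \<longrightarrow> t \<le> q \<longrightarrow> t - r < \<delta> \<longrightarrow>
       \<bar>\<Phi> (f t) - \<Phi> (f r) - integral {r..t} (\<lambda>x. \<Phi>' (f x) * f' x)\<bar>
       \<le> e * integral {r..t} (\<lambda>x. \<bar>f' x\<bar>)"
  proof (intro exI[of _ d2] conjI allI impI)
    fix r t assume rt: "p \<le> r" "r \<le> t" "t \<le> q" "t - r < d2"
    note sub = abs_int_sub_int[OF _ rt(1) rt(3)]
    obtain z where z: "\<Phi> (f t) - \<Phi> (f r) = \<Phi>' z * (f t - f r)" "min (f r) (f t) \<le> z" "z \<le> max (f r) (f t)"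
      using mvt[of "f r" "f t"] range[of r] range[of t] rt by auto
    have zr: "z \<in> {u..v}" using z range[of r] range[of t] rt by auto
    have "\<Phi> (f t) - \<Phi> (f r) - integral {r..t} (\<lambda>x. \<Phi>' (f x) * f' x)
       = integral {r..t} (\<lambda>x. \<Phi>' z * f' x) - integral {r..t} (\<lambda>x. \<Phi>' (f x) * f' x)"
      using ac_on_diff[OF f rt(1-3)] z by simp
    also have "\<dots> = integral {r..t} (\<lambda>x. \<Phi>' z * f' x - \<Phi>' (f x) * f' x)"
      by (subst Henstock_Kurzweil_Integration.integral_diff)
        (auto intro!: integrable_on_real_cmult sub[OF fi] sub[OF A])
    finally have "\<Phi> (f t) - \<Phi> (f r) - integral {r..t} (\<lambda>x. \<Phi>' (f x) * f' x) = \<dots>" .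
    moreover have "\<bar>integral {r..t} (\<lambda>x. \<Phi>' z * f' x - \<Phi>' (f x) * f' x)\<bar> \<le> integral {r..t} (\<lambda>x. e * \<bar>f' x\<bar>)"
    proof (rule abs_integral_le)
      show "(\<lambda>x. \<Phi>' z * f' x - \<Phi>' (f x) * f' x) integrable_on {r..t}"
        by (intro integrable_diff integrable_on_real_cmult sub[OF fi] sub[OF A])
      show "(\<lambda>x. e * \<bar>f' x\<bar>) integrable_on {r..t}"
        by (intro integrable_on_real_cmult sub[OF N])
      fix x assume x: "x \<in> {r..t}"
      have "\<bar>f r - f x\<bar> < d1/2" "\<bar>f t - f x\<bar> < d1/2"
        using d2(2)[of r x] d2(2)[of t x] x rt by auto
      then have "\<bar>z - f x\<bar> < d1" using z by linarith
      then have "\<bar>\<Phi>' z - \<Phi>' (f x)\<bar> \<le> e" using d1(2)[OF zr, of "f x"] range[of x] x rt by auto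
      then have "\<bar>\<Phi>' z - \<Phi>' (f x)\<bar> * \<bar>f' x\<bar> \<le> e * \<bar>f' x\<bar>" by (intro mult_right_mono) auto
      then show "\<bar>\<Phi>' z * f' x - \<Phi>' (f x) * f' x\<bar> \<le> e * \<bar>f' x\<bar>"
        by (simp add: abs_mult[symmetric] left_diff_distrib)
    qed
    ultimately show "\<bar>\<Phi> (f t) - \<Phi> (f r) - integral {r..t} (\<lambda>x. \<Phi>' (f x) * f' x)\<bar>
       \<le> e * integral {r..t} (\<lambda>x. \<bar>f' x\<bar>)" by simp
  qed (use d2 in auto)
qed auto

text \<open>By compactness f stays in a closed interval of positive numbers, on which inversion is
  continuously differentiable.\<close>

lemma ac_on_inverse:
  assumes f: "ac_on p q f f'" and pos: "\<And>x. x \<in> {p..q} \<Longrightarrow> f x > 0"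
  shows "ac_on p q (\<lambda>x. 1 / f x) (\<lambda>x. - f' x / (f x)\<^sup>2)"
proof (cases "p \<le> q")
  case True
  have comp: "compact (f ` {p..q})"
    by (intro compact_continuous_image ac_on_cont[OF f]) auto
  obtain x1 where x1: "x1 \<in> {p..q}" "\<And>x. x \<in> {p..q} \<Longrightarrow> f x1 \<le> f x"
    using continuous_attains_inf[OF _ _ ac_on_cont[OF f]] True by auto
  obtain x2 where x2: "x2 \<in> {p..q}" "\<And>x. x \<in> {p..q} \<Longrightarrow> f x \<le> f x2"
    using continuous_attains_sup[OF _ _ ac_on_cont[OF f]] True by auto
  have "ac_on p q (\<lambda>x. 1 / f x) (\<lambda>x. - 1 / (f x)\<^sup>2 * f' x)"
  proof (rule ac_on_compose[OF f])
    show "((\<lambda>x. 1 / x) has_real_derivative - 1 / y\<^sup>2) (at y)" if "y \<in> {f x1..f x2}" for y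
      using that pos[OF x1(1)] by (auto intro!: derivative_eq_intros simp: power2_eq_square)
    show "continuous_on {f x1..f x2} (\<lambda>x. - 1 / x\<^sup>2)"
      using pos[OF x1(1)] by (intro continuous_intros) auto
  qed (use x1 x2 in auto)
  then show ?thesis by simp
qed (auto simp: ac_on_def)

lemma ac_on_C1:
  assumes "\<And>x. x \<in> {p..q} \<Longrightarrow> (f has_real_derivative f' x) (at x within {p..q})" "continuous_on {p..q} f'"
  shows "ac_on p q f f'"
proof (rule ac_onI)
  show "f' absolutely_integrable_on {p..q}"
    by (rule absolutely_integrable_continuous_real[OF assms(2)])
  fix t assume t: "p \<le> t" "t \<le> q"
  have "(f has_vector_derivative f' x) (at x within {p..t})" if "x \<in> {p..t}" for x
    unfolding has_real_derivative_iff_has_vector_derivative[symmetric]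
    by (rule DERIV_subset[OF assms(1)]) (use t that in auto)
  then have "(f' has_integral f t - f p) {p..t}"
    using t by (intro fundamental_theorem_of_calculus) auto
  then show "integral {p..t} f' = f t - f p" by (rule integral_unique)
qed

lemma ac_on_ident: "ac_on p q (\<lambda>x. x) (\<lambda>x. 1)"
  by (rule ac_on_C1) (auto intro!: derivative_eq_intros)

lemma ac_on_square: "ac_on p q f f' \<Longrightarrow> ac_on p q (\<lambda>x. (f x)\<^sup>2) (\<lambda>x. 2 * f x * f' x)"
  using ac_on_mult[of p q f f' f f'] by (simp add: power2_eq_square algebra_simps)

lemma ac_on_integral:
  "g absolutely_integrable_on {p..q} \<Longrightarrow> ac_on p q (\<lambda>x. c + integral {p..x} g) g"
  by (rule ac_onI) auto

lemma ac_on_by_parts: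
  assumes "ac_on p q f f'" "ac_on p q g g'" "p \<le> q"
  shows "integral {p..q} (\<lambda>x. f x * g' x) = f q * g q - f p * g p - integral {p..q} (\<lambda>x. f' x * g x)"
proof -
  have "integral {p..q} (\<lambda>x. f x * g' x + g x * f' x) = f q * g q - f p * g p"
    by (rule ac_on_diff[OF ac_on_mult[OF assms(1,2)]]) (use assms in auto)
  moreover have "(\<lambda>x. f x * g' x) integrable_on {p..q}" "(\<lambda>x. g x * f' x) integrable_on {p..q}"
    using abs_int_mult_cont[OF ac_on_cont[OF assms(1)] ac_on_abs_int[OF assms(2)]]
      abs_int_mult_cont[OF ac_on_cont[OF assms(2)] ac_on_abs_int[OF assms(1)]]
    by (auto simp: absolutely_integrable_on_def)
  ultimately show ?thesis by (simp add: Henstock_Kurzweil_Integration.integral_add mult.commute)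
qed

section \<open>Weak derivatives in one variable\<close>

lemma AE_lebesgue_on_iff:
  assumes "S \<in> sets lebesgue"
  shows "(AE x in lebesgue_on S. P x) \<longleftrightarrow> (\<exists>N. negligible N \<and> (\<forall>x\<in>S - N. P x))"
proof
  assume "AE x in lebesgue_on S. P x"
  then have "AE x in lebesgue. x \<in> S \<longrightarrow> P x"
    using assms by (simp add: AE_restrict_space_iff)
  then obtain N where "N \<in> null_sets lebesgue" "{x \<in> space lebesgue. \<not> (x \<in> S \<longrightarrow> P x)} \<subseteq> N"
    unfolding eventually_ae_filter by blast
  then show "\<exists>N. negligible N \<and> (\<forall>x\<in>S - N. P x)"
    by (intro exI[of _ N]) (auto simp: negligible_iff_null_sets)
next
  assume "\<exists>N. negligible N \<and> (\<forall>x\<in>S - N. P x)"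
  then obtain N where "N \<in> null_sets lebesgue" "\<forall>x\<in>S - N. P x"
    by (auto simp: negligible_iff_null_sets)
  then have "AE x in lebesgue. x \<in> S \<longrightarrow> P x"
    unfolding eventually_ae_filter by (intro bexI[of _ N]) auto
  then show "AE x in lebesgue_on S. P x"
    using assms by (simp add: AE_restrict_space_iff)
qed

text \<open>The function spaces are phrased with the Lebesgue integral over an open interval, the
  calculus above with the gauge integral over the closed one. The end points form a null set, so the
  two agree.\<close>

lemma integrable_Ioo_iff:
  fixes f :: "real \<Rightarrow> real"
  shows "integrable (lebesgue_on {c<..<d}) f \<longleftrightarrow> f absolutely_integrable_on {c..d}"
  unfolding absolutely_integrable_on_Icc_iff_Ioo
  by (simp add: integrable_restrict_space set_integrable_def)

lemma lint_Ioo: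
  fixes f :: "real \<Rightarrow> real"
  assumes "integrable (lebesgue_on {c<..<d}) f"
  shows "(LINT x|lebesgue_on {c<..<d}. f x) = integral {c..d} f"
  using lebesgue_integral_eq_integral[OF assms] by (simp add: integral_open_interval_real)

lemma lmeasurable_ivl_sets: "{c..d::real} \<in> sets lebesgue"
  by simp

lemma AE_Icc_Ioo:
  "(AE x in lebesgue_on {c..d::real}. P x) \<longleftrightarrow> (AE x in lebesgue_on {c<..<d}. P x)"
proof
  assume "AE x in lebesgue_on {c..d}. P x"
  then show "AE x in lebesgue_on {c<..<d}. P x" by (auto simp: AE_lebesgue_on_iff)
next
  assume "AE x in lebesgue_on {c<..<d}. P x"
  then obtain N where N: "negligible N" "\<forall>x\<in>{c<..<d} - N. P x" by (auto simp: AE_lebesgue_on_iff)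
  have "negligible (N \<union> {c, d})" by (intro negligible_Un N) auto
  moreover have "\<forall>x\<in>{c..d} - (N \<union> {c,d}). P x" using N by auto
  ultimately show "AE x in lebesgue_on {c..d}. P x" unfolding AE_lebesgue_on_iff[OF lmeasurable_ivl_sets] by blast
qed

text \<open>The points where two continuous functions differ form an open set, and a nonempty open
  set is not negligible.\<close>

lemma AE_Ioo_unique_cont:
  fixes f g :: "real \<Rightarrow> real"
  assumes "AE x in lebesgue_on {c<..<d}. f x = g x" "continuous_on {c<..<d} f" "continuous_on {c<..<d} g"
    and x: "x \<in> {c<..<d}"
  shows "f x = g x"
proof (rule ccontr)
  assume ne: "f x \<noteq> g x"
  obtain N where N: "negligible N" "\<forall>x\<in>{c<..<d} - N. f x = g x"
    using assms(1) by (auto simp: AE_lebesgue_on_iff)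
  have "openin (top_of_set {c<..<d}) ({c<..<d} \<inter> (\<lambda>y. f y - g y) -` (- {0}))"
    by (intro continuous_openin_preimage_gen continuous_intros assms)
  then have "open ({c<..<d} \<inter> (\<lambda>y. f y - g y) -` (- {0}))"
    by (metis open_greaterThanLessThan openin_open_eq)
  moreover have "negligible ({c<..<d} \<inter> (\<lambda>y. f y - g y) -` (- {0}))"
    by (rule negligible_subset[OF N(1)]) (use N(2) in auto)
  ultimately have "{c<..<d} \<inter> (\<lambda>y. f y - g y) -` (- {0}) = {}"
    using open_not_negligible by blast
  then show False using ne x by auto
qed

lemma AE_zero_imp_zero:
  fixes D :: "real \<Rightarrow> real"
  assumes "AE x in lebesgue_on {p<..<q}. D x = 0" "continuous_on {p..q} D" "p < q" "x \<in> {p..q}"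
  shows "D x = 0"
proof -
  have "D y = 0" if "y \<in> {p<..<q}" for y
    by (rule AE_Ioo_unique_cont[OF assms(1) _ _ that]) (use assms(2) in \<open>auto intro: continuous_on_subset\<close>)
  then show ?thesis
    using continuous_constant_on_closure[of "{p<..<q}" D 0 x] assms by simp
qed

section \<open>Test functions, approximation and the fundamental lemma of the calculus of
  variations\<close>

lemma integrable_Ioo_mult_cont:
  fixes f h :: "real \<Rightarrow> real"
  assumes "integrable (lebesgue_on {c<..<d}) f" "continuous_on UNIV h"
  shows "integrable (lebesgue_on {c<..<d}) (\<lambda>x. f x * h x)"
  using abs_int_mult_cont[of c d h f] assms continuous_on_subset[of UNIV h "{c..d}"]
  by (simp add: integrable_Ioo_iff mult.commute)

text \<open>Only continuity is asked for, because these functions are to be derivatives of test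
  functions: those of mean zero have a primitive in \<open>C1c\<close> (see
  \<open>primitive_C1c\<close>).\<close>

definition compact_in :: "real \<Rightarrow> real \<Rightarrow> (real \<Rightarrow> real) \<Rightarrow> bool" where
  "compact_in c d f \<longleftrightarrow> continuous_on UNIV f \<and>
     (\<exists>c' d'. c < c' \<and> c' \<le> d' \<and> d' < d \<and> (\<forall>x. x \<notin> {c'..d'} \<longrightarrow> f x = 0))"

lemma compact_in_integrable:
  assumes "compact_in c d f"
  shows "integrable (lebesgue_on {c<..<d}) f"
  unfolding integrable_Ioo_iff
  by (rule absolutely_integrable_continuous_real)
    (use assms in \<open>auto simp: compact_in_def intro: continuous_on_subset\<close>)

text \<open>\<open>measurable_on\<close> provides continuous functions converging almost everywhere; truncating and
  cutting them off makes dominated convergence available.\<close>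

lemma approx_bounded:
  fixes f :: "real \<Rightarrow> real"
  assumes cd: "c < d" and f: "f \<in> borel_measurable (lebesgue_on {c<..<d})" and B: "\<And>x. \<bar>f x\<bar> \<le> B"
  obtains \<eta> where "\<And>n::nat. compact_in c d (\<eta> n)" "\<And>n x. \<bar>\<eta> n x\<bar> \<le> B"
    "AE x in lebesgue_on {c<..<d}. (\<lambda>n. \<eta> n x) \<longlonglongrightarrow> f x"
proof -
  have B0: "B \<ge> 0" using B[of 0] by linarith
  have "f measurable_on {c<..<d}"
    using f by (simp add: measurable_on_iff_borel_measurable)
  then obtain N g where N: "negligible N" and g: "\<And>n::nat. continuous_on UNIV (g n)"
    and lim: "\<And>x. x \<notin> N \<Longrightarrow> (\<lambda>n. g n x) \<longlonglongrightarrow> (if x \<in> {c<..<d} then f x else 0)"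
    unfolding measurable_on_def by blast
  \<comment> \<open>The offset n0 makes \<open>2 / (n0 + n)\<close> smaller than
    \<open>d - c\<close> already for n = 0, so the support interval is never empty. The factor
    \<open>cut n\<close> vanishes within distance \<open>1 / (n0 + n)\<close> of the end points and
    equals 1 beyond twice that distance.\<close>
  obtain n0 :: nat where n0: "2 / (d - c) < real n0" using reals_Archimedean2 by blast
  define cut where "cut n x = max 0 (min 1 (real (n0 + n) * min (x - c) (d - x) - 1))" for n x
  define \<eta> where "\<eta> n x = cut n x * max (- B) (min B (g n x))" for n x
  show thesis
  proof
    fix n
    have p: "real (n0 + n) > 2 / (d - c)" using n0 by simp
    then have p0: "real (n0 + n) > 0"
    proof -
      have "0 < 2 / (d - c)" using cd by simp
      then show ?thesis using p by linarith
    qed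
    have z: "cut n x = 0" if "x \<notin> {c + 1 / real (n0 + n)..d - 1 / real (n0 + n)}" for x
    proof -
      have "min (x - c) (d - x) < 1 / real (n0 + n)" using that by auto
      then have "real (n0 + n) * min (x - c) (d - x) < 1" using p0 by (simp add: field_simps)
      then show ?thesis by (simp add: cut_def)
    qed
    have "continuous_on UNIV (\<eta> n)"
      unfolding \<eta>_def cut_def by (intro continuous_intros g)
    moreover have "c < c + 1 / real (n0 + n)" "d - 1 / real (n0 + n) < d"
      using p0 by simp_all
    moreover have "c + 1 / real (n0 + n) \<le> d - 1 / real (n0 + n)"
    proof -
      have "2 / real (n0 + n) < d - c" using p p0 cd by (simp add: field_simps)
      then show ?thesis by simp
    qed
    ultimately show "compact_in c d (\<eta> n)"
      unfolding compact_in_def using z by (metis \<eta>_def mult_zero_left)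
    fix x
    have "\<bar>cut n x\<bar> \<le> 1" by (auto simp: cut_def)
    moreover have "\<bar>max (- B) (min B (g n x))\<bar> \<le> B" using B0 by auto
    ultimately show "\<bar>\<eta> n x\<bar> \<le> B"
      unfolding \<eta>_def abs_mult using mult_mono[of "\<bar>cut n x\<bar>" 1 "\<bar>max (- B) (min B (g n x))\<bar>" B] by auto
  next
    have "(\<lambda>n. \<eta> n x) \<longlonglongrightarrow> f x" if x: "x \<in> {c<..<d} - N" for x
    proof -
      have "(\<lambda>n. g n x) \<longlonglongrightarrow> f x" using lim[of x] x by auto
      then have 1: "(\<lambda>n. max (- B) (min B (g n x))) \<longlonglongrightarrow> max (- B) (min B (f x))"
        by (intro tendsto_intros)
      have m: "min (x - c) (d - x) > 0" using x by auto
      obtain n1 :: nat where n1: "2 / min (x - c) (d - x) < real n1" using reals_Archimedean2 by blast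
      have "cut n x = 1" if "n \<ge> n1" for n
      proof -
        have "2 / min (x - c) (d - x) < real (n0 + n)" using n1 that by simp
        then have "2 < real (n0 + n) * min (x - c) (d - x)" using m by (simp add: pos_divide_less_eq)
        then show ?thesis by (simp add: cut_def)
      qed
      then have "eventually (\<lambda>n. max (- B) (min B (g n x)) = \<eta> n x) sequentially"
        unfolding eventually_sequentially by (intro exI[of _ n1]) (auto simp: \<eta>_def)
      then have "(\<lambda>n. \<eta> n x) \<longlonglongrightarrow> max (- B) (min B (f x))"
        by (rule Lim_transform_eventually[OF 1])
      moreover have "max (- B) (min B (f x)) = f x" using B[of x] by auto
      ultimately show ?thesis by simp
    qed
    then show "AE x in lebesgue_on {c<..<d}. (\<lambda>n. \<eta> n x) \<longlonglongrightarrow> f x"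
      using N by (auto simp: AE_lebesgue_on_iff)
  qed
qed

text \<open>Truncation at a large height k costs little by dominated convergence. The truncated
  function is bounded on a set of finite measure, so its approximants converge in L1 with a constant
  as majorant.\<close>

lemma approx_L1:
  fixes f :: "real \<Rightarrow> real"
  assumes cd: "c < d" and f: "integrable (lebesgue_on {c<..<d}) f" and e: "e > 0"
  obtains \<eta> where "compact_in c d \<eta>" "(LINT x|lebesgue_on {c<..<d}. \<bar>f x - \<eta> x\<bar>) < e"
proof -
  let ?M = "lebesgue_on {c<..<d}"
  note [measurable] = borel_measurable_integrable[OF f]
  define h where "h k x = max (- real k) (min (real k) (f x))" for k x
  have hm[measurable]: "h k \<in> borel_measurable ?M" for k unfolding h_def by measurable
  have "(\<lambda>k. LINT x|?M. \<bar>f x - h k x\<bar>) \<longlonglongrightarrow> (LINT x|?M. 0)"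
  proof (rule integral_dominated_convergence[where w = "\<lambda>x. \<bar>f x\<bar>"])
    show "AE x in ?M. (\<lambda>k. \<bar>f x - h k x\<bar>) \<longlonglongrightarrow> 0"
    proof (intro AE_I2)
      fix x
      obtain n :: nat where n: "\<bar>f x\<bar> < real n" using reals_Archimedean2 by blast
      have "eventually (\<lambda>k. 0 = \<bar>f x - h k x\<bar>) sequentially"
        unfolding eventually_sequentially by (rule exI[of _ n]) (use n in \<open>auto simp: h_def\<close>)
      then show "(\<lambda>k. \<bar>f x - h k x\<bar>) \<longlonglongrightarrow> 0"
        by (rule Lim_transform_eventually[OF tendsto_const])
    qed
    show "AE x in ?M. norm \<bar>f x - h k x\<bar> \<le> \<bar>f x\<bar>" for k
      by (intro AE_I2) (auto simp: h_def)
  qed (use f in auto)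
  then have "eventually (\<lambda>k. (LINT x|?M. \<bar>f x - h k x\<bar>) < e / 2) sequentially"
    using e by (intro order_tendstoD) auto
  then obtain k where k: "(LINT x|?M. \<bar>f x - h k x\<bar>) < e / 2"
    by (auto simp: eventually_sequentially)
  have hb: "\<bar>h k x\<bar> \<le> real k" for x by (auto simp: h_def)
  obtain \<eta> where \<eta>: "\<And>n::nat. compact_in c d (\<eta> n)" "\<And>n x. \<bar>\<eta> n x\<bar> \<le> real k"
    "AE x in ?M. (\<lambda>n. \<eta> n x) \<longlonglongrightarrow> h k x"
    using approx_bounded[OF cd hm hb] by blast
  note [measurable] = borel_measurable_integrable[OF compact_in_integrable[OF \<eta>(1)]]
  interpret fm: finite_measure ?M by (rule finite_measure_lebesgue_on) auto
  have "(\<lambda>n. LINT x|?M. \<bar>h k x - \<eta> n x\<bar>) \<longlonglongrightarrow> (LINT x|?M. 0)"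
  proof (rule integral_dominated_convergence[where w = "\<lambda>x. 2 * real k"])
    show "AE x in ?M. (\<lambda>n. \<bar>h k x - \<eta> n x\<bar>) \<longlonglongrightarrow> 0"
      using \<eta>(3)
    proof eventually_elim
      case (elim x)
      have "(\<lambda>n. \<bar>h k x - \<eta> n x\<bar>) \<longlonglongrightarrow> \<bar>h k x - h k x\<bar>"
        by (intro tendsto_intros elim)
      then show ?case by simp
    qed
    show "AE x in ?M. norm \<bar>h k x - \<eta> n x\<bar> \<le> 2 * real k" for n
    proof (intro AE_I2)
      fix x show "norm \<bar>h k x - \<eta> n x\<bar> \<le> 2 * real k"
        using hb[of x] \<eta>(2)[of n x] unfolding real_norm_def by linarith
    qed
  qed auto
  then have "eventually (\<lambda>n. (LINT x|?M. \<bar>h k x - \<eta> n x\<bar>) < e / 2) sequentially"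
    using e by (intro order_tendstoD) auto
  then obtain n where n: "(LINT x|?M. \<bar>h k x - \<eta> n x\<bar>) < e / 2"
    by (auto simp: eventually_sequentially)
  have hi: "integrable ?M (h k)"
    by (rule Bochner_Integration.integrable_bound[OF f]) (auto simp: h_def)
  note \<eta>i = compact_in_integrable[OF \<eta>(1)[of n]]
  have "(LINT x|?M. \<bar>f x - \<eta> n x\<bar>) \<le> (LINT x|?M. \<bar>f x - h k x\<bar> + \<bar>h k x - \<eta> n x\<bar>)"
    using f hi \<eta>i by (intro integral_mono) auto
  also have "\<dots> = (LINT x|?M. \<bar>f x - h k x\<bar>) + (LINT x|?M. \<bar>h k x - \<eta> n x\<bar>)"
    using f hi \<eta>i by (intro Bochner_Integration.integral_add) auto
  also have "\<dots> < e" using k n by simp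
  finally show thesis using that \<eta>(1) by blast
qed

lemma C1cD:
  assumes "\<phi> \<in> C1c c d"
  shows "(\<phi> has_real_derivative deriv \<phi> x) (at x)" "continuous_on UNIV (deriv \<phi>)"
    "ac_on p q \<phi> (deriv \<phi>)" "x \<notin> {c<..<d} \<Longrightarrow> \<phi> x = 0"
proof -
  show 1: "(\<phi> has_real_derivative deriv \<phi> x) (at x)" for x
    using assms unfolding C1c_def
    by (auto simp: differentiable_on_def DERIV_deriv_iff_real_differentiable)
  show 2: "continuous_on UNIV (deriv \<phi>)" using assms by (auto simp: C1c_def)
  show "ac_on p q \<phi> (deriv \<phi>)"
    by (rule ac_on_C1[OF has_field_derivative_at_within[OF 1] continuous_on_subset[OF 2]]) auto
  show "x \<notin> {c<..<d} \<Longrightarrow> \<phi> x = 0" using assms by (auto simp: C1c_def)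
qed

text \<open>The vanishing mean brings the primitive back to zero to the right of the support of
  \<open>\<eta>\<close>.\<close>

lemma primitive_C1c:
  assumes \<eta>: "compact_in c d \<eta>" and z: "integral {c..d} \<eta> = 0"
  defines "\<phi> \<equiv> \<lambda>x. integral {c..x} \<eta>"
  shows "\<phi> \<in> C1c c d" "deriv \<phi> = \<eta>"
proof -
  obtain c' d' where cd: "c < c'" "c' \<le> d'" "d' < d" and z0: "\<And>x. x \<notin> {c'..d'} \<Longrightarrow> \<eta> x = 0"
    and cont: "continuous_on UNIV \<eta>"
    using \<eta> unfolding compact_in_def by blast
  have \<eta>i: "\<eta> integrable_on {p..q}" for p q
    by (intro integrable_continuous_real continuous_on_subset[OF cont]) auto
  have L: "\<phi> x = 0" if "x < c'" for x
  proof -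
    have "integral {c..x} \<eta> = integral {c..x} (\<lambda>x. 0)"
      using that by (intro integral_cong z0) auto
    then show ?thesis by (simp add: \<phi>_def)
  qed
  have R: "\<phi> x = 0" if "x > d'" for x
  proof (cases "x \<le> d")
    case True
    have "integral {c..x} \<eta> + integral {x..d} \<eta> = integral {c..d} \<eta>"
      using that cd True by (intro Henstock_Kurzweil_Integration.integral_combine \<eta>i) auto
    moreover have "integral {x..d} \<eta> = integral {x..d} (\<lambda>x. 0)"
      using that by (intro integral_cong z0) auto
    ultimately show ?thesis using z by (simp add: \<phi>_def)
  next
    case False
    have "integral {c..d} \<eta> + integral {d..x} \<eta> = integral {c..x} \<eta>"
      using that cd False by (intro Henstock_Kurzweil_Integration.integral_combine \<eta>i) auto
    moreover have "integral {d..x} \<eta> = integral {d..x} (\<lambda>x. 0)"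
      using that cd by (intro integral_cong z0) auto
    ultimately show ?thesis using z by (simp add: \<phi>_def)
  qed
  have D: "(\<phi> has_real_derivative \<eta> x) (at x)" for x
  \<comment> \<open>To the left of c the interval of integration is empty and the fundamental
    theorem does not apply. There, and up to c', the primitive is locally constant zero.\<close>
  proof (cases "x < c'")
    case True
    have "((\<lambda>x. 0) has_real_derivative 0) (at x)" by simp
    then have "(\<phi> has_real_derivative 0) (at x)"
      by (rule has_field_derivative_transform_within_open[of _ _ _ "{..<c'}"]) (use True L in auto)
    then show ?thesis using z0[of x] True by simp
  next
    case False
    then have "(\<phi> has_real_derivative \<eta> x) (at x within {c..x+1})"
      unfolding \<phi>_def using cd
      by (intro integral_has_real_derivative continuous_on_subset[OF cont]) auto
    then show ?thesis using False cd by (simp add: at_within_Icc_at)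
  qed
  show dv: "deriv \<phi> = \<eta>" using D by (intro ext DERIV_imp_deriv)
  have "\<phi> differentiable_on UNIV"
    using D by (auto simp: differentiable_on_def real_differentiable_def)
  moreover have "compact {c'..d'}" "{c'..d'} \<subseteq> {c<..<d}" "\<forall>x. x \<notin> {c'..d'} \<longrightarrow> \<phi> x = 0"
    using cd L R by (auto simp: not_le)
  ultimately show "\<phi> \<in> C1c c d"
    unfolding C1c_def using dv cont by blast
qed

lemma bump_exists:
  assumes "c < d"
  obtains \<eta> where "compact_in c d \<eta>" "\<And>x. \<eta> x \<ge> 0" "integral {c..d} \<eta> = 1"
proof -
  define c' where "c' = (2 * c + d) / 3" define d' where "d' = (c + 2 * d) / 3"
  have cd: "c < c'" "c' < d'" "d' < d" using assms by (auto simp: c'_def d'_def)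
  define b where "b x = max 0 (min (x - c') (d' - x))" for x
  have cont: "continuous_on S b" for S unfolding b_def by (intro continuous_intros)
  have bi: "b integrable_on {c..d}" by (intro integrable_continuous_real cont)
  have b0: "b x \<ge> 0" for x by (simp add: b_def)
  have "integral {c..d} b \<noteq> 0"
  proof
    assume "integral {c..d} b = 0"
    then have "(b has_integral 0) (cbox c d)" using bi by (metis box_real(2) integrable_integral)
    then have "b ((c' + d') / 2) = 0"
      by (intro has_integral_0_cbox_imp_0[of c d b]) (use cont b0 cd in auto)
    then show False using cd by (simp add: b_def field_simps)
  qed
  moreover have "integral {c..d} b \<ge> 0" using bi b0 by (intro Henstock_Kurzweil_Integration.integral_nonneg) auto
  ultimately have p: "integral {c..d} b > 0" by simp
  show thesis
  proof
    show "compact_in c d (\<lambda>x. (1 / integral {c..d} b) * b x)"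
      unfolding compact_in_def using cd
      by (intro conjI continuous_intros cont exI[of _ c'] exI[of _ d']) (auto simp: b_def)
    show "(1 / integral {c..d} b) * b x \<ge> 0" for x using p b0 by simp
    show "integral {c..d} (\<lambda>x. (1 / integral {c..d} b) * b x) = 1" using p by simp
  qed
qed

lemma compact_in_add:
  assumes "compact_in c d f" "compact_in c d g"
  shows "compact_in c d (\<lambda>x. f x + k * g x)"
proof -
  obtain c1 d1 where 1: "c < c1" "c1 \<le> d1" "d1 < d" "\<And>x. x \<notin> {c1..d1} \<Longrightarrow> f x = 0"
    using assms(1) unfolding compact_in_def by blast
  obtain c2 d2 where 2: "c < c2" "c2 \<le> d2" "d2 < d" "\<And>x. x \<notin> {c2..d2} \<Longrightarrow> g x = 0"
    using assms(2) unfolding compact_in_def by blast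
  have "continuous_on UNIV (\<lambda>x. f x + k * g x)"
    using assms unfolding compact_in_def by (intro continuous_intros) auto
  moreover have "f x + k * g x = 0" if "x \<notin> {min c1 c2..max d1 d2}" for x
    using 1(4)[of x] 2(4)[of x] that by (auto simp: min_le_iff_disj le_max_iff_disj)
  moreover have "c < min c1 c2" "min c1 c2 \<le> max d1 d2" "max d1 d2 < d" using 1(1-3) 2(1-3) by auto
  ultimately show ?thesis unfolding compact_in_def by blast
qed

text \<open>Test with functions that approximate \<open>sgn (U x)\<close> and stay bounded by 1;
  dominated convergence turns orthogonality into a vanishing integral of
  \<open>\<bar>U x\<bar>\<close>.\<close>

lemma orthogonal_imp_AE_zero:
  fixes U :: "real \<Rightarrow> real"
  assumes cd: "c < d" and U: "integrable (lebesgue_on {c<..<d}) U"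
    and orth: "\<And>\<eta>. compact_in c d \<eta> \<Longrightarrow> (LINT x|lebesgue_on {c<..<d}. U x * \<eta> x) = 0"
  shows "AE x in lebesgue_on {c<..<d}. U x = 0"
proof -
  let ?M = "lebesgue_on {c<..<d}"
  note [measurable] = borel_measurable_integrable[OF U]
  have sm: "(\<lambda>x. sgn (U x)) \<in> borel_measurable ?M" by measurable
  obtain \<eta> where \<eta>: "\<And>n::nat. compact_in c d (\<eta> n)" "\<And>n x. \<bar>\<eta> n x\<bar> \<le> 1"
    "AE x in ?M. (\<lambda>n. \<eta> n x) \<longlonglongrightarrow> sgn (U x)"
    by (rule approx_bounded[OF cd sm, of 1]) (auto simp: sgn_if)
  note [measurable] = borel_measurable_integrable[OF compact_in_integrable[OF \<eta>(1)]]
  have "(\<lambda>n. LINT x|?M. U x * \<eta> n x) \<longlonglongrightarrow> (LINT x|?M. U x * sgn (U x))"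
  proof (rule integral_dominated_convergence[where w = "\<lambda>x. \<bar>U x\<bar>"])
    show "AE x in ?M. (\<lambda>n. U x * \<eta> n x) \<longlonglongrightarrow> U x * sgn (U x)"
      using \<eta>(3) by eventually_elim (intro tendsto_intros)
    show "AE x in ?M. norm (U x * \<eta> n x) \<le> \<bar>U x\<bar>" for n
      using \<eta>(2)[of n] by (intro AE_I2) (simp add: abs_mult mult_left_le)
  qed (use U in auto)
  then have "(LINT x|?M. U x * sgn (U x)) = 0"
    unfolding orth[OF \<eta>(1)] using LIMSEQ_unique tendsto_const by blast
  then have "(LINT x|?M. \<bar>U x\<bar>) = 0"
    unfolding abs_sgn .
  then have "AE x in ?M. \<bar>U x\<bar> = 0"
    using U by (subst (asm) integral_nonneg_eq_0_iff_AE) auto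
  then show ?thesis by auto
qed

lemma du_Bois_Reymond_const:
  fixes U :: "real \<Rightarrow> real"
  assumes cd: "c < d" and U: "integrable (lebesgue_on {c<..<d}) U"
    and *: "\<And>\<phi>. \<phi> \<in> C1c c d \<Longrightarrow> (LINT x|lebesgue_on {c<..<d}. U x * deriv \<phi> x) = 0"
  shows "\<exists>k. AE x in lebesgue_on {c<..<d}. U x = k"
proof -
  let ?M = "lebesgue_on {c<..<d}"
  interpret fm: finite_measure ?M by (rule finite_measure_lebesgue_on) auto
  obtain b where b: "compact_in c d b" "\<And>x. b x \<ge> 0" "integral {c..d} b = 1"
    using bump_exists[OF cd] by blast
  have Um: "integrable ?M (\<lambda>x. U x * \<eta> x)" if "compact_in c d \<eta>" for \<eta>
  proof -
    have c: "continuous_on {c..d} \<eta>" using that by (auto simp: compact_in_def intro: continuous_on_subset)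
    show ?thesis
      using abs_int_mult_cont[OF c, of U] U unfolding integrable_Ioo_iff by (simp add: mult.commute)
  qed
  \<comment> \<open>The constant is the mean of U against a bump of mass 1. Any
    \<open>\<eta>\<close> minus its mass times this bump has mean zero and so is the derivative of a
    test function.\<close>
  define k where "k = (LINT x|?M. U x * b x)"
  have orth: "(LINT x|?M. (U x - k) * \<eta> x) = 0" if \<eta>: "compact_in c d \<eta>" for \<eta>
  proof -
    define m where "m = integral {c..d} \<eta>"
    let ?\<zeta> = "\<lambda>x. \<eta> x + (- m) * b x"
    have \<zeta>: "compact_in c d ?\<zeta>" by (rule compact_in_add[OF \<eta> b(1)])
    have ci: "f integrable_on {c..d}" if "compact_in c d f" for f
      using compact_in_integrable[OF that] by (auto simp: integrable_Ioo_iff absolutely_integrable_on_def)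
    have "integral {c..d} ?\<zeta> = integral {c..d} \<eta> + integral {c..d} (\<lambda>x. (- m) * b x)"
      by (rule Henstock_Kurzweil_Integration.integral_add[OF ci[OF \<eta>] integrable_on_real_cmult[OF ci[OF b(1)]]])
    also have "\<dots> = 0" using b(3) by (simp add: m_def)
    finally have z: "integral {c..d} ?\<zeta> = 0" .
    have "(LINT x|?M. U x * ?\<zeta> x) = 0"
      using *[OF primitive_C1c(1)[OF \<zeta> z]] primitive_C1c(2)[OF \<zeta> z] by simp
    moreover have "(LINT x|?M. U x * ?\<zeta> x) = (LINT x|?M. U x * \<eta> x - m * (U x * b x))"
      by (intro Bochner_Integration.integral_cong) (auto simp: algebra_simps)
    moreover have "\<dots> = (LINT x|?M. U x * \<eta> x) - m * k"
      unfolding k_def using Um[OF \<eta>] Um[OF b(1)] by (subst Bochner_Integration.integral_diff) auto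
    moreover have "(LINT x|?M. (U x - k) * \<eta> x) = (LINT x|?M. U x * \<eta> x - k * \<eta> x)"
      by (intro Bochner_Integration.integral_cong) (auto simp: algebra_simps)
    moreover have "\<dots> = (LINT x|?M. U x * \<eta> x) - k * m"
      unfolding m_def lint_Ioo[OF compact_in_integrable[OF \<eta>], symmetric]
      using Um[OF \<eta>] compact_in_integrable[OF \<eta>] by (subst Bochner_Integration.integral_diff) auto
    ultimately show ?thesis by simp
  qed
  have "integrable ?M (\<lambda>x. U x - k)" using U by auto
  then have "AE x in ?M. U x - k = 0" by (rule orthogonal_imp_AE_zero[OF cd _ orth])
  then show ?thesis by auto
qed

text \<open>Subtracting the primitive of g leaves a function with weak derivative zero, which is
  constant almost everywhere. The interval is arbitrary because the result serves both in space on
  (0,1) and in time on (0,T).\<close>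

lemma weak_deriv_imp_ac:
  assumes cd: "c < d" and u: "integrable (lebesgue_on {c<..<d}) u" and g: "integrable (lebesgue_on {c<..<d}) g"
    and *: "\<And>\<phi>. \<phi> \<in> C1c c d \<Longrightarrow> (LINT x|lebesgue_on {c<..<d}. u x * deriv \<phi> x)
              = - (LINT x|lebesgue_on {c<..<d}. g x * \<phi> x)"
  shows "\<exists>f. ac_on c d f g \<and> (AE x in lebesgue_on {c<..<d}. u x = f x)"
proof -
  let ?M = "lebesgue_on {c<..<d}"
  define G where "G x = integral {c..x} g" for x
  have G: "ac_on c d G g"
    using ac_on_integral[of c d g 0] g by (simp add: G_def[abs_def] integrable_Ioo_iff)
  have Gi: "integrable ?M G"
    using absolutely_integrable_continuous_real[OF ac_on_cont[OF G]] by (simp add: integrable_Ioo_iff)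
  note mc = integrable_Ioo_mult_cont
  have "\<exists>k. AE x in ?M. u x - G x = k"
  proof (rule du_Bois_Reymond_const[OF cd])
    show "integrable ?M (\<lambda>x. u x - G x)" using u Gi by auto
    fix \<phi> assume \<phi>: "\<phi> \<in> C1c c d"
    note [simp] = C1cD(4)[OF \<phi>, of c] C1cD(4)[OF \<phi>, of d]
    have c: "continuous_on UNIV \<phi>"
      using C1cD(1)[OF \<phi>] DERIV_isCont continuous_at_imp_continuous_on by blast
    note i1 = mc[OF u C1cD(2)[OF \<phi>]] and i2 = mc[OF Gi C1cD(2)[OF \<phi>]] and i3 = mc[OF g c]
    have "(LINT x|?M. G x * deriv \<phi> x) = - (LINT x|?M. g x * \<phi> x)"
      unfolding lint_Ioo[OF i2] lint_Ioo[OF i3]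
      using ac_on_by_parts[OF G C1cD(3)[OF \<phi>]] cd by simp
    then show "(LINT x|?M. (u x - G x) * deriv \<phi> x) = 0"
      unfolding left_diff_distrib using *[OF \<phi>] i1 i2 by simp
  qed
  then obtain k where k: "AE x in ?M. u x - G x = k" by blast
  have "ac_on c d (\<lambda>x. k + G x) g" using ac_on_add[OF ac_on_const G, of k] by simp
  moreover have "AE x in ?M. u x = k + G x" using k by eventually_elim auto
  ultimately show ?thesis by blast
qed

lemma weak_derivD:
  assumes "has_weak_deriv u g"
  shows "\<exists>f. ac_on 0 1 f g \<and> (AE x in lebesgue_on {0<..<1}. u x = f x)"
  using assms unfolding has_weak_deriv_def L1_def
  by (intro weak_deriv_imp_ac) auto

lemma weak_derivI:
  assumes f: "ac_on 0 1 f g" and uf: "AE x in lebesgue_on {0<..<1}. u x = f x"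
  shows "has_weak_deriv u g"
proof -
  let ?M = "lebesgue_on {0<..<1::real}"
  have fi: "integrable ?M f"
    using absolutely_integrable_continuous_real[OF ac_on_cont[OF f]] by (simp add: integrable_Ioo_iff)
  obtain N where N: "negligible N" "\<forall>x\<in>{0<..<1} - N. u x = f x"
    using uf by (auto simp: AE_lebesgue_on_iff)
  have ui: "integrable ?M u"
  proof -
    have "negligible (N \<union> {0,1})" by (intro negligible_Un N) auto
    then have "u absolutely_integrable_on {0..1}"
      by (rule absolutely_integrable_spike[rotated]) (use N fi in \<open>auto simp: integrable_Ioo_iff\<close>)
    then show ?thesis by (simp add: integrable_Ioo_iff)
  qed
  have gi: "integrable ?M g" using ac_on_abs_int[OF f] by (simp add: integrable_Ioo_iff)
  note mc = integrable_Ioo_mult_cont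
  have "(LINT x|?M. u x * deriv \<phi> x) = - (LINT x|?M. g x * \<phi> x)" if \<phi>: "\<phi> \<in> C1c 0 1" for \<phi>
  proof -
    note [simp] = C1cD(4)[OF \<phi>, of 0] C1cD(4)[OF \<phi>, of 1]
    have c: "continuous_on UNIV \<phi>"
      using C1cD(1)[OF \<phi>] DERIV_isCont continuous_at_imp_continuous_on by blast
    note i1 = mc[OF ui C1cD(2)[OF \<phi>]] and i2 = mc[OF fi C1cD(2)[OF \<phi>]] and i3 = mc[OF gi c]
    have "(LINT x|?M. u x * deriv \<phi> x) = (LINT x|?M. f x * deriv \<phi> x)"
      using uf i1 i2 by (intro integral_cong_AE) auto
    also have "\<dots> = - (LINT x|?M. g x * \<phi> x)"
      unfolding lint_Ioo[OF i2] lint_Ioo[OF i3]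
      using ac_on_by_parts[OF f C1cD(3)[OF \<phi>]] by simp
    finally show ?thesis .
  qed
  then show ?thesis using ui gi by (simp add: has_weak_deriv_def L1_def)
qed

text \<open>The difference of two densities has zero integral over every subinterval. The local
  increment criterion then shows that its product with a continuous \<open>\<eta>\<close> has
  primitive zero, since on a short interval \<open>\<eta>\<close> is almost constant. Orthogonality
  to all such \<open>\<eta>\<close> gives the claim without any theorem on differentiation of
  integrals.\<close>

lemma ac_on_AE_unique:
  assumes "ac_on c d f g" "ac_on c d f g'"
  shows "AE x in lebesgue_on {c<..<d}. g x = g' x"
proof (cases "c < d")
  case True
  let ?M = "lebesgue_on {c<..<d}"
  let ?h = "\<lambda>x. g x - g' x"
  have z: "ac_on c d (\<lambda>x. 0) ?h" using ac_on_sub_fun[OF assms] by simp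
  have ha: "?h absolutely_integrable_on {c..d}" by (rule ac_on_abs_int[OF z])
  have hi: "integrable ?M ?h" using ha by (simp add: integrable_Ioo_iff)
  have orth: "(LINT x|?M. ?h x * \<eta> x) = 0" if \<eta>: "compact_in c d \<eta>" for \<eta>
  proof -
    have c: "continuous_on {c..d} \<eta>" using \<eta> continuous_on_subset unfolding compact_in_def by blast
    have A: "(\<lambda>x. ?h x * \<eta> x) absolutely_integrable_on {c..d}"
      using abs_int_mult_cont[OF c ha] by (simp add: mult.commute)
    have N: "(\<lambda>x. \<bar>?h x\<bar>) absolutely_integrable_on {c..d}" by (rule set_integrable_abs[OF ha])
    have "ac_on c d (\<lambda>x. 0) (\<lambda>x. ?h x * \<eta> x)"
    proof (rule ac_onI_partition[OF A N])
      fix e :: real assume e: "e > 0"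
      obtain d1 where d1: "d1 > 0" "\<And>x y. x \<in> {c..d} \<Longrightarrow> y \<in> {c..d} \<Longrightarrow> \<bar>x - y\<bar> < d1 \<Longrightarrow> \<bar>\<eta> x - \<eta> y\<bar> < e"
        using unif_cont_Icc[OF c e] by blast
      show "\<exists>\<delta>>0. \<forall>r t. c \<le> r \<longrightarrow> r \<le> t \<longrightarrow> t \<le> d \<longrightarrow> t - r < \<delta> \<longrightarrow>
         \<bar>0 - 0 - integral {r..t} (\<lambda>x. ?h x * \<eta> x)\<bar> \<le> e * integral {r..t} (\<lambda>x. \<bar>?h x\<bar>)"
      proof (intro exI[of _ d1] conjI allI impI)
        fix r t assume rt: "c \<le> r" "r \<le> t" "t \<le> d" "t - r < d1"
        note sub = abs_int_sub_int[OF _ rt(1) rt(3)]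
        have "integral {r..t} (\<lambda>x. ?h x * \<eta> x) = integral {r..t} (\<lambda>x. ?h x * \<eta> x) - integral {r..t} (\<lambda>x. \<eta> r * ?h x)"
          using ac_on_diff[OF z rt(1-3)] by simp
        also have "\<dots> = integral {r..t} (\<lambda>x. ?h x * \<eta> x - \<eta> r * ?h x)"
          by (rule Henstock_Kurzweil_Integration.integral_diff[symmetric])
            (intro integrable_on_real_cmult sub[OF A] sub[OF ha])+
        finally have "\<bar>0 - 0 - integral {r..t} (\<lambda>x. ?h x * \<eta> x)\<bar> = \<bar>integral {r..t} (\<lambda>x. ?h x * \<eta> x - \<eta> r * ?h x)\<bar>"
          by simp
        also have "\<dots> \<le> integral {r..t} (\<lambda>x. e * \<bar>?h x\<bar>)"
        proof (rule abs_integral_le)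
          show "(\<lambda>x. ?h x * \<eta> x - \<eta> r * ?h x) integrable_on {r..t}"
            by (intro integrable_diff integrable_on_real_cmult sub[OF A] sub[OF ha])
          show "(\<lambda>x. e * \<bar>?h x\<bar>) integrable_on {r..t}"
            by (intro integrable_on_real_cmult sub[OF N])
          fix x assume x: "x \<in> {r..t}"
          have "\<bar>\<eta> x - \<eta> r\<bar> * \<bar>?h x\<bar> \<le> e * \<bar>?h x\<bar>"
            using d1(2)[of x r] x rt by (intro mult_right_mono) auto
          then show "\<bar>?h x * \<eta> x - \<eta> r * ?h x\<bar> \<le> e * \<bar>?h x\<bar>"
            by (simp add: abs_mult[symmetric] left_diff_distrib mult.commute)
        qed
        also have "\<dots> = e * integral {r..t} (\<lambda>x. \<bar>?h x\<bar>)" by simp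
        finally show "\<bar>0 - 0 - integral {r..t} (\<lambda>x. ?h x * \<eta> x)\<bar> \<le> e * integral {r..t} (\<lambda>x. \<bar>?h x\<bar>)" .
      qed (use d1 in auto)
    qed auto
    from ac_on_diff[OF this, of c d] True show ?thesis
      using lint_Ioo[of c d "\<lambda>x. ?h x * \<eta> x"] A by (simp add: integrable_Ioo_iff)
  qed
  have "AE x in ?M. ?h x = 0" by (rule orthogonal_imp_AE_zero[OF True hi orth])
  then show ?thesis by eventually_elim simp
qed (auto simp: AE_lebesgue_on_iff)

lemma weak_deriv_unique:
  assumes "has_weak_deriv u g" "has_weak_deriv v h" and uv: "AE x in lebesgue_on {0<..<1}. u x = v x"
  shows "AE x in lebesgue_on {0<..<1}. g x = h x"
proof -
  let ?M = "lebesgue_on {0<..<1::real}"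
  obtain f1 where f1: "ac_on 0 1 f1 g" "AE x in ?M. u x = f1 x"
    using weak_derivD[OF assms(1)] by blast
  obtain f2 where f2: "ac_on 0 1 f2 h" "AE x in ?M. v x = f2 x"
    using weak_derivD[OF assms(2)] by blast
  have ae: "AE x in ?M. f1 x - f2 x = 0" using f1(2) f2(2) uv by eventually_elim simp
  have c: "continuous_on {0..1} (\<lambda>x. f1 x - f2 x)"
    by (intro continuous_intros ac_on_cont[OF f1(1)] ac_on_cont[OF f2(1)])
  have "f1 x - f2 x = 0" if "x \<in> {0..1}" for x
    by (rule AE_zero_imp_zero[OF ae c _ that]) simp
  then have "ac_on 0 1 f1 h"
    by (intro ac_on_cong[OF f2(1), where S = "{}"]) auto
  then show ?thesis by (rule ac_on_AE_unique[OF f1(1)])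
qed

lemma weak_deriv_continuous_ac:
  assumes "has_weak_deriv u g" "continuous_on {0..1} u"
  shows "ac_on 0 1 u g"
proof -
  obtain f where f: "ac_on 0 1 f g" "AE x in lebesgue_on {0<..<1}. u x = f x" using weak_derivD[OF assms(1)] by blast
  have ae: "AE x in lebesgue_on {0<..<1}. u x - f x = 0" using f(2) by eventually_elim simp
  have c: "continuous_on {0..1} (\<lambda>x. u x - f x)" by (intro continuous_intros ac_on_cont[OF f(1)] assms(2))
  have "u x - f x = 0" if "x \<in> {0..1}" for x
    by (rule AE_zero_imp_zero[OF ae c _ that]) simp
  then show ?thesis by (intro ac_on_cong[OF f(1), where S = "{}"]) auto
qed

lemma wderiv_weak: "has_weak_deriv u g \<Longrightarrow> has_weak_deriv u (wderiv u)"
  unfolding wderiv_def using someI_ex[of "has_weak_deriv u"] by auto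

lemma wderiv_AE: "has_weak_deriv u g \<Longrightarrow> AE x in lebesgue_on {0<..<1}. wderiv u x = g x"
  by (rule weak_deriv_unique[OF wderiv_weak]) auto

section \<open>Boundary values and the description of \<open>W11_0\<close> by them\<close>

lemma ac_on_bound_pt:
  assumes f: "ac_on 0 1 f g" and y: "y \<in> {0..1}"
  shows "\<bar>f y\<bar> \<le> (LINT x|lebesgue_on {0<..<1}. \<bar>f x\<bar>) + (LINT x|lebesgue_on {0<..<1}. \<bar>g x\<bar>)"
proof -
  let ?M = "lebesgue_on {0<..<1::real}"
  note ga = ac_on_abs_int[OF f]
  have Ng: "(\<lambda>x. \<bar>g x\<bar>) absolutely_integrable_on {0..1}" by (rule set_integrable_abs[OF ga])
  have Nf: "(\<lambda>x. \<bar>f x\<bar>) absolutely_integrable_on {0..1}"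
    by (intro absolutely_integrable_continuous_real continuous_intros ac_on_cont[OF f])
  have *: "\<bar>f y\<bar> \<le> \<bar>f x\<bar> + integral {0..1} (\<lambda>x. \<bar>g x\<bar>)" if x: "x \<in> {0..1}" for x
  proof -
    have "\<bar>f t - f r\<bar> \<le> integral {0..1} (\<lambda>x. \<bar>g x\<bar>)" if "0 \<le> r" "r \<le> t" "t \<le> 1" for r t
    proof -
      have "\<bar>integral {r..t} g\<bar> \<le> integral {r..t} (\<lambda>x. \<bar>g x\<bar>)"
        by (rule abs_integral_le[OF abs_int_sub_int[OF ga] abs_int_sub_int[OF Ng]]) (use that in auto)
      also have "\<dots> \<le> integral {0..1} (\<lambda>x. \<bar>g x\<bar>)"
        by (rule integral_subset_le[OF _ abs_int_sub_int[OF Ng] abs_int_sub_int[OF Ng]]) (use that in auto)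
      finally show ?thesis using ac_on_diff[OF f that] by simp
    qed
    from this[of x y] this[of y x] x y show ?thesis by (cases "x \<le> y") auto
  qed
  have "integral {0..1::real} (\<lambda>x. \<bar>f y\<bar>) \<le> integral {0..1} (\<lambda>x. \<bar>f x\<bar> + integral {0..1} (\<lambda>x. \<bar>g x\<bar>))"
    using Nf by (intro integral_le integrable_add *) (auto simp: absolutely_integrable_on_def)
  also have "\<dots> = integral {0..1} (\<lambda>x. \<bar>f x\<bar>) + integral {0..1} (\<lambda>x. \<bar>g x\<bar>)"
    using Nf by (subst Henstock_Kurzweil_Integration.integral_add) (auto simp: absolutely_integrable_on_def)
  finally show ?thesis using Nf Ng by (simp add: lint_Ioo integrable_Ioo_iff)
qed

text \<open>Test functions vanish at both ends, and the W^{1,1} norm controls the value at every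
  point of the closed interval, so this value survives the passage to the limit.\<close>

lemma W11_0D:
  assumes u: "u \<in> W11_0" and f: "ac_on 0 1 f g" and uf: "AE x in lebesgue_on {0<..<1}. u x = f x"
    and y: "y = 0 \<or> y = 1"
  shows "f y = 0"
proof -
  let ?M = "lebesgue_on {0<..<1::real}"
  have w: "has_weak_deriv u g" by (rule weak_derivI[OF f uf])
  note wg = wderiv_AE[OF w]
  have um: "integrable ?M u" "integrable ?M g" "integrable ?M (wderiv u)"
    using w wderiv_weak[OF w] by (auto simp: has_weak_deriv_def L1_def)
  have fm: "integrable ?M f"
    using absolutely_integrable_continuous_real[OF ac_on_cont[OF f]] by (simp add: integrable_Ioo_iff)
  have "\<bar>f y\<bar> \<le> 0 + e" if e: "e > 0" for e
  proof -
    obtain \<phi> where \<phi>: "\<phi> \<in> C1c 0 1" and small: "(LINT x|?M. \<bar>u x - \<phi> x\<bar>) + (LINT x|?M. \<bar>wderiv u x - deriv \<phi> x\<bar>) < e"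
      using u e unfolding W11_0_def by blast
    have pm: "integrable ?M \<phi>" "integrable ?M (deriv \<phi>)"
      using absolutely_integrable_continuous_real[OF ac_on_cont[OF C1cD(3)[OF \<phi>, of 0 1]]]
        ac_on_abs_int[OF C1cD(3)[OF \<phi>, of 0 1]] by (auto simp: integrable_Ioo_iff)
    note [measurable] = borel_measurable_integrable[OF pm(1)] borel_measurable_integrable[OF pm(2)]
      borel_measurable_integrable[OF um(1)] borel_measurable_integrable[OF um(2)]
      borel_measurable_integrable[OF um(3)] borel_measurable_integrable[OF fm]
    have "\<phi> y = 0" using C1cD(4)[OF \<phi>, of y] y by auto
    then have "\<bar>f y\<bar> = \<bar>f y - \<phi> y\<bar>" by simp
    also have "\<dots> \<le> (LINT x|?M. \<bar>f x - \<phi> x\<bar>) + (LINT x|?M. \<bar>g x - deriv \<phi> x\<bar>)"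
      by (rule ac_on_bound_pt[OF ac_on_sub_fun[OF f C1cD(3)[OF \<phi>]]]) (use y in auto)
    also have "(LINT x|?M. \<bar>f x - \<phi> x\<bar>) = (LINT x|?M. \<bar>u x - \<phi> x\<bar>)"
      by (rule integral_cong_AE) (use uf in auto)
    also have "(LINT x|?M. \<bar>g x - deriv \<phi> x\<bar>) = (LINT x|?M. \<bar>wderiv u x - deriv \<phi> x\<bar>)"
      by (rule integral_cong_AE) (use wg in auto)
    finally show ?thesis using small by simp
  qed
  then have "\<bar>f y\<bar> \<le> 0" by (rule field_le_epsilon)
  then show ?thesis by simp
qed

text \<open>Approximate the derivative rather than the function. As f vanishes at both ends, g has
  mean zero, so an L1 approximation of g has small mean m; removing m times a bump makes it the
  derivative of a test function. This is what places the conjugated function w in the space where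
  the Hardy inequality holds.\<close>

lemma W11_0I:
  assumes f: "ac_on 0 1 f g" and uf: "AE x in lebesgue_on {0<..<1}. u x = f x" and f0: "f 0 = 0" "f 1 = 0"
  shows "u \<in> W11_0"
proof -
  let ?M = "lebesgue_on {0<..<1::real}"
  have w: "has_weak_deriv u g" by (rule weak_derivI[OF f uf])
  note wg = wderiv_AE[OF w]
  have um: "integrable ?M u" "integrable ?M g" "integrable ?M (wderiv u)"
    using w wderiv_weak[OF w] by (auto simp: has_weak_deriv_def L1_def)
  have fm: "integrable ?M f"
    using absolutely_integrable_continuous_real[OF ac_on_cont[OF f]] by (simp add: integrable_Ioo_iff)
  have "\<exists>\<phi>\<in>C1c 0 1. (LINT x|?M. \<bar>u x - \<phi> x\<bar>) + (LINT x|?M. \<bar>wderiv u x - deriv \<phi> x\<bar>) < e" if e: "e > 0" for e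
  proof -
    \<comment> \<open>One e/8 pays for the approximation and one for the correction of the mean, so
      the derivatives differ by less than e/4 in L1. Integrating from 0, the functions differ by at
      most e/4 everywhere.\<close>
    obtain \<eta> where \<eta>: "compact_in 0 1 \<eta>" "(LINT x|?M. \<bar>g x - \<eta> x\<bar>) < e / 8"
      using approx_L1[OF _ um(2), of "e/8"] e by auto
    obtain b where b: "compact_in 0 1 b" "\<And>x. b x \<ge> 0" "integral {0..1} b = 1"
      using bump_exists[of 0 1] by auto
    note \<eta>i = compact_in_integrable[OF \<eta>(1)] and bi = compact_in_integrable[OF b(1)]
    define m where "m = integral {0..1} \<eta>"
    have "integral {0..1} g = 0" using ac_on_diff[OF f, of 0 1] f0 by simp
    then have "m = (LINT x|?M. \<eta> x) - (LINT x|?M. g x)"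
      by (simp add: m_def lint_Ioo[OF \<eta>i] lint_Ioo[OF um(2)])
    also have "\<dots> = (LINT x|?M. \<eta> x - g x)" using \<eta>i um by simp
    finally have "\<bar>m\<bar> \<le> (LINT x|?M. \<bar>\<eta> x - g x\<bar>)"
      using integral_norm_bound[of ?M "\<lambda>x. \<eta> x - g x"] by simp
    then have m: "\<bar>m\<bar> < e / 8" using \<eta>(2) by (simp add: abs_minus_commute)
    let ?\<zeta> = "\<lambda>x. \<eta> x + (- m) * b x"
    have \<zeta>: "compact_in 0 1 ?\<zeta>" by (rule compact_in_add[OF \<eta>(1) b(1)])
    note \<zeta>i = compact_in_integrable[OF \<zeta>]
    have "integral {0..1} ?\<zeta> = (LINT x|?M. ?\<zeta> x)" using \<zeta>i by (simp add: lint_Ioo)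
    also have "\<dots> = (LINT x|?M. \<eta> x) + (- m) * (LINT x|?M. b x)" using \<eta>i bi by simp
    also have "\<dots> = 0" by (simp add: lint_Ioo[OF \<eta>i] lint_Ioo[OF bi] b(3) m_def)
    finally have z: "integral {0..1} ?\<zeta> = 0" .
    define \<phi> where "\<phi> x = integral {0..x} ?\<zeta>" for x
    have \<phi>: "\<phi> \<in> C1c 0 1" "deriv \<phi> = ?\<zeta>"
      using primitive_C1c[OF \<zeta> z] by (auto simp: \<phi>_def[abs_def])
    have "(LINT x|?M. \<bar>g x - ?\<zeta> x\<bar>) \<le> (LINT x|?M. \<bar>g x - \<eta> x\<bar> + \<bar>m\<bar> * b x)"
    proof (rule integral_mono)
      fix x
      have "\<bar>g x - ?\<zeta> x\<bar> \<le> \<bar>g x - \<eta> x\<bar> + \<bar>m * b x\<bar>" by simp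
      then show "\<bar>g x - ?\<zeta> x\<bar> \<le> \<bar>g x - \<eta> x\<bar> + \<bar>m\<bar> * b x" using b(2)[of x] by (simp add: abs_mult)
    qed (use um \<eta>i bi in auto)
    also have "\<dots> = (LINT x|?M. \<bar>g x - \<eta> x\<bar>) + \<bar>m\<bar> * (LINT x|?M. b x)"
      using um \<eta>i bi by simp
    also have "\<dots> < e / 4" using \<eta>(2) m by (simp add: lint_Ioo[OF bi] b(3))
    finally have D: "(LINT x|?M. \<bar>g x - ?\<zeta> x\<bar>) < e / 4" .
    have dac: "ac_on 0 1 (\<lambda>x. f x - \<phi> x) (\<lambda>x. g x - ?\<zeta> x)"
      using ac_on_sub_fun[OF f C1cD(3)[OF \<phi>(1)]] \<phi>(2) by simp
    have pt: "\<bar>f y - \<phi> y\<bar> \<le> e / 4" if y: "y \<in> {0<..<1}" for y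
    proof -
      have a: "(\<lambda>x. g x - ?\<zeta> x) absolutely_integrable_on {0..1}" using dac by (rule ac_on_abs_int)
      have N: "(\<lambda>x. \<bar>g x - ?\<zeta> x\<bar>) absolutely_integrable_on {0..1}" by (rule set_integrable_abs[OF a])
      have "\<bar>integral {0..y} (\<lambda>x. g x - ?\<zeta> x)\<bar> \<le> integral {0..y} (\<lambda>x. \<bar>g x - ?\<zeta> x\<bar>)"
        by (rule abs_integral_le[OF abs_int_sub_int[OF a] abs_int_sub_int[OF N]]) (use y in auto)
      also have "\<dots> \<le> integral {0..1} (\<lambda>x. \<bar>g x - ?\<zeta> x\<bar>)"
        by (rule integral_subset_le[OF _ abs_int_sub_int[OF N] abs_int_sub_int[OF N]]) (use y in auto)
      also have "\<dots> = (LINT x|?M. \<bar>g x - ?\<zeta> x\<bar>)" using N by (simp add: lint_Ioo integrable_Ioo_iff)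
      finally have "\<bar>integral {0..y} (\<lambda>x. g x - ?\<zeta> x)\<bar> \<le> e / 4" using D by linarith
      moreover have "integral {0..y} (\<lambda>x. g x - ?\<zeta> x) = f y - \<phi> y"
        using ac_on_diff[OF dac, of 0 y] y f0 C1cD(4)[OF \<phi>(1), of 0] by simp
      ultimately show ?thesis by simp
    qed
    have pm: "integrable ?M \<phi>" "integrable ?M (deriv \<phi>)"
      using absolutely_integrable_continuous_real[OF ac_on_cont[OF C1cD(3)[OF \<phi>(1), of 0 1]]]
        ac_on_abs_int[OF C1cD(3)[OF \<phi>(1), of 0 1]] by (auto simp: integrable_Ioo_iff)
    note [measurable] = borel_measurable_integrable[OF pm(1)] borel_measurable_integrable[OF pm(2)]
      borel_measurable_integrable[OF um(1)] borel_measurable_integrable[OF um(2)]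
      borel_measurable_integrable[OF um(3)] borel_measurable_integrable[OF fm]
    have "(LINT x|?M. \<bar>u x - \<phi> x\<bar>) = (LINT x|?M. \<bar>f x - \<phi> x\<bar>)"
      by (rule integral_cong_AE) (use uf in auto)
    also have "\<dots> \<le> (LINT x|?M. e / 4)"
      using fm pm pt finite_measure.integrable_const[OF finite_measure_lebesgue_on, of "{0<..<1::real}" "e/4"]
      by (intro integral_mono) auto
    also have "\<dots> = e / 4" by (simp add: measure_restrict_space)
    finally have A: "(LINT x|?M. \<bar>u x - \<phi> x\<bar>) \<le> e / 4" .
    have "(LINT x|?M. \<bar>wderiv u x - deriv \<phi> x\<bar>) = (LINT x|?M. \<bar>g x - deriv \<phi> x\<bar>)"
      by (rule integral_cong_AE) (use wg in auto)
    also have "\<dots> < e / 4" using D by (simp add: \<phi>(2))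
    finally have "(LINT x|?M. \<bar>u x - \<phi> x\<bar>) + (LINT x|?M. \<bar>wderiv u x - deriv \<phi> x\<bar>) < e"
      using A e by linarith
    then show ?thesis using \<phi>(1) by blast
  qed
  then show ?thesis using w unfolding W11_0_def W11_def by blast
qed

section \<open>Degenerate coefficients\<close>

abbreviation I01 :: "real measure" where "I01 \<equiv> lebesgue_on {0<..<1}"

section \<open>One-sided comparison and improper integrals\<close>

lemma AE_sub_Ioo:
  assumes "AE x in lebesgue_on {c<..<d}. P x" "c \<le> p" "q \<le> d"
  shows "AE x in lebesgue_on {p<..<q::real}. P x"
proof -
  obtain N where "negligible N" "\<forall>x\<in>{c<..<d} - N. P x"
    using assms(1) by (auto simp: AE_lebesgue_on_iff)
  then have "\<forall>x\<in>{p<..<q} - N. P x" using assms(2,3) by auto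
  then show ?thesis using \<open>negligible N\<close> by (auto simp: AE_lebesgue_on_iff)
qed

text \<open>All differential inequalities, in space and in time, are integrated through this
  comparison. The inequality is only assumed on the open interval, so the end points join the
  exceptional null set.\<close>

lemma ac_on_lower:
  assumes f: "ac_on p q f f'" and pq: "p \<le> q" and h: "h integrable_on {p..q}"
    and le: "AE x in lebesgue_on {p<..<q}. h x \<le> f' x"
  shows "f p + integral {p..q} h \<le> f q"
proof -
  obtain N where N: "negligible N" "\<forall>x\<in>{p<..<q} - N. h x \<le> f' x"
    using le by (auto simp: AE_lebesgue_on_iff)
  let ?N = "N \<union> {p, q}"
  have neg: "negligible ?N" by (intro negligible_Un N) auto
  let ?g = "\<lambda>x. if x \<in> ?N then h x else f' x"
  have gi: "?g integrable_on {p..q}"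
    by (rule integrable_spike[OF ac_on_int[OF f] neg]) auto
  have "integral {p..q} h \<le> integral {p..q} ?g"
    by (rule integral_le[OF h gi]) (use N in auto)
  also have "\<dots> = integral {p..q} f'"
    by (rule integral_spike[OF neg]) auto
  finally show ?thesis using ac_on_diff[OF f, of p q] pq by simp
qed

text \<open>Monotone convergence for truncations away from p. The value 0 at p fits the application:
  p is the degenerate point x0, where the quotient \<open>(x - x0) / a x\<close> is 0/0, which is 0
  by convention.\<close>

lemma integrable_improper_right:
  fixes h :: "real \<Rightarrow> real"
  assumes pq: "p < q" and h0: "\<And>x. x \<in> {p..q} \<Longrightarrow> 0 \<le> h x" and hp: "h p = 0"
    and int: "\<And>d. p < d \<Longrightarrow> d \<le> q \<Longrightarrow> h integrable_on {d..q} \<and> integral {d..q} h \<le> B"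
  shows "h integrable_on {p..q}"
proof -
  \<comment> \<open>The cut-off points start at q for n = 0 and decrease to p, so each lies in the
    range where h is known to be integrable.\<close>
  define e where "e n = p + (q - p) / real (Suc n)" for n
  have e: "p < e n" "e n \<le> q" "e (Suc n) \<le> e n" for n
  proof -
    show "p < e n" using pq by (simp add: e_def)
    have "(q - p) / real (Suc n) \<le> (q - p) / 1" using pq by (intro divide_left_mono) auto
    then show "e n \<le> q" by (simp add: e_def)
    have "(q - p) / real (Suc (Suc n)) \<le> (q - p) / real (Suc n)" using pq by (intro divide_left_mono) auto
    then show "e (Suc n) \<le> e n" by (simp add: e_def)
  qed
  define f where "f n x = (if x \<in> {e n..q} then h x else 0)" for n x
  have sub: "{e n..q} \<subseteq> {p..q}" for n using e[of n] by auto
  have fh: "(f n has_integral integral {e n..q} h) {p..q}" for n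
    unfolding f_def[abs_def] has_integral_restrict[OF sub]
    using int[OF e(1,2), of n] by (simp add: integrable_integral)
  have fi: "f n integrable_on {p..q}" for n using fh by blast
  have fI: "integral {p..q} (f n) = integral {e n..q} h" for n using fh by (rule integral_unique)
  have "h integrable_on {p..q} \<and> (\<lambda>k. integral {p..q} (f k)) \<longlonglongrightarrow> integral {p..q} h"
  proof (rule monotone_convergence_increasing[OF fi])
    show "f k x \<le> f (Suc k) x" if "x \<in> {p..q}" for k x
      using h0[OF that] e(3)[of k] that by (auto simp: f_def)
    show "(\<lambda>k. f k x) \<longlonglongrightarrow> h x" if x: "x \<in> {p..q}" for x
    proof (cases "x = p")
      case True
      have "f k p = 0" for k using hp by (simp add: f_def)
      then show ?thesis using True hp by simp
    next
      case False
      then have xp: "x - p > 0" using x by auto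
      obtain n :: nat where n: "(q - p) / (x - p) < real n" using reals_Archimedean2 by blast
      have "f k x = h x" if "k \<ge> n" for k
      proof -
        have "(q - p) / (x - p) < real (Suc k)" using n that by linarith
        then have "(q - p) / real (Suc k) < x - p" using xp by (simp add: field_simps)
        then have "e k \<le> x" by (simp add: e_def)
        then show ?thesis using x by (simp add: f_def)
      qed
      then have "eventually (\<lambda>k. h x = f k x) sequentially"
        unfolding eventually_sequentially by (intro exI[of _ n] allI impI) (simp add: \<open>\<And>k. n \<le> k \<Longrightarrow> f k x = h x\<close>)
      then show ?thesis by (rule Lim_transform_eventually[OF tendsto_const])
    qed
    have "\<bar>integral {p..q} (f k)\<bar> \<le> B" for k
    proof -
      have "0 \<le> integral {e k..q} h"
        using int[OF e(1,2), of k] h0 sub[of k] by (intro Henstock_Kurzweil_Integration.integral_nonneg) auto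
      then show ?thesis using int[OF e(1,2), of k] fI by simp
    qed
    then show "bounded (range (\<lambda>k. integral {p..q} (f k)))"
      by (auto simp: bounded_iff intro!: exI[of _ B])
  qed
  then show ?thesis by simp
qed

lemma integrable_improper_left:
  fixes h :: "real \<Rightarrow> real"
  assumes pq: "p < q" and h0: "\<And>x. x \<in> {p..q} \<Longrightarrow> 0 \<le> h x" and hq: "h q = 0"
    and int: "\<And>d. p \<le> d \<Longrightarrow> d < q \<Longrightarrow> h integrable_on {p..d} \<and> integral {p..d} h \<le> B"
  shows "h integrable_on {p..q}"
proof -
  have "(\<lambda>x. h (- x)) integrable_on {- q..- p}"
  proof (rule integrable_improper_right)
    fix d assume d: "- q < d" "d \<le> - p"
    have "h integrable_on {p..- d} \<and> integral {p..- d} h \<le> B" by (rule int) (use d in auto)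
    then show "(\<lambda>x. h (- x)) integrable_on {d..- p} \<and> integral {d..- p} (\<lambda>x. h (- x)) \<le> B"
      using Henstock_Kurzweil_Integration.integrable_reflect_real[where f = h and a = p and b = "- d"] Henstock_Kurzweil_Integration.integral_reflect_real[where f = h and a = p and b = "- d"] by simp
  qed (use pq h0 hq in auto)
  then show ?thesis using Henstock_Kurzweil_Integration.integrable_reflect_real[where f = h and a = p and b = q] by simp
qed

text \<open>The form the product rule gives for the derivative of y^2/A, factored so that y A'/A
  appears, the quantity bounded by K1.\<close>

lemma square_quotient_deriv:
  "A \<noteq> 0 \<Longrightarrow> y\<^sup>2 * (- w / A\<^sup>2) + 1 / A * (2 * y * 1) = y / A * (2 - y * w / A :: real)"
  by (simp add: field_simps power2_eq_square)

text \<open>All cases of the hypotheses are reduced to two numbers. \<open>\<beta>\<close> bounds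
  lam (x - x0) b'/b from above, and \<open>\<kappa>\<close> is the part of 2 - K1 that survives
  after the Hardy inequality has absorbed \<open>\<beta>\<close> times the singular
  integral.\<close>

locale coeffs =
  fixes a b :: "real \<Rightarrow> real" and x0 K1 lam \<beta> \<kappa> c1 c2 T :: real
  assumes x0: "0 < x0" "x0 < 1"
    and a_cont: "continuous_on {0..1} a" and b_cont: "continuous_on {0..1} b"
    and a_x0: "a x0 = 0" and b_x0: "b x0 = 0"
    and a_pos: "\<And>x. x \<in> {0..1} \<Longrightarrow> x \<noteq> x0 \<Longrightarrow> 0 < a x"
    and b_pos: "\<And>x. x \<in> {0..1} \<Longrightarrow> x \<noteq> x0 \<Longrightarrow> 0 < b x"
    and a_ac: "ac_on 0 1 a (wderiv a)" and b_ac: "ac_on 0 1 b (wderiv b)"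
    and a_deg: "AE x in I01. (x - x0) * wderiv a x \<le> K1 * a x"
    and K1: "K1 < 2"
    and b_deg: "AE x in I01. lam * ((x - x0) * wderiv b x) \<le> \<beta> * b x"
    and lam: "lam \<noteq> 0"
    and kappa: "0 < \<kappa>" "\<kappa> \<le> 2 - K1"
    and hardy: "\<And>u. u \<in> H1ab a b \<Longrightarrow> \<beta> * (LINT x|I01. (u x)\<^sup>2 / b x)
        \<le> (2 - K1 - \<kappa>) * (LINT x|I01. a x * (wderiv u x)\<^sup>2)"
    and c1: "0 < c1" and c2: "(SUP x\<in>{0..1}. psi_int a x0 x) < c2" and T: "0 < T"
begin

lemma a_nonneg: "x \<in> {0..1} \<Longrightarrow> 0 \<le> a x"
  using a_pos[of x] a_x0 by (cases "x = x0") auto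

lemma b_nonneg: "x \<in> {0..1} \<Longrightarrow> 0 \<le> b x"
  using b_pos[of x] b_x0 by (cases "x = x0") auto

text \<open>\<open>p2a\<close> is monotone on each side of \<open>x0\<close> with \<open>p2a' \<ge> (2 - K1) (x - x0) / a\<close> to the right of \<open>x0\<close>.
  This bounds \<open>p2a\<close> and makes \<open>(x - x0) / a\<close> integrable, so that the weight \<open>psi\<close> is absolutely continuous.\<close>

definition p2a :: "real \<Rightarrow> real" where "p2a x = (x - x0)\<^sup>2 / a x"

lemma p2a_nonneg: "x \<in> {0..1} \<Longrightarrow> 0 \<le> p2a x"
  using a_nonneg by (simp add: p2a_def)

lemma ac_inv_a:
  assumes "0 \<le> p" "q \<le> 1" "x0 \<notin> {p..q}"
  shows "ac_on p q (\<lambda>x. 1 / a x) (\<lambda>x. - wderiv a x / (a x)\<^sup>2)"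
  by (rule ac_on_inverse[OF ac_on_sub[OF a_ac assms(1,2)]], rule a_pos) (use assms in auto)

lemma ac_inv_b:
  assumes "0 \<le> p" "q \<le> 1" "x0 \<notin> {p..q}"
  shows "ac_on p q (\<lambda>x. 1 / b x) (\<lambda>x. - wderiv b x / (b x)\<^sup>2)"
  by (rule ac_on_inverse[OF ac_on_sub[OF b_ac assms(1,2)]], rule b_pos) (use assms in auto)

lemma ac_shift: "ac_on p q (\<lambda>x. x - x0) (\<lambda>x. 1)"
  using ac_on_sub_fun[OF ac_on_ident ac_on_const] by simp

lemma ac_p2a:
  assumes "0 \<le> p" "q \<le> 1" "x0 \<notin> {p..q}"
  shows "ac_on p q p2a (\<lambda>x. (x - x0) / a x * (2 - (x - x0) * wderiv a x / a x))"
proof -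
  have "a x \<noteq> 0" if "p \<le> x" "x \<le> q" for x using a_pos[of x] assms that by auto
  then show ?thesis
    by (intro ac_on_cong[OF ac_on_mult[OF ac_on_square[OF ac_shift] ac_inv_a[OF assms]], where S = "{}"]
        square_quotient_deriv) (auto simp: p2a_def)
qed

lemma quot_cont:
  assumes "0 \<le> p" "q \<le> 1" "x0 \<notin> {p..q}"
  shows "continuous_on {p..q} (\<lambda>x. (x - x0) / a x)"
  using ac_on_cont[OF ac_on_mult[OF ac_shift ac_inv_a[OF assms]]] by simp

lemma p2a_growth:
  assumes "0 \<le> p" "q \<le> 1" "p \<le> q" "x0 < p"
  shows "p2a p + (2 - K1) * integral {p..q} (\<lambda>x. (x - x0) / a x) \<le> p2a q"
proof -
  have n: "x0 \<notin> {p..q}" using assms by auto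
  have "p2a p + integral {p..q} (\<lambda>x. (2 - K1) * ((x - x0) / a x)) \<le> p2a q"
  proof (rule ac_on_lower[OF ac_p2a[OF assms(1,2) n] assms(3)])
    show "(\<lambda>x. (2 - K1) * ((x - x0) / a x)) integrable_on {p..q}"
      by (intro integrable_on_real_cmult integrable_continuous_real quot_cont assms n)
    have "AE x in lebesgue_on {p<..<q}. (x - x0) * wderiv a x \<le> K1 * a x \<and> x \<in> {p<..<q}"
      using AE_sub_Ioo[OF a_deg assms(1,2)] AE_space[of "lebesgue_on {p<..<q}"] by eventually_elim auto
    then show "AE x in lebesgue_on {p<..<q}. (2 - K1) * ((x - x0) / a x)
        \<le> (x - x0) / a x * (2 - (x - x0) * wderiv a x / a x)"
    proof eventually_elim
      case (elim x)
      have ap: "a x > 0" using a_pos[of x] assms elim by auto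
      then have "(x - x0) * wderiv a x / a x \<le> K1" using elim by (simp add: field_simps)
      then show ?case using ap elim assms
        by (subst mult.commute) (intro mult_left_mono, auto)
    qed
  qed
  then show ?thesis unfolding integral_mult_right .
qed

lemma p2a_decay:
  assumes "0 \<le> p" "q \<le> 1" "p \<le> q" "q < x0"
  shows "p2a q + (2 - K1) * integral {p..q} (\<lambda>x. (x0 - x) / a x) \<le> p2a p"
proof -
  have n: "x0 \<notin> {p..q}" using assms by auto
  have "- p2a p + integral {p..q} (\<lambda>x. (2 - K1) * ((x0 - x) / a x)) \<le> - p2a q"
  proof (rule ac_on_lower[OF ac_on_minus[OF ac_p2a[OF assms(1,2) n]] assms(3)])
    have "continuous_on {p..q} (\<lambda>x. - ((x - x0) / a x))"
      by (intro continuous_intros quot_cont assms n)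
    then have "continuous_on {p..q} (\<lambda>x. (x0 - x) / a x)" by (simp add: minus_divide_left)
    then show "(\<lambda>x. (2 - K1) * ((x0 - x) / a x)) integrable_on {p..q}"
      by (intro integrable_on_real_cmult integrable_continuous_real)
    have "AE x in lebesgue_on {p<..<q}. (x - x0) * wderiv a x \<le> K1 * a x \<and> x \<in> {p<..<q}"
      using AE_sub_Ioo[OF a_deg assms(1,2)] AE_space[of "lebesgue_on {p<..<q}"] by eventually_elim auto
    then show "AE x in lebesgue_on {p<..<q}. (2 - K1) * ((x0 - x) / a x)
        \<le> - ((x - x0) / a x * (2 - (x - x0) * wderiv a x / a x))"
    proof eventually_elim
      case (elim x)
      have ap: "a x > 0" using a_pos[of x] assms elim by auto
      then have "(x - x0) * wderiv a x / a x \<le> K1" using elim by (simp add: field_simps)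
      then have "(2 - K1) * ((x0 - x) / a x) \<le> (2 - (x - x0) * wderiv a x / a x) * ((x0 - x) / a x)"
        using ap elim assms by (intro mult_right_mono) auto
      also have "\<dots> = - ((x - x0) / a x * (2 - (x - x0) * wderiv a x / a x))"
        by (metis minus_diff_eq minus_divide_left minus_mult_left mult.commute)
      finally show ?case .
    qed
  qed
  then show ?thesis unfolding integral_mult_right by linarith
qed

text \<open>A common bound for \<open>p2a\<close> on both sides of x0: it is monotone away from x0,
  so each side is bounded by its value at the end point.\<close>

definition Gam :: real where "Gam = p2a 0 + p2a 1"

lemma p2a_le: "x \<in> {0..1} \<Longrightarrow> p2a x \<le> Gam"
proof -
  assume x: "x \<in> {0..1}"
  have nn: "0 \<le> p2a 0" "0 \<le> p2a 1" by (auto intro: p2a_nonneg)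
  consider "x = x0" | "x0 < x" | "x < x0" by linarith
  then show "p2a x \<le> Gam"
  proof cases
    case 1
    then show ?thesis using nn by (simp add: p2a_def Gam_def)
  next
    case 2
    have "0 \<le> integral {x..1} (\<lambda>x. (x - x0) / a x)"
      by (rule Henstock_Kurzweil_Integration.integral_nonneg)
        (use 2 x a_nonneg in \<open>auto intro!: integrable_continuous_real quot_cont\<close>)
    then have "0 \<le> (2 - K1) * integral {x..1} (\<lambda>x. (x - x0) / a x)" using K1 by simp
    then show ?thesis using p2a_growth[of x 1] 2 x nn by (simp add: Gam_def)
  next
    case 3
    have "continuous_on {0..x} (\<lambda>x. - ((x - x0) / a x))"
      by (intro continuous_intros quot_cont) (use 3 x in auto)
    then have "continuous_on {0..x} (\<lambda>x. (x0 - x) / a x)" by (simp add: minus_divide_left)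
    then have "0 \<le> integral {0..x} (\<lambda>x. (x0 - x) / a x)"
      by (intro Henstock_Kurzweil_Integration.integral_nonneg)
        (use 3 x a_nonneg in \<open>auto intro!: integrable_continuous_real\<close>)
    then have "0 \<le> (2 - K1) * integral {0..x} (\<lambda>x. (x0 - x) / a x)" using K1 by simp
    then show ?thesis using p2a_decay[of 0 x] 3 x nn by (simp add: Gam_def)
  qed
qed

text \<open>The growth of \<open>p2a\<close> bounds the integral over \<open>{d..1}\<close> by
  \<open>Gam / (2 - K1)\<close> uniformly in d, and likewise on the left. This is where K1 < 2 makes
  the weight meaningful.\<close>

lemma quot_abs_int: "(\<lambda>x. (x - x0) / a x) absolutely_integrable_on {0..1}"
proof -
  have r: "(\<lambda>x. (x - x0) / a x) integrable_on {x0..1}"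
  proof (rule integrable_improper_right)
    fix d assume d: "x0 < d" "d \<le> 1"
    have "(2 - K1) * integral {d..1} (\<lambda>x. (x - x0) / a x) \<le> Gam"
      using p2a_growth[of d 1] d x0 p2a_nonneg[of d] p2a_nonneg[of 0] by (auto simp: Gam_def)
    then have "integral {d..1} (\<lambda>x. (x - x0) / a x) \<le> Gam / (2 - K1)"
      using K1 by (simp add: field_simps)
    then show "(\<lambda>x. (x - x0) / a x) integrable_on {d..1} \<and> integral {d..1} (\<lambda>x. (x - x0) / a x) \<le> Gam / (2 - K1)"
      using d x0 by (auto intro!: integrable_continuous_real quot_cont)
  qed (use x0 a_nonneg in auto)
  have l: "(\<lambda>x. (x0 - x) / a x) integrable_on {0..x0}"
  proof (rule integrable_improper_left)
    fix d assume d: "0 \<le> d" "d < x0"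
    have "continuous_on {0..d} (\<lambda>x. - ((x - x0) / a x))"
      by (intro continuous_intros quot_cont) (use d x0 in auto)
    then have c: "continuous_on {0..d} (\<lambda>x. (x0 - x) / a x)" by (simp add: minus_divide_left)
    have "(2 - K1) * integral {0..d} (\<lambda>x. (x0 - x) / a x) \<le> Gam"
      using p2a_decay[of 0 d] d x0 p2a_nonneg[of d] p2a_nonneg[of 1] by (auto simp: Gam_def)
    then have "integral {0..d} (\<lambda>x. (x0 - x) / a x) \<le> Gam / (2 - K1)"
      using K1 by (simp add: field_simps)
    then show "(\<lambda>x. (x0 - x) / a x) integrable_on {0..d} \<and> integral {0..d} (\<lambda>x. (x0 - x) / a x) \<le> Gam / (2 - K1)"
      using c by (auto intro!: integrable_continuous_real)
  qed (use x0 a_nonneg in auto)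
  have R: "(\<lambda>x. (x - x0) / a x) absolutely_integrable_on {x0..1}"
    by (rule nonnegative_absolutely_integrable_1[OF r]) (use x0 a_nonneg in auto)
  have "(\<lambda>x. (x0 - x) / a x) absolutely_integrable_on {0..x0}"
    by (rule nonnegative_absolutely_integrable_1[OF l]) (use x0 a_nonneg in auto)
  then have "(\<lambda>x. (- 1) * ((x0 - x) / a x)) absolutely_integrable_on {0..x0}" by (rule set_integrable_mult_right)
  then have L: "(\<lambda>x. (x - x0) / a x) absolutely_integrable_on {0..x0}" by (simp add: minus_divide_left)
  have "{0..x0} \<union> {x0..1} = {0..1}" using x0 by auto
  then show ?thesis using absolutely_integrable_Un[OF L R] by simp
qed

text \<open>\<open>psi_int\<close> is an oriented integral for Borel measure, whereas integrability
  is known for the gauge integral. On an open interval that avoids x0 the integrand is continuous,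
  hence Borel measurable, and both integrals agree.\<close>

lemma lborel_quot_integrable:
  assumes "0 \<le> p" "q \<le> 1" "x0 \<notin> {p<..<q}"
  shows "set_integrable lborel {p<..<q} (\<lambda>x. (x - x0) / a x)"
    "(LINT x:{p<..<q}|lborel. (x - x0) / a x) = integral {p..q} (\<lambda>x. (x - x0) / a x)"
proof -
  have A: "(\<lambda>x. (x - x0) / a x) absolutely_integrable_on {p..q}"
    by (rule absolutely_integrable_on_subinterval[OF quot_abs_int]) (use assms in auto)
  have sub: "{p<..<q} \<subseteq> {0..1}" using assms by auto
  have "a x \<noteq> 0" if "x \<in> {p<..<q}" for x using a_pos[of x] that sub assms(3) by fastforce
  then have "continuous_on {p<..<q} (\<lambda>x. (x - x0) / a x)"
    by (intro continuous_intros continuous_on_subset[OF a_cont sub]) auto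
  then have m: "(\<lambda>x. indicator {p<..<q} x *\<^sub>R ((x - x0) / a x)) \<in> borel_measurable borel"
    by (intro borel_measurable_continuous_on_indicator) auto
  have "integrable lebesgue (\<lambda>x. indicator {p<..<q} x *\<^sub>R ((x - x0) / a x))"
    using A[unfolded absolutely_integrable_on_Icc_iff_Ioo] unfolding set_integrable_def .
  then show i: "set_integrable lborel {p<..<q} (\<lambda>x. (x - x0) / a x)"
    unfolding set_integrable_def by (rule integrable_completion[THEN iffD1, rotated]) (use m in simp)
  show "(LINT x:{p<..<q}|lborel. (x - x0) / a x) = integral {p..q} (\<lambda>x. (x - x0) / a x)"
    using set_borel_integral_eq_integral(2)[OF i] by (simp add: integral_open_interval_real)
qed

text \<open>Moving the base point from x0 to 0 removes the orientation of the interval, so that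
  \<open>psi_int\<close> becomes a primitive on all of [0,1].\<close>

lemma psi_int_eq:
  assumes x: "x \<in> {0..1}"
  shows "psi_int a x0 x = integral {0..x} (\<lambda>x. (x - x0) / a x) - integral {0..x0} (\<lambda>x. (x - x0) / a x)"
proof -
  let ?f = "\<lambda>x. (x - x0) / a x"
  note fi = abs_int_sub_int[OF quot_abs_int]
  show ?thesis
  proof (cases "x0 \<le> x")
    case True
    have "psi_int a x0 x = integral {x0..x} ?f"
      unfolding psi_int_def using True x x0 lborel_quot_integrable(2)[of x0 x]
      by (simp add: interval_lebesgue_integral_def)
    moreover have "integral {0..x0} ?f + integral {x0..x} ?f = integral {0..x} ?f"
      using True x x0 by (intro Henstock_Kurzweil_Integration.integral_combine fi) auto
    ultimately show ?thesis by simp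
  next
    case False
    have "psi_int a x0 x = - integral {x..x0} ?f"
      unfolding psi_int_def using False x x0 lborel_quot_integrable(2)[of x x0]
      by (simp add: interval_lebesgue_integral_def)
    moreover have "integral {0..x} ?f + integral {x..x0} ?f = integral {0..x0} ?f"
      using False x x0 by (intro Henstock_Kurzweil_Integration.integral_combine fi) auto
    ultimately show ?thesis by simp
  qed
qed

abbreviation ps :: "real \<Rightarrow> real" where "ps \<equiv> psi a x0 c1 c2"

lemma ac_psi_int: "ac_on 0 1 (psi_int a x0) (\<lambda>x. (x - x0) / a x)"
  by (rule ac_on_cong[OF ac_on_integral[OF quot_abs_int, of "- integral {0..x0} (\<lambda>x. (x - x0) / a x)"], where S = "{}"])
    (auto simp: psi_int_eq)

lemma ac_psi: "ac_on 0 1 ps (\<lambda>x. c1 * ((x - x0) / a x))"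
  using ac_on_cmult[OF ac_on_sub_fun[OF ac_psi_int ac_on_const], of c1 c2] by (simp add: psi_def[abs_def])

lemma psi_cont: "continuous_on {0..1} ps"
  by (rule ac_on_cont[OF ac_psi])

text \<open>Continuity of \<open>psi_int\<close> makes the supremum a genuine upper bound, and the
  strict inequality for c2 leaves a uniform gap. The gap makes the exponential weight at most 1 and
  lets it decay like exp(-s d Theta) as t tends to 0 or T.\<close>

lemma psi_neg: obtains d where "d > 0" "\<And>x. x \<in> {0..1} \<Longrightarrow> ps x \<le> - d"
proof
  let ?S = "SUP x\<in>{0..1}. psi_int a x0 x"
  show "c1 * (c2 - ?S) > 0" using c1 c2 by simp
  fix x :: real assume x: "x \<in> {0..1}"
  have "compact (psi_int a x0 ` {0..1})"
    by (intro compact_continuous_image ac_on_cont[OF ac_psi_int]) auto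
  then have "bdd_above (psi_int a x0 ` {0..1})"
    by (intro bounded_imp_bdd_above compact_imp_bounded)
  then have "psi_int a x0 x \<le> ?S" using x by (intro cSUP_upper) auto
  then have "c1 * (psi_int a x0 x - c2) \<le> c1 * (?S - c2)" using c1 by simp
  then show "ps x \<le> - (c1 * (c2 - ?S))" by (simp add: psi_def algebra_simps)
qed

lemma psi_bound: obtains B where "B > 0" "\<And>x. x \<in> {0..1} \<Longrightarrow> \<bar>ps x\<bar> \<le> B"
proof -
  have "bounded (ps ` {0..1})"
    by (intro compact_imp_bounded compact_continuous_image psi_cont) auto
  then show ?thesis using that by (auto simp: bounded_pos)
qed

end

section \<open>The Hilbert space \<open>L\<^sup>2\<close>\<close>

abbreviation L2I :: "(real \<Rightarrow> real) set" where "L2I \<equiv> L2 {0<..<1}"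

definition ip :: "(real \<Rightarrow> real) \<Rightarrow> (real \<Rightarrow> real) \<Rightarrow> real" where
  "ip f g = (LINT x|I01. f x * g x)"

definition n2 :: "(real \<Rightarrow> real) \<Rightarrow> real" where
  "n2 f = sqrt (LINT x|I01. (f x)\<^sup>2)"

lemma finite_measure_I01: "finite_measure I01"
  by (rule finite_measure_lebesgue_on) auto

lemma L2_meas: "f \<in> L2I \<Longrightarrow> f \<in> borel_measurable I01"
  and L2_sq: "f \<in> L2I \<Longrightarrow> integrable I01 (\<lambda>x. (f x)\<^sup>2)"
  by (auto simp: L2_def)

lemma L2I: "f \<in> borel_measurable I01 \<Longrightarrow> integrable I01 (\<lambda>x. (f x)\<^sup>2) \<Longrightarrow> f \<in> L2I"
  by (auto simp: L2_def)

lemma L2_mult: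
  assumes "f \<in> L2I" "g \<in> L2I"
  shows "integrable I01 (\<lambda>x. f x * g x)"
proof (rule Bochner_Integration.integrable_bound[where f = "\<lambda>x. (f x)\<^sup>2 + (g x)\<^sup>2"])
  note [measurable] = L2_meas[OF assms(1)] L2_meas[OF assms(2)]
  show "(\<lambda>x. f x * g x) \<in> borel_measurable I01" by measurable
  show "integrable I01 (\<lambda>x. (f x)\<^sup>2 + (g x)\<^sup>2)" using assms L2_sq by auto
  show "AE x in I01. norm (f x * g x) \<le> norm ((f x)\<^sup>2 + (g x)\<^sup>2)"
  proof (intro AE_I2)
    fix x
    have "2 * (\<bar>f x\<bar> * \<bar>g x\<bar>) \<le> (f x)\<^sup>2 + (g x)\<^sup>2"
      using sum_squares_bound[of "\<bar>f x\<bar>" "\<bar>g x\<bar>"] by (simp only: power2_abs mult.assoc)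
    moreover have "0 \<le> \<bar>f x\<bar> * \<bar>g x\<bar>" by simp
    ultimately have "\<bar>f x\<bar> * \<bar>g x\<bar> \<le> (f x)\<^sup>2 + (g x)\<^sup>2" by linarith
    also have "\<dots> = norm ((f x)\<^sup>2 + (g x)\<^sup>2)" by simp
    finally show "norm (f x * g x) \<le> norm ((f x)\<^sup>2 + (g x)\<^sup>2)" by (simp only: real_norm_def abs_mult)
  qed
qed

lemma L2_add:
  assumes "f \<in> L2I" "g \<in> L2I"
  shows "(\<lambda>x. f x + g x) \<in> L2I"
proof (rule L2I)
  note [measurable] = L2_meas[OF assms(1)] L2_meas[OF assms(2)]
  show "(\<lambda>x. f x + g x) \<in> borel_measurable I01" by measurable
  show "integrable I01 (\<lambda>x. (f x + g x)\<^sup>2)"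
    unfolding power2_sum mult.assoc
    by (intro Bochner_Integration.integrable_add L2_sq assms integrable_mult_right L2_mult)
qed

lemma L2_bdd_mult:
  assumes f: "f \<in> L2I" and r: "\<rho> \<in> borel_measurable I01" and B: "\<And>x. x \<in> {0<..<1} \<Longrightarrow> \<bar>\<rho> x\<bar> \<le> B"
  shows "(\<lambda>x. \<rho> x * f x) \<in> L2I"
proof (rule L2I)
  note [measurable] = L2_meas[OF f] r
  show m: "(\<lambda>x. \<rho> x * f x) \<in> borel_measurable I01" by measurable
  show "integrable I01 (\<lambda>x. (\<rho> x * f x)\<^sup>2)"
  proof (rule Bochner_Integration.integrable_bound)
    show "integrable I01 (\<lambda>x. B\<^sup>2 * (f x)\<^sup>2)" using L2_sq[OF f] by simp
    have "(\<rho> x)\<^sup>2 * (f x)\<^sup>2 \<le> B\<^sup>2 * (f x)\<^sup>2" if "x \<in> {0<..<1}" for x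
      using B[OF that] by (intro mult_right_mono) (auto simp: abs_le_square_iff[symmetric])
    then show "AE x in I01. norm ((\<rho> x * f x)\<^sup>2) \<le> norm (B\<^sup>2 * (f x)\<^sup>2)"
      by (intro AE_I2) (auto simp: power_mult_distrib)
  qed measurable
qed

lemma L2_cmult: "f \<in> L2I \<Longrightarrow> (\<lambda>x. c * f x) \<in> L2I"
  by (rule L2_bdd_mult[where B = "\<bar>c\<bar>"]) auto

lemma L2_diff: "f \<in> L2I \<Longrightarrow> g \<in> L2I \<Longrightarrow> (\<lambda>x. f x - g x) \<in> L2I"
  using L2_add[of f "\<lambda>x. (-1) * g x"] L2_cmult[of g "-1"] by simp

lemma L2_const: "(\<lambda>x. c) \<in> L2I"
  using finite_measure.integrable_const[OF finite_measure_I01] by (intro L2I) auto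

lemma L2_integrable: "f \<in> L2I \<Longrightarrow> integrable I01 f"
  using L2_mult[OF L2_const[of 1]] by simp

lemma n2_nonneg: "0 \<le> n2 f"
  by (simp add: n2_def)

lemma n2_sq: "(n2 f)\<^sup>2 = ip f f"
  by (simp add: n2_def ip_def power2_eq_square)

lemma ip_commute: "ip f g = ip g f"
  by (simp add: ip_def mult.commute)

lemma ip_add_right: "g \<in> L2I \<Longrightarrow> f \<in> L2I \<Longrightarrow> h \<in> L2I \<Longrightarrow> ip g (\<lambda>x. f x + h x) = ip g f + ip g h"
  unfolding ip_def distrib_left using L2_mult by (intro Bochner_Integration.integral_add) auto

lemma ip_cmult_right: "ip g (\<lambda>x. c * f x) = c * ip g f"
  by (simp add: ip_def mult.left_commute)

lemma ip_diff_right: "g \<in> L2I \<Longrightarrow> f \<in> L2I \<Longrightarrow> h \<in> L2I \<Longrightarrow> ip g (\<lambda>x. f x - h x) = ip g f - ip g h"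
  unfolding ip_def right_diff_distrib using L2_mult by (intro Bochner_Integration.integral_diff) auto

lemma ip_diff_left: "g \<in> L2I \<Longrightarrow> f \<in> L2I \<Longrightarrow> h \<in> L2I \<Longrightarrow> ip (\<lambda>x. f x - h x) g = ip f g - ip h g"
  using ip_diff_right[of g f h] by (simp add: ip_commute)

lemma Cauchy_Schwarz_L2:
  assumes f: "f \<in> L2I" and g: "g \<in> L2I"
  shows "\<bar>ip f g\<bar> \<le> n2 f * n2 g"
proof -
  have q: "0 \<le> t\<^sup>2 * (n2 f)\<^sup>2 + 2 * t * ip f g + (n2 g)\<^sup>2" for t
  proof -
    have "0 \<le> (LINT x|I01. (t * f x + g x)\<^sup>2)" by simp
    also have "\<dots> = (LINT x|I01. t\<^sup>2 * (f x * f x) + 2 * t * (f x * g x) + g x * g x)"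
      by (intro Bochner_Integration.integral_cong) (auto simp: power2_eq_square algebra_simps)
    also have "\<dots> = t\<^sup>2 * ip f f + 2 * t * ip f g + ip g g"
      unfolding ip_def using L2_mult[OF f f] L2_mult[OF f g] L2_mult[OF g g] by simp
    finally show ?thesis by (simp add: n2_sq)
  qed
  have "(ip f g)\<^sup>2 \<le> (n2 f)\<^sup>2 * (n2 g)\<^sup>2"
  proof (cases "n2 f = 0")
    case True
    have "ip f g = 0"
    proof (rule ccontr)
      assume ne: "ip f g \<noteq> 0"
      \<comment> \<open>If f has norm zero, the quadratic is affine in t and takes the value -1 at
        this point.\<close>
      show False using q[of "- ((n2 g)\<^sup>2 + 1) / (2 * ip f g)"] True ne by (simp add: field_simps)
    qed
    then show ?thesis by simp
  next
    case False
    have "0 \<le> (- ip f g / (n2 f)\<^sup>2)\<^sup>2 * (n2 f)\<^sup>2 + 2 * (- ip f g / (n2 f)\<^sup>2) * ip f g + (n2 g)\<^sup>2" by (rule q)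
    also have "\<dots> = (n2 g)\<^sup>2 - (ip f g)\<^sup>2 / (n2 f)\<^sup>2" using False by (simp add: field_simps power2_eq_square)
    finally show ?thesis using False by (simp add: field_simps)
  qed
  then have "\<bar>ip f g\<bar>\<^sup>2 \<le> (n2 f * n2 g)\<^sup>2" by (simp add: power_mult_distrib)
  then show ?thesis using n2_nonneg by (simp add: power2_le_iff_abs_le)
qed

text \<open>Duality: test with f itself. Norm bounds for curves are obtained from bounds on their
  scalar pairings in this way.\<close>

lemma n2_le_I:
  assumes "f \<in> L2I" "B \<ge> 0" "\<And>g. g \<in> L2I \<Longrightarrow> \<bar>ip g f\<bar> \<le> n2 g * B"
  shows "n2 f \<le> B"
proof (cases "n2 f = 0")
  case False
  then have p: "n2 f > 0" using n2_nonneg[of f] by simp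
  have "n2 f * n2 f \<le> n2 f * B"
    using assms(3)[OF assms(1)] n2_sq[of f] by (simp add: power2_eq_square)
  then show ?thesis using p by simp
qed (use assms in simp)

text \<open>Completeness of Lebesgue measure. It is needed because most identities between
  representatives hold only almost everywhere.\<close>

lemma measurable_lebesgue_AE:
  fixes f g :: "real \<Rightarrow> real"
  assumes "f \<in> borel_measurable (lebesgue_on S)" "AE x in lebesgue_on S. g x = f x" "S \<in> sets lebesgue"
  shows "g \<in> borel_measurable (lebesgue_on S)"
proof -
  obtain N where N: "negligible N" "\<forall>x\<in>S - N. g x = f x"
    using assms(2,3) by (auto simp: AE_lebesgue_on_iff)
  have 1: "(\<lambda>x. if x \<in> S then f x else 0) measurable_on UNIV"
    using assms(1,3) by (simp add: measurable_on_UNIV measurable_on_iff_borel_measurable)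
  have "(\<lambda>x. if x \<in> S then g x else 0) measurable_on UNIV"
    by (rule measurable_on_spike[OF 1 N(1)]) (use N in auto)
  then show ?thesis using assms(3) by (simp add: measurable_on_UNIV measurable_on_iff_borel_measurable)
qed

section \<open>Bounded functionals on function-valued curves\<close>

text \<open>\<open>l\<close> is linear on the subspace \<open>X\<close> of functions and bounded with respect to \<open>N\<close>. Through such
  functionals, statements on Bochner spaces become statements on real functions of time.\<close>

definition blf :: "(real \<Rightarrow> real) set \<Rightarrow> ((real \<Rightarrow> real) \<Rightarrow> real) \<Rightarrow> ((real \<Rightarrow> real) \<Rightarrow> real) \<Rightarrow> bool" where
  "blf X N l \<longleftrightarrow> (\<forall>u\<in>X. \<forall>v\<in>X. \<forall>c. (\<lambda>x. u x + c * v x) \<in> X \<and> l (\<lambda>x. u x + c * v x) = l u + c * l v) \<and>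
     (\<exists>C\<ge>0. \<forall>u\<in>X. \<bar>l u\<bar> \<le> C * N u)"

lemma blf_comb:
  assumes "blf X N l" "u \<in> X" "v \<in> X"
  shows "(\<lambda>x. u x + c * v x) \<in> X" "l (\<lambda>x. u x + c * v x) = l u + c * l v"
  using assms unfolding blf_def by blast+

lemma blf_diff:
  assumes "blf X N l" "u \<in> X" "v \<in> X"
  shows "(\<lambda>x. u x - v x) \<in> X" "l (\<lambda>x. u x - v x) = l u - l v"
  using blf_comb[OF assms, of "-1"] by auto

lemma blf_scale:
  assumes "blf X N l" "u \<in> X"
  shows "(\<lambda>x. c * u x) \<in> X" "l (\<lambda>x. c * u x) = c * l u"
  using blf_comb[OF assms assms(2), of "c - 1"] by (auto simp: algebra_simps)

lemma blf_bound:
  assumes "blf X N l"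
  obtains C where "C \<ge> 0" "\<And>u. u \<in> X \<Longrightarrow> \<bar>l u\<bar> \<le> C * N u"
  using assms unfolding blf_def by blast

lemma blf_sum:
  assumes l: "blf X N l" and A: "finite A" "A \<noteq> {}" "A \<subseteq> X"
  shows "(\<lambda>x. \<Sum>g\<in>A. c g * g x) \<in> X \<and> l (\<lambda>x. \<Sum>g\<in>A. c g * g x) = (\<Sum>g\<in>A. c g * l g)"
  using A
proof (induction A rule: finite_ne_induct)
  case (singleton g)
  then show ?case using blf_scale[OF l, of g "c g"] by simp
next
  case (insert g F)
  have g: "g \<in> X" and F: "(\<lambda>x. \<Sum>g\<in>F. c g * g x) \<in> X" using insert by auto
  have eq: "(\<lambda>x. \<Sum>g\<in>insert g F. c g * g x) = (\<lambda>x. (\<Sum>g\<in>F. c g * g x) + c g * g x)"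
    using insert.hyps by (auto simp: add.commute)
  show ?case
    unfolding eq using blf_comb[OF l F g, of "c g"] insert by (simp add: add.commute)
qed

text \<open>For finitely many values, the scalar integral and the functional of the vector integral
  are the same finite sum over the level sets.\<close>

lemma simple_valued_blf:
  assumes l: "blf X N l" and s: "simple_valued T X s" and T: "T > 0"
  shows "integrable (lebesgue_on {0<..<T}) (\<lambda>t. l (s t))" (is ?A)
    "(LINT t|lebesgue_on {0<..<T}. l (s t)) = l (simple_bochner T s)" (is ?B)
    "simple_bochner T s \<in> X" (is ?C)
    "(\<lambda>t. l (s t)) \<in> borel_measurable (lebesgue_on {0<..<T})" (is ?D)
proof -
  let ?M = "lebesgue_on {0<..<T}"
  interpret finite_measure ?M by (rule finite_measure_lebesgue_on) auto
  define A where "A = s ` {0<..<T}"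
  have sf: "simple_function ?M s" and sX: "A \<subseteq> X" using s by (auto simp: simple_valued_def A_def)
  have fin: "finite A" using simple_functionD(1)[OF sf] by (simp add: A_def)
  have ne: "A \<noteq> {}" using T by (auto simp: A_def)
  define E where "E g = {t \<in> {0<..<T}. s t = g}" for g
  have Em: "E g \<in> sets ?M" for g
    using simple_functionD(2)[OF sf, of "{g}"] by (simp add: E_def vimage_def Int_def conj_commute)
  have rep: "l (s t) = (\<Sum>g\<in>A. indicator (E g) t * l g)" if "t \<in> {0<..<T}" for t
  proof -
    have "(\<Sum>g\<in>A. indicator (E g) t * l g) = (\<Sum>g\<in>A. if g = s t then l g else 0)"
      using that by (intro sum.cong) (auto simp: E_def)
    also have "\<dots> = l (s t)" using fin that by (subst sum.delta) (auto simp: A_def)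
    finally show ?thesis by simp
  qed
  have ii: "integrable ?M (\<lambda>t. indicator (E g) t * l g)" for g
    using Em[of g] by (intro integrable_mult_left) (auto simp: less_top[symmetric])
  have int: "integrable ?M (\<lambda>t. \<Sum>g\<in>A. indicator (E g) t * l g)"
    by (intro Bochner_Integration.integrable_sum ii)
  show A: ?A using Bochner_Integration.integrable_cong[of ?M ?M, THEN iffD2, OF refl _ int] rep by auto
  show ?D by (rule borel_measurable_integrable[OF A])
  have ms: "measure ?M (E g) = measure lebesgue {t \<in> {0<..<T}. s t = g}" for g
    by (subst measure_restrict_space) (auto simp: E_def)
  have "(LINT t|?M. l (s t)) = (LINT t|?M. (\<Sum>g\<in>A. indicator (E g) t * l g))"
    by (intro Bochner_Integration.integral_cong) (auto simp: rep)
  also have "\<dots> = (\<Sum>g\<in>A. (LINT t|?M. indicator (E g) t * l g))"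
    by (intro Bochner_Integration.integral_sum ii)
  also have "\<dots> = (\<Sum>g\<in>A. measure ?M (E g) * l g)"
  proof (intro sum.cong refl)
    fix g
    have "E g \<inter> space ?M = E g" by (auto simp: E_def)
    then show "(LINT t|?M. indicator (E g) t * l g) = measure ?M (E g) * l g" by simp
  qed
  also have "\<dots> = l (simple_bochner T s)"
    using blf_sum[OF l fin ne sX, of "\<lambda>g. measure ?M (E g)"]
    by (simp add: simple_bochner_def[abs_def] A_def ms)
  finally show ?B .
  show ?C
    using blf_sum[OF l fin ne sX, of "\<lambda>g. measure ?M (E g)"]
    by (simp add: simple_bochner_def[abs_def] A_def ms)
qed

lemma strongly_measurable_blf:
  assumes l: "blf X N l" and f: "strongly_measurable T X N f" and T: "T > 0"
  shows "(\<lambda>t. l (f t)) \<in> borel_measurable (lebesgue_on {0<..<T})"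
proof -
  let ?M = "lebesgue_on {0<..<T}"
  obtain C where C: "C \<ge> 0" "\<And>u. u \<in> X \<Longrightarrow> \<bar>l u\<bar> \<le> C * N u" using blf_bound[OF l] by blast
  obtain s where s: "\<And>n::nat. simple_valued T X (s n)"
    and lim: "AE t in ?M. f t \<in> X \<and> (\<lambda>n. N (\<lambda>x. f t x - s n t x)) \<longlonglongrightarrow> 0"
    using f unfolding strongly_measurable_def by blast
  obtain Z where Z: "negligible Z"
    "\<forall>t\<in>{0<..<T} - Z. f t \<in> X \<and> (\<lambda>n. N (\<lambda>x. f t x - s n t x)) \<longlonglongrightarrow> 0"
    using lim by (subst (asm) AE_lebesgue_on_iff) auto
  \<comment> \<open>Setting everything to zero on the exceptional set turns almost everywhere
    convergence into convergence at every point, as the limit lemma for measurable functions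
    requires.\<close>
  define h where "h n t = (if t \<in> Z then 0 else l (s n t))" for n t
  have hm: "h n \<in> borel_measurable ?M" for n
  proof (rule measurable_lebesgue_AE[OF simple_valued_blf(4)[OF l s T]])
    show "AE t in ?M. h n t = l (s n t)"
      by (subst AE_lebesgue_on_iff) (use Z(1) in \<open>auto simp: h_def\<close>)
  qed auto
  define F where "F t = (if t \<in> Z then 0 else l (f t))" for t
  have "F \<in> borel_measurable ?M"
  proof (rule borel_measurable_LIMSEQ_real[OF _ hm])
    fix t assume "t \<in> space ?M"
    then have t: "t \<in> {0<..<T}" by simp
    show "(\<lambda>n. h n t) \<longlonglongrightarrow> F t"
    proof (cases "t \<in> Z")
      case False
      then have ft: "f t \<in> X" and L: "(\<lambda>n. N (\<lambda>x. f t x - s n t x)) \<longlonglongrightarrow> 0" using Z t by auto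
      have sX: "s n t \<in> X" for n using s t by (auto simp: simple_valued_def)
      have "(\<lambda>n. l (s n t)) \<longlonglongrightarrow> l (f t)"
      proof (rule LIM_zero_cancel, rule Lim_null_comparison)
        show "\<forall>\<^sub>F n in sequentially. norm (l (s n t) - l (f t)) \<le> C * N (\<lambda>x. f t x - s n t x)"
          using C(2)[OF blf_diff(1)[OF l ft sX]] by (auto simp: blf_diff(2)[OF l ft sX] abs_minus_commute)
        show "(\<lambda>n. C * N (\<lambda>x. f t x - s n t x)) \<longlonglongrightarrow> 0"
          using tendsto_mult_right_zero[OF L] by simp
      qed
      then show ?thesis using False by (simp add: h_def F_def)
    qed (simp add: h_def F_def)
  qed
  then show ?thesis
  proof (rule measurable_lebesgue_AE)
    show "AE t in ?M. l (f t) = F t"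
      by (subst AE_lebesgue_on_iff) (use Z(1) in \<open>auto simp: F_def\<close>)
  qed auto
qed

lemma strongly_measurable_AE_in: "strongly_measurable T X N f \<Longrightarrow> AE t in lebesgue_on {0<..<T}. f t \<in> X"
  unfolding strongly_measurable_def by (auto elim: eventually_mono)

text \<open>A bounded functional commutes with the vector integral: it does so for simple functions,
  and the two limits in the definition force the same for f.\<close>

lemma has_X_integral_blf:
  assumes l: "blf X N l" and f: "has_X_integral T X N f J" and T: "T > 0"
    and li: "integrable (lebesgue_on {0<..<T}) (\<lambda>t. l (f t))"
  shows "(LINT t|lebesgue_on {0<..<T}. l (f t)) = l J"
proof -
  let ?M = "lebesgue_on {0<..<T}"
  obtain C where C: "C \<ge> 0" "\<And>u. u \<in> X \<Longrightarrow> \<bar>l u\<bar> \<le> C * N u" using blf_bound[OF l] by blast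
  obtain s where J: "J \<in> X" and sm: "strongly_measurable T X N f" and s: "\<And>n::nat. simple_valued T X (s n)"
    and L1: "(\<lambda>n. \<integral>\<^sup>+ t. ennreal (N (\<lambda>x. f t x - s n t x)) \<partial>?M) \<longlonglongrightarrow> 0"
    and L2: "(\<lambda>n. N (\<lambda>x. simple_bochner T (s n) x - J x)) \<longlonglongrightarrow> 0"
    using f unfolding has_X_integral_def by blast
  note lm = borel_measurable_integrable[OF li]
  have sb: "simple_bochner T (s n) \<in> X" for n by (rule simple_valued_blf(3)[OF l s T])
  have "(\<lambda>n. l (simple_bochner T (s n))) \<longlonglongrightarrow> l J"
  proof (rule LIM_zero_cancel, rule Lim_null_comparison)
    show "\<forall>\<^sub>F n in sequentially. norm (l (simple_bochner T (s n)) - l J) \<le> C * N (\<lambda>x. simple_bochner T (s n) x - J x)"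
      using C(2)[OF blf_diff(1)[OF l sb J]] by (auto simp: blf_diff(2)[OF l sb J])
    show "(\<lambda>n. C * N (\<lambda>x. simple_bochner T (s n) x - J x)) \<longlonglongrightarrow> 0"
      using tendsto_mult_right_zero[OF L2] by simp
  qed
  moreover have "(\<lambda>n. LINT t|?M. l (s n t)) \<longlonglongrightarrow> (LINT t|?M. l (f t))"
  proof (rule tendsto_L1_int)
    show "integrable ?M (\<lambda>t. l (s n t))" for n by (rule simple_valued_blf(1)[OF l s T])
    show "integrable ?M (\<lambda>t. l (f t))" by (rule li)
    have le: "(\<integral>\<^sup>+ t. ennreal (norm (l (s n t) - l (f t))) \<partial>?M)
        \<le> ennreal C * (\<integral>\<^sup>+ t. ennreal (N (\<lambda>x. f t x - s n t x)) \<partial>?M)" (is "?L \<le> _") for n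
    proof -
      have ae: "AE t in ?M. f t \<in> X \<and> t \<in> {0<..<T}"
        using strongly_measurable_AE_in[OF sm] AE_space[of ?M] by eventually_elim auto
      have [measurable]: "(\<lambda>t. l (s n t)) \<in> borel_measurable ?M" by (rule simple_valued_blf(4)[OF l s T])
      note [measurable] = lm
      show ?thesis
      \<comment> \<open>The map t to N (f t - s n t) is not known to be measurable, so C cannot be
        pulled out of its integral. Instead the measurable scalar integrand is divided by C, which
        needs C > 0.\<close>
      proof (cases "C = 0")
        case True
        have "?L = (\<integral>\<^sup>+ t. 0 \<partial>?M)"
        proof (rule nn_integral_cong_AE)
          show "AE t in ?M. ennreal (norm (l (s n t) - l (f t))) = 0"
            using ae
          proof eventually_elim
            case (elim t)
            then have ft: "f t \<in> X" and st: "s n t \<in> X" using s by (auto simp: simple_valued_def)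
            then show ?case using C(2)[OF ft] C(2)[OF st] True by simp
          qed
        qed
        then show ?thesis by simp
      next
        case False
        then have Cp: "C > 0" using C(1) by simp
        have "?L = ennreal C * (\<integral>\<^sup>+ t. ennreal (norm (l (s n t) - l (f t)) / C) \<partial>?M)"
          using Cp by (subst nn_integral_cmult[symmetric]) (auto simp: ennreal_mult[symmetric])
        also have "\<dots> \<le> ennreal C * (\<integral>\<^sup>+ t. ennreal (N (\<lambda>x. f t x - s n t x)) \<partial>?M)"
        proof (intro mult_left_mono nn_integral_mono_AE)
          show "AE t in ?M. ennreal (norm (l (s n t) - l (f t)) / C) \<le> ennreal (N (\<lambda>x. f t x - s n t x))"
            using ae
          proof eventually_elim
            case (elim t)
            then have ft: "f t \<in> X" and st: "s n t \<in> X" using s by (auto simp: simple_valued_def)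
            have "\<bar>l (f t) - l (s n t)\<bar> \<le> C * N (\<lambda>x. f t x - s n t x)"
              using C(2)[OF blf_diff(1)[OF l ft st]] by (simp add: blf_diff(2)[OF l ft st])
            then have "norm (l (s n t) - l (f t)) / C \<le> N (\<lambda>x. f t x - s n t x)"
              using Cp by (simp add: field_simps abs_minus_commute)
            then show ?case by (rule ennreal_leI)
          qed
        qed auto
        finally show ?thesis .
      qed
    qed
    have lim: "(\<lambda>n. ennreal C * (\<integral>\<^sup>+ t. ennreal (N (\<lambda>x. f t x - s n t x)) \<partial>?M)) \<longlonglongrightarrow> 0"
      using ennreal_tendsto_cmult[OF _ L1, of "ennreal C"] by simp
    show "(\<lambda>n. \<integral>\<^sup>+ t. ennreal (norm (l (s n t) - l (f t))) \<partial>?M) \<longlonglongrightarrow> 0"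
    proof (rule tendsto_sandwich[OF _ _ tendsto_const lim])
      show "\<forall>\<^sub>F n in sequentially. (\<integral>\<^sup>+ t. ennreal (norm (l (s n t) - l (f t))) \<partial>?M)
          \<le> ennreal C * (\<integral>\<^sup>+ t. ennreal (N (\<lambda>x. f t x - s n t x)) \<partial>?M)"
        by (intro always_eventually allI le)
    qed simp
  qed
  moreover have "(LINT t|?M. l (s n t)) = l (simple_bochner T (s n))" for n
    by (rule simple_valued_blf(2)[OF l s T])
  ultimately show ?thesis using LIMSEQ_unique by auto
qed

lemma bochner_L2_blf_sq:
  assumes l: "blf X N l" and f: "f \<in> bochner_L2 T X N" and T: "T > 0"
  shows "integrable (lebesgue_on {0<..<T}) (\<lambda>t. (l (f t))\<^sup>2)"
proof -
  let ?M = "lebesgue_on {0<..<T}"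
  obtain C where C: "C \<ge> 0" "\<And>u. u \<in> X \<Longrightarrow> \<bar>l u\<bar> \<le> C * N u" using blf_bound[OF l] by blast
  have sm: "strongly_measurable T X N f" and Ni: "integrable ?M (\<lambda>t. (N (f t))\<^sup>2)"
    using f by (auto simp: bochner_L2_def)
  note [measurable] = strongly_measurable_blf[OF l sm T]
  show ?thesis
  proof (rule Bochner_Integration.integrable_bound)
    show "integrable ?M (\<lambda>t. C\<^sup>2 * (N (f t))\<^sup>2)" using Ni by simp
    show "AE t in ?M. norm ((l (f t))\<^sup>2) \<le> norm (C\<^sup>2 * (N (f t))\<^sup>2)"
      using strongly_measurable_AE_in[OF sm]
    proof eventually_elim
      case (elim t)
      have "\<bar>l (f t)\<bar> \<le> \<bar>C * N (f t)\<bar>" using C(2)[OF elim] by linarith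
      then have "(l (f t))\<^sup>2 \<le> (C * N (f t))\<^sup>2" by (rule abs_le_square_iff[THEN iffD1])
      then show ?case by (simp add: power_mult_distrib)
    qed
  qed measurable
qed

lemma bochner_L2_blf:
  assumes l: "blf X N l" and f: "f \<in> bochner_L2 T X N" and T: "T > 0"
  shows "integrable (lebesgue_on {0<..<T}) (\<lambda>t. l (f t))"
proof -
  let ?M = "lebesgue_on {0<..<T}"
  interpret finite_measure ?M by (rule finite_measure_lebesgue_on) auto
  have sm: "strongly_measurable T X N f" using f by (auto simp: bochner_L2_def)
  note [measurable] = strongly_measurable_blf[OF l sm T]
  show ?thesis
  proof (rule Bochner_Integration.integrable_bound)
    show "integrable ?M (\<lambda>t. 1 + (l (f t))\<^sup>2)" using bochner_L2_blf_sq[OF assms] by simp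
    show "AE t in ?M. norm (l (f t)) \<le> norm (1 + (l (f t))\<^sup>2)"
    proof (intro AE_I2)
      fix t
      have "2 * \<bar>l (f t)\<bar> * 1 \<le> \<bar>l (f t)\<bar>\<^sup>2 + 1\<^sup>2" by (rule sum_squares_bound)
      then show "norm (l (f t)) \<le> norm (1 + (l (f t))\<^sup>2)" by simp
    qed
  qed measurable
qed

text \<open>The passage from Bochner spaces to scalar functions. Applying l to both vector integrals
  gives a scalar weak derivative, hence an absolutely continuous representative; continuity of t to
  l (f t) identifies the two at every t, end points included.\<close>

lemma weak_time_deriv_blf:
  assumes l: "blf X N l" and f: "f \<in> bochner_L2 T X N" and g: "g \<in> bochner_L2 T X N" and T: "T > 0"
    and w: "weak_time_deriv T X N f g" and cont: "continuous_on {0..T} (\<lambda>t. l (f t))"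
  shows "ac_on 0 T (\<lambda>t. l (f t)) (\<lambda>t. l (g t))"
proof -
  let ?M = "lebesgue_on {0<..<T}"
  note fi = bochner_L2_blf[OF l f T] and gi = bochner_L2_blf[OF l g T]
  have fX: "AE t in ?M. f t \<in> X" and gX: "AE t in ?M. g t \<in> X"
    by (rule strongly_measurable_AE_in[of T X N], use f g in \<open>simp add: bochner_L2_def\<close>)+
  note mc = integrable_Ioo_mult_cont
  have scal: "integrable ?M (\<lambda>t. l (\<lambda>x. k t * f t x))"
    "(LINT t|?M. l (\<lambda>x. k t * f t x)) = (LINT t|?M. l (f t) * k t)"
    if "integrable ?M (\<lambda>t. l (f t) * k t)" "AE t in ?M. f t \<in> X" for f and k :: "real \<Rightarrow> real"
  proof -
    have ae: "AE t in ?M. l (\<lambda>x. k t * f t x) = l (f t) * k t"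
      using that(2) by eventually_elim (simp add: blf_scale(2)[OF l] mult.commute)
    have m: "(\<lambda>t. l (\<lambda>x. k t * f t x)) \<in> borel_measurable ?M"
      by (rule measurable_lebesgue_AE[OF borel_measurable_integrable[OF that(1)] ae]) auto
    show "integrable ?M (\<lambda>t. l (\<lambda>x. k t * f t x))"
      using Bochner_Integration.integrable_cong_AE[OF m borel_measurable_integrable[OF that(1)] ae] that(1) by simp
    show "(LINT t|?M. l (\<lambda>x. k t * f t x)) = (LINT t|?M. l (f t) * k t)"
      by (rule integral_cong_AE[OF m borel_measurable_integrable[OF that(1)] ae])
  qed
  have "(LINT t|?M. l (f t) * deriv \<phi> t) = - (LINT t|?M. l (g t) * \<phi> t)" if \<phi>: "\<phi> \<in> C1c 0 T" for \<phi>
  proof -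
    obtain J where J: "has_X_integral T X N (\<lambda>t x. deriv \<phi> t * f t x) J"
      "has_X_integral T X N (\<lambda>t x. - (\<phi> t * g t x)) J"
      using w[unfolded weak_time_deriv_def, rule_format, OF \<phi>] by (elim exE conjE)
    have c: "continuous_on UNIV \<phi>"
      by (intro continuous_at_imp_continuous_on ballI DERIV_isCont[OF C1cD(1)[OF \<phi>]])
    have i1: "integrable ?M (\<lambda>t. l (f t) * deriv \<phi> t)" by (rule mc[OF fi C1cD(2)[OF \<phi>]])
    have i2: "integrable ?M (\<lambda>t. l (g t) * (- \<phi> t))" by (rule mc[OF gi continuous_on_minus[OF c]])
    note s1 = scal[where f = f and k = "deriv \<phi>", OF i1 fX]
    note s2 = scal[where f = g and k = "\<lambda>t. - \<phi> t", OF i2 gX]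
    have eq: "(\<lambda>t x. - (\<phi> t * g t x)) = (\<lambda>t x. - \<phi> t * g t x)" by simp
    have "(LINT t|?M. l (f t) * deriv \<phi> t) = l J"
      unfolding s1(2)[symmetric]
      by (rule has_X_integral_blf[where f = "\<lambda>t x. deriv \<phi> t * f t x", OF l J(1) T s1(1)])
    moreover have "(LINT t|?M. l (g t) * (- \<phi> t)) = l J"
      unfolding s2(2)[symmetric]
      by (rule has_X_integral_blf[where f = "\<lambda>t x. - \<phi> t * g t x", OF l J(2)[unfolded eq] T s2(1)])
    moreover have "(LINT t|?M. l (g t) * (- \<phi> t)) = - (LINT t|?M. l (g t) * \<phi> t)" by simp
    ultimately show ?thesis by linarith
  qed
  then obtain F where F: "ac_on 0 T F (\<lambda>t. l (g t))" "AE t in ?M. l (f t) = F t"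
    using weak_deriv_imp_ac[OF T fi gi] by blast
  have ae: "AE t in ?M. l (f t) - F t = 0" using F(2) by eventually_elim simp
  have c: "continuous_on {0..T} (\<lambda>t. l (f t) - F t)"
    by (intro continuous_intros ac_on_cont[OF F(1)] cont)
  have "l (f t) - F t = 0" if "t \<in> {0..T}" for t
    by (rule AE_zero_imp_zero[OF ae c T that])
  then show ?thesis
    by (intro ac_on_cong[OF F(1), where S = "{}"]) auto
qed

section \<open>Weakly absolutely continuous curves in \<open>L\<^sup>2\<close>\<close>

lemma n2_triangle:
  assumes "f \<in> L2I" "g \<in> L2I"
  shows "n2 (\<lambda>x. f x + g x) \<le> n2 f + n2 g"
proof (rule n2_le_I[OF L2_add[OF assms]])
  show "0 \<le> n2 f + n2 g" using n2_nonneg by simp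
  fix h assume h: "h \<in> L2I"
  have "\<bar>ip h (\<lambda>x. f x + g x)\<bar> \<le> \<bar>ip h f\<bar> + \<bar>ip h g\<bar>"
    unfolding ip_add_right[OF h assms] by (rule abs_triangle_ineq)
  also have "\<dots> \<le> n2 h * n2 f + n2 h * n2 g"
    by (intro add_mono Cauchy_Schwarz_L2 h assms)
  finally show "\<bar>ip h (\<lambda>x. f x + g x)\<bar> \<le> n2 h * (n2 f + n2 g)" by (simp add: distrib_left)
qed

lemma n2_bdd_mult:
  assumes f: "f \<in> L2I" and r: "\<rho> \<in> borel_measurable I01" and B: "\<And>x. x \<in> {0<..<1} \<Longrightarrow> \<bar>\<rho> x\<bar> \<le> B"
  shows "n2 (\<lambda>x. \<rho> x * f x) \<le> B * n2 f"
proof -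
  have B0: "B \<ge> 0" using B[of "1/2"] by auto
  have "(LINT x|I01. (\<rho> x * f x)\<^sup>2) \<le> (LINT x|I01. B\<^sup>2 * (f x)\<^sup>2)"
  proof (rule integral_mono)
    show "integrable I01 (\<lambda>x. (\<rho> x * f x)\<^sup>2)" by (rule L2_sq[OF L2_bdd_mult[OF f r B]])
    show "integrable I01 (\<lambda>x. B\<^sup>2 * (f x)\<^sup>2)" using L2_sq[OF f] by simp
    fix x assume "x \<in> space I01"
    then have "x \<in> {0<..<1}" by simp
    from B[OF this] show "(\<rho> x * f x)\<^sup>2 \<le> B\<^sup>2 * (f x)\<^sup>2"
      unfolding power_mult_distrib by (intro mult_right_mono) (auto simp: abs_le_square_iff[symmetric])
  qed
  also have "\<dots> = B\<^sup>2 * (n2 f)\<^sup>2" by (simp add: n2_def)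
  finally have "sqrt (LINT x|I01. (\<rho> x * f x)\<^sup>2) \<le> sqrt ((B * n2 f)\<^sup>2)"
    by (simp only: power_mult_distrib real_sqrt_le_iff)
  then show ?thesis using B0 n2_nonneg[of f] by (simp add: n2_def)
qed

text \<open>\<open>p'\<close> is the derivative of the \<open>L\<^sup>2\<close>-valued curve \<open>p\<close> in the weak sense, with \<open>\<parallel>p'\<parallel> \<le> N\<close>; strong
  continuity of \<open>p\<close> is a consequence.\<close>

definition curve :: "real \<Rightarrow> real \<Rightarrow> (real \<Rightarrow> real \<Rightarrow> real) \<Rightarrow> (real \<Rightarrow> real \<Rightarrow> real) \<Rightarrow> (real \<Rightarrow> real) \<Rightarrow> bool" where
  "curve s e p p' N \<longleftrightarrow> (\<forall>t\<in>{s..e}. p t \<in> L2I \<and> p' t \<in> L2I \<and> n2 (p' t) \<le> N t) \<and>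
     N absolutely_integrable_on {s..e} \<and>
     (\<forall>g\<in>L2I. ac_on s e (\<lambda>t. ip g (p t)) (\<lambda>t. ip g (p' t)))"

lemma curveD:
  assumes "curve s e p p' N" "t \<in> {s..e}"
  shows "p t \<in> L2I" "p' t \<in> L2I" "n2 (p' t) \<le> N t" "0 \<le> N t"
  using assms n2_nonneg[of "p' t"] unfolding curve_def by (auto intro: order_trans)

lemma curve_N: "curve s e p p' N \<Longrightarrow> N absolutely_integrable_on {s..e}"
  by (simp add: curve_def)

lemma curve_ac: "curve s e p p' N \<Longrightarrow> g \<in> L2I \<Longrightarrow> ac_on s e (\<lambda>t. ip g (p t)) (\<lambda>t. ip g (p' t))"
  by (simp add: curve_def)

lemma curve_sub:
  assumes "curve s e p p' N" "s \<le> s'" "e' \<le> e"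
  shows "curve s' e' p p' N"
  unfolding curve_def
proof (intro conjI ballI)
  fix t assume t: "t \<in> {s'..e'}"
  then have "t \<in> {s..e}" using assms by auto
  from curveD[OF assms(1) this] show "p t \<in> L2I" "p' t \<in> L2I" "n2 (p' t) \<le> N t" by auto
next
  show "N absolutely_integrable_on {s'..e'}" by (rule abs_int_sub[OF curve_N[OF assms(1)] assms(2,3)])
  show "ac_on s' e' (\<lambda>t. ip g (p t)) (\<lambda>t. ip g (p' t))" if "g \<in> L2I" for g
    by (rule ac_on_sub[OF curve_ac[OF assms(1) that] assms(2,3)])
qed

text \<open>Each pairing with g has increment at most \<open>n2 g\<close> times the integral of N,
  and duality removes g. Strong continuity of the curve follows.\<close>

lemma curve_diff_le:
  assumes c: "curve s e p p' N" and rt: "s \<le> r" "r \<le> t" "t \<le> e"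
  shows "n2 (\<lambda>x. p t x - p r x) \<le> integral {r..t} N"
proof -
  have pt: "p t \<in> L2I" "p r \<in> L2I" using curveD(1)[OF c, of t] curveD(1)[OF c, of r] rt by auto
  note Ni = abs_int_sub_int[OF curve_N[OF c] rt(1,3)]
  show ?thesis
  proof (rule n2_le_I[OF L2_diff[OF pt]])
    show "0 \<le> integral {r..t} N"
      using curveD(4)[OF c] rt by (intro Henstock_Kurzweil_Integration.integral_nonneg Ni) auto
    fix g assume g: "g \<in> L2I"
    note ac = curve_ac[OF c g]
    have "ip g (\<lambda>x. p t x - p r x) = integral {r..t} (\<lambda>t. ip g (p' t))"
      unfolding ip_diff_right[OF g pt] ac_on_diff[OF ac rt] ..
    also have "\<bar>\<dots>\<bar> \<le> integral {r..t} (\<lambda>t. n2 g * N t)"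
    proof (rule abs_integral_le)
      show "(\<lambda>t. ip g (p' t)) integrable_on {r..t}" by (rule abs_int_sub_int[OF ac_on_abs_int[OF ac] rt(1,3)])
      show "(\<lambda>t. n2 g * N t) integrable_on {r..t}" by (intro integrable_on_real_cmult Ni)
      fix u assume "u \<in> {r..t}"
      then have u: "u \<in> {s..e}" using rt by auto
      have "\<bar>ip g (p' u)\<bar> \<le> n2 g * n2 (p' u)" by (rule Cauchy_Schwarz_L2[OF g curveD(2)[OF c u]])
      also have "\<dots> \<le> n2 g * N u" by (intro mult_left_mono curveD(3)[OF c u] n2_nonneg)
      finally show "\<bar>ip g (p' u)\<bar> \<le> n2 g * N u" .
    qed
    finally show "\<bar>ip g (\<lambda>x. p t x - p r x)\<bar> \<le> n2 g * integral {r..t} N" by simp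
  qed
qed

lemma curve_uniform:
  assumes c: "curve s e p p' N" and eps: "\<epsilon> > 0"
  obtains d where "d > 0" "\<And>r t. s \<le> r \<Longrightarrow> r \<le> t \<Longrightarrow> t \<le> e \<Longrightarrow> t - r < d \<Longrightarrow> n2 (\<lambda>x. p t x - p r x) \<le> \<epsilon>"
proof -
  have ac: "ac_on s e (\<lambda>x. 0 + integral {s..x} N) N" by (rule ac_on_integral[OF curve_N[OF c]])
  obtain d where d: "d > 0" "\<And>x y. x \<in> {s..e} \<Longrightarrow> y \<in> {s..e} \<Longrightarrow> \<bar>x - y\<bar> < d \<Longrightarrow>
      \<bar>(0 + integral {s..x} N) - (0 + integral {s..y} N)\<bar> < \<epsilon>"
    using unif_cont_Icc[OF ac_on_cont[OF ac] eps] by blast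
  show thesis
  proof (rule that[OF d(1)])
    fix r t assume rt: "s \<le> r" "r \<le> t" "t \<le> e" "t - r < d"
    have "n2 (\<lambda>x. p t x - p r x) \<le> integral {r..t} N" by (rule curve_diff_le[OF c rt(1-3)])
    also have "\<dots> \<le> \<epsilon>" using ac_on_diff[OF ac rt(1-3)] d(2)[of t r] rt by auto
    finally show "n2 (\<lambda>x. p t x - p r x) \<le> \<epsilon>" .
  qed
qed

lemma curve_bounded:
  assumes c: "curve s e p p' N"
  obtains M where "M \<ge> 0" "\<And>t. t \<in> {s..e} \<Longrightarrow> n2 (p t) \<le> M"
proof
  show "0 \<le> n2 (p s) + \<bar>integral {s..e} N\<bar>" using n2_nonneg[of "p s"] by simp
  fix t assume t: "t \<in> {s..e}"
  then have s: "s \<in> {s..e}" by auto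
  have "n2 (p t) = n2 (\<lambda>x. p s x + (p t x - p s x))" by simp
  also have "\<dots> \<le> n2 (p s) + n2 (\<lambda>x. p t x - p s x)"
    by (intro n2_triangle L2_diff curveD(1)[OF c] t s)
  also have "n2 (\<lambda>x. p t x - p s x) \<le> integral {s..t} N" by (rule curve_diff_le[OF c]) (use t in auto)
  also have "integral {s..t} N \<le> integral {s..e} N"
    using curveD(4)[OF c] t
    by (intro integral_subset_le abs_int_sub_int[OF curve_N[OF c]]) auto
  finally show "n2 (p t) \<le> n2 (p s) + \<bar>integral {s..e} N\<bar>" by simp
qed

text \<open>The point is measurability in t when both factors move, since only pairings of
  \<open>q'\<close> with fixed functions are known to be measurable. Freezing p on a grid gives
  functions with countably many frozen factors, and strong continuity of p makes them
  converge.\<close>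

lemma curve_ip_abs_int:
  assumes p: "curve s e p p' N" and q: "curve s e q q' N'"
  shows "(\<lambda>t. ip (p t) (q' t)) absolutely_integrable_on {s..e}"
proof -
  let ?M = "lebesgue_on {s..e}"
  obtain M where M: "M \<ge> 0" "\<And>t. t \<in> {s..e} \<Longrightarrow> n2 (p t) \<le> M" using curve_bounded[OF p] by blast
  \<comment> \<open>Rounds t down to the grid of mesh \<open>1 / Suc n\<close> that starts at s, so
    the rounded time never leaves \<open>{s..e}\<close>.\<close>
  define gr where "gr n t = s + real_of_int \<lfloor>(t - s) * real (Suc n)\<rfloor> / real (Suc n)" for n t
  have gr: "s \<le> gr n t" "gr n t \<le> t" "t - gr n t \<le> 1 / real (Suc n)" if "t \<in> {s..e}" for n t
  proof -
    let ?f = "real_of_int \<lfloor>(t - s) * real (Suc n)\<rfloor>"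
    have f: "?f \<le> (t - s) * real (Suc n)" "(t - s) * real (Suc n) < ?f + 1" by linarith+
    have "0 \<le> (t - s) * real (Suc n)" using that by simp
    then have "0 \<le> ?f" by simp
    then show "s \<le> gr n t" by (simp add: gr_def)
    have "?f / real (Suc n) \<le> t - s" using f(1) by (simp only: pos_divide_le_eq of_nat_0_less_iff zero_less_Suc)
    then show "gr n t \<le> t" by (simp add: gr_def)
    have "t - s \<le> (?f + 1) / real (Suc n)"
      using f(2) by (simp only: pos_le_divide_eq of_nat_0_less_iff zero_less_Suc less_imp_le)
    then show "t - gr n t \<le> 1 / real (Suc n)" by (simp add: gr_def add_divide_distrib)
  qed
  \<comment> \<open>The countable composition runs over all integer multiples of the mesh, also
    those outside \<open>{s..e}\<close>; extending by zero keeps every frozen factor in L2.\<close>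
  define P where "P u = (if u \<in> {s..e} then p u else (\<lambda>x. 0))" for u
  have PL: "P u \<in> L2I" for u using curveD(1)[OF p] L2_const[of 0] by (simp add: P_def)
  have m1: "(\<lambda>t. ip (P u) (q' t)) \<in> borel_measurable ?M" for u
    using ac_on_abs_int[OF curve_ac[OF q PL[of u]]] by (rule absolutely_integrable_imp_borel_measurable) auto
  have mf: "(\<lambda>t. \<lfloor>(t - s) * real (Suc n)\<rfloor>) \<in> measurable ?M (count_space UNIV)" for n
    by (rule measurable_compose[OF _ measurable_real_floor])
       (intro borel_measurable_times borel_measurable_diff borel_measurable_const; simp add: id_borel_measurable_lebesgue_on[unfolded id_def])
  have m2: "(\<lambda>t. ip (P (gr n t)) (q' t)) \<in> borel_measurable ?M" for n
    unfolding gr_def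
    by (rule measurable_compose_countable[where f = "\<lambda>i t. ip (P (s + real_of_int i / real (Suc n))) (q' t)", OF m1 mf])
  have lim: "(\<lambda>n. ip (P (gr n t)) (q' t)) \<longlonglongrightarrow> ip (p t) (q' t)" if t: "t \<in> {s..e}" for t
  proof (rule LIM_zero_cancel, rule LIMSEQ_I)
    fix \<epsilon> :: real assume eps: "\<epsilon> > 0"
    define \<eta> where "\<eta> = \<epsilon> / (2 * (n2 (q' t) + 1))"
    have \<eta>: "\<eta> > 0" using eps n2_nonneg[of "q' t"] by (simp add: \<eta>_def)
    obtain d where d: "d > 0" "\<And>r t. s \<le> r \<Longrightarrow> r \<le> t \<Longrightarrow> t \<le> e \<Longrightarrow> t - r < d \<Longrightarrow> n2 (\<lambda>x. p t x - p r x) \<le> \<eta>"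
      using curve_uniform[OF p \<eta>] by blast
    obtain n0 where n0: "inverse (real (Suc n0)) < d" using reals_Archimedean[OF d(1)] by blast
    have "norm (ip (P (gr n t)) (q' t) - ip (p t) (q' t) - 0) < \<epsilon>" if n: "n \<ge> n0" for n
    proof -
      have gi: "gr n t \<in> {s..e}" using gr[OF t, of n] t by auto
      have "1 / real (Suc n) \<le> 1 / real (Suc n0)" using n by (intro divide_left_mono) auto
      then have "t - gr n t < d" using gr(3)[OF t, of n] n0 by (simp add: inverse_eq_divide)
      then have le: "n2 (\<lambda>x. p t x - p (gr n t) x) \<le> \<eta>" using gr[OF t, of n] t by (intro d(2)) auto
      have "ip (P (gr n t)) (q' t) - ip (p t) (q' t) = - ip (\<lambda>x. p t x - p (gr n t) x) (q' t)"
        using gi curveD(1)[OF p t] curveD(1)[OF p gi] curveD(2)[OF q t] by (simp add: P_def ip_diff_left)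
      then have "\<bar>ip (P (gr n t)) (q' t) - ip (p t) (q' t)\<bar> \<le> n2 (\<lambda>x. p t x - p (gr n t) x) * n2 (q' t)"
        using Cauchy_Schwarz_L2[OF L2_diff[OF curveD(1)[OF p t] curveD(1)[OF p gi]] curveD(2)[OF q t]] by simp
      also have "\<dots> \<le> \<eta> * (n2 (q' t) + 1)" using le \<eta> n2_nonneg by (intro mult_mono) auto
      also have "\<dots> = \<epsilon> / 2"
      proof -
        have "\<epsilon> / (2 * y) * y = \<epsilon> / 2" if "y \<noteq> 0" for y :: real using that by simp
        moreover have "n2 (q' t) + 1 \<noteq> 0" using n2_nonneg[of "q' t"] by linarith
        ultimately show ?thesis unfolding \<eta>_def by blast
      qed
      finally show ?thesis using eps by simp
    qed
    then show "\<exists>no. \<forall>n\<ge>no. norm (ip (P (gr n t)) (q' t) - ip (p t) (q' t) - 0) < \<epsilon>" by blast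
  qed
  have m: "(\<lambda>t. ip (p t) (q' t)) \<in> borel_measurable ?M"
    by (rule borel_measurable_LIMSEQ_real[OF _ m2]) (use lim in simp)
  show ?thesis
  proof (rule measurable_bounded_by_integrable_imp_absolutely_integrable[OF m])
    show "(\<lambda>t. M * N' t) integrable_on {s..e}"
      using curve_N[OF q] by (intro integrable_on_real_cmult) (simp add: absolutely_integrable_on_def)
    fix t assume t: "t \<in> {s..e}"
    have "\<bar>ip (p t) (q' t)\<bar> \<le> n2 (p t) * n2 (q' t)"
      by (intro Cauchy_Schwarz_L2 curveD(1)[OF p t] curveD(2)[OF q t])
    also have "\<dots> \<le> M * N' t" by (intro mult_mono M(2)[OF t] curveD(3)[OF q t] M(1) n2_nonneg)
    finally show "norm (ip (p t) (q' t)) \<le> M * N' t" by simp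
  qed auto
qed

text \<open>The argument for \<open>ac_on_mult\<close> in Hilbert space: freeze p at the right end
  and q at the left end, and estimate the error by Cauchy-Schwarz, the uniform continuity of both
  curves and the bounds N and N'.\<close>

lemma curve_ip:
  assumes p: "curve s e p p' N" and q: "curve s e q q' N'"
  shows "ac_on s e (\<lambda>t. ip (p t) (q t)) (\<lambda>t. ip (p t) (q' t) + ip (q t) (p' t))"
proof (rule ac_onI_partition[where N = "\<lambda>t. N t + N' t"])
  note A1 = curve_ip_abs_int[OF p q] and A2 = curve_ip_abs_int[OF q p]
  show A: "(\<lambda>t. ip (p t) (q' t) + ip (q t) (p' t)) absolutely_integrable_on {s..e}"
    by (intro set_integral_add A1 A2)
  show NN: "(\<lambda>t. N t + N' t) absolutely_integrable_on {s..e}"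
    by (intro set_integral_add curve_N[OF p] curve_N[OF q])
  show "0 \<le> N t + N' t" if "t \<in> {s..e}" for t using curveD(4)[OF p that] curveD(4)[OF q that] by simp
  fix \<epsilon> :: real assume eps: "\<epsilon> > 0"
  obtain d1 where d1: "d1 > 0" "\<And>r t. s \<le> r \<Longrightarrow> r \<le> t \<Longrightarrow> t \<le> e \<Longrightarrow> t - r < d1 \<Longrightarrow> n2 (\<lambda>x. p t x - p r x) \<le> \<epsilon>"
    using curve_uniform[OF p eps] by blast
  obtain d2 where d2: "d2 > 0" "\<And>r t. s \<le> r \<Longrightarrow> r \<le> t \<Longrightarrow> t \<le> e \<Longrightarrow> t - r < d2 \<Longrightarrow> n2 (\<lambda>x. q t x - q r x) \<le> \<epsilon>"
    using curve_uniform[OF q eps] by blast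
  show "\<exists>\<delta>>0. \<forall>r t. s \<le> r \<longrightarrow> r \<le> t \<longrightarrow> t \<le> e \<longrightarrow> t - r < \<delta> \<longrightarrow>
      \<bar>ip (p t) (q t) - ip (p r) (q r) - integral {r..t} (\<lambda>t. ip (p t) (q' t) + ip (q t) (p' t))\<bar>
        \<le> \<epsilon> * integral {r..t} (\<lambda>t. N t + N' t)"
  proof (intro exI[of _ "min d1 d2"] conjI allI impI)
    fix r t assume rt: "s \<le> r" "r \<le> t" "t \<le> e" "t - r < min d1 d2"
    have mem: "r \<in> {s..e}" "t \<in> {s..e}" using rt by auto
    note pr = curveD(1)[OF p mem(1)] and pt = curveD(1)[OF p mem(2)]
      and qr = curveD(1)[OF q mem(1)] and qt = curveD(1)[OF q mem(2)]
    note acq = curve_ac[OF q pt] and acp = curve_ac[OF p qr]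
    note sub = abs_int_sub_int[OF _ rt(1,3)]
    let ?g = "\<lambda>u. (ip (p t) (q' u) + ip (q r) (p' u)) - (ip (p u) (q' u) + ip (q u) (p' u))"
    have "ip (p t) (q t) - ip (p r) (q r) = (ip (p t) (q t) - ip (p t) (q r)) + (ip (q r) (p t) - ip (q r) (p r))"
      by (simp add: ip_commute)
    also have "\<dots> = integral {r..t} (\<lambda>u. ip (p t) (q' u)) + integral {r..t} (\<lambda>u. ip (q r) (p' u))"
      unfolding ac_on_diff[OF acq rt(1-3)] ac_on_diff[OF acp rt(1-3)] ..
    also have "\<dots> = integral {r..t} (\<lambda>u. ip (p t) (q' u) + ip (q r) (p' u))"
      by (rule Henstock_Kurzweil_Integration.integral_add[symmetric])
        (intro sub ac_on_abs_int[OF acq] ac_on_abs_int[OF acp])+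
    finally have "ip (p t) (q t) - ip (p r) (q r) - integral {r..t} (\<lambda>t. ip (p t) (q' t) + ip (q t) (p' t))
        = integral {r..t} (\<lambda>u. ip (p t) (q' u) + ip (q r) (p' u)) - integral {r..t} (\<lambda>t. ip (p t) (q' t) + ip (q t) (p' t))"
      by simp
    also have "\<dots> = integral {r..t} ?g"
      by (rule Henstock_Kurzweil_Integration.integral_diff[symmetric])
        (intro integrable_add sub A ac_on_abs_int[OF acq] ac_on_abs_int[OF acp])+
    finally have eq: "ip (p t) (q t) - ip (p r) (q r) - integral {r..t} (\<lambda>t. ip (p t) (q' t) + ip (q t) (p' t))
        = integral {r..t} ?g" .
    have "\<bar>integral {r..t} ?g\<bar> \<le> integral {r..t} (\<lambda>t. \<epsilon> * (N t + N' t))"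
    proof (rule abs_integral_le)
      show "?g integrable_on {r..t}"
        by (intro integrable_add integrable_diff sub A1 A2 ac_on_abs_int[OF acq] ac_on_abs_int[OF acp])
      show "(\<lambda>t. \<epsilon> * (N t + N' t)) integrable_on {r..t}" by (intro integrable_on_real_cmult sub NN)
      fix u assume u: "u \<in> {r..t}"
      then have um: "u \<in> {s..e}" using rt by auto
      note pu = curveD[OF p um] and qu = curveD[OF q um]
      have 1: "n2 (\<lambda>x. p t x - p u x) \<le> \<epsilon>" by (rule d1(2)) (use u rt in auto)
      have 2: "n2 (\<lambda>x. q u x - q r x) \<le> \<epsilon>" by (rule d2(2)) (use u rt in auto)
      have gu: "?g u = ip (\<lambda>x. p t x - p u x) (q' u) - ip (\<lambda>x. q u x - q r x) (p' u)"
        using pt pu qr qu by (simp add: ip_diff_left)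
      have "\<bar>?g u\<bar> \<le> \<bar>ip (\<lambda>x. p t x - p u x) (q' u)\<bar> + \<bar>ip (\<lambda>x. q u x - q r x) (p' u)\<bar>"
        unfolding gu by simp
      also have "\<dots> \<le> n2 (\<lambda>x. p t x - p u x) * n2 (q' u) + n2 (\<lambda>x. q u x - q r x) * n2 (p' u)"
        by (rule add_mono[OF Cauchy_Schwarz_L2[OF L2_diff[OF pt pu(1)] qu(2)]
              Cauchy_Schwarz_L2[OF L2_diff[OF qu(1) qr] pu(2)]])
      also have "\<dots> \<le> \<epsilon> * N' u + \<epsilon> * N u"
        by (rule add_mono[OF mult_mono[OF 1 qu(3) less_imp_le[OF eps] n2_nonneg]
              mult_mono[OF 2 pu(3) less_imp_le[OF eps] n2_nonneg]])
      finally show "\<bar>?g u\<bar> \<le> \<epsilon> * (N u + N' u)" by (simp add: distrib_left add.commute)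
    qed
    then show "\<bar>ip (p t) (q t) - ip (p r) (q r) - integral {r..t} (\<lambda>t. ip (p t) (q' t) + ip (q t) (p' t))\<bar>
        \<le> \<epsilon> * integral {r..t} (\<lambda>t. N t + N' t)" unfolding eq by simp
  qed (use d1 d2 in auto)
qed

lemma curve_add:
  assumes p: "curve s e p p' N" and q: "curve s e q q' N'"
  shows "curve s e (\<lambda>t x. p t x + q t x) (\<lambda>t x. p' t x + q' t x) (\<lambda>t. N t + N' t)"
  unfolding curve_def
proof (intro conjI ballI)
  fix t assume t: "t \<in> {s..e}"
  note P = curveD[OF p t] and Q = curveD[OF q t]
  show "(\<lambda>x. p t x + q t x) \<in> L2I" "(\<lambda>x. p' t x + q' t x) \<in> L2I" using P Q by (auto intro: L2_add)
  show "n2 (\<lambda>x. p' t x + q' t x) \<le> N t + N' t" using n2_triangle[OF P(2) Q(2)] P Q by simp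
next
  show "(\<lambda>t. N t + N' t) absolutely_integrable_on {s..e}"
    by (intro set_integral_add curve_N[OF p] curve_N[OF q])
  fix g assume g: "g \<in> L2I"
  show "ac_on s e (\<lambda>t. ip g (\<lambda>x. p t x + q t x)) (\<lambda>t. ip g (\<lambda>x. p' t x + q' t x))"
    by (rule ac_on_cong[OF ac_on_add[OF curve_ac[OF p g] curve_ac[OF q g]], where S = "{}"])
      (use curveD[OF p] curveD[OF q] g in \<open>auto simp: ip_add_right\<close>)
qed

section \<open>Multiplication of curves by coefficients depending on time and space\<close>

definition coef :: "real \<Rightarrow> real \<Rightarrow> (real \<Rightarrow> real \<Rightarrow> real) \<Rightarrow> (real \<Rightarrow> real \<Rightarrow> real) \<Rightarrow> bool" where
  "coef s e r r' \<longleftrightarrow> (\<exists>r'' M. \<forall>x\<in>{0<..<1}. \<forall>t\<in>{s..e}.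
       ((\<lambda>t. r t x) has_real_derivative r' t x) (at t) \<and>
       ((\<lambda>t. r' t x) has_real_derivative r'' t x) (at t) \<and>
       \<bar>r t x\<bar> \<le> M \<and> \<bar>r' t x\<bar> \<le> M \<and> \<bar>r'' t x\<bar> \<le> M) \<and>
     (\<forall>t\<in>{s..e}. r t \<in> borel_measurable I01 \<and> r' t \<in> borel_measurable I01)"

text \<open>The second time derivative in \<open>coef\<close> is used only here. By the mean value
  theorem its bound gives a Lipschitz estimate for r' and a quadratic Taylor estimate for r, both
  uniform in x.\<close>

lemma coefD:
  assumes "coef s e r r'"
  obtains M where "M \<ge> 0" "\<And>t x. t \<in> {s..e} \<Longrightarrow> x \<in> {0<..<1} \<Longrightarrow> \<bar>r t x\<bar> \<le> M"
    "\<And>t x. t \<in> {s..e} \<Longrightarrow> x \<in> {0<..<1} \<Longrightarrow> \<bar>r' t x\<bar> \<le> M"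
    "\<And>t u x. t \<in> {s..e} \<Longrightarrow> u \<in> {s..e} \<Longrightarrow> x \<in> {0<..<1} \<Longrightarrow> \<bar>r' t x - r' u x\<bar> \<le> M * \<bar>t - u\<bar>"
    "\<And>t u x. t \<in> {s..e} \<Longrightarrow> u \<in> {s..e} \<Longrightarrow> x \<in> {0<..<1} \<Longrightarrow>
       \<bar>r t x - r u x - (t - u) * r' u x\<bar> \<le> M * \<bar>t - u\<bar> * \<bar>t - u\<bar>"
proof -
  obtain r'' M0 where H: "\<And>x t. x\<in>{0<..<1} \<Longrightarrow> t\<in>{s..e} \<Longrightarrow>
       ((\<lambda>t. r t x) has_real_derivative r' t x) (at t) \<and>
       ((\<lambda>t. r' t x) has_real_derivative r'' t x) (at t) \<and>
       \<bar>r t x\<bar> \<le> M0 \<and> \<bar>r' t x\<bar> \<le> M0 \<and> \<bar>r'' t x\<bar> \<le> M0"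
    using assms unfolding coef_def by blast
  define M where "M = \<bar>M0\<bar>"
  have mvt: "\<exists>z. f t - f u = f' z * (t - u) \<and> min t u \<le> z \<and> z \<le> max t u"
    if "\<And>z. z \<in> {s..e} \<Longrightarrow> (f has_real_derivative f' z) (at z)" "t \<in> {s..e}" "u \<in> {s..e}"
    for f f' :: "real \<Rightarrow> real" and t u
  proof (cases t u rule: linorder_cases)
    case less
    have "\<exists>z>t. z < u \<and> f u - f t = (u - t) * f' z"
      by (rule MVT2[OF less]) (use that in auto)
    then obtain z where "z > t" "z < u" "f u - f t = (u - t) * f' z" by blast
    then show ?thesis by (intro exI[of _ z]) (auto simp: algebra_simps)
  next
    case greater
    have "\<exists>z>u. z < t \<and> f t - f u = (t - u) * f' z"
      by (rule MVT2[OF greater]) (use that in auto)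
    then obtain z where "z > u" "z < t" "f t - f u = (t - u) * f' z" by blast
    then show ?thesis by (intro exI[of _ z]) (auto simp: algebra_simps)
  qed auto
  have L: "\<bar>r' t x - r' u x\<bar> \<le> M * \<bar>t - u\<bar>" if A: "t \<in> {s..e}" "u \<in> {s..e}" "x \<in> {0<..<1}" for t u x
  proof -
    obtain z where z: "r' t x - r' u x = r'' z x * (t - u)" "min t u \<le> z" "z \<le> max t u"
      using mvt[of "\<lambda>t. r' t x" "\<lambda>t. r'' t x" t u] H[OF A(3)] A by blast
    have "z \<in> {s..e}" using z A by auto
    then have "\<bar>r'' z x\<bar> \<le> M" using H[OF A(3)] by (fastforce simp: M_def)
    then show ?thesis unfolding z(1) abs_mult by (intro mult_right_mono) auto
  qed
  show thesis
  proof (rule that[of M])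
    fix t u x :: real assume A: "t \<in> {s..e}" "u \<in> {s..e}" "x \<in> {0<..<1}"
    obtain z where z: "r t x - r u x = r' z x * (t - u)" "min t u \<le> z" "z \<le> max t u"
      using mvt[of "\<lambda>t. r t x" "\<lambda>t. r' t x" t u] H[OF A(3)] A by blast
    have zm: "z \<in> {s..e}" using z A by auto
    have "r t x - r u x - (t - u) * r' u x = (r' z x - r' u x) * (t - u)"
      using z(1) by (simp add: algebra_simps)
    also have "\<bar>\<dots>\<bar> \<le> M * \<bar>z - u\<bar> * \<bar>t - u\<bar>"
      unfolding abs_mult using L[OF zm A(2,3)] by (intro mult_right_mono) auto
    also have "\<dots> \<le> M * \<bar>t - u\<bar> * \<bar>t - u\<bar>"
      using z(2,3) by (intro mult_right_mono mult_left_mono) (auto simp: M_def)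
    finally show "\<bar>r t x - r u x - (t - u) * r' u x\<bar> \<le> M * \<bar>t - u\<bar> * \<bar>t - u\<bar>" .
  next
    fix t x :: real assume A: "t \<in> {s..e}" "x \<in> {0<..<1}"
    show "\<bar>r t x\<bar> \<le> M" "\<bar>r' t x\<bar> \<le> M" using H[OF A(2,1)] by (auto simp: M_def)
  qed (use L in \<open>auto simp: M_def\<close>)
qed

lemma coef_meas: "coef s e r r' \<Longrightarrow> t \<in> {s..e} \<Longrightarrow> r t \<in> borel_measurable I01"
  "coef s e r r' \<Longrightarrow> t \<in> {s..e} \<Longrightarrow> r' t \<in> borel_measurable I01"
  by (auto simp: coef_def)

text \<open>The uniform Taylor estimate allows differentiation under the integral sign: the
  difference quotient of the pairing with h misses its limit by at most a constant times
  \<open>\<bar>t - u\<bar>\<close>.\<close>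

lemma coef_curve_const:
  assumes c: "coef s e r r'" and g: "g \<in> L2I"
  shows "\<exists>N. curve s e (\<lambda>t x. r t x * g x) (\<lambda>t x. r' t x * g x) N"
proof -
  obtain M where M: "M \<ge> 0" "\<And>t x. t \<in> {s..e} \<Longrightarrow> x \<in> {0<..<1} \<Longrightarrow> \<bar>r t x\<bar> \<le> M"
    "\<And>t x. t \<in> {s..e} \<Longrightarrow> x \<in> {0<..<1} \<Longrightarrow> \<bar>r' t x\<bar> \<le> M"
    and L1: "\<And>t u x. t \<in> {s..e} \<Longrightarrow> u \<in> {s..e} \<Longrightarrow> x \<in> {0<..<1} \<Longrightarrow> \<bar>r' t x - r' u x\<bar> \<le> M * \<bar>t - u\<bar>"
    and L2: "\<And>t u x. t \<in> {s..e} \<Longrightarrow> u \<in> {s..e} \<Longrightarrow> x \<in> {0<..<1} \<Longrightarrow>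
       \<bar>r t x - r u x - (t - u) * r' u x\<bar> \<le> M * \<bar>t - u\<bar> * \<bar>t - u\<bar>"
    using coefD[OF c] by blast
  have rg: "(\<lambda>x. r t x * g x) \<in> L2I" "(\<lambda>x. r' t x * g x) \<in> L2I" if "t \<in> {s..e}" for t
    by (rule L2_bdd_mult[OF g coef_meas(1)[OF c that] M(2)[OF that]], assumption)
       (rule L2_bdd_mult[OF g coef_meas(2)[OF c that] M(3)[OF that]], assumption)
  have "curve s e (\<lambda>t x. r t x * g x) (\<lambda>t x. r' t x * g x) (\<lambda>t. M * n2 g)"
    unfolding curve_def
  proof (intro conjI ballI)
    fix t assume t: "t \<in> {s..e}"
    show "n2 (\<lambda>x. r' t x * g x) \<le> M * n2 g"
      by (rule n2_bdd_mult[OF g coef_meas(2)[OF c t] M(3)[OF t]])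
  next
    show "(\<lambda>t. M * n2 g) absolutely_integrable_on {s..e}" by (intro absolutely_integrable_continuous_real continuous_intros)
    fix h assume h: "h \<in> L2I"
    note hg = L2_mult[OF h g]
    define K where "K = (LINT x|I01. \<bar>h x * g x\<bar>)"
    have bound: "\<bar>LINT x|I01. y x * (h x * g x)\<bar> \<le> B * K"
      if "integrable I01 (\<lambda>x. y x * (h x * g x))" "\<And>x. x \<in> {0<..<1} \<Longrightarrow> \<bar>y x\<bar> \<le> B" for y B
    proof -
      have "\<bar>LINT x|I01. y x * (h x * g x)\<bar> \<le> (LINT x|I01. \<bar>y x * (h x * g x)\<bar>)"
        by (rule integral_abs_bound)
      also have "\<dots> \<le> (LINT x|I01. B * \<bar>h x * g x\<bar>)"
      proof (rule integral_mono)
        show "integrable I01 (\<lambda>x. \<bar>y x * (h x * g x)\<bar>)" using that(1) by (rule integrable_abs)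
        show "integrable I01 (\<lambda>x. B * \<bar>h x * g x\<bar>)" by (intro integrable_mult_right integrable_abs hg)
        fix x assume "x \<in> space I01"
        then show "\<bar>y x * (h x * g x)\<bar> \<le> B * \<bar>h x * g x\<bar>"
          unfolding abs_mult[of "y x"] using that(2)[of x] by (intro mult_right_mono) auto
      qed
      finally show ?thesis by (simp add: K_def)
    qed
    have ii: "integrable I01 (\<lambda>x. r t x * (h x * g x))" "integrable I01 (\<lambda>x. r' t x * (h x * g x))"
      if "t \<in> {s..e}" for t
      using L2_mult[OF h rg(1)[OF that]] L2_mult[OF h rg(2)[OF that]] by (simp_all add: mult.left_commute)
    have ipe: "ip h (\<lambda>x. r t x * g x) = (LINT x|I01. r t x * (h x * g x))"
      "ip h (\<lambda>x. r' t x * g x) = (LINT x|I01. r' t x * (h x * g x))" for t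
      by (simp_all add: ip_def mult.left_commute)
    show "ac_on s e (\<lambda>t. ip h (\<lambda>x. r t x * g x)) (\<lambda>t. ip h (\<lambda>x. r' t x * g x))"
      unfolding ipe
    proof (rule ac_on_C1)
      fix u assume u: "u \<in> {s..e}"
      let ?E = "\<lambda>t. LINT x|I01. r t x * (h x * g x)" and ?G = "\<lambda>t. LINT x|I01. r' t x * (h x * g x)"
      have q: "\<bar>(?E t - ?E u) / (t - u) - ?G u\<bar> \<le> M * K * \<bar>t - u\<bar>" if t: "t \<in> {s..e}" "t \<noteq> u" for t
      proof -
        have E1: "?E t - ?E u - (t - u) * ?G u = (LINT x|I01. r t x * (h x * g x) - r u x * (h x * g x) - (t - u) * (r' u x * (h x * g x)))"
          using ii[OF t(1)] ii[OF u] by simp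
        have E2: "\<dots> = (LINT x|I01. (r t x - r u x - (t - u) * r' u x) * (h x * g x))"
          by (intro Bochner_Integration.integral_cong) (auto simp: algebra_simps)
        have "\<bar>?E t - ?E u - (t - u) * ?G u\<bar> \<le> M * \<bar>t - u\<bar> * \<bar>t - u\<bar> * K"
          unfolding E1 E2
        proof (rule bound)
          have "integrable I01 (\<lambda>x. r t x * (h x * g x) - r u x * (h x * g x) - (t - u) * (r' u x * (h x * g x)))"
            using ii[OF t(1)] ii[OF u] by simp
          then show "integrable I01 (\<lambda>x. (r t x - r u x - (t - u) * r' u x) * (h x * g x))"
            by (simp add: algebra_simps)
        qed (use L2 t u in auto)
        then have "\<bar>?E t - ?E u - (t - u) * ?G u\<bar> \<le> (M * K * \<bar>t - u\<bar>) * \<bar>t - u\<bar>" by (simp add: mult_ac)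
        moreover have "(?E t - ?E u) / (t - u) - ?G u = (?E t - ?E u - (t - u) * ?G u) / (t - u)"
          using t by (simp add: field_simps)
        ultimately show ?thesis using t by (simp add: abs_divide pos_divide_le_eq)
      qed
      show "(?E has_real_derivative ?G u) (at u within {s..e})"
        unfolding has_field_derivative_iff
      proof (rule LIM_zero_cancel, rule Lim_null_comparison)
        show "\<forall>\<^sub>F t in at u within {s..e}. norm ((?E t - ?E u) / (t - u) - ?G u) \<le> M * K * \<bar>t - u\<bar>"
          unfolding eventually_at by (intro exI[of _ 1]) (use q in auto)
        have "((\<lambda>t. M * K * \<bar>t - u\<bar>) \<longlongrightarrow> M * K * \<bar>u - u\<bar>) (at u within {s..e})"
          by (intro tendsto_intros)
        then show "((\<lambda>t. M * K * \<bar>t - u\<bar>) \<longlongrightarrow> 0) (at u within {s..e})" by simp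
      qed
    next
      let ?G = "\<lambda>t. LINT x|I01. r' t x * (h x * g x)"
      have q: "\<bar>?G t - ?G u\<bar> \<le> M * \<bar>t - u\<bar> * K" if t: "t \<in> {s..e}" and u: "u \<in> {s..e}" for t u
      proof -
        have E1: "?G t - ?G u = (LINT x|I01. r' t x * (h x * g x) - r' u x * (h x * g x))"
          using ii[OF t] ii[OF u] by simp
        have E2: "\<dots> = (LINT x|I01. (r' t x - r' u x) * (h x * g x))"
          by (intro Bochner_Integration.integral_cong) (auto simp: algebra_simps)
        show ?thesis
          unfolding E1 E2
        proof (rule bound)
          have "integrable I01 (\<lambda>x. r' t x * (h x * g x) - r' u x * (h x * g x))"
            using ii[OF t] ii[OF u] by simp
          then show "integrable I01 (\<lambda>x. (r' t x - r' u x) * (h x * g x))"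
            by (simp add: algebra_simps)
        qed (use L1 t u in auto)
      qed
      show "continuous_on {s..e} ?G"
        unfolding continuous_on_def
      proof (intro ballI, rule LIM_zero_cancel, rule Lim_null_comparison)
        fix u assume u: "u \<in> {s..e}"
        show "\<forall>\<^sub>F t in at u within {s..e}. norm (?G t - ?G u) \<le> M * \<bar>t - u\<bar> * K"
          unfolding eventually_at by (intro exI[of _ 1]) (use q u in auto)
        have "((\<lambda>t. M * \<bar>t - u\<bar> * K) \<longlongrightarrow> M * \<bar>u - u\<bar> * K) (at u within {s..e})"
          by (intro tendsto_intros)
        then show "((\<lambda>t. M * \<bar>t - u\<bar> * K) \<longlongrightarrow> 0) (at u within {s..e})" by simp
      qed
    qed
  qed (use rg in auto)
  then show ?thesis by blast
qed

text \<open>The coefficient is moved to the test function: the pairing of g with r p is the pairing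
  of r g with p. As r g is already a curve, the product rule for pairings applies.\<close>

lemma curve_coef:
  assumes c: "coef s e r r'" and p: "curve s e p p' N"
  shows "\<exists>N'. curve s e (\<lambda>t x. r t x * p t x) (\<lambda>t x. r' t x * p t x + r t x * p' t x) N'"
proof -
  obtain M where M: "M \<ge> 0" "\<And>t x. t \<in> {s..e} \<Longrightarrow> x \<in> {0<..<1} \<Longrightarrow> \<bar>r t x\<bar> \<le> M"
    "\<And>t x. t \<in> {s..e} \<Longrightarrow> x \<in> {0<..<1} \<Longrightarrow> \<bar>r' t x\<bar> \<le> M"
  proof (rule coefD[OF c])
    fix M assume M: "M \<ge> 0" "\<And>t x. t \<in> {s..e} \<Longrightarrow> x \<in> {0<..<1} \<Longrightarrow> \<bar>r t x\<bar> \<le> M"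
      "\<And>t x. t \<in> {s..e} \<Longrightarrow> x \<in> {0<..<1} \<Longrightarrow> \<bar>r' t x\<bar> \<le> M"
    show thesis by (rule that[OF M])
  qed
  obtain P where P: "P \<ge> 0" "\<And>t. t \<in> {s..e} \<Longrightarrow> n2 (p t) \<le> P" using curve_bounded[OF p] by blast
  note cm = coef_meas[OF c]
  have L: "(\<lambda>x. r t x * p t x) \<in> L2I" "(\<lambda>x. r' t x * p t x) \<in> L2I" "(\<lambda>x. r t x * p' t x) \<in> L2I"
    if t: "t \<in> {s..e}" for t
    by (rule L2_bdd_mult[OF curveD(1)[OF p t] cm(1)[OF t] M(2)[OF t]], assumption)
       (rule L2_bdd_mult[OF curveD(1)[OF p t] cm(2)[OF t] M(3)[OF t]], assumption,
        rule L2_bdd_mult[OF curveD(2)[OF p t] cm(1)[OF t] M(2)[OF t]], assumption)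
  have "curve s e (\<lambda>t x. r t x * p t x) (\<lambda>t x. r' t x * p t x + r t x * p' t x) (\<lambda>t. M * P + M * N t)"
    unfolding curve_def
  proof (intro conjI ballI)
    fix t assume t: "t \<in> {s..e}"
    have "n2 (\<lambda>x. r' t x * p t x + r t x * p' t x) \<le> n2 (\<lambda>x. r' t x * p t x) + n2 (\<lambda>x. r t x * p' t x)"
      by (rule n2_triangle[OF L(2,3)[OF t]])
    also have "\<dots> \<le> M * n2 (p t) + M * n2 (p' t)"
      by (rule add_mono[OF n2_bdd_mult[OF curveD(1)[OF p t] cm(2)[OF t] M(3)[OF t]]
            n2_bdd_mult[OF curveD(2)[OF p t] cm(1)[OF t] M(2)[OF t]]])
    also have "\<dots> \<le> M * P + M * N t"
      by (intro add_mono mult_left_mono P(2)[OF t] curveD(3)[OF p t] M(1))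
    finally show "n2 (\<lambda>x. r' t x * p t x + r t x * p' t x) \<le> M * P + M * N t" .
  next
    show "(\<lambda>t. M * P + M * N t) absolutely_integrable_on {s..e}"
      by (intro set_integral_add set_integrable_mult_right curve_N[OF p] absolutely_integrable_continuous_real continuous_intros)
    fix g assume g: "g \<in> L2I"
    obtain N1 where N1: "curve s e (\<lambda>t x. r t x * g x) (\<lambda>t x. r' t x * g x) N1"
      using coef_curve_const[OF c g] by blast
    show "ac_on s e (\<lambda>t. ip g (\<lambda>x. r t x * p t x)) (\<lambda>t. ip g (\<lambda>x. r' t x * p t x + r t x * p' t x))"
    proof (rule ac_on_cong[OF curve_ip[OF N1 p], where S = "{}"])
      fix t assume "s \<le> t" "t \<le> e"
      then have t: "t \<in> {s..e}" by auto
      show "ip (\<lambda>x. r t x * g x) (p t) = ip g (\<lambda>x. r t x * p t x)"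
        by (simp add: ip_def mult_ac)
      have "ip g (\<lambda>x. r' t x * p t x + r t x * p' t x) = ip g (\<lambda>x. r' t x * p t x) + ip g (\<lambda>x. r t x * p' t x)"
        by (rule ip_add_right[OF g L(2,3)[OF t]])
      then show "ip (\<lambda>x. r t x * g x) (p' t) + ip (p t) (\<lambda>x. r' t x * g x) = ip g (\<lambda>x. r' t x * p t x + r t x * p' t x)"
        by (simp add: ip_def mult_ac)
    qed auto
  qed (use L L2_add in auto)
  then show ?thesis by blast
qed

lemma coef_space:
  assumes "y \<in> borel_measurable I01" "\<And>x. x \<in> {0<..<1} \<Longrightarrow> \<bar>y x\<bar> \<le> B"
  shows "coef s e (\<lambda>t. y) (\<lambda>t x. 0)"
  unfolding coef_def
proof (intro conjI exI[of _ "\<lambda>t x. 0"] exI[of _ "\<bar>B\<bar>"] ballI)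
  fix x :: real assume "x \<in> {0<..<1}"
  then show "\<bar>y x\<bar> \<le> \<bar>B\<bar>" using assms(2)[of x] by auto
qed (use assms in auto)

lemma coef_time:
  assumes "\<And>t. t \<in> {s..e} \<Longrightarrow> (f has_real_derivative f' t) (at t)"
    "\<And>t. t \<in> {s..e} \<Longrightarrow> (f' has_real_derivative f'' t) (at t)" "continuous_on {s..e} f''"
  shows "coef s e (\<lambda>t x. f t) (\<lambda>t x. f' t)"
proof -
  have cf: "continuous_on {s..e} f" "continuous_on {s..e} f'"
    by (intro continuous_at_imp_continuous_on ballI, rule DERIV_isCont, erule assms)+
  have bd: "\<exists>B. \<forall>t\<in>{s..e}. \<bar>g t\<bar> \<le> B" if "continuous_on {s..e} g" for g :: "real \<Rightarrow> real"
    using compact_imp_bounded[OF compact_continuous_image[OF that]] by (auto simp: bounded_iff)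
  obtain B0 where B0: "\<forall>t\<in>{s..e}. \<bar>f t\<bar> \<le> B0" using bd[OF cf(1)] by (elim exE)
  obtain B1 where B1: "\<forall>t\<in>{s..e}. \<bar>f' t\<bar> \<le> B1" using bd[OF cf(2)] by (elim exE)
  obtain B2 where B2: "\<forall>t\<in>{s..e}. \<bar>f'' t\<bar> \<le> B2" using bd[OF assms(3)] by (elim exE)
  have B: "\<bar>f t\<bar> \<le> \<bar>B0\<bar> + \<bar>B1\<bar> + \<bar>B2\<bar> \<and> \<bar>f' t\<bar> \<le> \<bar>B0\<bar> + \<bar>B1\<bar> + \<bar>B2\<bar> \<and> \<bar>f'' t\<bar> \<le> \<bar>B0\<bar> + \<bar>B1\<bar> + \<bar>B2\<bar>"
    if "t \<in> {s..e}" for t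
    using bspec[OF B0 that] bspec[OF B1 that] bspec[OF B2 that] by linarith
  show ?thesis unfolding coef_def
    by (intro conjI exI[of _ "\<lambda>t x. f'' t"] exI[of _ "\<bar>B0\<bar> + \<bar>B1\<bar> + \<bar>B2\<bar>"] ballI)
      (use assms B in auto)
qed

lemma coef_mult:
  assumes "coef s e r r'" "coef s e q q'"
  shows "coef s e (\<lambda>t x. r t x * q t x) (\<lambda>t x. r' t x * q t x + r t x * q' t x)"
proof -
  obtain r'' M1 where R: "\<And>x t. x\<in>{0<..<1} \<Longrightarrow> t\<in>{s..e} \<Longrightarrow>
       ((\<lambda>t. r t x) has_real_derivative r' t x) (at t) \<and>
       ((\<lambda>t. r' t x) has_real_derivative r'' t x) (at t) \<and>
       \<bar>r t x\<bar> \<le> M1 \<and> \<bar>r' t x\<bar> \<le> M1 \<and> \<bar>r'' t x\<bar> \<le> M1"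
    using assms(1) unfolding coef_def by blast
  obtain q'' M2 where Q: "\<And>x t. x\<in>{0<..<1} \<Longrightarrow> t\<in>{s..e} \<Longrightarrow>
       ((\<lambda>t. q t x) has_real_derivative q' t x) (at t) \<and>
       ((\<lambda>t. q' t x) has_real_derivative q'' t x) (at t) \<and>
       \<bar>q t x\<bar> \<le> M2 \<and> \<bar>q' t x\<bar> \<le> M2 \<and> \<bar>q'' t x\<bar> \<le> M2"
    using assms(2) unfolding coef_def by blast
  have pr: "\<bar>u * v\<bar> \<le> M1 * M2" if "\<bar>u\<bar> \<le> M1" "\<bar>v\<bar> \<le> M2" for u v :: real
    unfolding abs_mult using that by (intro mult_mono) auto
  show ?thesis unfolding coef_def
  proof (intro conjI exI[of _ "\<lambda>t x. r'' t x * q t x + 2 * (r' t x * q' t x) + r t x * q'' t x"] exI[of _ "4 * (M1 * M2)"] ballI)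
    fix x t :: real assume x: "x \<in> {0<..<1}" and t: "t \<in> {s..e}"
    note R = R[OF x t] and Q = Q[OF x t]
    show "((\<lambda>t. r t x * q t x) has_real_derivative r' t x * q t x + r t x * q' t x) (at t)"
      using DERIV_mult[of "\<lambda>t. r t x" "r' t x" t UNIV "\<lambda>t. q t x" "q' t x"] R Q by (simp add: mult.commute add.commute)
    show "((\<lambda>t. r' t x * q t x + r t x * q' t x) has_real_derivative
        r'' t x * q t x + 2 * (r' t x * q' t x) + r t x * q'' t x) (at t)"
      using DERIV_add[OF DERIV_mult[of "\<lambda>t. r' t x" "r'' t x" t UNIV "\<lambda>t. q t x" "q' t x"]
          DERIV_mult[of "\<lambda>t. r t x" "r' t x" t UNIV "\<lambda>t. q' t x" "q'' t x"]] R Q by (simp add: algebra_simps)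
    have p: "\<bar>r t x * q t x\<bar> \<le> M1 * M2" "\<bar>r' t x * q t x\<bar> \<le> M1 * M2" "\<bar>r t x * q' t x\<bar> \<le> M1 * M2"
      "\<bar>r'' t x * q t x\<bar> \<le> M1 * M2" "\<bar>r' t x * q' t x\<bar> \<le> M1 * M2" "\<bar>r t x * q'' t x\<bar> \<le> M1 * M2"
      using R Q by (auto intro!: pr)
    then show "\<bar>r t x * q t x\<bar> \<le> 4 * (M1 * M2)" "\<bar>r' t x * q t x + r t x * q' t x\<bar> \<le> 4 * (M1 * M2)"
      "\<bar>r'' t x * q t x + 2 * (r' t x * q' t x) + r t x * q'' t x\<bar> \<le> 4 * (M1 * M2)" by linarith+
  qed (use coef_meas[OF assms(1)] coef_meas[OF assms(2)] in auto)
qed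

lemma coef_add:
  assumes "coef s e r r'" "coef s e q q'"
  shows "coef s e (\<lambda>t x. r t x + q t x) (\<lambda>t x. r' t x + q' t x)"
proof -
  obtain r'' M1 where R: "\<And>x t. x\<in>{0<..<1} \<Longrightarrow> t\<in>{s..e} \<Longrightarrow>
       ((\<lambda>t. r t x) has_real_derivative r' t x) (at t) \<and>
       ((\<lambda>t. r' t x) has_real_derivative r'' t x) (at t) \<and>
       \<bar>r t x\<bar> \<le> M1 \<and> \<bar>r' t x\<bar> \<le> M1 \<and> \<bar>r'' t x\<bar> \<le> M1"
    using assms(1) unfolding coef_def by blast
  obtain q'' M2 where Q: "\<And>x t. x\<in>{0<..<1} \<Longrightarrow> t\<in>{s..e} \<Longrightarrow>
       ((\<lambda>t. q t x) has_real_derivative q' t x) (at t) \<and>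
       ((\<lambda>t. q' t x) has_real_derivative q'' t x) (at t) \<and>
       \<bar>q t x\<bar> \<le> M2 \<and> \<bar>q' t x\<bar> \<le> M2 \<and> \<bar>q'' t x\<bar> \<le> M2"
    using assms(2) unfolding coef_def by blast
  show ?thesis unfolding coef_def
  proof (intro conjI exI[of _ "\<lambda>t x. r'' t x + q'' t x"] exI[of _ "M1 + M2"] ballI)
    fix x t :: real assume x: "x \<in> {0<..<1}" and t: "t \<in> {s..e}"
    note R = R[OF x t] and Q = Q[OF x t]
    show "((\<lambda>t. r t x + q t x) has_real_derivative r' t x + q' t x) (at t)"
      "((\<lambda>t. r' t x + q' t x) has_real_derivative r'' t x + q'' t x) (at t)"
      using R Q by (auto intro: DERIV_add)
    show "\<bar>r t x + q t x\<bar> \<le> M1 + M2" "\<bar>r' t x + q' t x\<bar> \<le> M1 + M2" "\<bar>r'' t x + q'' t x\<bar> \<le> M1 + M2"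
      using R Q by linarith+
  qed (use coef_meas[OF assms(1)] coef_meas[OF assms(2)] in auto)
qed

lemma coef_exp:
  assumes "coef s e r r'"
  shows "coef s e (\<lambda>t x. exp (r t x)) (\<lambda>t x. exp (r t x) * r' t x)"
proof -
  obtain r'' M where R: "\<And>x t. x\<in>{0<..<1} \<Longrightarrow> t\<in>{s..e} \<Longrightarrow>
       ((\<lambda>t. r t x) has_real_derivative r' t x) (at t) \<and>
       ((\<lambda>t. r' t x) has_real_derivative r'' t x) (at t) \<and>
       \<bar>r t x\<bar> \<le> M \<and> \<bar>r' t x\<bar> \<le> M \<and> \<bar>r'' t x\<bar> \<le> M"
    using assms(1) unfolding coef_def by blast
  show ?thesis unfolding coef_def
  proof (intro conjI exI[of _ "\<lambda>t x. exp (r t x) * (r'' t x + r' t x * r' t x)"] exI[of _ "exp M * (1 + M + M * M)"] ballI)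
    fix x t :: real assume x: "x \<in> {0<..<1}" and t: "t \<in> {s..e}"
    note R = R[OF x t]
    have M: "M \<ge> 0" using R by linarith
    show 1: "((\<lambda>t. exp (r t x)) has_real_derivative exp (r t x) * r' t x) (at t)"
      by (rule DERIV_fun_exp) (use R in auto)
    show "((\<lambda>t. exp (r t x) * r' t x) has_real_derivative exp (r t x) * (r'' t x + r' t x * r' t x)) (at t)"
      using DERIV_mult[OF 1, of "\<lambda>t. r' t x" "r'' t x"] R by (simp add: algebra_simps)
    have ex: "exp (r t x) \<le> exp M" using R by auto
    have m2: "\<bar>r' t x * r' t x\<bar> \<le> M * M" unfolding abs_mult using R M by (intro mult_mono) auto
    have b: "\<bar>exp (r t x) * u\<bar> \<le> exp M * (1 + M + M * M)" if "\<bar>u\<bar> \<le> 1 + M + M * M" for u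
      unfolding abs_mult using ex that by (intro mult_mono) auto
    have MM: "0 \<le> M * M" using M by simp
    show "\<bar>exp (r t x)\<bar> \<le> exp M * (1 + M + M * M)" using b[of 1] M MM by simp
    show "\<bar>exp (r t x) * r' t x\<bar> \<le> exp M * (1 + M + M * M)" using R M MM by (intro b) linarith
    show "\<bar>exp (r t x) * (r'' t x + r' t x * r' t x)\<bar> \<le> exp M * (1 + M + M * M)"
      using R M MM m2 by (intro b) linarith
  qed (use coef_meas[OF assms(1)] in auto)
qed

section \<open>The spatial estimate\<close>

text \<open>Otherwise f would dominate e/(x - c) near c, which is not integrable: its integral over
  \<open>{c + h..c + 2 * h}\<close> is at least e/2 for every small h. Applied to w^2/b at x0, it
  yields the points at which the singular boundary term is small.\<close>

lemma small_point_right: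
  fixes f :: "real \<Rightarrow> real"
  assumes f: "f absolutely_integrable_on {c..d}" and cd: "c < d" and e: "e > 0" "\<delta> > 0"
  shows "\<exists>p. c < p \<and> p < c + \<delta> \<and> p < d \<and> (p - c) * f p < e"
proof (rule ccontr)
  assume "\<not> ?thesis"
  then have big: "(p - c) * f p \<ge> e" if "c < p" "p < c + \<delta>" "p < d" for p
    using that by (meson not_le)
  have ac: "ac_on c d (\<lambda>x. 0 + integral {c..x} f) f" by (rule ac_on_integral[OF f])
  obtain d1 where d1: "d1 > 0" "\<And>x y. x \<in> {c..d} \<Longrightarrow> y \<in> {c..d} \<Longrightarrow> \<bar>x - y\<bar> < d1 \<Longrightarrow>
      \<bar>(0 + integral {c..x} f) - (0 + integral {c..y} f)\<bar> < e / 2"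
    using unif_cont_Icc[OF ac_on_cont[OF ac], of "e/2"] e by auto
  define h where "h = min d1 (min \<delta> (d - c)) / 4"
  have h: "h > 0" "2 * h < d1" "2 * h < \<delta>" "2 * h < d - c"
    using d1(1) e(2) cd by (auto simp: h_def min_def)
  have "e / 2 = integral {c + h..c + 2 * h} (\<lambda>x. e / (2 * h))" using h by simp
  also have "\<dots> \<le> integral {c + h..c + 2 * h} f"
  proof (rule integral_le)
    show "f integrable_on {c + h..c + 2 * h}" using h by (intro abs_int_sub_int[OF f]) auto
    fix x assume x: "x \<in> {c + h..c + 2 * h}"
    then have "e \<le> (x - c) * f x" by (intro big) (use h in auto)
    then have "e / (x - c) \<le> f x" using x h by (simp add: field_simps)
    moreover have "e / (2 * h) \<le> e / (x - c)" using x h e by (intro divide_left_mono mult_pos_pos) auto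
    ultimately show "e / (2 * h) \<le> f x" by simp
  qed auto
  also have "\<dots> < e / 2"
  proof -
    have "\<bar>(0 + integral {c..c + 2 * h} f) - (0 + integral {c..c + h} f)\<bar> < e / 2"
      by (rule d1(2)) (use h in auto)
    moreover have "integral {c + h..c + 2 * h} f = (0 + integral {c..c + 2 * h} f) - (0 + integral {c..c + h} f)"
      by (rule ac_on_diff[OF ac]) (use h in auto)
    ultimately show ?thesis by linarith
  qed
  finally show False by simp
qed

lemma small_point_left:
  fixes f :: "real \<Rightarrow> real"
  assumes f: "f absolutely_integrable_on {c..d}" and cd: "c < d" and e: "e > 0" "\<delta> > 0"
  shows "\<exists>p. p < d \<and> d - \<delta> < p \<and> c < p \<and> (d - p) * f p < e"
proof -
  have f': "(\<lambda>x. f (- x)) absolutely_integrable_on {- d..- c}"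
    using f by simp
  have "- d < - c" using cd by simp
  from small_point_right[OF f' this e] obtain p where "- d < p" "p < - d + \<delta>" "p < - c" "(p - - d) * f (- p) < e"
    by blast
  then show ?thesis by (intro exI[of _ "- p"]) (auto simp: add.commute)
qed

text \<open>Here y = x - x0, while al, be and m0 stand for the derivatives of a, b and m; the right
  side is k Z' exactly as the product rules produce it. Right minus left equals k times the sum of a
  w'^2 (K1 - q), (w^2/b) (\<open>\<beta>\<close> - r) and k^2 (K1 - q) (y^2/a) w^2, where q = y al/a
  and r = lam y be/b. The hypotheses make all three terms nonnegative.\<close>

lemma multiplier_identity:
  fixes a b y w w' F' m m0 ga al be k lam \<mu> K1 \<beta> :: real
  assumes "a > 0" "b > 0" "k \<ge> 0" and al: "y * al \<le> K1 * a" and be: "lam * (y * be) \<le> \<beta> * b"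
    and m0: "m0 = \<mu> * (y / a) + k\<^sup>2 * (y / a * (2 - y * al / a))"
  defines "F \<equiv> a * w'"
  shows "k * (2 - K1) * (a * w'\<^sup>2) - k * \<beta> * (w\<^sup>2 / b) + k * ((\<mu> + k\<^sup>2 * (2 - K1)) * (y\<^sup>2 / a) * w\<^sup>2)
      - (F' + lam * (w / b) + m * w) * (- 2 * k * y * w' - k * w)
    \<le> k * ((y * (1 / a) * (2 * F * F') + F\<^sup>2 * (y * (- al / a\<^sup>2) + 1 / a * 1)) + (F * w' + w * F')
      + lam * (y * (1 / b) * (2 * w * w') + w\<^sup>2 * (y * (- be / b\<^sup>2) + 1 / b * 1))
      + (y * m * (2 * w * w') + w\<^sup>2 * (y * m0 + m * 1)))"
proof -
  define q where "q = y * al / a"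
  define r where "r = lam * (y * be) / b"
  have q: "q \<le> K1" using al assms(1) by (simp add: q_def pos_divide_le_eq)
  have r: "r \<le> \<beta>" using be assms(2) by (simp add: r_def pos_divide_le_eq)
  have e1: "y * (1 / a) * (2 * F * F') = 2 * y * w' * F'" using assms(1) by (simp add: F_def)
  have e2: "F\<^sup>2 * (y * (- al / a\<^sup>2) + 1 / a * 1) = a * w'\<^sup>2 * (1 - q)"
    using assms(1) by (simp add: F_def q_def power2_eq_square field_simps)
  have e3: "lam * (y * (1 / b) * (2 * w * w') + w\<^sup>2 * (y * (- be / b\<^sup>2) + 1 / b * 1))
      = 2 * lam * (y * (w / b) * w') + w\<^sup>2 / b * (lam - r)"
    using assms(2) by (simp add: r_def power2_eq_square field_simps)
  have e4: "w\<^sup>2 * (y * m0 + m * 1) = w\<^sup>2 * m + (\<mu> + k\<^sup>2 * (2 - q)) * (y\<^sup>2 / a) * w\<^sup>2"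
    by (simp add: m0 q_def power2_eq_square algebra_simps)
  have e5: "F * w' = a * w'\<^sup>2" by (simp add: F_def power2_eq_square)
  \<comment> \<open>Naming the quotient leaves a polynomial identity in which no denominator b has
    to be cleared.\<close>
  define u where "u = w / b"
  have wu: "w\<^sup>2 / b = w * u" by (simp add: u_def power2_eq_square)
  have L: "k * ((y * (1 / a) * (2 * F * F') + F\<^sup>2 * (y * (- al / a\<^sup>2) + 1 / a * 1)) + (F * w' + w * F')
      + lam * (y * (1 / b) * (2 * w * w') + w\<^sup>2 * (y * (- be / b\<^sup>2) + 1 / b * 1))
      + (y * m * (2 * w * w') + w\<^sup>2 * (y * m0 + m * 1)))
    - (k * (2 - K1) * (a * w'\<^sup>2) - k * \<beta> * (w\<^sup>2 / b) + k * ((\<mu> + k\<^sup>2 * (2 - K1)) * (y\<^sup>2 / a) * w\<^sup>2)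
      - (F' + lam * (w / b) + m * w) * (- 2 * k * y * w' - k * w))
    = k * (a * w'\<^sup>2 * (K1 - q)) + k * (w\<^sup>2 / b * (\<beta> - r)) + k * (k\<^sup>2 * (K1 - q) * (y\<^sup>2 / a) * w\<^sup>2)"
    unfolding e1 e2 e3 e4 e5 wu u_def[symmetric] by (simp add: power2_eq_square algebra_simps)
  have "0 \<le> k * (a * w'\<^sup>2 * (K1 - q)) + k * (w\<^sup>2 / b * (\<beta> - r)) + k * (k\<^sup>2 * (K1 - q) * (y\<^sup>2 / a) * w\<^sup>2)"
    using assms(1-3) q r by (intro add_nonneg_nonneg mult_nonneg_nonneg) auto
  then show ?thesis unfolding L[symmetric] by (simp only: diff_ge_0_iff_ge)
qed

lemma four_terms_ge:
  "0 \<le> A \<Longrightarrow> \<bar>B - B0\<bar> < e \<Longrightarrow> \<bar>C\<bar> \<le> E \<Longrightarrow> \<bar>D\<bar> \<le> e \<Longrightarrow> B0 - e - E - e \<le> A + B + C + D" for A :: real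
  by linarith

lemma four_terms_le:
  "A \<le> 0 \<Longrightarrow> \<bar>B - B0\<bar> < e \<Longrightarrow> \<bar>C\<bar> \<le> E \<Longrightarrow> \<bar>D\<bar> \<le> e \<Longrightarrow> A + B + C + D \<le> B0 + e + E + e" for A :: real
  by linarith

lemma lint_comb:
  assumes "integrable M f" "integrable M g" "integrable M h"
  shows "(LINT x|M. c * f x - d * g x + e * h x :: real) = c * (LINT x|M. f x) - d * (LINT x|M. g x) + e * (LINT x|M. h x)"
  using assms by simp

context coeffs
begin

lemma a_meas [measurable]: "a \<in> borel_measurable I01"
  by (rule continuous_imp_measurable_on_sets_lebesgue[OF continuous_on_subset[OF a_cont]]) auto

lemma b_meas [measurable]: "b \<in> borel_measurable I01"
  by (rule continuous_imp_measurable_on_sets_lebesgue[OF continuous_on_subset[OF b_cont]]) auto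

lemma ident_meas [measurable]: "(\<lambda>x. x) \<in> borel_measurable I01"
  using id_borel_measurable_lebesgue_on[unfolded id_def] .

lemma psi_meas [measurable]: "ps \<in> borel_measurable I01"
  by (rule continuous_imp_measurable_on_sets_lebesgue[OF continuous_on_subset[OF psi_cont]]) auto

lemma p2a_meas [measurable]: "p2a \<in> borel_measurable I01"
  unfolding p2a_def[abs_def] by measurable

text \<open>This is sqrt a times psi'/c1, a square root of \<open>p2a\<close> with sign. It is
  bounded although psi' need not be, so the extra term of sqrt a w_x is a bounded multiple of
  v.\<close>

definition gam :: "real \<Rightarrow> real" where "gam x = (x - x0) / sqrt (a x)"

lemma gam_meas [measurable]: "gam \<in> borel_measurable I01"
  unfolding gam_def[abs_def] by measurable

lemma gam_sq: "x \<in> {0..1} \<Longrightarrow> (gam x)\<^sup>2 = p2a x"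
  using a_nonneg[of x] by (simp add: gam_def p2a_def power_divide)

lemma Gam_nonneg: "0 \<le> Gam"
  using p2a_nonneg[of 0] p2a_nonneg[of 1] by (simp add: Gam_def)

lemma p2a_abs: "x \<in> {0<..<1} \<Longrightarrow> \<bar>p2a x\<bar> \<le> Gam"
  using p2a_nonneg[of x] p2a_le[of x] by auto

lemma gam_abs: "x \<in> {0<..<1} \<Longrightarrow> \<bar>gam x\<bar> \<le> sqrt Gam"
  using gam_sq[of x] p2a_le[of x] by (intro real_le_rsqrt) auto

lemma AE_off_x0: "AE x in I01. x \<in> {0<..<1} \<and> x \<noteq> x0"
  by (subst AE_lebesgue_on_iff) (auto intro!: exI[of _ "{x0}"])

lemma ac_L2:
  assumes "ac_on 0 1 f f'"
  shows "f \<in> L2I"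
proof (rule L2I)
  have "f absolutely_integrable_on {0..1}" "(\<lambda>x. (f x)\<^sup>2) absolutely_integrable_on {0..1}"
    by (intro absolutely_integrable_continuous_real continuous_intros ac_on_cont[OF assms])+
  then have "integrable I01 f" "integrable I01 (\<lambda>x. (f x)\<^sup>2)" by (simp_all add: integrable_Ioo_iff)
  then show "f \<in> borel_measurable I01" "integrable I01 (\<lambda>x. (f x)\<^sup>2)" by auto
qed

definition Aint :: "(real \<Rightarrow> real) \<Rightarrow> real" where "Aint w' = (LINT x|I01. a x * (w' x)\<^sup>2)"
definition Bint :: "(real \<Rightarrow> real) \<Rightarrow> real" where "Bint w = (LINT x|I01. p2a x * (w x)\<^sup>2)"

lemma grad_sq:
  assumes "(\<lambda>x. sqrt (a x) * w' x) \<in> L2I"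
  shows "integrable I01 (\<lambda>x. a x * (w' x)\<^sup>2)" "Aint w' = (n2 (\<lambda>x. sqrt (a x) * w' x))\<^sup>2"
proof -
  have eq: "(sqrt (a x) * w' x)\<^sup>2 = a x * (w' x)\<^sup>2" if "x \<in> {0<..<1}" for x
    using a_nonneg[of x] that by (simp add: power_mult_distrib)
  show "integrable I01 (\<lambda>x. a x * (w' x)\<^sup>2)"
    using L2_sq[OF assms] by (rule Bochner_Integration.integrable_cong[THEN iffD1, rotated 2]) (auto simp: eq)
  have "Aint w' = (LINT x|I01. (sqrt (a x) * w' x)\<^sup>2)"
    unfolding Aint_def by (intro Bochner_Integration.integral_cong) (auto simp: eq)
  then show "Aint w' = (n2 (\<lambda>x. sqrt (a x) * w' x))\<^sup>2" by (simp add: n2_def)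
qed

lemma weight_sq:
  assumes "w \<in> L2I"
  shows "integrable I01 (\<lambda>x. p2a x * (w x)\<^sup>2)"
  using L2_mult[OF assms L2_bdd_mult[OF assms p2a_meas p2a_abs]] by (simp add: power2_eq_square mult_ac)

text \<open>Off x0 the function is the bounded factor \<open>gam\<close> times sqrt a w'.\<close>

lemma shifted_grad_L2:
  assumes w': "(\<lambda>x. sqrt (a x) * w' x) \<in> L2I" and m: "w' \<in> borel_measurable I01"
  shows "(\<lambda>x. (x - x0) * w' x) \<in> L2I"
proof (rule L2I)
  note [measurable] = m
  have 1: "(\<lambda>x. gam x * (sqrt (a x) * w' x)) \<in> L2I" by (rule L2_bdd_mult[OF w' gam_meas gam_abs])
  have ae: "AE x in I01. (gam x * (sqrt (a x) * w' x))\<^sup>2 = ((x - x0) * w' x)\<^sup>2"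
    using AE_off_x0
  proof eventually_elim
    case (elim x)
    then have "a x > 0" using a_pos[of x] by auto
    then show ?case by (simp add: gam_def)
  qed
  show "(\<lambda>x. (x - x0) * w' x) \<in> borel_measurable I01" by measurable
  have [measurable]: "(\<lambda>x. gam x * (sqrt (a x) * w' x)) \<in> borel_measurable I01" by (rule L2_meas[OF 1])
  show "integrable I01 (\<lambda>x. ((x - x0) * w' x)\<^sup>2)"
    using L2_sq[OF 1] by (rule integrable_cong_AE[THEN iffD1, rotated 3, OF _]) (use ae in auto)
qed

text \<open>Integration by parts in \<open>\<integral> w\<^sup>2 = \<integral> (x - x0)' w\<^sup>2\<close>.\<close>

lemma uncertainty:
  assumes w: "ac_on 0 1 w w'" and w01: "w 0 = 0" "w 1 = 0" and w': "(\<lambda>x. sqrt (a x) * w' x) \<in> L2I" and k: "k > 0"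
  shows "(LINT x|I01. (w x)\<^sup>2) \<le> Aint w' / k + k * Bint w"
proof -
  have wi: "integrable I01 w'" using ac_on_abs_int[OF w] by (simp add: integrable_Ioo_iff)
  note [measurable] = borel_measurable_integrable[OF wi]
  note wL = ac_L2[OF w]
  have sg: "(\<lambda>x. (x - x0) * w' x) \<in> L2I" by (rule shifted_grad_L2[OF w']) measurable
  have ac: "ac_on 0 1 (\<lambda>x. (x - x0) * (w x)\<^sup>2) (\<lambda>x. (x - x0) * (2 * w x * w' x) + (w x)\<^sup>2 * 1)"
    by (rule ac_on_mult[OF ac_shift ac_on_square[OF w]])
  have i1: "integrable I01 (\<lambda>x. w x * ((x - x0) * w' x))" by (rule L2_mult[OF wL sg])
  have ii: "integrable I01 (\<lambda>x. (x - x0) * (2 * w x * w' x) + (w x)\<^sup>2 * 1)"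
    using ac_on_abs_int[OF ac] by (simp only: integrable_Ioo_iff)
  have "0 = integral {0..1} (\<lambda>x. (x - x0) * (2 * w x * w' x) + (w x)\<^sup>2 * 1)"
    using ac_on_diff[OF ac, of 0 1] w01 by simp
  also have "\<dots> = (LINT x|I01. 2 * (w x * ((x - x0) * w' x)) + (w x)\<^sup>2)"
    unfolding lint_Ioo[OF ii, symmetric] by (intro Bochner_Integration.integral_cong) (auto simp: algebra_simps)
  also have "\<dots> = 2 * (LINT x|I01. w x * ((x - x0) * w' x)) + (LINT x|I01. (w x)\<^sup>2)"
    using i1 L2_sq[OF wL] by simp
  finally have "(LINT x|I01. (w x)\<^sup>2) = (LINT x|I01. - 2 * (w x * ((x - x0) * w' x)))" using i1 by simp
  also have "\<dots> \<le> (LINT x|I01. (1 / k) * (a x * (w' x)\<^sup>2) + k * (p2a x * (w x)\<^sup>2))"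
  proof (rule integral_mono_AE)
    show "integrable I01 (\<lambda>x. - 2 * (w x * ((x - x0) * w' x)))" using i1 by simp
    show "integrable I01 (\<lambda>x. (1 / k) * (a x * (w' x)\<^sup>2) + k * (p2a x * (w x)\<^sup>2))"
      by (intro Bochner_Integration.integrable_add integrable_mult_right grad_sq(1)[OF w'] weight_sq[OF wL])
    show "AE x in I01. - 2 * (w x * ((x - x0) * w' x)) \<le> (1 / k) * (a x * (w' x)\<^sup>2) + k * (p2a x * (w x)\<^sup>2)"
      using AE_off_x0
    proof eventually_elim
      case (elim x)
      then have ap: "a x > 0" using a_pos[of x] by auto
      \<comment> \<open>Young's inequality by completing the square; division by k a produces
        exactly the weights 1/k for the gradient and k for \<open>p2a\<close>.\<close>
      have "0 \<le> (a x * w' x + k * ((x - x0) * w x))\<^sup>2 / (k * a x)" using ap k by simp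
      also have "\<dots> = (1 / k) * (a x * (w' x)\<^sup>2) + k * (p2a x * (w x)\<^sup>2) + 2 * (w x * ((x - x0) * w' x))"
        using ap k by (simp add: p2a_def power2_eq_square field_simps)
      finally show ?case by simp
    qed
  qed
  also have "\<dots> = (1 / k) * Aint w' + k * Bint w"
    unfolding Aint_def Bint_def using grad_sq(1)[OF w'] weight_sq[OF wL] by simp
  finally show ?thesis by simp
qed

text \<open>Away from \<open>x0\<close> the difference of \<open>L R\<close> and the quadratic lower bound dominates \<open>- k Z'\<close> with
  \<open>Z = (x - x0) F\<^sup>2 / a + F w + lam (x - x0) w\<^sup>2 / b + (x - x0) m w\<^sup>2\<close>. At \<open>x0\<close> the first term of \<open>Z\<close> has the right
  sign, \<open>F w\<close> is continuous, and the other two tend to zero along a sequence because \<open>w\<^sup>2 / b\<close> is integrable.\<close>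

lemma spatial_estimate:
  fixes k \<mu> :: real and w w' F F' :: "real \<Rightarrow> real"
  assumes k: "k \<ge> 0" and w: "ac_on 0 1 w w'" and w01: "w 0 = 0" "w 1 = 0"
    and F: "ac_on 0 1 F F'" and Fw: "AE x in I01. F x = a x * w' x"
    and w'L: "(\<lambda>x. sqrt (a x) * w' x) \<in> L2I" and F'L: "F' \<in> L2I" and wb: "(\<lambda>x. w x / b x) \<in> L2I"
  defines "m \<equiv> \<lambda>x. \<mu> * ps x + k\<^sup>2 * p2a x"
  defines "R \<equiv> \<lambda>x. - 2 * k * (x - x0) * w' x - k * w x"
    and "L \<equiv> \<lambda>x. F' x + lam * (w x / b x) + m x * w x"
  shows "R \<in> L2I" "L \<in> L2I"
    "k * (2 - K1) * Aint w' - k * \<beta> * (LINT x|I01. (w x)\<^sup>2 / b x) + k * (\<mu> * c1 + k\<^sup>2 * (2 - K1)) * Bint w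
       - k * ((1 - x0) * (F 1)\<^sup>2 / a 1 + x0 * (F 0)\<^sup>2 / a 0) \<le> ip L R"
proof -
  have wi: "integrable I01 w'" using ac_on_abs_int[OF w] by (simp add: integrable_Ioo_iff)
  note [measurable] = borel_measurable_integrable[OF wi]
  note wL = ac_L2[OF w]
  have sg: "(\<lambda>x. (x - x0) * w' x) \<in> L2I" by (rule shifted_grad_L2[OF w'L]) measurable
  have "(\<lambda>x. (- 2 * k) * ((x - x0) * w' x) - k * w x) \<in> L2I"
    by (intro L2_diff L2_cmult sg wL)
  then show RL: "R \<in> L2I" by (simp add: R_def mult.assoc)
  obtain PB where PB: "PB > 0" "\<And>x. x \<in> {0..1} \<Longrightarrow> \<bar>ps x\<bar> \<le> PB" using psi_bound by blast
  have m_bd: "\<bar>m x\<bar> \<le> \<bar>\<mu>\<bar> * PB + k\<^sup>2 * Gam" if "x \<in> {0..1}" for x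
  proof -
    have "\<bar>m x\<bar> \<le> \<bar>\<mu> * ps x\<bar> + \<bar>k\<^sup>2 * p2a x\<bar>" unfolding m_def by (rule abs_triangle_ineq)
    also have "\<dots> \<le> \<bar>\<mu>\<bar> * PB + k\<^sup>2 * Gam"
      unfolding abs_mult using PB(2)[OF that] p2a_nonneg[OF that] p2a_le[OF that]
      by (intro add_mono mult_mono) auto
    finally show ?thesis .
  qed
  have m_meas: "m \<in> borel_measurable I01" unfolding m_def by measurable
  have mw: "(\<lambda>x. m x * w x) \<in> L2I" by (rule L2_bdd_mult[OF wL m_meas m_bd]) auto
  show LL: "L \<in> L2I" unfolding L_def by (intro L2_add L2_cmult F'L wb mw)
  have wbi: "integrable I01 (\<lambda>x. (w x)\<^sup>2 / b x)" using L2_mult[OF wL wb] by (simp add: power2_eq_square)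
  define good where "good x = k * (2 - K1) * (a x * (w' x)\<^sup>2) - k * \<beta> * ((w x)\<^sup>2 / b x)
      + k * (\<mu> * c1 + k\<^sup>2 * (2 - K1)) * (p2a x * (w x)\<^sup>2)" for x
  have gi: "integrable I01 good" unfolding good_def
    by (intro Bochner_Integration.integrable_add Bochner_Integration.integrable_diff integrable_mult_right
        grad_sq(1)[OF w'L] weight_sq[OF wL] wbi)
  have gI: "(LINT x|I01. good x) = k * (2 - K1) * Aint w' - k * \<beta> * (LINT x|I01. (w x)\<^sup>2 / b x)
      + k * (\<mu> * c1 + k\<^sup>2 * (2 - K1)) * Bint w"
    unfolding good_def Aint_def Bint_def by (rule lint_comb[OF grad_sq(1)[OF w'L] wbi weight_sq[OF wL]])
  \<comment> \<open>D is integrable on the whole of [0,1], being built from L2 products. Hence all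
    limits at x0 can be taken in its continuous primitive I, and integrability of Z' near x0 never
    enters.\<close>
  define D where "D x = L x * R x - good x" for x
  have Di: "integrable I01 D" unfolding D_def by (intro Bochner_Integration.integrable_diff L2_mult LL RL gi)
  have Da: "D absolutely_integrable_on {0..1}" using Di by (simp add: integrable_Ioo_iff)
  define Z where "Z x = (x - x0) * (1 / a x) * (F x)\<^sup>2 + F x * w x + lam * ((x - x0) * (1 / b x) * (w x)\<^sup>2)
      + (x - x0) * m x * (w x)\<^sup>2" for x
  have step: "k * Z p - k * Z q \<le> integral {p..q} D" if pq: "0 \<le> p" "p \<le> q" "q \<le> 1" "x0 \<notin> {p..q}" for p q
  proof -
    have acm: "ac_on p q m (\<lambda>x. \<mu> * (c1 * ((x - x0) / a x)) + k\<^sup>2 * ((x - x0) / a x * (2 - (x - x0) * wderiv a x / a x)))"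
      unfolding m_def
      by (intro ac_on_add ac_on_cmult ac_on_sub[OF ac_psi] ac_p2a) (use pq in auto)
    have acF: "ac_on p q F F'" and acw: "ac_on p q w w'"
      by (rule ac_on_sub[OF F pq(1,3)], rule ac_on_sub[OF w pq(1,3)])
    have aca: "ac_on p q (\<lambda>x. 1 / a x) (\<lambda>x. - wderiv a x / (a x)\<^sup>2)" by (rule ac_inv_a) (use pq in auto)
    have acb: "ac_on p q (\<lambda>x. 1 / b x) (\<lambda>x. - wderiv b x / (b x)\<^sup>2)" by (rule ac_inv_b) (use pq in auto)
    have acZ: "ac_on p q Z (\<lambda>x.
        ((x - x0) * (1 / a x) * (2 * F x * F' x) + (F x)\<^sup>2 * ((x - x0) * (- wderiv a x / (a x)\<^sup>2) + 1 / a x * 1))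
        + (F x * w' x + w x * F' x)
        + lam * ((x - x0) * (1 / b x) * (2 * w x * w' x) + (w x)\<^sup>2 * ((x - x0) * (- wderiv b x / (b x)\<^sup>2) + 1 / b x * 1))
        + ((x - x0) * m x * (2 * w x * w' x)
          + (w x)\<^sup>2 * ((x - x0) * (\<mu> * (c1 * ((x - x0) / a x)) + k\<^sup>2 * ((x - x0) / a x * (2 - (x - x0) * wderiv a x / a x))) + m x * 1)))"
      unfolding Z_def
      by (intro ac_on_add ac_on_cmult ac_on_mult ac_on_square acF acw aca acb acm ac_shift)
    have kZ: "k * Z p + integral {p..q} (\<lambda>x. - D x) \<le> k * Z q"
    proof (rule ac_on_lower[OF ac_on_cmult[OF acZ] pq(2)])
      have "D integrable_on {p..q}" by (rule abs_int_sub_int[OF Da]) (use pq in auto)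
      then show "(\<lambda>x. - D x) integrable_on {p..q}" by (rule integrable_neg)
      have ev: "AE x in lebesgue_on {p<..<q}. x \<in> {p<..<q} \<and> (x - x0) * wderiv a x \<le> K1 * a x
          \<and> lam * ((x - x0) * wderiv b x) \<le> \<beta> * b x \<and> F x = a x * w' x"
        using AE_sub_Ioo[OF a_deg pq(1,3)] AE_sub_Ioo[OF b_deg pq(1,3)] AE_sub_Ioo[OF Fw pq(1,3)]
          AE_space[of "lebesgue_on {p<..<q}"] by eventually_elim auto
      show "AE x in lebesgue_on {p<..<q}. - D x \<le> k * (((x - x0) * (1 / a x) * (2 * F x * F' x) + (F x)\<^sup>2 * ((x - x0) * (- wderiv a x / (a x)\<^sup>2) + 1 / a x * 1))
        + (F x * w' x + w x * F' x)
        + lam * ((x - x0) * (1 / b x) * (2 * w x * w' x) + (w x)\<^sup>2 * ((x - x0) * (- wderiv b x / (b x)\<^sup>2) + 1 / b x * 1))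
        + ((x - x0) * m x * (2 * w x * w' x)
          + (w x)\<^sup>2 * ((x - x0) * (\<mu> * (c1 * ((x - x0) / a x)) + k\<^sup>2 * ((x - x0) / a x * (2 - (x - x0) * wderiv a x / a x))) + m x * 1)))"
        using ev
      proof eventually_elim
        case (elim x)
        have x: "x \<in> {0..1}" "x \<noteq> x0" using elim pq by auto
        have m0: "\<mu> * (c1 * ((x - x0) / a x)) + k\<^sup>2 * ((x - x0) / a x * (2 - (x - x0) * wderiv a x / a x))
          = (\<mu> * c1) * ((x - x0) / a x) + k\<^sup>2 * ((x - x0) / a x * (2 - (x - x0) * wderiv a x / a x))" by simp
        have fx: "F x = a x * w' x" using elim by blast
        have "- D x = k * (2 - K1) * (a x * (w' x)\<^sup>2) - k * \<beta> * ((w x)\<^sup>2 / b x)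
             + k * ((\<mu> * c1 + k\<^sup>2 * (2 - K1)) * ((x - x0)\<^sup>2 / a x) * (w x)\<^sup>2)
             - (F' x + lam * (w x / b x) + m x * w x) * (- 2 * k * (x - x0) * w' x - k * w x)"
          unfolding D_def good_def L_def R_def p2a_def by (simp only: minus_diff_eq mult.assoc)
        also have "\<dots> \<le> k * (((x - x0) * (1 / a x) * (2 * F x * F' x) + (F x)\<^sup>2 * ((x - x0) * (- wderiv a x / (a x)\<^sup>2) + 1 / a x * 1))
        + (F x * w' x + w x * F' x)
        + lam * ((x - x0) * (1 / b x) * (2 * w x * w' x) + (w x)\<^sup>2 * ((x - x0) * (- wderiv b x / (b x)\<^sup>2) + 1 / b x * 1))
        + ((x - x0) * m x * (2 * w x * w' x)
          + (w x)\<^sup>2 * ((x - x0) * (\<mu> * (c1 * ((x - x0) / a x)) + k\<^sup>2 * ((x - x0) / a x * (2 - (x - x0) * wderiv a x / a x))) + m x * 1)))"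
          unfolding fx
          by (rule multiplier_identity[OF a_pos[OF x] b_pos[OF x] k _ _ m0]) (use elim in auto)
        finally show ?case .
      qed
    qed
    then show ?thesis by simp
  qed
  define I where "I x = integral {0..x} D" for x
  have acI: "ac_on 0 1 I D" using ac_on_integral[OF Da, of 0] by (simp add: I_def[abs_def])
  have Fwc: "continuous_on {0..1} (\<lambda>x. F x * w x)"
    by (intro continuous_intros ac_on_cont[OF F] ac_on_cont[OF w])
  have w2c: "continuous_on {0..1} (\<lambda>x. (w x)\<^sup>2)" by (intro continuous_intros ac_on_cont[OF w])
  have "compact ((\<lambda>x. (w x)\<^sup>2) ` {0..1})" by (intro compact_continuous_image w2c) auto
  then have "bounded ((\<lambda>x. (w x)\<^sup>2) ` {0..1})" by (rule compact_imp_bounded)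
  then obtain W where W: "W > 0" "\<And>x. x \<in> {0..1} \<Longrightarrow> (w x)\<^sup>2 \<le> W" by (auto simp: bounded_pos)
  define M where "M = (\<bar>\<mu>\<bar> * PB + k\<^sup>2 * Gam) * W"
  have M: "M \<ge> 0" unfolding M_def using PB W Gam_nonneg by auto
  have wba: "(\<lambda>x. (w x)\<^sup>2 / b x) absolutely_integrable_on {0..1}" using wbi by (simp add: integrable_Ioo_iff)
  define BT where "BT = (1 - x0) * (F 1)\<^sup>2 / a 1 + x0 * (F 0)\<^sup>2 / a 0"
  \<comment> \<open>BT equals Z 1 - Z 0, since w vanishes at both ends. The inequality
    \<open>step\<close> is used on [0,q] and [p,1] with q < x0 < p close to x0. The gap between q
    and p costs two \<open>\<epsilon>\<close> in I, and Z p - Z q is at least -(4 + 2 |lam|)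
    \<open>\<epsilon>\<close> because the common value F w at x0 cancels.\<close>
  have key: "- k * BT \<le> I 1 + \<epsilon> * (2 + k * (2 + 2 * \<bar>lam\<bar> + 2))" if eps: "\<epsilon> > 0" for \<epsilon>
  proof -
    obtain d1 where d1: "d1 > 0" "\<And>x y. x \<in> {0..1} \<Longrightarrow> y \<in> {0..1} \<Longrightarrow> \<bar>x - y\<bar> < d1 \<Longrightarrow> \<bar>I x - I y\<bar> < \<epsilon>"
      using unif_cont_Icc[OF ac_on_cont[OF acI] eps] by blast
    obtain d2 where d2: "d2 > 0" "\<And>x y. x \<in> {0..1} \<Longrightarrow> y \<in> {0..1} \<Longrightarrow> \<bar>x - y\<bar> < d2 \<Longrightarrow> \<bar>F x * w x - F y * w y\<bar> < \<epsilon>"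
      using unif_cont_Icc[OF Fwc eps] by blast
    define d where "d = min (min d1 d2) (\<epsilon> / (M + 1))"
    have d: "d > 0" "d \<le> d1" "d \<le> d2" "d \<le> \<epsilon> / (M + 1)" using d1(1) d2(1) eps M by (auto simp: d_def)
    have dM: "d * M \<le> \<epsilon>"
    proof -
      have "d * M \<le> d * (M + 1)" using d(1) by simp
      also have "\<dots> \<le> \<epsilon>" using d(4) M by (simp add: pos_le_divide_eq)
      finally show ?thesis .
    qed
    have mterm: "\<bar>(x - x0) * m x * (w x)\<^sup>2\<bar> \<le> \<epsilon>" if x: "x \<in> {0..1}" "\<bar>x - x0\<bar> \<le> d" for x
    proof -
      have "\<bar>m x\<bar> * (w x)\<^sup>2 \<le> M" unfolding M_def using m_bd[OF x(1)] W(2)[OF x(1)] by (intro mult_mono) auto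
      then have "\<bar>x - x0\<bar> * (\<bar>m x\<bar> * (w x)\<^sup>2) \<le> d * M" using x d by (intro mult_mono) auto
      then show ?thesis using dM by (simp add: abs_mult mult.assoc)
    qed
    obtain p where p: "x0 < p" "p < x0 + d" "p < 1" "(p - x0) * ((w p)\<^sup>2 / b p) < \<epsilon>"
      using small_point_right[OF abs_int_sub[OF wba, of x0 1] x0(2) eps d(1)] x0 by auto
    obtain q where q: "q < x0" "x0 - d < q" "0 < q" "(x0 - q) * ((w q)\<^sup>2 / b q) < \<epsilon>"
      using small_point_left[OF abs_int_sub[OF wba, of 0 x0] x0(1) eps d(1)] x0 by auto
    have pm: "p \<in> {0..1}" "\<bar>p - x0\<bar> < d" and qm: "q \<in> {0..1}" "\<bar>q - x0\<bar> < d" and xm: "x0 \<in> {0..1}"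
      using p q x0 by auto
    have bp: "b p > 0" "a p > 0" and bq: "b q > 0" "a q > 0"
      using b_pos[of p] a_pos[of p] b_pos[of q] a_pos[of q] pm qm p q by auto
    have lt: "\<bar>lam * ((p - x0) * (1 / b p) * (w p)\<^sup>2)\<bar> \<le> \<bar>lam\<bar> * \<epsilon>"
    proof -
      have "\<bar>(p - x0) * (1 / b p) * (w p)\<^sup>2\<bar> = (p - x0) * ((w p)\<^sup>2 / b p)" using p bp by (simp add: abs_mult)
      then show ?thesis unfolding abs_mult[of lam] using p(4) by (intro mult_left_mono) auto
    qed
    have lq: "\<bar>lam * ((q - x0) * (1 / b q) * (w q)\<^sup>2)\<bar> \<le> \<bar>lam\<bar> * \<epsilon>"
    proof -
      have "\<bar>(q - x0) * (1 / b q) * (w q)\<^sup>2\<bar> = (x0 - q) * ((w q)\<^sup>2 / b q)" using q bq by (simp add: abs_mult)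
      then show ?thesis unfolding abs_mult[of lam] using q(4) by (intro mult_left_mono) auto
    qed
    have Zp: "Z p \<ge> F x0 * w x0 - \<epsilon> - \<bar>lam\<bar> * \<epsilon> - \<epsilon>"
    proof -
      have "0 \<le> (p - x0) * (1 / a p) * (F p)\<^sup>2" using p bp by simp
      moreover have "\<bar>F p * w p - F x0 * w x0\<bar> < \<epsilon>" using d2(2)[OF pm(1) xm] pm d by auto
      moreover have "\<bar>(p - x0) * m p * (w p)\<^sup>2\<bar> \<le> \<epsilon>" using mterm[OF pm(1)] pm by auto
      ultimately show ?thesis unfolding Z_def using lt by (intro four_terms_ge)
    qed
    have Zq: "Z q \<le> F x0 * w x0 + \<epsilon> + \<bar>lam\<bar> * \<epsilon> + \<epsilon>"
    proof -
      have "(q - x0) * (1 / a q) * (F q)\<^sup>2 \<le> 0" using q bq by (simp add: divide_nonpos_pos mult_nonpos_nonneg)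
      moreover have "\<bar>F q * w q - F x0 * w x0\<bar> < \<epsilon>" using d2(2)[OF qm(1) xm] qm d by auto
      moreover have "\<bar>(q - x0) * m q * (w q)\<^sup>2\<bar> \<le> \<epsilon>" using mterm[OF qm(1)] qm by auto
      ultimately show ?thesis unfolding Z_def using lq by (intro four_terms_le)
    qed
    have Z1: "Z 1 = (1 - x0) * (F 1)\<^sup>2 / a 1" and Z0: "Z 0 = - (x0 * (F 0)\<^sup>2 / a 0)"
      using w01 by (simp_all add: Z_def)
    have s1: "k * Z p - k * Z 1 \<le> I 1 - I p" using step[of p 1] p x0 ac_on_diff[OF acI, of p 1] by auto
    have s2: "k * Z 0 - k * Z q \<le> I q" using step[of 0 q] q x0 by (auto simp: I_def)
    have "\<bar>I p - I x0\<bar> < \<epsilon>" "\<bar>I q - I x0\<bar> < \<epsilon>" using d1(2)[OF pm(1) xm] d1(2)[OF qm(1) xm] pm qm d by auto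
    then have "k * (Z p - Z q) - k * BT \<le> I 1 + 2 * \<epsilon>"
      using s1 s2 by (simp add: BT_def Z1 Z0 algebra_simps)
    moreover have "k * (- (4 * \<epsilon> + 2 * \<bar>lam\<bar> * \<epsilon>)) \<le> k * (Z p - Z q)"
      using Zp Zq k by (intro mult_left_mono) auto
    ultimately show ?thesis by (simp add: algebra_simps)
  qed
  have "- k * BT \<le> I 1 + e" if e: "e > 0" for e
  proof -
    define c where "c = 2 + k * (2 + 2 * \<bar>lam\<bar> + 2)"
    have c: "c > 0" unfolding c_def using k by (intro add_pos_nonneg) auto
    have "- k * BT \<le> I 1 + (e / c) * c" using key[of "e / c"] e c unfolding c_def by simp
    then show ?thesis using c by simp
  qed
  then have "- k * BT \<le> I 1" by (rule field_le_epsilon)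
  also have "I 1 = (LINT x|I01. D x)" unfolding I_def by (rule lint_Ioo[OF Di, symmetric])
  also have "\<dots> = ip L R - (LINT x|I01. good x)"
    unfolding D_def ip_def by (rule Bochner_Integration.integral_diff[OF L2_mult[OF LL RL] gi])
  finally show "k * (2 - K1) * Aint w' - k * \<beta> * (LINT x|I01. (w x)\<^sup>2 / b x) + k * (\<mu> * c1 + k\<^sup>2 * (2 - K1)) * Bint w
       - k * ((1 - x0) * (F 1)\<^sup>2 / a 1 + x0 * (F 0)\<^sup>2 / a 0) \<le> ip L R"
    unfolding gI BT_def by simp
qed

end

section \<open>Linear structure of the weighted spaces\<close>

lemma L2_AE:
  assumes "f \<in> L2I" "AE x in I01. g x = f x"
  shows "g \<in> L2I"
proof (rule L2I)
  show m[measurable]: "g \<in> borel_measurable I01" by (rule measurable_lebesgue_AE[OF L2_meas[OF assms(1)] assms(2)]) auto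
  have [measurable]: "f \<in> borel_measurable I01" by (rule L2_meas[OF assms(1)])
  have ae: "AE x in I01. (f x)\<^sup>2 = (g x)\<^sup>2" using assms(2) by eventually_elim simp
  have m1: "(\<lambda>x. (f x)\<^sup>2) \<in> borel_measurable I01" and m2: "(\<lambda>x. (g x)\<^sup>2) \<in> borel_measurable I01" by measurable
  show "integrable I01 (\<lambda>x. (g x)\<^sup>2)"
    using integrable_cong_AE[OF m1 m2 ae] L2_sq[OF assms(1)] by simp
qed

lemma ip_AE:
  assumes "g \<in> L2I" "f \<in> L2I" "AE x in I01. f' x = f x"
  shows "ip g f' = ip g f"
proof -
  note [measurable] = L2_meas[OF assms(1)] L2_meas[OF assms(2)] L2_meas[OF L2_AE[OF assms(2,3)]]
  show ?thesis unfolding ip_def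
    by (rule integral_cong_AE) (use assms(3) in \<open>auto elim: eventually_mono\<close>)
qed

text \<open>Linearity of C is only asked for almost everywhere, because \<open>wderiv\<close> picks
  an arbitrary representative for each function.\<close>

lemma blf_ip:
  assumes X: "\<And>u v c. u \<in> X \<Longrightarrow> v \<in> X \<Longrightarrow> (\<lambda>x. u x + c * v x) \<in> X"
    and C: "\<And>u. u \<in> X \<Longrightarrow> C u \<in> L2I" "\<And>u. u \<in> X \<Longrightarrow> n2 (C u) \<le> N u"
    and lin: "\<And>u v c. u \<in> X \<Longrightarrow> v \<in> X \<Longrightarrow> AE x in I01. C (\<lambda>x. u x + c * v x) x = C u x + c * C v x"
    and g: "g \<in> L2I"
  shows "blf X N (\<lambda>u. ip g (C u))"
  unfolding blf_def
proof (intro conjI ballI allI exI[of _ "n2 g"])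
  fix u v c assume u: "u \<in> X" and v: "v \<in> X"
  show "(\<lambda>x. u x + c * v x) \<in> X" by (rule X[OF u v])
  have "ip g (C (\<lambda>x. u x + c * v x)) = ip g (\<lambda>x. C u x + c * C v x)"
    by (rule ip_AE[OF g L2_add[OF C(1)[OF u] L2_cmult[OF C(1)[OF v]]] lin[OF u v]])
  also have "\<dots> = ip g (C u) + c * ip g (C v)"
    unfolding ip_add_right[OF g C(1)[OF u] L2_cmult[OF C(1)[OF v]]] ip_cmult_right ..
  finally show "ip g (C (\<lambda>x. u x + c * v x)) = ip g (C u) + c * ip g (C v)" .
next
  fix u assume u: "u \<in> X"
  have "\<bar>ip g (C u)\<bar> \<le> n2 g * n2 (C u)" by (rule Cauchy_Schwarz_L2[OF g C(1)[OF u]])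
  also have "\<dots> \<le> n2 g * N u" by (intro mult_left_mono C(2)[OF u] n2_nonneg)
  finally show "\<bar>ip g (C u)\<bar> \<le> n2 g * N u" .
qed (rule n2_nonneg)

lemma blf_add:
  assumes "blf X N l" "blf X N l'"
  shows "blf X N (\<lambda>u. l u + l' u)"
proof -
  obtain C where C: "C \<ge> 0" "\<And>u. u \<in> X \<Longrightarrow> \<bar>l u\<bar> \<le> C * N u" using blf_bound[OF assms(1)] by blast
  obtain C' where C': "C' \<ge> 0" "\<And>u. u \<in> X \<Longrightarrow> \<bar>l' u\<bar> \<le> C' * N u" using blf_bound[OF assms(2)] by blast
  show ?thesis unfolding blf_def
  proof (intro conjI ballI allI exI[of _ "C + C'"])
    fix u v c assume u: "u \<in> X" and v: "v \<in> X"
    show "(\<lambda>x. u x + c * v x) \<in> X" by (rule blf_comb(1)[OF assms(1) u v])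
    show "l (\<lambda>x. u x + c * v x) + l' (\<lambda>x. u x + c * v x) = l u + l' u + c * (l v + l' v)"
      unfolding blf_comb(2)[OF assms(1) u v] blf_comb(2)[OF assms(2) u v] by (simp add: algebra_simps)
  next
    fix u assume u: "u \<in> X"
    show "\<bar>l u + l' u\<bar> \<le> (C + C') * N u"
      using C(2)[OF u] C'(2)[OF u] abs_triangle_ineq[of "l u" "l' u"] by (simp add: distrib_right)
  qed (use C C' in simp)
qed

lemma weak_deriv_AE_cong:
  assumes "has_weak_deriv u g" "AE x in I01. u' x = u x" "AE x in I01. g' x = g x"
  shows "has_weak_deriv u' g'"
proof -
  obtain f where f: "ac_on 0 1 f g" "AE x in I01. u x = f x" using weak_derivD[OF assms(1)] by blast
  obtain S where S: "negligible S" "\<forall>x\<in>{0<..<1} - S. g' x = g x"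
    using assms(3) by (subst (asm) AE_lebesgue_on_iff) auto
  have "negligible (S \<union> {0, 1})" by (intro negligible_Un S) auto
  then have "ac_on 0 1 f g'"
    by (rule ac_on_cong[OF f(1), rotated]) (use S(2) in auto)
  moreover have "AE x in I01. u' x = f x" using assms(2) f(2) by eventually_elim simp
  ultimately show ?thesis by (rule weak_derivI)
qed

lemma weak_deriv_comb:
  assumes "has_weak_deriv u g" "has_weak_deriv v h"
  shows "has_weak_deriv (\<lambda>x. u x + c * v x) (\<lambda>x. g x + c * h x)"
proof -
  obtain f1 where f1: "ac_on 0 1 f1 g" "AE x in I01. u x = f1 x" using weak_derivD[OF assms(1)] by blast
  obtain f2 where f2: "ac_on 0 1 f2 h" "AE x in I01. v x = f2 x" using weak_derivD[OF assms(2)] by blast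
  show ?thesis
    by (rule weak_derivI[OF ac_on_add[OF f1(1) ac_on_cmult[OF f2(1)]]])
      (use f1(2) f2(2) in eventually_elim, simp)
qed

lemma W11_0_weak: "u \<in> W11_0 \<Longrightarrow> has_weak_deriv u (wderiv u)"
  unfolding W11_0_def W11_def using wderiv_weak by auto

lemma wderiv_comb:
  assumes "u \<in> W11_0" "v \<in> W11_0"
  shows "AE x in I01. wderiv (\<lambda>x. u x + c * v x) x = wderiv u x + c * wderiv v x"
  by (rule wderiv_AE[OF weak_deriv_comb[OF W11_0_weak[OF assms(1)] W11_0_weak[OF assms(2)]]])

lemma W11_0_rep:
  assumes "u \<in> W11_0"
  obtains f where "ac_on 0 1 f (wderiv u)" "AE x in I01. u x = f x" "f 0 = 0" "f 1 = 0"
proof -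
  obtain f where f: "ac_on 0 1 f (wderiv u)" "AE x in I01. u x = f x"
    using weak_derivD[OF W11_0_weak[OF assms]] by blast
  show thesis by (rule that[OF f W11_0D[OF assms f] W11_0D[OF assms f]]) auto
qed

lemma W11_0_comb:
  assumes "u \<in> W11_0" "v \<in> W11_0"
  shows "(\<lambda>x. u x + c * v x) \<in> W11_0"
proof -
  obtain f1 where f1: "ac_on 0 1 f1 (wderiv u)" "AE x in I01. u x = f1 x" "f1 0 = 0" "f1 1 = 0"
    using W11_0_rep[OF assms(1)] .
  obtain f2 where f2: "ac_on 0 1 f2 (wderiv v)" "AE x in I01. v x = f2 x" "f2 0 = 0" "f2 1 = 0"
    using W11_0_rep[OF assms(2)] .
  show ?thesis
  proof (rule W11_0I[OF ac_on_add[OF f1(1) ac_on_cmult[OF f2(1), of c]]])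
    show "AE x in I01. u x + c * v x = f1 x + c * f2 x" using f1(2) f2(2) by eventually_elim simp
  qed (use f1 f2 in auto)
qed

lemma W11_0_meas: "u \<in> W11_0 \<Longrightarrow> wderiv u \<in> borel_measurable I01"
  using W11_0_weak[of u] by (auto simp: has_weak_deriv_def L1_def)

context coeffs
begin

abbreviation XH :: "(real \<Rightarrow> real) set" where "XH \<equiv> H1ab a b"
abbreviation NH :: "(real \<Rightarrow> real) \<Rightarrow> real" where "NH \<equiv> norm_H1ab a b"
abbreviation X2 :: "(real \<Rightarrow> real) set" where "X2 \<equiv> H2ab a b lam"
abbreviation N2 :: "(real \<Rightarrow> real) \<Rightarrow> real" where "N2 \<equiv> norm_H2ab a b lam"

definition grad :: "(real \<Rightarrow> real) \<Rightarrow> real \<Rightarrow> real" where "grad u x = sqrt (a x) * wderiv u x"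
definition sing :: "(real \<Rightarrow> real) \<Rightarrow> real \<Rightarrow> real" where "sing u x = u x / sqrt (b x)"
definition flux :: "(real \<Rightarrow> real) \<Rightarrow> real \<Rightarrow> real" where "flux u x = a x * wderiv u x"

lemma H1aD:
  assumes "u \<in> H1a a"
  shows "u \<in> W11_0" "grad u \<in> L2I" "u \<in> L2I"
proof -
  show u: "u \<in> W11_0" and "grad u \<in> L2I" using assms by (auto simp: H1a_def grad_def[abs_def])
  obtain f where f: "ac_on 0 1 f (wderiv u)" "AE x in I01. u x = f x" "f 0 = 0" "f 1 = 0"
    using W11_0_rep[OF u] .
  show "u \<in> L2I" by (rule L2_AE[OF ac_L2[OF f(1)] f(2)])
qed

lemma H1abD:
  assumes "u \<in> XH"
  shows "u \<in> H1a a" "u \<in> W11_0" "grad u \<in> L2I" "u \<in> L2I" "sing u \<in> L2I"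
  using assms H1aD[of u] by (auto simp: H1ab_def sing_def[abs_def])

lemma grad_comb:
  assumes "u \<in> W11_0" "v \<in> W11_0"
  shows "AE x in I01. grad (\<lambda>x. u x + c * v x) x = grad u x + c * grad v x"
  using wderiv_comb[OF assms, of c] by eventually_elim (simp add: grad_def algebra_simps)

lemma H1a_comb:
  assumes "u \<in> H1a a" "v \<in> H1a a"
  shows "(\<lambda>x. u x + c * v x) \<in> H1a a"
proof -
  note u = H1aD[OF assms(1)] and v = H1aD[OF assms(2)]
  have "grad (\<lambda>x. u x + c * v x) \<in> L2I"
    by (rule L2_AE[OF L2_add[OF u(2) L2_cmult[OF v(2)]] grad_comb[OF u(1) v(1)]])
  then show ?thesis using W11_0_comb[OF u(1) v(1)] by (simp add: H1a_def grad_def[abs_def])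
qed

lemma sing_comb: "sing (\<lambda>x. u x + c * v x) x = sing u x + c * sing v x"
  by (simp add: sing_def add_divide_distrib)

lemma H1ab_comb:
  assumes "u \<in> XH" "v \<in> XH"
  shows "(\<lambda>x. u x + c * v x) \<in> XH"
proof -
  note u = H1abD[OF assms(1)] and v = H1abD[OF assms(2)]
  have "sing (\<lambda>x. u x + c * v x) \<in> L2I"
    using L2_add[OF u(5) L2_cmult[OF v(5)]] by (simp add: sing_comb[abs_def])
  then show ?thesis using H1a_comb[OF u(1) v(1)] by (simp add: H1ab_def sing_def[abs_def])
qed

lemma H1ab_norm:
  shows "NH u = sqrt ((n2 (grad u))\<^sup>2 + (n2 u)\<^sup>2 + (n2 (sing u))\<^sup>2)"
proof -
  have "(LINT x|I01. a x * wderiv u x * wderiv u x) = (n2 (grad u))\<^sup>2"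
    unfolding n2_sq ip_def grad_def using a_nonneg
    by (intro Bochner_Integration.integral_cong) auto
  moreover have "(LINT x|I01. u x * u x / b x) = (n2 (sing u))\<^sup>2"
    unfolding n2_sq ip_def sing_def using b_nonneg
    by (intro Bochner_Integration.integral_cong) auto
  ultimately show ?thesis by (simp add: norm_H1ab_def inner_H1ab_def n2_sq ip_def)
qed

lemma H1ab_norm_ge:
  "n2 (grad u) \<le> NH u" "n2 u \<le> NH u" "n2 (sing u) \<le> NH u" "0 \<le> NH u"
  unfolding H1ab_norm by (auto intro!: real_le_rsqrt)

lemma blf_H1ab:
  assumes g: "g \<in> L2I"
  shows "blf XH NH (\<lambda>u. ip g (grad u))" "blf XH NH (\<lambda>u. ip g u)" "blf XH NH (\<lambda>u. ip g (sing u))"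
proof -
  show "blf XH NH (\<lambda>u. ip g (grad u))"
    by (rule blf_ip[OF H1ab_comb H1abD(3) H1ab_norm_ge(1) grad_comb[OF H1abD(2) H1abD(2)] g])
  show "blf XH NH (\<lambda>u. ip g u)"
    by (rule blf_ip[where C = "\<lambda>u. u", OF H1ab_comb H1abD(4) H1ab_norm_ge(2) _ g]) auto
  show "blf XH NH (\<lambda>u. ip g (sing u))"
    by (rule blf_ip[OF H1ab_comb H1abD(5) H1ab_norm_ge(3) _ g]) (auto simp: sing_comb)
qed

lemma H2abD:
  assumes "u \<in> X2"
  shows "u \<in> H1a a" "flux u \<in> L2I" "has_weak_deriv (flux u) (flux_deriv a u)" "flux_deriv a u \<in> L2I"
    "(\<lambda>x. u x / b x) \<in> L2I"
proof -
  show u: "u \<in> H1a a" using assms by (simp add: H2ab_def)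
  have H: "flux u \<in> H1" and S: "(\<lambda>x. flux_deriv a u x + lam / b x * u x) \<in> L2I"
    using assms by (auto simp: H2ab_def flux_def[abs_def])
  have fd: "flux_deriv a u = wderiv (flux u)" by (simp add: flux_deriv_def flux_def[abs_def])
  show fl: "flux u \<in> L2I" using H by (simp add: H1_def)
  obtain g where g: "g \<in> L2I" "has_weak_deriv (flux u) g" using H by (auto simp: H1_def)
  show "has_weak_deriv (flux u) (flux_deriv a u)" unfolding fd by (rule wderiv_weak[OF g(2)])
  show f2: "flux_deriv a u \<in> L2I" unfolding fd by (rule L2_AE[OF g(1) wderiv_AE[OF g(2)]])
  \<comment> \<open>Both the flux derivative and its sum with lam u/b are in L2; as lam is nonzero,
    u/b itself is in L2.\<close>
  have "(\<lambda>x. (1 / lam) * ((flux_deriv a u x + lam / b x * u x) - flux_deriv a u x)) \<in> L2I"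
    by (intro L2_cmult L2_diff S f2)
  then show "(\<lambda>x. u x / b x) \<in> L2I" using lam by simp
qed

lemma flux_comb:
  assumes "u \<in> W11_0" "v \<in> W11_0"
  shows "AE x in I01. flux (\<lambda>x. u x + c * v x) x = flux u x + c * flux v x"
  using wderiv_comb[OF assms, of c] by eventually_elim (simp add: flux_def algebra_simps)

lemma flux_deriv_comb:
  assumes "u \<in> X2" "v \<in> X2"
  shows "has_weak_deriv (flux (\<lambda>x. u x + c * v x)) (\<lambda>x. flux_deriv a u x + c * flux_deriv a v x)"
    "AE x in I01. flux_deriv a (\<lambda>x. u x + c * v x) x = flux_deriv a u x + c * flux_deriv a v x"
proof -
  note u = H2abD[OF assms(1)] and v = H2abD[OF assms(2)]
  show w: "has_weak_deriv (flux (\<lambda>x. u x + c * v x)) (\<lambda>x. flux_deriv a u x + c * flux_deriv a v x)"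
    by (rule weak_deriv_AE_cong[OF weak_deriv_comb[OF u(3) v(3)] flux_comb[OF H1aD(1)[OF u(1)] H1aD(1)[OF v(1)]]]) simp
  show "AE x in I01. flux_deriv a (\<lambda>x. u x + c * v x) x = flux_deriv a u x + c * flux_deriv a v x"
    using wderiv_AE[OF w] by (simp add: flux_deriv_def[of a "\<lambda>x. u x + c * v x"] flux_def[abs_def])
qed

lemma H2ab_comb:
  assumes "u \<in> X2" "v \<in> X2"
  shows "(\<lambda>x. u x + c * v x) \<in> X2"
proof -
  let ?w = "\<lambda>x. u x + c * v x"
  note u = H2abD[OF assms(1)] and v = H2abD[OF assms(2)]
  have f: "flux ?w \<in> L2I"
    by (rule L2_AE[OF L2_add[OF u(2) L2_cmult[OF v(2)]] flux_comb[OF H1aD(1)[OF u(1)] H1aD(1)[OF v(1)]]])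
  have d: "(\<lambda>x. flux_deriv a u x + c * flux_deriv a v x) \<in> L2I" by (intro L2_add L2_cmult u(4) v(4))
  then have "flux ?w \<in> H1" using f flux_deriv_comb(1)[OF assms] by (auto simp: H1_def)
  moreover have "(\<lambda>x. flux_deriv a ?w x + lam / b x * ?w x) \<in> L2I"
  proof (rule L2_AE)
    show "(\<lambda>x. (flux_deriv a u x + c * flux_deriv a v x) + lam * (u x / b x + c * (v x / b x))) \<in> L2I"
      by (intro L2_add L2_cmult u v)
    show "AE x in I01. flux_deriv a ?w x + lam / b x * ?w x
        = (flux_deriv a u x + c * flux_deriv a v x) + lam * (u x / b x + c * (v x / b x))"
      using flux_deriv_comb(2)[OF assms] by eventually_elim (simp add: add_divide_distrib algebra_simps)
  qed
  ultimately show ?thesis using H1a_comb[OF u(1) v(1)] by (simp add: H2ab_def flux_def[abs_def])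
qed

lemma H2ab_norm_ge:
  shows "n2 (flux u) \<le> N2 u" "n2 (flux_deriv a u) \<le> N2 u"
proof -
  have nn: "0 \<le> (LINT x|I01. a x * (wderiv u x)\<^sup>2)"
    by (rule Bochner_Integration.integral_nonneg) (use a_nonneg in auto)
  show "n2 (flux u) \<le> N2 u" "n2 (flux_deriv a u) \<le> N2 u"
    unfolding n2_def norm_H2ab_def flux_def using nn by (auto intro!: add_nonneg_nonneg)
qed

text \<open>The values of the flux at \<open>1\<close> and \<open>0\<close>, written as functionals that are bounded on \<open>H2ab\<close>.\<close>

definition trace1 :: "(real \<Rightarrow> real) \<Rightarrow> real" where
  "trace1 u = ip (\<lambda>x. 1) (flux u) + ip (\<lambda>x. x) (flux_deriv a u)"

definition trace0 :: "(real \<Rightarrow> real) \<Rightarrow> real" where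
  "trace0 u = ip (\<lambda>x. 1) (flux u) + ip (\<lambda>x. x - 1) (flux_deriv a u)"

lemma blf_traces: "blf X2 N2 trace1" "blf X2 N2 trace0"
proof -
  have i: "(\<lambda>x. x) \<in> L2I" by (rule ac_L2[OF ac_on_ident])
  have j: "(\<lambda>x. x - 1) \<in> L2I" by (intro L2_diff L2_const i)
  have f: "blf X2 N2 (\<lambda>u. ip g (flux u))" if "g \<in> L2I" for g
    by (rule blf_ip[OF H2ab_comb H2abD(2) H2ab_norm_ge(1) flux_comb[OF H1aD(1)[OF H2abD(1)] H1aD(1)[OF H2abD(1)]] that])
  have d: "blf X2 N2 (\<lambda>u. ip g (flux_deriv a u))" if "g \<in> L2I" for g
    by (rule blf_ip[OF H2ab_comb H2abD(4) H2ab_norm_ge(2) flux_deriv_comb(2) that])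
  show "blf X2 N2 trace1" "blf X2 N2 trace0"
    unfolding trace1_def[abs_def] trace0_def[abs_def] by (intro blf_add f d L2_const i j)+
qed

lemma flux_rep:
  assumes "u \<in> X2"
  obtains F where "ac_on 0 1 F (flux_deriv a u)" "AE x in I01. F x = a x * wderiv u x" "F 1 = trace1 u" "F 0 = trace0 u"
proof -
  note u = H2abD[OF assms]
  obtain F where F: "ac_on 0 1 F (flux_deriv a u)" "AE x in I01. flux u x = F x"
    using weak_derivD[OF u(3)] by blast
  have ae: "AE x in I01. F x = a x * wderiv u x" using F(2) by eventually_elim (simp add: flux_def)
  \<comment> \<open>Integrate the derivative of (x - c) F over [0,1]. The choice c = 0 isolates F 1
    and c = 1 isolates F 0, which explains the two trace formulas.\<close>
  have *: "ip (\<lambda>x. 1) (flux u) + ip (\<lambda>x. x - c) (flux_deriv a u) = (1 - c) * F 1 + c * F 0" for c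
  proof -
    have L: "(\<lambda>x. x - c) \<in> L2I" by (intro L2_diff L2_const ac_L2[OF ac_on_ident])
    have ac: "ac_on 0 1 (\<lambda>x. (x - c) * F x) (\<lambda>x. (x - c) * flux_deriv a u x + F x * 1)"
      using ac_on_mult[OF ac_on_sub_fun[OF ac_on_ident ac_on_const] F(1), of c] by simp
    have ii: "integrable I01 (\<lambda>x. (x - c) * flux_deriv a u x + F x * 1)"
      using ac_on_abs_int[OF ac] by (simp only: integrable_Ioo_iff)
    have FL: "F \<in> L2I" by (rule ac_L2[OF F(1)])
    have "(1 - c) * F 1 + c * F 0 = (LINT x|I01. (x - c) * flux_deriv a u x + F x * 1)"
      using ac_on_diff[OF ac, of 0 1] lint_Ioo[OF ii] by simp
    also have "\<dots> = ip (\<lambda>x. x - c) (flux_deriv a u) + ip (\<lambda>x. 1) F"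
      unfolding ip_def using L2_mult[OF L u(4)] L2_integrable[OF FL] by simp
    also have "ip (\<lambda>x. 1) F = ip (\<lambda>x. 1) (flux u)" by (rule ip_AE[OF L2_const FL F(2), symmetric])
    finally show ?thesis by simp
  qed
  show thesis
    by (rule that[OF F(1) ae]) (use *[of 0] *[of 1] in \<open>simp_all add: trace1_def trace0_def\<close>)
qed

end

section \<open>The conjugated equation at a fixed time\<close>

context coeffs
begin

definition quo :: "real \<Rightarrow> real" where "quo x = (x - x0) / a x"

lemma sqrt_quo: "x \<in> {0..1} \<Longrightarrow> sqrt (a x) * quo x = gam x"
proof (cases "a x = 0")
  case False
  assume "x \<in> {0..1}"
  then have aa: "a x = sqrt (a x) * sqrt (a x)" using a_nonneg[of x] by simp
  have "sqrt (a x) \<noteq> 0" using False by simp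
  moreover have "quo x = (x - x0) / (sqrt (a x) * sqrt (a x))" unfolding quo_def using aa by simp
  ultimately show ?thesis by (simp only: gam_def) (simp add: field_simps)
qed (simp add: quo_def gam_def)

lemma a_quo: "x \<in> {0..1} \<Longrightarrow> x \<noteq> x0 \<Longrightarrow> a x * quo x = x - x0"
  using a_pos[of x] by (simp add: quo_def)

lemma quo_p2a: "quo x * (x - x0) = p2a x"
  by (simp add: quo_def p2a_def power2_eq_square)

lemma ac_weight: "ac_on 0 1 (\<lambda>x. exp (r * ps x)) (\<lambda>x. exp (r * ps x) * (r * (c1 * quo x)))"
proof -
  obtain B where B: "B > 0" "\<And>x. x \<in> {0..1} \<Longrightarrow> \<bar>ps x\<bar> \<le> B" using psi_bound by blast
  have bd: "\<bar>r * ps x\<bar> \<le> \<bar>r\<bar> * B" if "x \<in> {0..1}" for x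
    unfolding abs_mult using B(2)[OF that] by (intro mult_left_mono) auto
  then have R: "r * ps x \<in> {- (\<bar>r\<bar> * B)..\<bar>r\<bar> * B}" if "x \<in> {0..1}" for x
  proof -
    have "\<bar>r * ps x\<bar> \<le> \<bar>r\<bar> * B" by (rule bd[OF that])
    then show ?thesis unfolding atLeastAtMost_iff by linarith
  qed
  show ?thesis unfolding quo_def
    by (rule ac_on_compose[where \<Phi> = exp and \<Phi>' = exp, OF ac_on_cmult[OF ac_psi] DERIV_exp _ R])
      (intro continuous_intros)
qed

end

text \<open>\<open>V\<close>, \<open>vt\<close>, \<open>Th\<close> and \<open>T1\<close> are the values of the solution, its time derivative, \<open>\<Theta>\<close> and \<open>\<Theta>'\<close> at
  one instant. Below, \<open>P\<close>, \<open>S\<close> and \<open>W\<close> are \<open>sqrt a w\<^sub>x\<close>, \<open>w / sqrt b\<close> and \<open>w\<close>, and \<open>Pt\<close>, \<open>St\<close>, \<open>Wt\<close> their time derivatives.\<close>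

locale slice = coeffs +
  fixes s Th T1 :: real and V vt h :: "real \<Rightarrow> real"
  assumes s: "s > 0" and Th: "Th > 0"
    and V: "V \<in> XH" "V \<in> X2" "continuous_on {0..1} V" and vt: "vt \<in> XH"
    and eqn: "AE x in I01. vt x + flux_deriv a V x + lam / b x * V x = h x"
begin

abbreviation "kk \<equiv> s * Th * c1"
abbreviation "ww x \<equiv> exp (s * Th * ps x)"
abbreviation "W x \<equiv> ww x * V x"
abbreviation "W' x \<equiv> ww x * (wderiv V x + kk * quo x * V x)"
abbreviation "P x \<equiv> ww x * grad V x + kk * gam x * ww x * V x"
abbreviation "S x \<equiv> ww x * sing V x"
abbreviation "wt x \<equiv> ww x * (s * T1 * ps x)"
abbreviation "Wt x \<equiv> wt x * V x + ww x * vt x"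
abbreviation "Pt x \<equiv> (wt x * grad V x + ww x * grad vt x) +
   ((s * T1 * c1 * gam x * ww x + kk * gam x * wt x) * V x + kk * gam x * ww x * vt x)"
abbreviation "St x \<equiv> wt x * sing V x + ww x * sing vt x"
abbreviation "mm x \<equiv> (- s * T1) * ps x + kk\<^sup>2 * p2a x"

lemma kk: "kk > 0"
  using s Th c1 by simp

lemma V_ac: "ac_on 0 1 V (wderiv V)"
  by (rule weak_deriv_continuous_ac[OF W11_0_weak[OF H1abD(2)[OF V(1)]] V(3)])

lemma V_bdry: "V 0 = 0" "V 1 = 0"
  using W11_0D[OF H1abD(2)[OF V(1)] V_ac, of 0] W11_0D[OF H1abD(2)[OF V(1)] V_ac, of 1] by auto

lemma ww_meas [measurable]: "ww \<in> borel_measurable I01" and ww_bd: "x \<in> {0<..<1} \<Longrightarrow> \<bar>ww x\<bar> \<le> 1"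
proof -
  show "ww \<in> borel_measurable I01" by measurable
  obtain d where d: "d > 0" "\<And>x. x \<in> {0..1} \<Longrightarrow> ps x \<le> - d" using psi_neg by blast
  show "\<bar>ww x\<bar> \<le> 1" if "x \<in> {0<..<1}"
    using d(1) d(2)[of x] that s Th by (simp add: mult_nonneg_nonpos)
qed

lemma L2_ww: "f \<in> L2I \<Longrightarrow> (\<lambda>x. ww x * f x) \<in> L2I"
  by (rule L2_bdd_mult[OF _ ww_meas ww_bd])

lemma L2_gam: "f \<in> L2I \<Longrightarrow> (\<lambda>x. gam x * f x) \<in> L2I"
  by (rule L2_bdd_mult[OF _ gam_meas gam_abs])

lemma L2_ps: "f \<in> L2I \<Longrightarrow> (\<lambda>x. ps x * f x) \<in> L2I"
proof -
  obtain B where B: "B > 0" "\<And>x. x \<in> {0..1} \<Longrightarrow> \<bar>ps x\<bar> \<le> B" using psi_bound by blast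
  show "f \<in> L2I \<Longrightarrow> (\<lambda>x. ps x * f x) \<in> L2I"
    by (rule L2_bdd_mult[OF _ psi_meas B(2)]) auto
qed

lemma L2_p2a: "f \<in> L2I \<Longrightarrow> (\<lambda>x. p2a x * f x) \<in> L2I"
  by (rule L2_bdd_mult[OF _ p2a_meas p2a_abs])

lemma W_ac: "ac_on 0 1 W W'"
  by (rule ac_on_cong[OF ac_on_mult[OF ac_weight[of "s * Th"] V_ac], where S = "{}"])
    (auto simp: algebra_simps)

lemma W_bdry: "W 0 = 0" "W 1 = 0"
  using V_bdry by auto

lemma P_eq: "x \<in> {0..1} \<Longrightarrow> sqrt (a x) * W' x = P x"
  using sqrt_quo[of x] by (simp add: grad_def algebra_simps)

lemma P_L2: "P \<in> L2I" and S_L2: "S \<in> L2I" and W_L2: "W \<in> L2I"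
  and Wt_L2: "Wt \<in> L2I" and St_L2: "St \<in> L2I" and Pt_L2: "Pt \<in> L2I"
proof -
  note v = H1abD[OF V(1)] and t = H1abD[OF vt]
  have "(\<lambda>x. ww x * grad V x + kk * (ww x * (gam x * V x))) \<in> L2I"
    by (intro L2_add L2_cmult L2_ww L2_gam v)
  then show "P \<in> L2I" by (simp add: mult_ac)
  show "S \<in> L2I" "W \<in> L2I" by (intro L2_ww v)+
  have "(\<lambda>x. (s * T1) * (ww x * (ps x * V x)) + ww x * vt x) \<in> L2I"
    by (intro L2_add L2_cmult L2_ww L2_ps v t)
  then show "Wt \<in> L2I" by (simp add: mult_ac)
  have "(\<lambda>x. (s * T1) * (ww x * (ps x * sing V x)) + ww x * sing vt x) \<in> L2I"
    by (intro L2_add L2_cmult L2_ww L2_ps v t)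
  then show "St \<in> L2I" by (simp add: mult_ac)
  have "(\<lambda>x. ((s * T1) * (ww x * (ps x * grad V x)) + ww x * grad vt x) +
      ((s * T1 * c1) * (ww x * (gam x * V x)) + (kk * (s * T1)) * (ww x * (ps x * (gam x * V x)))
        + kk * (ww x * (gam x * vt x)))) \<in> L2I"
    by (intro L2_add L2_cmult L2_ww L2_ps L2_gam v t)
  then show "Pt \<in> L2I" by (simp add: algebra_simps)
qed

lemma W'_L2: "(\<lambda>x. sqrt (a x) * W' x) \<in> L2I"
  by (rule L2_AE[OF P_L2]) (use P_eq in \<open>auto intro!: AE_I2\<close>)

text \<open>Membership in \<open>H1ab\<close> is what allows the Hardy inequality to be applied to
  the conjugated function w instead of v.\<close>

lemma W_XH: "W \<in> XH" and W'_wderiv: "AE x in I01. wderiv W x = W' x"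
proof -
  show wd: "AE x in I01. wderiv W x = W' x" by (rule wderiv_AE[OF weak_derivI[OF W_ac]]) simp
  have W0: "W \<in> W11_0" by (rule W11_0I[OF W_ac _ W_bdry]) simp
  have "grad W \<in> L2I"
    by (rule L2_AE[OF W'_L2]) (use wd in \<open>eventually_elim, simp add: grad_def\<close>)
  moreover have "sing W \<in> L2I" using S_L2 by (simp add: sing_def[abs_def])
  ultimately show "W \<in> XH" using W0 by (simp add: H1ab_def H1a_def grad_def[abs_def] sing_def[abs_def])
qed

lemma Aint_eq: "Aint (wderiv W) = Aint W'"
proof -
  have [measurable]: "wderiv W \<in> borel_measurable I01" by (rule W11_0_meas[OF H1abD(2)[OF W_XH]])
  have [measurable]: "W' \<in> borel_measurable I01"
    using ac_on_abs_int[OF W_ac] unfolding integrable_Ioo_iff[symmetric] by (rule borel_measurable_integrable)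
  show ?thesis unfolding Aint_def
    by (rule integral_cong_AE) (use W'_wderiv in \<open>auto elim: eventually_mono\<close>)
qed

lemma hardy_W: "\<beta> * (LINT x|I01. (W x)\<^sup>2 / b x) \<le> (2 - K1 - \<kappa>) * Aint W'"
  using hardy[OF W_XH] Aint_eq by (simp add: Aint_def)

lemma L2_sum_bound: "(LINT x|I01. (W x)\<^sup>2) \<le> Aint W' / kk + kk * Bint W"
  by (rule uncertainty[OF W_ac W_bdry W'_L2 kk])

text \<open>The conjugated equation splits e^{s phi} h into L and w_t + R. The pairing of L with w_t
  is rewritten by one integration by parts, the pairing with R is estimated from below by
  \<open>spatial_estimate\<close>, and \<open>\<beta>\<close> times the singular integral is paid
  for by the Hardy inequality.\<close>

lemma product_estimate:
  "- ip P Pt + lam * ip S St + ip (\<lambda>x. mm x * W x) Wt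
     + \<kappa> * (kk * Aint W') + (2 - K1) * (kk ^ 3 * Bint W) - kk * (s * \<bar>T1\<bar> * c1) * Bint W
   \<le> (LINT x|I01. (h x)\<^sup>2 * (ww x)\<^sup>2) / 2
     + kk * ((1 - x0) * (ww 1 * trace1 V)\<^sup>2 / a 1 + x0 * (ww 0 * trace0 V)\<^sup>2 / a 0)"
proof -
  note v = H1abD[OF V(1)] and v2 = H2abD[OF V(2)] and t = H1abD[OF vt]
  obtain F where F: "ac_on 0 1 F (flux_deriv a V)" "AE x in I01. F x = a x * wderiv V x"
    "F 1 = trace1 V" "F 0 = trace0 V" using flux_rep[OF V(2)] .
  \<comment> \<open>The flux a w_x, written with a \<open>quo\<close> = x - x0 already cancelled. In
    this form it is visibly absolutely continuous across x0.\<close>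
  define FW where "FW x = ww x * (F x + kk * ((x - x0) * V x))" for x
  define FW' where "FW' x = ww x * (flux_deriv a V x + kk * ((x - x0) * wderiv V x + V x * 1))
     + (F x + kk * ((x - x0) * V x)) * (ww x * (s * Th * (c1 * quo x)))" for x
  have acFW: "ac_on 0 1 FW FW'"
    unfolding FW_def FW'_def by (intro ac_on_mult ac_weight ac_on_add ac_on_cmult ac_shift V_ac F(1))
  have FWae: "AE x in I01. FW x = a x * W' x"
    using F(2) AE_off_x0
  proof eventually_elim
    case (elim x)
    then have "a x * quo x = x - x0" by (intro a_quo) auto
    then have "kk * ((x - x0) * V x) = kk * (a x * quo x * V x)" by simp
    then show ?case using elim(1) by (simp add: FW_def algebra_simps)
  qed
  have sg: "(\<lambda>x. (x - x0) * wderiv V x) \<in> L2I"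
    by (rule shifted_grad_L2[OF v(3)[unfolded grad_def[abs_def]] W11_0_meas[OF v(2)]])
  have FWL: "FW' \<in> L2I"
  proof (rule L2_AE)
    show "(\<lambda>x. ww x * (flux_deriv a V x + kk * ((x - x0) * wderiv V x + V x))
        + kk * (ww x * ((x - x0) * wderiv V x + kk * (p2a x * V x)))) \<in> L2I"
      by (intro L2_add L2_ww L2_cmult L2_p2a v2(4) sg v(4))
    show "AE x in I01. FW' x = ww x * (flux_deriv a V x + kk * ((x - x0) * wderiv V x + V x))
        + kk * (ww x * ((x - x0) * wderiv V x + kk * (p2a x * V x)))"
      using F(2) AE_off_x0
    proof eventually_elim
      case (elim x)
      then have q: "a x * quo x = x - x0" by (intro a_quo) auto
      have "F x * quo x = (a x * quo x) * wderiv V x" using elim(1) by simp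
      then have Fq: "F x * quo x = (x - x0) * wderiv V x" unfolding q .
      have "(F x + kk * ((x - x0) * V x)) * (ww x * (s * Th * (c1 * quo x)))
          = kk * (ww x * (F x * quo x + kk * (quo x * (x - x0) * V x)))"
        by (simp add: algebra_simps)
      then show ?case unfolding FW'_def Fq quo_p2a by simp
    qed
  qed
  have WbL: "(\<lambda>x. W x / b x) \<in> L2I" using L2_ww[OF v2(5)] by simp
  let ?L = "\<lambda>x. FW' x + lam * (W x / b x) + mm x * W x"
  let ?R = "\<lambda>x. - 2 * kk * (x - x0) * W' x - kk * W x"
  note RL = spatial_estimate(1)[OF less_imp_le[OF kk] W_ac W_bdry acFW FWae W'_L2 FWL WbL]
  note LL = spatial_estimate(2)[where \<mu> = "- s * T1", OF less_imp_le[OF kk] W_ac W_bdry acFW FWae W'_L2 FWL WbL]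
  note est = spatial_estimate(3)[where \<mu> = "- s * T1", OF less_imp_le[OF kk] W_ac W_bdry acFW FWae W'_L2 FWL WbL]
  have FWb: "FW 1 = ww 1 * trace1 V" "FW 0 = ww 0 * trace0 V"
    using V_bdry F(3,4) by (simp_all add: FW_def)
  have mWL: "(\<lambda>x. mm x * W x) \<in> L2I"
  proof -
    have "(\<lambda>x. (- s * T1) * (ps x * W x) + kk\<^sup>2 * (p2a x * W x)) \<in> L2I"
      by (intro L2_add L2_cmult L2_ps L2_p2a W_L2)
    then show ?thesis by (simp add: algebra_simps)
  qed
  have parts: "ip FW' Wt = - ip P Pt"
  proof -
    \<comment> \<open>As \<open>vt\<close> lies in \<open>W11_0\<close>, it has an absolutely
      continuous representative vanishing at 0 and 1. The function z built from it represents w_t,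
      and the boundary terms of the integration by parts disappear.\<close>
    obtain g where g: "ac_on 0 1 g (wderiv vt)" "AE x in I01. vt x = g x" "g 0 = 0" "g 1 = 0"
      using W11_0_rep[OF t(2)] .
    define z where "z x = ww x * g x + (s * T1) * (ps x * W x)" for x
    define z' where "z' x = (ww x * wderiv vt x + g x * (ww x * (s * Th * (c1 * quo x))))
      + (s * T1) * (ps x * W' x + W x * (c1 * quo x))" for x
    have acz: "ac_on 0 1 z z'"
      unfolding z_def z'_def
      by (intro ac_on_add ac_on_mult ac_on_cmult ac_weight g(1) W_ac ac_psi[folded quo_def])
    have zL: "z \<in> L2I" by (rule ac_L2[OF acz])
    have i1: "integrable I01 (\<lambda>x. z x * FW' x)" by (rule L2_mult[OF zL FWL])
    have i2: "integrable I01 (\<lambda>x. z' x * FW x)"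
      using abs_int_mult_cont[OF ac_on_cont[OF acFW] ac_on_abs_int[OF acz]]
      by (simp add: integrable_Ioo_iff mult.commute)
    have zae: "AE x in I01. Wt x = z x" using g(2) by eventually_elim (simp add: z_def algebra_simps)
    have "ip FW' Wt = ip FW' z" by (rule ip_AE[OF FWL zL zae])
    also have "\<dots> = integral {0..1} (\<lambda>x. z x * FW' x)"
      unfolding ip_def using lint_Ioo[OF i1] by (simp add: mult.commute)
    also have "\<dots> = - integral {0..1} (\<lambda>x. z' x * FW x)"
      using ac_on_by_parts[OF acz acFW] g(3,4) W_bdry by (simp add: z_def)
    also have "integral {0..1} (\<lambda>x. z' x * FW x) = (LINT x|I01. z' x * FW x)" by (rule lint_Ioo[OF i2, symmetric])
    also have "\<dots> = ip P Pt"
      unfolding ip_def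
    proof (rule integral_cong_AE)
      show "(\<lambda>x. z' x * FW x) \<in> borel_measurable I01" by (rule borel_measurable_integrable[OF i2])
      show "(\<lambda>x. P x * Pt x) \<in> borel_measurable I01" by (rule borel_measurable_integrable[OF L2_mult[OF P_L2 Pt_L2]])
      show "AE x in I01. z' x * FW x = P x * Pt x"
        using FWae g(2) AE_off_x0
      proof eventually_elim
        case (elim x)
        then have x: "x \<in> {0..1}" by auto
        have sz: "sqrt (a x) * z' x = Pt x"
        proof -
          have "sqrt (a x) * z' x = (ww x * grad vt x + g x * (ww x * (s * Th * (c1 * (sqrt (a x) * quo x)))))
              + (s * T1) * (ps x * (sqrt (a x) * W' x) + W x * (c1 * (sqrt (a x) * quo x)))"
            by (simp add: z'_def grad_def algebra_simps)
          also have "\<dots> = Pt x" unfolding sqrt_quo[OF x] P_eq[OF x] elim(2)[symmetric] by (simp add: algebra_simps)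
          finally show ?thesis .
        qed
        have "z' x * FW x = (sqrt (a x) * sqrt (a x)) * (z' x * W' x)"
          using elim(1) a_nonneg[OF x] by simp
        also have "\<dots> = (sqrt (a x) * W' x) * (sqrt (a x) * z' x)" by (simp only: mult_ac)
        finally show ?case unfolding sz P_eq[OF x] .
      qed
    qed
    finally show ?thesis .
  qed
  have sing_part: "ip (\<lambda>x. W x / b x) Wt = ip S St"
    unfolding ip_def
  proof (rule Bochner_Integration.integral_cong)
    fix x assume "x \<in> space I01"
    then have bx: "b x \<ge> 0" by (intro b_nonneg) auto
    have st: "St x = Wt x / sqrt (b x)" by (simp add: sing_def add_divide_distrib)
    have "S x * St x = W x * Wt x / (sqrt (b x) * sqrt (b x))" unfolding st by (simp add: sing_def)
    then show "W x / b x * Wt x = S x * St x" using bx by simp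
  qed simp
  have "ip ?L Wt = ip Wt ?L" by (rule ip_commute)
  also have "\<dots> = ip Wt FW' + lam * ip Wt (\<lambda>x. W x / b x) + ip Wt (\<lambda>x. mm x * W x)"
    by (simp only: ip_add_right[OF Wt_L2 L2_add[OF FWL L2_cmult[OF WbL]] mWL]
        ip_add_right[OF Wt_L2 FWL L2_cmult[OF WbL]] ip_cmult_right)
  also have "\<dots> = - ip P Pt + lam * ip S St + ip (\<lambda>x. mm x * W x) Wt"
    unfolding ip_commute[of Wt] parts sing_part ..
  finally have LW: "ip ?L Wt = - ip P Pt + lam * ip S St + ip (\<lambda>x. mm x * W x) Wt" .
  have sum: "AE x in I01. ww x * h x = ?L x + (Wt x + ?R x)"
    using eqn F(2) AE_off_x0
  proof eventually_elim
    case (elim x)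
    then have q: "a x * quo x = x - x0" by (intro a_quo) auto
    have "F x * quo x = (a x * quo x) * wderiv V x" using elim(2) by simp
    then have Fq: "F x * quo x = (x - x0) * wderiv V x" unfolding q .
    have e1: "(F x + kk * ((x - x0) * V x)) * (ww x * (s * Th * (c1 * quo x)))
        = kk * (ww x * (F x * quo x + kk * (quo x * (x - x0) * V x)))"
      by (simp add: algebra_simps)
    have e2: "(x - x0) * W' x = ww x * ((x - x0) * wderiv V x + kk * (quo x * (x - x0)) * V x)"
      by (simp add: algebra_simps)
    have R: "?R x = - 2 * kk * ((x - x0) * W' x) - kk * W x" by simp
    show ?case
      unfolding elim(1)[symmetric] FW'_def e1 R e2 Fq quo_p2a
      by (simp add: power2_eq_square algebra_simps)
  qed
  have WR: "(\<lambda>x. Wt x + ?R x) \<in> L2I" by (rule L2_add[OF Wt_L2 RL])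
  have "ip ?L Wt + ip ?L ?R = ip ?L (\<lambda>x. Wt x + ?R x)" by (rule ip_add_right[OF LL Wt_L2 RL, symmetric])
  \<comment> \<open>From y z \<le> (y + z)^2 / 2, where y + z is e^{s phi} h by the conjugated
    equation.\<close>
  also have "\<dots> \<le> (LINT x|I01. (1/2) * ((?L x + (Wt x + ?R x)))\<^sup>2)"
    unfolding ip_def
  proof (rule integral_mono)
    show "integrable I01 (\<lambda>x. ?L x * (Wt x + ?R x))" by (rule L2_mult[OF LL WR])
    show "integrable I01 (\<lambda>x. (1/2) * ((?L x + (Wt x + ?R x)))\<^sup>2)"
      by (intro integrable_mult_right L2_sq L2_add LL WR)
    fix x
    have "y * z \<le> (1/2) * (y + z)\<^sup>2" for y z :: real
    proof -
      have "(1/2) * (y + z)\<^sup>2 = y * z + (y\<^sup>2 + z\<^sup>2) / 2" by (simp add: power2_eq_square algebra_simps)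
      then show ?thesis by simp
    qed
    then show "?L x * (Wt x + ?R x) \<le> (1/2) * ((?L x + (Wt x + ?R x)))\<^sup>2" .
  qed
  also have "\<dots> = (LINT x|I01. (1/2) * ((h x)\<^sup>2 * (ww x)\<^sup>2))"
  proof (rule integral_cong_AE)
    show m: "(\<lambda>x. (1/2) * ((?L x + (Wt x + ?R x)))\<^sup>2) \<in> borel_measurable I01"
      by (intro borel_measurable_integrable integrable_mult_right L2_sq L2_add LL WR)
    have ae: "AE x in I01. (1/2) * ((h x)\<^sup>2 * (ww x)\<^sup>2) = (1/2) * ((?L x + (Wt x + ?R x)))\<^sup>2"
      using sum
    proof eventually_elim
      case (elim x)
      have "(h x)\<^sup>2 * (ww x)\<^sup>2 = (ww x * h x)\<^sup>2" by (simp add: power_mult_distrib)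
      then show ?case unfolding elim by simp
    qed
    show "(\<lambda>x. (1/2) * ((h x)\<^sup>2 * (ww x)\<^sup>2)) \<in> borel_measurable I01"
      by (rule measurable_lebesgue_AE[OF m ae]) auto
    show "AE x in I01. (1/2) * ((?L x + (Wt x + ?R x)))\<^sup>2 = (1/2) * ((h x)\<^sup>2 * (ww x)\<^sup>2)"
      using ae by eventually_elim (rule sym)
  qed
  also have "\<dots> = (LINT x|I01. (h x)\<^sup>2 * (ww x)\<^sup>2) / 2" by simp
  finally have up: "ip ?L Wt + ip ?L ?R \<le> (LINT x|I01. (h x)\<^sup>2 * (ww x)\<^sup>2) / 2" .
  have "kk * (\<beta> * (LINT x|I01. (W x)\<^sup>2 / b x)) \<le> kk * ((2 - K1 - \<kappa>) * Aint W')"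
    using hardy_W kk by (intro mult_left_mono) auto
  then have low1: "\<kappa> * (kk * Aint W') \<le> kk * (2 - K1) * Aint W' - kk * \<beta> * (LINT x|I01. (W x)\<^sup>2 / b x)"
    by (simp add: algebra_simps)
  have B0: "0 \<le> Bint W"
    unfolding Bint_def by (rule Bochner_Integration.integral_nonneg) (use p2a_nonneg in auto)
  \<comment> \<open>Theta' changes sign on (0,T), so its contribution to the weighted term is kept
    as an error, to be absorbed by the cubic term.\<close>
  have "- (s * \<bar>T1\<bar> * c1) \<le> (- s * T1) * c1" using s c1 by (simp add: mult_mono)
  then have "(- (s * \<bar>T1\<bar> * c1)) * (kk * Bint W) \<le> ((- s * T1) * c1) * (kk * Bint W)"
    using B0 kk by (intro mult_right_mono) auto
  then have low2: "(2 - K1) * (kk ^ 3 * Bint W) - kk * (s * \<bar>T1\<bar> * c1) * Bint W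
      \<le> kk * ((- s * T1) * c1 + kk\<^sup>2 * (2 - K1)) * Bint W"
    by (simp add: power2_eq_square power3_eq_cube algebra_simps)
  show ?thesis
    using est up low1 low2 unfolding LW FWb by linarith
qed

text \<open>The return from w to v: e^{s phi} v_x = w_x - k \<open>quo\<close> w, and a
  \<open>quo\<close>^2 = \<open>p2a\<close>, so the weighted gradient of v costs at most twice that
  of w plus a term of the same type as the cubic one.\<close>

lemma weighted_bound:
  assumes vx: "AE x in I01. vx x = wderiv V x"
  shows "(LINT x|I01. (s * Th * a x * (vx x)\<^sup>2 + s ^ 3 * Th ^ 3 * ((x - x0)\<^sup>2 / a x) * (V x)\<^sup>2) * (ww x)\<^sup>2)
    \<le> (2 / c1 + 1 / c1 ^ 3) * (kk * Aint W' + kk ^ 3 * Bint W)"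
proof -
  note v = H1abD[OF V(1)]
  have [measurable]: "vx \<in> borel_measurable I01"
    by (rule measurable_lebesgue_AE[OF W11_0_meas[OF v(2)] vx]) auto
  have [measurable]: "V \<in> borel_measurable I01" by (rule L2_meas[OF v(4)])
  define C where "C = 2 / c1 + 1 / c1 ^ 3"
  have "(LINT x|I01. (s * Th * a x * (vx x)\<^sup>2 + s ^ 3 * Th ^ 3 * ((x - x0)\<^sup>2 / a x) * (V x)\<^sup>2) * (ww x)\<^sup>2)
    \<le> (LINT x|I01. (C * kk) * (a x * (W' x)\<^sup>2) + (C * kk ^ 3) * (p2a x * (W x)\<^sup>2))"
  proof (rule integral_mono_AE')
    show "integrable I01 (\<lambda>x. (C * kk) * (a x * (W' x)\<^sup>2) + (C * kk ^ 3) * (p2a x * (W x)\<^sup>2))"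
      by (intro Bochner_Integration.integrable_add integrable_mult_right grad_sq(1)[OF W'_L2] weight_sq[OF W_L2])
    \<comment> \<open>Since s Theta = \<open>kk\<close> / c1, the summand 2/c1 pays for the factor 2
      from the square and 1/c1^3 converts (s Theta)^3 into the cube of \<open>kk\<close>.\<close>
    have C: "C * kk \<ge> 2 * (s * Th)" "C * kk ^ 3 \<ge> 2 * (s * Th) * kk\<^sup>2 + (s * Th) ^ 3"
    proof -
      have "C * kk = 2 * (s * Th) + kk / c1 ^ 3" using c1 by (simp add: C_def field_simps)
      then show "C * kk \<ge> 2 * (s * Th)" using kk c1 by simp
      have "C * kk ^ 3 = 2 * (s * Th) * kk\<^sup>2 + (s * Th) ^ 3"
        using c1 by (simp add: C_def power3_eq_cube power2_eq_square field_simps)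
      then show "C * kk ^ 3 \<ge> 2 * (s * Th) * kk\<^sup>2 + (s * Th) ^ 3" by simp
    qed
    show "AE x in I01. (s * Th * a x * (vx x)\<^sup>2 + s ^ 3 * Th ^ 3 * ((x - x0)\<^sup>2 / a x) * (V x)\<^sup>2) * (ww x)\<^sup>2
      \<le> (C * kk) * (a x * (W' x)\<^sup>2) + (C * kk ^ 3) * (p2a x * (W x)\<^sup>2)"
      using vx AE_off_x0
    proof eventually_elim
      case (elim x)
      then have x: "x \<in> {0..1}" "x \<noteq> x0" by auto
      have ap: "a x > 0" by (rule a_pos[OF x])
      have aq: "a x * (quo x)\<^sup>2 = p2a x" using ap by (simp add: quo_def p2a_def power2_eq_square)
      have sq: "(y - z)\<^sup>2 \<le> 2 * y\<^sup>2 + 2 * z\<^sup>2" for y z :: real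
      proof -
        have "2 * y\<^sup>2 + 2 * z\<^sup>2 - (y - z)\<^sup>2 = (y + z)\<^sup>2" by (simp add: power2_eq_square algebra_simps)
        then show ?thesis using zero_le_power2[of "y + z"] by linarith
      qed
      have "ww x * vx x = W' x - kk * quo x * W x" using elim(1) by (simp add: algebra_simps)
      then have "(ww x * vx x)\<^sup>2 \<le> 2 * (W' x)\<^sup>2 + 2 * (kk * quo x * W x)\<^sup>2" using sq by simp
      then have "a x * (ww x * vx x)\<^sup>2 \<le> a x * (2 * (W' x)\<^sup>2 + 2 * (kk * quo x * W x)\<^sup>2)"
        using ap by (intro mult_left_mono) auto
      also have "\<dots> = 2 * (a x * (W' x)\<^sup>2) + 2 * kk\<^sup>2 * (a x * (quo x)\<^sup>2 * (W x)\<^sup>2)"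
        by (simp only: power_mult_distrib distrib_left mult_ac)
      finally have g: "a x * (ww x * vx x)\<^sup>2 \<le> 2 * (a x * (W' x)\<^sup>2) + 2 * kk\<^sup>2 * (p2a x * (W x)\<^sup>2)"
        unfolding aq .
      have "(s * Th * a x * (vx x)\<^sup>2 + s ^ 3 * Th ^ 3 * ((x - x0)\<^sup>2 / a x) * (V x)\<^sup>2) * (ww x)\<^sup>2
          = (s * Th) * (a x * (ww x * vx x)\<^sup>2) + (s * Th) ^ 3 * (p2a x * (W x)\<^sup>2)"
        by (simp add: p2a_def power_mult_distrib algebra_simps)
      also have "\<dots> \<le> (s * Th) * (2 * (a x * (W' x)\<^sup>2) + 2 * kk\<^sup>2 * (p2a x * (W x)\<^sup>2)) + (s * Th) ^ 3 * (p2a x * (W x)\<^sup>2)"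
        using g s Th by (intro add_right_mono mult_left_mono) auto
      also have "\<dots> = 2 * (s * Th) * (a x * (W' x)\<^sup>2) + (2 * (s * Th) * kk\<^sup>2 + (s * Th) ^ 3) * (p2a x * (W x)\<^sup>2)"
        by (simp only: distrib_left distrib_right mult_ac)
      also have "\<dots> \<le> (C * kk) * (a x * (W' x)\<^sup>2) + (C * kk ^ 3) * (p2a x * (W x)\<^sup>2)"
        using C ap p2a_nonneg[OF x(1)] by (intro add_mono mult_right_mono) auto
      finally show ?case .
    qed
    show "AE x in I01. 0 \<le> (C * kk) * (a x * (W' x)\<^sup>2) + (C * kk ^ 3) * (p2a x * (W x)\<^sup>2)"
    proof (intro AE_I2)
      fix x assume "x \<in> space I01"
      then have "x \<in> {0..1}" by simp
      moreover have "C \<ge> 0" using c1 by (simp add: C_def)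
      ultimately show "0 \<le> (C * kk) * (a x * (W' x)\<^sup>2) + (C * kk ^ 3) * (p2a x * (W x)\<^sup>2)"
        using s Th c1 a_nonneg[of x] p2a_nonneg[of x] by (intro add_nonneg_nonneg mult_nonneg_nonneg) auto
    qed
  qed
  also have "\<dots> = (C * kk) * Aint W' + (C * kk ^ 3) * Bint W"
    unfolding Aint_def Bint_def using grad_sq(1)[OF W'_L2] weight_sq[OF W_L2] by simp
  also have "\<dots> = C * (kk * Aint W' + kk ^ 3 * Bint W)" by (simp add: algebra_simps)
  finally show ?thesis unfolding C_def .
qed

text \<open>The pairing of m w with w_t is half the time derivative of the integral of m w^2 minus
  half the integral of m_t w^2; \<open>mt\<close> is m_t. The left side is thus the exact energy
  derivative plus half of the coercive terms, and the other half absorbs m_t and the error with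
  Theta'.\<close>

lemma absorbed_estimate:
  fixes T2 c PB :: real
  assumes T1: "\<bar>T1\<bar> \<le> c * Th\<^sup>2" and T2: "\<bar>T2\<bar> \<le> c * Th\<^sup>2"
    and PB: "\<And>x. x \<in> {0..1} \<Longrightarrow> \<bar>ps x\<bar> \<le> PB" and large: "c * PB + 4 * c1 * c \<le> \<kappa> * c1\<^sup>2 * s"
  defines "mt \<equiv> \<lambda>x. (- s * T2) * ps x + 2 * (s * Th * c1) * (s * T1 * c1) * p2a x"
  shows "- ip P Pt + lam * ip S St + (ip (\<lambda>x. mm x * W x) Wt + ip W (\<lambda>x. mt x * W x + mm x * Wt x)) / 2
      + \<kappa> / 2 * (kk * Aint W' + kk ^ 3 * Bint W)
    \<le> (LINT x|I01. (h x)\<^sup>2 * (ww x)\<^sup>2) / 2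
      + kk * ((1 - x0) * (ww 1 * trace1 V)\<^sup>2 / a 1 + x0 * (ww 0 * trace0 V)\<^sup>2 / a 0)"
proof -
  have mL: "(\<lambda>x. mm x * f x) \<in> L2I" if "f \<in> L2I" for f
  proof -
    have "(\<lambda>x. (- s * T1) * (ps x * f x) + kk\<^sup>2 * (p2a x * f x)) \<in> L2I"
      by (intro L2_add L2_cmult L2_ps L2_p2a that)
    then show ?thesis by (simp add: algebra_simps)
  qed
  have mtL: "(\<lambda>x. mt x * W x) \<in> L2I"
  proof -
    have "(\<lambda>x. (- s * T2) * (ps x * W x) + (2 * (s * Th * c1) * (s * T1 * c1)) * (p2a x * W x)) \<in> L2I"
      by (intro L2_add L2_cmult L2_ps L2_p2a W_L2)
    then show ?thesis by (simp add: mt_def algebra_simps)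
  qed
  have "ip W (\<lambda>x. mt x * W x + mm x * Wt x) = ip W (\<lambda>x. mt x * W x) + ip W (\<lambda>x. mm x * Wt x)"
    by (rule ip_add_right[OF W_L2 mtL mL[OF Wt_L2]])
  moreover have "ip W (\<lambda>x. mm x * Wt x) = ip (\<lambda>x. mm x * W x) Wt"
    unfolding ip_def by (simp only: mult.assoc mult.left_commute)
  ultimately have half: "(ip (\<lambda>x. mm x * W x) Wt + ip W (\<lambda>x. mt x * W x + mm x * Wt x)) / 2
      = ip (\<lambda>x. mm x * W x) Wt + ip W (\<lambda>x. mt x * W x) / 2" by simp
  define A where "A = Aint W'"
  define B where "B = Bint W"
  define J where "J = (LINT x|I01. (W x)\<^sup>2)"
  have A0: "0 \<le> A" unfolding A_def Aint_def
    by (rule Bochner_Integration.integral_nonneg) (use a_nonneg in auto)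
  have B0: "0 \<le> B" unfolding B_def Bint_def
    by (rule Bochner_Integration.integral_nonneg) (use p2a_nonneg in auto)
  have c0: "0 \<le> c"
  proof -
    have "0 \<le> c * Th\<^sup>2" using T1 by linarith
    then show ?thesis using Th by (simp add: zero_le_mult_iff)
  qed
  have PB0: "0 \<le> PB" using PB[of 0] by auto
  have Jb: "J \<le> A / kk + kk * B" unfolding J_def A_def B_def by (rule L2_sum_bound)
  \<comment> \<open>D bounds s Theta'' psi. Q bounds the product of k and the absolute value of its
    time derivative, so 2 Q \<open>p2a\<close> bounds the other part of m_t. The first part carries
    no \<open>p2a\<close>, which is why the uncertainty inequality is needed.\<close>
  define D where "D = (s * (c * Th\<^sup>2)) * PB"
  define Q where "Q = s\<^sup>2 * c1\<^sup>2 * c * Th ^ 3"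
  have D0: "0 \<le> D" unfolding D_def using s c0 PB0 by simp
  have TT: "(s * Th * c1) * (s * \<bar>T1\<bar> * c1) \<le> Q"
  proof -
    have "(s * Th * c1) * (s * \<bar>T1\<bar> * c1) \<le> (s * Th * c1) * (s * (c * Th\<^sup>2) * c1)"
      using s Th c1 T1 by (intro mult_left_mono mult_right_mono) auto
    then show ?thesis by (simp add: Q_def power2_eq_square power3_eq_cube mult_ac)
  qed
  have mtb: "ip W (\<lambda>x. mt x * W x) \<le> D * J + 2 * Q * B"
  proof -
    have "ip W (\<lambda>x. mt x * W x) \<le> (LINT x|I01. D * (W x)\<^sup>2 + 2 * Q * (p2a x * (W x)\<^sup>2))"
      unfolding ip_def
    proof (rule integral_mono)
      show "integrable I01 (\<lambda>x. W x * (mt x * W x))" by (rule L2_mult[OF W_L2 mtL])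
      show "integrable I01 (\<lambda>x. D * (W x)\<^sup>2 + 2 * Q * (p2a x * (W x)\<^sup>2))"
        by (intro Bochner_Integration.integrable_add integrable_mult_right L2_sq weight_sq W_L2)
      fix x assume "x \<in> space I01"
      then have x: "x \<in> {0..1}" by simp
      have "\<bar>(- s * T2) * ps x\<bar> \<le> D"
      proof -
        have "\<bar>(- s * T2) * ps x\<bar> = s * \<bar>T2\<bar> * \<bar>ps x\<bar>" using s by (simp add: abs_mult)
        also have "\<dots> \<le> s * (c * Th\<^sup>2) * PB"
          using s T2 PB[OF x] c0 by (intro mult_mono mult_nonneg_nonneg) auto
        finally show ?thesis by (simp add: D_def)
      qed
      moreover have "\<bar>2 * (s * Th * c1) * (s * T1 * c1) * p2a x\<bar> \<le> 2 * Q * p2a x"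
      proof -
        have "\<bar>2 * (s * Th * c1) * (s * T1 * c1) * p2a x\<bar> = 2 * ((s * Th * c1) * (s * \<bar>T1\<bar> * c1)) * p2a x"
          using s Th c1 p2a_nonneg[OF x] by (simp add: abs_mult)
        also have "\<dots> \<le> 2 * Q * p2a x" using TT p2a_nonneg[OF x] by (intro mult_right_mono mult_left_mono) auto
        finally show ?thesis .
      qed
      ultimately have "mt x \<le> D + 2 * Q * p2a x" unfolding mt_def by linarith
      then have "mt x * (W x)\<^sup>2 \<le> (D + 2 * Q * p2a x) * (W x)\<^sup>2" by (intro mult_right_mono) auto
      moreover have "W x * (mt x * W x) = mt x * (W x)\<^sup>2" by (simp only: power2_eq_square mult_ac)
      moreover have "(D + 2 * Q * p2a x) * (W x)\<^sup>2 = D * (W x)\<^sup>2 + 2 * Q * (p2a x * (W x)\<^sup>2)"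
        by (simp only: distrib_right mult.assoc)
      ultimately show "W x * (mt x * W x) \<le> D * (W x)\<^sup>2 + 2 * Q * (p2a x * (W x)\<^sup>2)" by linarith
    qed
    also have "\<dots> = D * J + 2 * Q * B"
      unfolding J_def B_def Bint_def using L2_sq[OF W_L2] weight_sq[OF W_L2]
      by (subst Bochner_Integration.integral_add) (auto simp only: integral_mult_right_zero integrable_mult_right)
    finally show ?thesis .
  qed
  have DJ: "D * J \<le> c * PB * Th / c1 * A + c * PB * c1 * s\<^sup>2 * Th ^ 3 * B"
  proof -
    have "D * J \<le> D * (A / kk + kk * B)" using Jb D0 by (rule mult_left_mono)
    also have "\<dots> = c * PB * Th / c1 * A + c * PB * c1 * s\<^sup>2 * Th ^ 3 * B"
      using s Th c1 by (simp add: D_def power2_eq_square power3_eq_cube field_simps)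
    finally show ?thesis .
  qed
  have lA: "c * PB * Th / c1 * A \<le> \<kappa> * (kk * A)"
  proof -
    have "0 \<le> 4 * c1 * c" using c1 c0 by simp
    then have "c * PB \<le> \<kappa> * c1\<^sup>2 * s" using large by linarith
    then have "c * PB * (Th / c1 * A) \<le> \<kappa> * c1\<^sup>2 * s * (Th / c1 * A)"
      using Th c1 A0 by (intro mult_right_mono) auto
    moreover have "\<kappa> * c1\<^sup>2 * s * (Th / c1 * A) = \<kappa> * (kk * A)" using c1 by (simp add: power2_eq_square)
    ultimately show ?thesis by (simp add: mult.assoc)
  qed
  \<comment> \<open>The 4 in the condition on s: Q times B occurs once in half of the m_t term and
    once through the error with Theta', and only half of \<open>\<kappa>\<close> is available, which
    doubles the sum.\<close>
  have lB: "(c * PB + 4 * c1 * c) * (c1 * s\<^sup>2 * Th ^ 3 * B) \<le> \<kappa> * (kk ^ 3 * B)"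
  proof -
    have "(c * PB + 4 * c1 * c) * (c1 * s\<^sup>2 * Th ^ 3 * B) \<le> (\<kappa> * c1\<^sup>2 * s) * (c1 * s\<^sup>2 * Th ^ 3 * B)"
      using large c1 Th B0 by (intro mult_right_mono) auto
    also have "\<dots> = \<kappa> * (kk ^ 3 * B)" by (simp add: power2_eq_square power3_eq_cube mult_ac)
    finally show ?thesis .
  qed
  have e1: "kk * (s * \<bar>T1\<bar> * c1) * B \<le> Q * B" using TT B0 by (intro mult_right_mono) auto
  have split: "(c * PB + 4 * c1 * c) * (c1 * s\<^sup>2 * Th ^ 3 * B) = c * PB * c1 * s\<^sup>2 * Th ^ 3 * B + 4 * (Q * B)"
    by (simp add: Q_def power2_eq_square algebra_simps)
  have K: "\<kappa> * (kk ^ 3 * B) \<le> (2 - K1) * (kk ^ 3 * B)"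
    using kappa(2) kk B0 by (intro mult_right_mono mult_nonneg_nonneg zero_le_power less_imp_le[OF kk]) auto
  have half2: "\<kappa> / 2 * (kk * A + kk ^ 3 * B) = (\<kappa> * (kk * A)) / 2 + (\<kappa> * (kk ^ 3 * B)) / 2"
    by (simp add: algebra_simps)
  have "ip W (\<lambda>x. mt x * W x) / 2 + \<kappa> / 2 * (kk * A + kk ^ 3 * B)
      \<le> \<kappa> * (kk * A) + (2 - K1) * (kk ^ 3 * B) - kk * (s * \<bar>T1\<bar> * c1) * B"
    using mtb DJ lA lB e1 split K unfolding half2 by linarith
  then show ?thesis using product_estimate unfolding half A_def B_def by linarith
qed

end

section \<open>The time weight\<close>

definition Th1 :: "real \<Rightarrow> real \<Rightarrow> real" where "Th1 T t = - 4 * (T - 2 * t) / (t * (T - t)) ^ 5"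
definition Th2 :: "real \<Rightarrow> real \<Rightarrow> real" where
  "Th2 T t = 8 / (t * (T - t)) ^ 5 + 20 * (T - 2 * t)\<^sup>2 / (t * (T - t)) ^ 6"
definition Th3 :: "real \<Rightarrow> real \<Rightarrow> real" where
  "Th3 T t = - 120 * (T - 2 * t) / (t * (T - t)) ^ 6 - 120 * (T - 2 * t) ^ 3 / (t * (T - t)) ^ 7"

text \<open>Three derivatives are needed because m contains Theta' and a coefficient in the sense of
  \<open>coef\<close> has two bounded time derivatives.\<close>

lemma Theta_deriv:
  assumes "0 < t" "t < T"
  shows "(Theta T has_real_derivative Th1 T t) (at t)"
    "(Th1 T has_real_derivative Th2 T t) (at t)"
    "(Th2 T has_real_derivative Th3 T t) (at t)"
proof -
  define u where "u = t * (T - t)"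
  have u: "u \<noteq> 0" using assms by (simp add: u_def)
  have pw: "((\<lambda>t. 1 / (t * (T - t)) ^ n) has_real_derivative (- real n * (T - 2 * t) / u ^ Suc n)) (at t)" for n
  proof -
    have "((\<lambda>t. t * (T - t)) has_real_derivative (T - 2 * t)) (at t)"
      by (auto intro!: derivative_eq_intros)
    note d = DERIV_inverse_fun[OF DERIV_power[OF this, of n]]
    have "((\<lambda>t. inverse ((t * (T - t)) ^ n)) has_real_derivative
        - (inverse (u ^ n) * (of_nat n * (u ^ (n - Suc 0) * (T - 2 * t))) * inverse (u ^ n))) (at t)"
      using d u by (simp add: u_def mult_ac)
    moreover have "- (inverse (u ^ n) * (of_nat n * (u ^ (n - Suc 0) * (T - 2 * t))) * inverse (u ^ n))
        = - real n * (T - 2 * t) / u ^ Suc n"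
      using u by (cases n) (simp_all add: field_simps)
    ultimately show ?thesis by (simp add: inverse_eq_divide)
  qed
  have lin: "((\<lambda>t. T - 2 * t) has_real_derivative - 2) (at t)" by (auto intro!: derivative_eq_intros)
  show "(Theta T has_real_derivative Th1 T t) (at t)"
    using pw[of 4] by (simp add: Theta_def[abs_def] Th1_def u_def)
  have "((\<lambda>t. - 4 * (T - 2 * t) * (1 / (t * (T - t)) ^ 5)) has_real_derivative
      8 * (1 / u ^ 5) + (- real 5 * (T - 2 * t) / u ^ Suc 5) * (- 4 * (T - 2 * t))) (at t)"
    using DERIV_mult[OF DERIV_cmult[OF lin, of "-4"] pw[of 5]] by (simp add: u_def)
  moreover have "8 * (1 / u ^ 5) + (- real 5 * (T - 2 * t) / u ^ Suc 5) * (- 4 * (T - 2 * t)) = Th2 T t"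
  proof -
    have "8 * (1 / u ^ 5) + (- real 5 * w / u ^ Suc 5) * (- 4 * w) = 8 / u ^ 5 + 20 * w\<^sup>2 / u ^ 6" for w
      by (simp add: power2_eq_square)
    then show ?thesis by (simp only: Th2_def u_def)
  qed
  ultimately show "(Th1 T has_real_derivative Th2 T t) (at t)"
    by (simp add: Th1_def[abs_def])
  have "((\<lambda>t. 8 * (1 / (t * (T - t)) ^ 5) + 20 * (T - 2 * t)\<^sup>2 * (1 / (t * (T - t)) ^ 6)) has_real_derivative
      8 * (- real 5 * (T - 2 * t) / u ^ Suc 5)
      + ((20 * (real 2 * ((T - 2 * t) ^ (2 - Suc 0) * (- 2)))) * (1 / u ^ 6)
         + (- real 6 * (T - 2 * t) / u ^ Suc 6) * (20 * (T - 2 * t)\<^sup>2))) (at t)"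
    using DERIV_add[OF DERIV_cmult[OF pw[of 5], of 8]
        DERIV_mult[OF DERIV_cmult[OF DERIV_power[OF lin, of 2], of 20] pw[of 6]]]
    by (simp add: u_def mult_ac)
  moreover have "8 * (- real 5 * (T - 2 * t) / u ^ Suc 5)
      + ((20 * (real 2 * ((T - 2 * t) ^ (2 - Suc 0) * (- 2)))) * (1 / u ^ 6)
         + (- real 6 * (T - 2 * t) / u ^ Suc 6) * (20 * (T - 2 * t)\<^sup>2)) = Th3 T t"
    by (simp add: Th3_def u_def[symmetric] power2_eq_square power3_eq_cube) (simp add: diff_divide_distrib[symmetric] add_divide_distrib[symmetric] algebra_simps)
  ultimately show "(Th2 T has_real_derivative Th3 T t) (at t)"
    by (simp add: Th2_def[abs_def])
qed

lemma Theta_pos: "0 < t \<Longrightarrow> t < T \<Longrightarrow> 0 < Theta T t"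
  by (simp add: Theta_def)

text \<open>With u = t (T - t) \<le> T^2, surplus powers of u are bounded by powers of T to reach
  u^-8 = Theta^2. The constant adds 4 T^7, from Theta', and (8 + 20) T^6, from Theta''. The exponent
  2 is what the absorption tolerates: Theta^2 divided by k grows like Theta, as does k.\<close>

lemma Theta_bounds:
  assumes "0 < T"
  defines "c \<equiv> 4 * T ^ 7 + 28 * T ^ 6"
  assumes t: "0 < t" "t < T"
  shows "\<bar>Th1 T t\<bar> \<le> c * (Theta T t)\<^sup>2" "\<bar>Th2 T t\<bar> \<le> c * (Theta T t)\<^sup>2"
proof -
  define u where "u = t * (T - t)"
  have u0: "0 < u" using t by (simp add: u_def)
  have uT: "u \<le> T\<^sup>2" unfolding u_def power2_eq_square using t by (intro mult_mono) auto
  have l: "\<bar>T - 2 * t\<bar> \<le> T" using t by auto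
  have sq: "(Theta T t)\<^sup>2 = 1 / u ^ 8" by (simp add: Theta_def u_def power_divide power_mult_distrib flip: power_mult)
  have u3: "u ^ 3 \<le> T ^ 6" using power_mono[OF uT, of 3] u0 by (simp flip: power_mult)
  have u2: "u ^ 2 \<le> T ^ 4" using power_mono[OF uT, of 2] u0 by (simp flip: power_mult)
  have "\<bar>Th1 T t\<bar> = 4 * \<bar>T - 2 * t\<bar> * u ^ 3 / u ^ 8"
  proof -
    have "\<bar>- 4 * w / u ^ 5\<bar> = 4 * \<bar>w\<bar> * u ^ 3 / u ^ 8" for w
      using u0 by (simp add: abs_mult field_simps flip: power_add)
    then show ?thesis by (simp only: Th1_def u_def)
  qed
  also have "\<dots> \<le> 4 * T * T ^ 6 / u ^ 8"
    using l u3 u0 t by (intro divide_right_mono mult_mono) auto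
  also have "\<dots> \<le> c / u ^ 8" using u0 t by (intro divide_right_mono) (simp_all add: c_def eval_nat_numeral)
  finally show "\<bar>Th1 T t\<bar> \<le> c * (Theta T t)\<^sup>2" by (simp add: sq)
  have l2: "(T - 2 * t)\<^sup>2 \<le> T\<^sup>2" using power_mono[OF l, of 2] by simp
  have "\<bar>Th2 T t\<bar> = Th2 T t" using u0 by (simp add: Th2_def u_def[symmetric])
  also have "\<dots> = (8 * u ^ 3 + 20 * (T - 2 * t)\<^sup>2 * u ^ 2) / u ^ 8"
    using u0 by (simp add: Th2_def u_def[symmetric] add_divide_distrib field_simps eval_nat_numeral)
  also have "\<dots> \<le> (8 * T ^ 6 + 20 * T\<^sup>2 * T ^ 4) / u ^ 8"
    using l2 u3 u2 u0 t by (intro divide_right_mono add_mono mult_mono) auto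
  also have "\<dots> \<le> c / u ^ 8" using u0 t by (intro divide_right_mono) (simp_all add: c_def eval_nat_numeral)
  finally show "\<bar>Th2 T t\<bar> \<le> c * (Theta T t)\<^sup>2" by (simp add: sq)
qed

lemma Theta_at_top:
  assumes T: "0 < T"
  shows "filterlim (Theta T) at_top (at_right 0)" "filterlim (Theta T) at_top (at_left T)"
proof -
  have e: "Theta T = (\<lambda>t. inverse ((t * (T - t)) ^ 4))" by (simp add: Theta_def[abs_def] inverse_eq_divide)
  have "((\<lambda>t. (t * (T - t)) ^ 4) \<longlongrightarrow> (0 * (T - 0)) ^ 4) (at_right 0)" by (intro tendsto_intros)
  moreover have "eventually (\<lambda>t. 0 < (t * (T - t)) ^ 4) (at_right 0)"
    using T unfolding eventually_at_right_field by (intro exI[of _ T]) auto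
  ultimately show "filterlim (Theta T) at_top (at_right 0)"
    unfolding e by (intro filterlim_inverse_at_top) auto
  have "((\<lambda>t. (t * (T - t)) ^ 4) \<longlongrightarrow> (T * (T - T)) ^ 4) (at_left T)" by (intro tendsto_intros)
  moreover have "eventually (\<lambda>t. 0 < (t * (T - t)) ^ 4) (at_left T)"
    using T unfolding eventually_at_left_field by (intro exI[of _ 0]) auto
  ultimately show "filterlim (Theta T) at_top (at_left T)"
    unfolding e by (intro filterlim_inverse_at_top) auto
qed

section \<open>The energy along a solution\<close>

lemma coef_cong:
  assumes "coef p q r r'" "\<And>t x. r t x = f t x" "\<And>t x. r' t x = f' t x"
  shows "coef p q f f'"
proof -
  have "r = f" "r' = f'" by (intro ext assms)+
  then show ?thesis using assms(1) by simp
qed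

locale solution = coeffs +
  fixes h :: "real \<times> real \<Rightarrow> real" and v vt :: "real \<Rightarrow> real \<Rightarrow> real"
  assumes v2: "v \<in> bochner_L2 T X2 N2" and vH: "v \<in> bochner_L2 T XH NH" and vtH: "vt \<in> bochner_L2 T XH NH"
    and wtd: "weak_time_deriv T XH NH v vt"
    and v_XH: "\<And>t. t \<in> {0..T} \<Longrightarrow> v t \<in> XH"
    and v_lim: "\<And>t. t \<in> {0..T} \<Longrightarrow> ((\<lambda>r. NH (\<lambda>x. v r x - v t x)) \<longlongrightarrow> 0) (at t within {0..T})"
    and v_cont: "\<And>t. t \<in> {0..T} \<Longrightarrow> continuous_on {0..1} (v t)"
    and eqn: "AE t in lebesgue_on {0<..<T}. AE x in I01. vt t x + flux_deriv a (v t) x + lam / b x * v t x = h (t, x)"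
begin

lemma blf_cont:
  assumes l: "blf XH NH l"
  shows "continuous_on {0..T} (\<lambda>t. l (v t))"
proof -
  obtain C where C: "C \<ge> 0" "\<And>u. u \<in> XH \<Longrightarrow> \<bar>l u\<bar> \<le> C * NH u" using blf_bound[OF l] by blast
  show ?thesis
    unfolding continuous_on_def
  proof (intro ballI, rule LIM_zero_cancel, rule Lim_null_comparison)
    fix t assume t: "t \<in> {0..T}"
    show "\<forall>\<^sub>F r in at t within {0..T}. norm (l (v r) - l (v t)) \<le> C * NH (\<lambda>x. v r x - v t x)"
      unfolding eventually_at
    proof (intro exI[of _ 1] conjI ballI impI)
      fix r assume r: "r \<in> {0..T}"
      show "norm (l (v r) - l (v t)) \<le> C * NH (\<lambda>x. v r x - v t x)"
        using C(2)[OF blf_diff(1)[OF l v_XH[OF r] v_XH[OF t]]] blf_diff(2)[OF l v_XH[OF r] v_XH[OF t]] by simp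
    qed simp
    show "((\<lambda>r. C * NH (\<lambda>x. v r x - v t x)) \<longlongrightarrow> 0) (at t within {0..T})"
      using tendsto_mult_right_zero[OF v_lim[OF t]] by simp
  qed
qed

text \<open>A representative of the time derivative that lies in \<open>H1ab\<close> at every instant.\<close>

definition vt' :: "real \<Rightarrow> real \<Rightarrow> real" where
  "vt' t = (if vt t \<in> XH then vt t else v 0)"

lemma vt'_XH: "vt' t \<in> XH"
  using v_XH[of 0] T by (simp add: vt'_def)

lemma vt'_AE: "AE t in lebesgue_on {0<..<T}. vt' t = vt t"
proof -
  have "AE t in lebesgue_on {0<..<T}. vt t \<in> XH"
    by (rule strongly_measurable_AE_in[of T XH NH]) (use vtH in \<open>simp add: bochner_L2_def\<close>)
  then show ?thesis by eventually_elim (simp add: vt'_def)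
qed

definition NN :: "real \<Rightarrow> real" where "NN t = NH (vt' t)"

lemma NN_abs_int: "NN absolutely_integrable_on {0..T}"
proof -
  let ?M = "lebesgue_on {0<..<T}"
  interpret finite_measure ?M by (rule finite_measure_lebesgue_on) auto
  have i: "integrable ?M (\<lambda>t. (NH (vt t))\<^sup>2)" using vtH by (simp add: bochner_L2_def)
  \<comment> \<open>Membership in \<open>bochner_L2\<close> provides measurability of the squared
    norm, so the norm is recovered as a square root.\<close>
  have ae: "AE t in ?M. NN t = sqrt ((NH (vt t))\<^sup>2)"
    using vt'_AE by eventually_elim (simp add: NN_def H1ab_norm_ge(4))
  have [measurable]: "(\<lambda>t. (NH (vt t))\<^sup>2) \<in> borel_measurable ?M" by (rule borel_measurable_integrable[OF i])
  have sm: "(\<lambda>t. sqrt ((NH (vt t))\<^sup>2)) \<in> borel_measurable ?M" by measurable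
  have m: "NN \<in> borel_measurable ?M" by (rule measurable_lebesgue_AE[OF sm ae]) auto
  have "integrable ?M NN"
  proof (rule Bochner_Integration.integrable_bound[OF _ m])
    show "integrable ?M (\<lambda>t. 1 + (NH (vt t))\<^sup>2)" using i by simp
    show "AE t in ?M. norm (NN t) \<le> norm (1 + (NH (vt t))\<^sup>2)"
      using vt'_AE
    proof eventually_elim
      case (elim t)
      have "2 * NH (vt t) * 1 \<le> (NH (vt t))\<^sup>2 + 1\<^sup>2" by (rule sum_squares_bound)
      then show ?case using H1ab_norm_ge(4)[of "vt t"] by (simp add: NN_def elim)
    qed
  qed
  then show ?thesis by (simp add: integrable_Ioo_iff)
qed

text \<open>A bounded linear map C from the energy space to L2 carries the weak time derivative
  along. It is applied to the identity, \<open>grad\<close> and \<open>sing\<close>, the three parts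
  of the norm.\<close>

lemma curve_base:
  assumes C: "\<And>u. u \<in> XH \<Longrightarrow> C u \<in> L2I" "\<And>u. n2 (C u) \<le> NH u"
    and l: "\<And>g. g \<in> L2I \<Longrightarrow> blf XH NH (\<lambda>u. ip g (C u))"
  shows "curve 0 T (\<lambda>t. C (v t)) (\<lambda>t. C (vt' t)) NN"
  unfolding curve_def
proof (intro conjI ballI)
  fix g assume g: "g \<in> L2I"
  have ac: "ac_on 0 T (\<lambda>t. ip g (C (v t))) (\<lambda>t. ip g (C (vt t)))"
    by (rule weak_time_deriv_blf[where l = "\<lambda>u. ip g (C u)" and f = v and g = vt and X = XH and N = NH,
          OF l[OF g] vH vtH T wtd blf_cont[where l = "\<lambda>u. ip g (C u)", OF l[OF g]]])
  obtain S where S: "negligible S" "\<forall>t\<in>{0<..<T} - S. vt' t = vt t"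
    using vt'_AE by (subst (asm) AE_lebesgue_on_iff) auto
  have "negligible (S \<union> {0, T})" by (intro negligible_Un S) auto
  then show "ac_on 0 T (\<lambda>t. ip g (C (v t))) (\<lambda>t. ip g (C (vt' t)))"
    by (rule ac_on_cong[OF ac, rotated]) (use S(2) in auto)
qed (use C v_XH vt'_XH NN_abs_int in \<open>auto simp: NN_def\<close>)

lemma curve_v: "curve 0 T v vt' NN"
proof (rule curve_base[where C = "\<lambda>u. u"])
  show "blf XH NH (\<lambda>u. ip g u)" if "g \<in> L2I" for g by (rule blf_H1ab(2)[OF that])
qed (rule H1abD(4), assumption, rule H1ab_norm_ge(2))

lemma curve_grad: "curve 0 T (\<lambda>t. grad (v t)) (\<lambda>t. grad (vt' t)) NN"
proof (rule curve_base[where C = grad])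
  show "blf XH NH (\<lambda>u. ip g (grad u))" if "g \<in> L2I" for g by (rule blf_H1ab(1)[OF that])
qed (rule H1abD(3), assumption, rule H1ab_norm_ge(1))

lemma curve_sing: "curve 0 T (\<lambda>t. sing (v t)) (\<lambda>t. sing (vt' t)) NN"
proof (rule curve_base[where C = sing])
  show "blf XH NH (\<lambda>u. ip g (sing u))" if "g \<in> L2I" for g by (rule blf_H1ab(3)[OF that])
qed (rule H1abD(5), assumption, rule H1ab_norm_ge(3))

context
  fixes s :: real
begin

abbreviation "ee t x \<equiv> exp (s * Theta T t * ps x)"
abbreviation "et t x \<equiv> ee t x * (s * Th1 T t * ps x)"
abbreviation "WW t x \<equiv> ee t x * v t x"
abbreviation "WWt t x \<equiv> et t x * v t x + ee t x * vt' t x"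
abbreviation "PP t x \<equiv> ee t x * grad (v t) x + s * Theta T t * c1 * gam x * ee t x * v t x"
abbreviation "PPt t x \<equiv> (et t x * grad (v t) x + ee t x * grad (vt' t) x) +
   ((s * Th1 T t * c1 * gam x * ee t x + s * Theta T t * c1 * gam x * et t x) * v t x
      + s * Theta T t * c1 * gam x * ee t x * vt' t x)"
abbreviation "SS t x \<equiv> ee t x * sing (v t) x"
abbreviation "SSt t x \<equiv> et t x * sing (v t) x + ee t x * sing (vt' t) x"
abbreviation "mc t x \<equiv> (- s * Th1 T t) * ps x + (s * Theta T t * c1)\<^sup>2 * p2a x"
abbreviation "mct t x \<equiv> (- s * Th2 T t) * ps x + 2 * (s * Theta T t * c1) * (s * Th1 T t * c1) * p2a x"

text \<open>Half the quadratic form of L at w: minus the gradient term, plus the singular term, plus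
  the integral of m w^2. The last pairing keeps m w and w apart because each is a curve to which the
  product rule applies.\<close>

definition En :: "real \<Rightarrow> real" where
  "En t = - (ip (PP t) (PP t) / 2) + lam * (ip (SS t) (SS t) / 2) + ip (\<lambda>x. mc t x * WW t x) (WW t) / 2"

text \<open>The derivative of \<open>En\<close> in the form that the product rule for curves
  delivers, which is also the form of \<open>absorbed_estimate\<close>.\<close>

definition Gn :: "real \<Rightarrow> real" where
  "Gn t = - ip (PP t) (PPt t) + lam * ip (SS t) (SSt t)
     + (ip (\<lambda>x. mc t x * WW t x) (WWt t) + ip (WW t) (\<lambda>x. mct t x * WW t x + mc t x * WWt t x)) / 2"

text \<open>Restricted to compact subintervals of (0,T), since Theta blows up at both ends and its
  derivatives must be bounded to give coefficients.\<close>

lemma energy_ac: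
  assumes pq: "0 < p" "q < T"
  shows "ac_on p q En Gn"
proof -
  have t: "0 < t" "t < T" if "t \<in> {p..q}" for t using that pq by auto
  note D = Theta_deriv[OF t]
  have cnt: "continuous_on {p..q} (Th2 T)" "continuous_on {p..q} (Th3 T)"
    unfolding Th2_def Th3_def using pq by (auto intro!: continuous_intros)
  have c0: "coef p q (\<lambda>t x. Theta T t) (\<lambda>t x. Th1 T t)" by (rule coef_time[OF D(1) D(2) cnt(1)])
  have c1': "coef p q (\<lambda>t x. Th1 T t) (\<lambda>t x. Th2 T t)" by (rule coef_time[OF D(2) D(3) cnt(2)])
  obtain B where B: "B > 0" "\<And>x. x \<in> {0..1} \<Longrightarrow> \<bar>ps x\<bar> \<le> B" using psi_bound by blast
  have cps: "coef p q (\<lambda>t. ps) (\<lambda>t x. 0)" by (rule coef_space[OF psi_meas B(2)]) auto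
  have cgam: "coef p q (\<lambda>t. gam) (\<lambda>t x. 0)" by (rule coef_space[OF gam_meas gam_abs])
  have cp2a: "coef p q (\<lambda>t. p2a) (\<lambda>t x. 0)" by (rule coef_space[OF p2a_meas p2a_abs])
  have cc: "coef p q (\<lambda>t x. k) (\<lambda>t x. 0)" for k by (rule coef_space[of _ "\<bar>k\<bar>"]) auto
  have ce: "coef p q ee et"
    by (rule coef_cong[OF coef_exp[OF coef_mult[OF coef_mult[OF cc[of s] c0] cps]]]) auto
  have ck: "coef p q (\<lambda>t x. s * Theta T t * c1) (\<lambda>t x. s * Th1 T t * c1)"
    by (rule coef_cong[OF coef_mult[OF coef_mult[OF cc[of s] c0] cc[of c1]]]) auto
  have ckg: "coef p q (\<lambda>t x. s * Theta T t * c1 * gam x * ee t x)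
      (\<lambda>t x. s * Th1 T t * c1 * gam x * ee t x + s * Theta T t * c1 * gam x * et t x)"
    by (rule coef_cong[OF coef_mult[OF coef_mult[OF ck cgam] ce]]) auto
  have cm: "coef p q mc mct"
    by (rule coef_cong[OF coef_add[OF coef_mult[OF coef_mult[OF cc[of "- s"] c1'] cps]
          coef_mult[OF coef_mult[OF ck ck] cp2a]]]) (auto simp: power2_eq_square algebra_simps)
  note cv = curve_sub[OF curve_v less_imp_le[OF pq(1)] less_imp_le[OF pq(2)]]
    and cg = curve_sub[OF curve_grad less_imp_le[OF pq(1)] less_imp_le[OF pq(2)]]
    and cs = curve_sub[OF curve_sing less_imp_le[OF pq(1)] less_imp_le[OF pq(2)]]
  obtain N1 where W: "curve p q WW WWt N1" using curve_coef[OF ce cv] by blast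
  obtain N2 where P1: "curve p q (\<lambda>t x. ee t x * grad (v t) x) (\<lambda>t x. et t x * grad (v t) x + ee t x * grad (vt' t) x) N2"
    using curve_coef[OF ce cg] by blast
  obtain N3 where P2: "curve p q (\<lambda>t x. s * Theta T t * c1 * gam x * ee t x * v t x)
      (\<lambda>t x. (s * Th1 T t * c1 * gam x * ee t x + s * Theta T t * c1 * gam x * et t x) * v t x
        + s * Theta T t * c1 * gam x * ee t x * vt' t x) N3"
    using curve_coef[OF ckg cv] by blast
  note P = curve_add[OF P1 P2]
  obtain N4 where S: "curve p q SS SSt N4" using curve_coef[OF ce cs] by blast
  obtain N5 where M: "curve p q (\<lambda>t x. mc t x * WW t x) (\<lambda>t x. mct t x * WW t x + mc t x * WWt t x) N5"
    using curve_coef[OF cm W] by blast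
  show ?thesis
  proof (rule ac_on_cong[where S = "{}", OF ac_on_add[OF ac_on_add[OF
          ac_on_cmult[OF curve_ip[OF P P], of "- 1/2"] ac_on_cmult[OF curve_ip[OF S S], of "lam / 2"]]
          ac_on_cmult[OF curve_ip[OF M W], of "1/2"]]])
  qed (auto simp: En_def Gn_def field_simps)
qed

end

end

section \<open>Fubini for the Lebesgue measure\<close>

lemma measurable_lebesgue_AE_UNIV:
  fixes f g :: "real \<Rightarrow> real"
  assumes "f \<in> borel_measurable lebesgue" "AE x in lebesgue. g x = f x"
  shows "g \<in> borel_measurable lebesgue"
  using measurable_lebesgue_AE[of f UNIV g] assms unfolding lebesgue_on_UNIV_eq by simp

text \<open>Lebesgue measure in the plane is the completion of the product measure, so f is first
  replaced by a Borel function F' equal to it almost everywhere. Fubini holds for F', almost every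
  section of f agrees almost everywhere with that of F', and completeness carries measurability
  back.\<close>

lemma Fubini_lebesgue_on:
  fixes f :: "real \<times> real \<Rightarrow> real"
  assumes A: "A \<in> sets borel" and B: "B \<in> sets borel" and f: "integrable (lebesgue_on (A \<times> B)) f"
  shows "AE t in lebesgue_on A. integrable (lebesgue_on B) (\<lambda>x. f (t, x))"
    "integrable (lebesgue_on A) (\<lambda>t. LINT x|lebesgue_on B. f (t, x))"
    "(LINT z|lebesgue_on (A \<times> B). f z) = (LINT t|lebesgue_on A. LINT x|lebesgue_on B. f (t, x))"
proof -
  have ABb: "A \<times> B \<in> sets borel"
    using A B by (simp add: borel_Times)
  have sets: "A \<times> B \<in> sets lebesgue" "A \<in> sets lebesgue" "B \<in> sets lebesgue"
    using ABb A B by auto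
  define F where "F z = (if z \<in> A \<times> B then f z else 0)" for z
  have Fi: "integrable lebesgue F" unfolding F_def using f sets(1) by (simp add: Lebesgue_Measure.integrable_restrict_UNIV)
  have Fint: "integral\<^sup>L lebesgue F = (LINT z|lebesgue_on (A \<times> B). f z)"
    unfolding F_def by (rule Lebesgue_Measure.integral_restrict_UNIV[OF sets(1)])
  obtain F' where F': "F' \<in> borel \<rightarrow>\<^sub>M borel" "AE z in lborel. F z = F' z"
    using completion_ex_borel_measurable_real[OF borel_measurable_integrable[OF Fi]] by auto
  have F'm: "F' \<in> borel_measurable (completion lborel)" using F'(1) by (intro measurable_completion) simp
  have "integrable lebesgue F'"
    using integrable_cong_AE[OF borel_measurable_integrable[OF Fi] F'm AE_completion[OF F'(2)]] Fi by simp
  then have F'i: "integrable lborel F'" using integrable_completion[of F' lborel] F'(1) by simp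
  have F'int: "integral\<^sup>L lborel F' = integral\<^sup>L lebesgue F"
    using integral_cong_AE[OF borel_measurable_integrable[OF Fi] F'm AE_completion[OF F'(2)]]
      integral_completion[of F' lborel] F'(1) by simp
  have F'p: "integrable (lborel \<Otimes>\<^sub>M lborel) F'" using F'i by (simp add: lborel_prod)
  have aeF: "AE t in lborel. AE x in lborel. F (t, x) = F' (t, x)"
  proof -
    have "AE z in (lborel \<Otimes>\<^sub>M lborel). F z = F' z" using F'(2) unfolding lborel_prod .
    then show ?thesis by (rule lborel_pair.AE_pair)
  qed
  have aeI: "AE t in lborel. integrable lborel (\<lambda>x. F' (t, x))" by (rule lborel_pair.AE_integrable_fst'[OF F'p])
  have sec: "integrable lebesgue (\<lambda>x. F (t, x)) \<and> integral\<^sup>L lebesgue (\<lambda>x. F (t, x)) = integral\<^sup>L lborel (\<lambda>x. F' (t, x))"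
    if "AE x in lborel. F (t, x) = F' (t, x)" "integrable lborel (\<lambda>x. F' (t, x))" for t
  proof -
    have mb: "(\<lambda>x. F' (t, x)) \<in> borel_measurable lborel" by (rule borel_measurable_integrable[OF that(2)])
    have m': "(\<lambda>x. F' (t, x)) \<in> borel_measurable lebesgue" by (rule measurable_completion[OF mb])
    have ae: "AE x in lebesgue. F (t, x) = F' (t, x)" by (rule AE_completion[OF that(1)])
    have m: "(\<lambda>x. F (t, x)) \<in> borel_measurable lebesgue"
      by (rule measurable_lebesgue_AE_UNIV[OF m' ae])
    have "integrable lebesgue (\<lambda>x. F' (t, x))" using integrable_completion[OF mb] that(2) by simp
    then show ?thesis
      using integrable_cong_AE[OF m m' ae] integral_cong_AE[OF m m' ae] integral_completion[OF mb] by simp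
  qed
  have ae: "AE t in lborel. integrable lebesgue (\<lambda>x. F (t, x)) \<and> integral\<^sup>L lebesgue (\<lambda>x. F (t, x)) = integral\<^sup>L lborel (\<lambda>x. F' (t, x))"
    using aeF aeI by eventually_elim (rule sec)
  have FA: "(\<lambda>x. F (t, x)) = (\<lambda>x. if x \<in> B then f (t, x) else 0)" if "t \<in> A" for t
    using that by (auto simp: F_def)
  have aeA: "AE t in lebesgue_on A. t \<in> A \<and> integrable lebesgue (\<lambda>x. F (t, x)) \<and> integral\<^sup>L lebesgue (\<lambda>x. F (t, x)) = integral\<^sup>L lborel (\<lambda>x. F' (t, x))"
  proof (subst AE_restrict_space_iff)
    show "A \<inter> space lebesgue \<in> sets lebesgue" using sets(2) by simp
    show "AE t\<in>A in lebesgue. t \<in> A \<and> integrable lebesgue (\<lambda>x. F (t, x)) \<and> integral\<^sup>L lebesgue (\<lambda>x. F (t, x)) = integral\<^sup>L lborel (\<lambda>x. F' (t, x))"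
      using AE_completion[OF ae] by eventually_elim simp
  qed
  show "AE t in lebesgue_on A. integrable (lebesgue_on B) (\<lambda>x. f (t, x))"
    using aeA by eventually_elim (use FA sets(3) in \<open>auto simp: Lebesgue_Measure.integrable_restrict_UNIV\<close>)
  have g: "integrable lborel (\<lambda>t. integral\<^sup>L lborel (\<lambda>x. F' (t, x)))" by (rule lborel_pair.integrable_fst'[OF F'p])
  have gm: "(\<lambda>t. integral\<^sup>L lborel (\<lambda>x. F' (t, x))) \<in> borel_measurable lborel" by (rule borel_measurable_integrable[OF g])
  have gl: "integrable lebesgue (\<lambda>t. integral\<^sup>L lborel (\<lambda>x. F' (t, x)))" using integrable_completion[OF gm] g by simp
  define G where "G t = (if t \<in> A then (LINT x|lebesgue_on B. f (t, x)) else 0)" for t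
  have aeG: "AE t in lebesgue. G t = integral\<^sup>L lborel (\<lambda>x. F' (t, x))"
    using AE_completion[OF ae]
  proof eventually_elim
    case (elim t)
    show ?case
    proof (cases "t \<in> A")
      case True
      have "G t = integral\<^sup>L lebesgue (\<lambda>x. F (t, x))"
        unfolding FA[OF True] Lebesgue_Measure.integral_restrict_UNIV[OF sets(3)] using True by (simp add: G_def)
      then show ?thesis using elim by simp
    next
      case False
      then have "(\<lambda>x. F (t, x)) = (\<lambda>x. 0)" by (auto simp: F_def)
      then have "integral\<^sup>L lebesgue (\<lambda>x. F (t, x)) = 0" by simp
      then show ?thesis using elim False by (simp add: G_def)
    qed
  qed
  have Gm: "G \<in> borel_measurable lebesgue"
    by (rule measurable_lebesgue_AE_UNIV[OF borel_measurable_integrable[OF gl] aeG])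
  have Gi: "integrable lebesgue G" using integrable_cong_AE[OF Gm borel_measurable_integrable[OF gl] aeG] gl by simp
  show "integrable (lebesgue_on A) (\<lambda>t. LINT x|lebesgue_on B. f (t, x))"
    using Gi unfolding G_def by (simp add: Lebesgue_Measure.integrable_restrict_UNIV[OF sets(2)])
  have "(LINT t|lebesgue_on A. LINT x|lebesgue_on B. f (t, x)) = integral\<^sup>L lebesgue G"
    unfolding G_def by (rule Lebesgue_Measure.integral_restrict_UNIV[OF sets(2), symmetric])
  also have "\<dots> = integral\<^sup>L lborel (\<lambda>t. integral\<^sup>L lborel (\<lambda>x. F' (t, x)))"
    using integral_cong_AE[OF Gm borel_measurable_integrable[OF gl] aeG] integral_completion[OF gm] by simp
  also have "\<dots> = integral\<^sup>L (lborel \<Otimes>\<^sub>M lborel) F'" by (rule lborel_pair.integral_fst'[OF F'p])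
  also have "\<dots> = (LINT z|lebesgue_on (A \<times> B). f z)" using F'int Fint by (simp add: lborel_prod)
  finally show "(LINT z|lebesgue_on (A \<times> B). f z) = (LINT t|lebesgue_on A. LINT x|lebesgue_on B. f (t, x))" by simp
qed

section \<open>Decay of the energy at the end points\<close>

lemma square_exp_decay:
  fixes k :: real
  assumes "k > 0"
  shows "((\<lambda>y. y\<^sup>2 * exp (- k * y)) \<longlongrightarrow> 0) at_top"
proof -
  have "filterlim (\<lambda>y. k * y) at_top at_top"
    using assms by (intro filterlim_tendsto_pos_mult_at_top[OF tendsto_const _ filterlim_ident])
  then have "((\<lambda>y. (k * y)\<^sup>2 / exp (k * y)) \<longlongrightarrow> 0) at_top"
    by (rule filterlim_compose[OF tendsto_power_div_exp_0])
  then have "((\<lambda>y. (1 / k\<^sup>2) * ((k * y)\<^sup>2 / exp (k * y))) \<longlongrightarrow> 0) at_top"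
    by (rule tendsto_mult_right_zero)
  moreover have "(1 / k\<^sup>2) * ((k * y)\<^sup>2 / exp (k * y)) = y\<^sup>2 * exp (- k * y)" for y
    using assms by (simp add: power_mult_distrib exp_minus field_simps)
  ultimately show ?thesis by simp
qed

context solution
begin

text \<open>The three components of v are bounded in L2 on [0,T] by continuity. Conjugation
  contributes at most Theta^2 and two factors exp(-s d Theta); the assumption Theta \<ge> 1 lets all
  terms be compared with Theta^2.\<close>

lemma energy_bound:
  assumes s: "s > 0"
  obtains K \<delta> where "\<delta> > 0" "\<And>t. 0 < t \<Longrightarrow> t < T \<Longrightarrow> Theta T t \<ge> 1 \<Longrightarrow>
    \<bar>En s t\<bar> \<le> K * ((Theta T t)\<^sup>2 * exp (- \<delta> * Theta T t))"
proof -
  obtain d where d: "d > 0" "\<And>x. x \<in> {0..1} \<Longrightarrow> ps x \<le> - d" using psi_neg by blast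
  obtain PB where PB: "PB > 0" "\<And>x. x \<in> {0..1} \<Longrightarrow> \<bar>ps x\<bar> \<le> PB" using psi_bound by blast
  obtain M1 where M1: "M1 \<ge> 0" "\<And>t. t \<in> {0..T} \<Longrightarrow> n2 (v t) \<le> M1" using curve_bounded[OF curve_v] by blast
  obtain M2 where M2: "M2 \<ge> 0" "\<And>t. t \<in> {0..T} \<Longrightarrow> n2 (grad (v t)) \<le> M2" using curve_bounded[OF curve_grad] by blast
  obtain M3 where M3: "M3 \<ge> 0" "\<And>t. t \<in> {0..T} \<Longrightarrow> n2 (sing (v t)) \<le> M3" using curve_bounded[OF curve_sing] by blast
  define c where "c = 4 * T ^ 7 + 28 * T ^ 6"
  have c0: "c \<ge> 0" using T by (simp add: c_def)
  define al where "al = M2 + s * c1 * sqrt Gam * M1"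
  have al0: "al \<ge> 0" unfolding al_def using M1 M2 s c1 Gam_nonneg by simp
  define mb where "mb = s * c * PB + (s * c1)\<^sup>2 * Gam"
  have mb0: "mb \<ge> 0" unfolding mb_def using s c0 PB Gam_nonneg by simp
  define K where "K = al\<^sup>2 / 2 + \<bar>lam\<bar> * (M3\<^sup>2 / 2) + mb * M1\<^sup>2 / 2"
  show thesis
  proof (rule that[of "2 * (s * d)" K])
    show "2 * (s * d) > 0" using s d by simp
    fix t assume t: "0 < t" "t < T" and y1: "Theta T t \<ge> 1"
    define y where "y = Theta T t"
    have y: "y \<ge> 1" "y > 0" using y1 by (simp_all add: y_def)
    have tm: "t \<in> {0..T}" using t by simp
    note v = H1abD[OF v_XH[OF tm]]
    define E0 where "E0 = exp (- (s * d * y))"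
    have E0: "E0 > 0" by (simp add: E0_def)
    have eb: "\<bar>ee s t x\<bar> \<le> E0" if "x \<in> {0<..<1}" for x
    proof -
      have "s * y * ps x \<le> s * y * (- d)" using d(2)[of x] that s y by (intro mult_left_mono) auto
      then show ?thesis by (simp add: E0_def y_def[symmetric] mult_ac)
    qed
    have em[measurable]: "ee s t \<in> borel_measurable I01" by measurable
    have W: "n2 (WW s t) \<le> E0 * M1" and WL: "WW s t \<in> L2I"
    proof -
      have "n2 (WW s t) \<le> E0 * n2 (v t)" by (rule n2_bdd_mult[OF v(4) em eb])
      also have "\<dots> \<le> E0 * M1" using M1(2)[OF tm] E0 by simp
      finally show "n2 (WW s t) \<le> E0 * M1" .
      show "WW s t \<in> L2I" by (rule L2_bdd_mult[OF v(4) em eb])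
    qed
    have S: "n2 (SS s t) \<le> E0 * M3"
    proof -
      have "n2 (SS s t) \<le> E0 * n2 (sing (v t))" by (rule n2_bdd_mult[OF v(5) em eb])
      also have "\<dots> \<le> E0 * M3" using M3(2)[OF tm] E0 by simp
      finally show ?thesis .
    qed
    have P: "n2 (PP s t) \<le> E0 * (al * y)"
    proof -
      have gm: "(\<lambda>x. s * Theta T t * c1 * gam x * ee s t x) \<in> borel_measurable I01" by measurable
      have gb: "\<bar>s * Theta T t * c1 * gam x * ee s t x\<bar> \<le> (s * y * c1 * sqrt Gam) * E0" if x: "x \<in> {0<..<1}" for x
      proof -
        have "\<bar>s * Theta T t * c1 * gam x * ee s t x\<bar> = (s * y * c1 * \<bar>gam x\<bar>) * \<bar>ee s t x\<bar>"
          using s y c1 by (simp add: abs_mult y_def[symmetric])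
        also have "\<dots> \<le> (s * y * c1 * sqrt Gam) * E0"
          using s y c1 gam_abs[OF x] eb[OF x] Gam_nonneg by (intro mult_mono mult_left_mono) auto
        finally show ?thesis .
      qed
      have "n2 (PP s t) \<le> n2 (\<lambda>x. ee s t x * grad (v t) x) + n2 (\<lambda>x. s * Theta T t * c1 * gam x * ee s t x * v t x)"
        by (rule n2_triangle[OF L2_bdd_mult[OF v(3) em eb] L2_bdd_mult[OF v(4) gm gb]])
      also have "\<dots> \<le> E0 * n2 (grad (v t)) + (s * y * c1 * sqrt Gam) * E0 * n2 (v t)"
        by (rule add_mono[OF n2_bdd_mult[OF v(3) em eb] n2_bdd_mult[OF v(4) gm gb]])
      also have "\<dots> \<le> E0 * M2 + (s * y * c1 * sqrt Gam) * E0 * M1"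
        using M1(2)[OF tm] M2(2)[OF tm] E0 s y c1 Gam_nonneg by (intro add_mono mult_left_mono) auto
      also have "\<dots> \<le> E0 * (M2 * y) + (s * y * c1 * sqrt Gam) * E0 * M1"
        using E0 M2(1) y by (intro add_right_mono mult_left_mono) (auto simp: mult_le_cancel_left1)
      also have "\<dots> = E0 * (al * y)" by (simp add: al_def algebra_simps)
      finally show ?thesis .
    qed
    have mm: "mc s t \<in> borel_measurable I01" by measurable
    have mbd: "\<bar>mc s t x\<bar> \<le> mb * y\<^sup>2" if x: "x \<in> {0<..<1}" for x
    proof -
      have "\<bar>(- s * Th1 T t) * ps x\<bar> = s * \<bar>Th1 T t\<bar> * \<bar>ps x\<bar>" using s by (simp add: abs_mult)
      also have "\<dots> \<le> s * (c * y\<^sup>2) * PB"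
        using s Theta_bounds(1)[OF T t] PB(2)[of x] x c0 unfolding y_def c_def[symmetric] by (intro mult_mono) auto
      finally have 1: "\<bar>(- s * Th1 T t) * ps x\<bar> \<le> s * (c * y\<^sup>2) * PB" .
      have "\<bar>(s * Theta T t * c1)\<^sup>2 * p2a x\<bar> = (s * y * c1)\<^sup>2 * \<bar>p2a x\<bar>" by (simp add: abs_mult y_def)
      also have "\<dots> \<le> (s * y * c1)\<^sup>2 * Gam" using p2a_abs[OF x] by (intro mult_left_mono) auto
      finally have 2: "\<bar>(s * Theta T t * c1)\<^sup>2 * p2a x\<bar> \<le> (s * y * c1)\<^sup>2 * Gam" .
      have 3: "s * (c * y\<^sup>2) * PB + (s * y * c1)\<^sup>2 * Gam = mb * y\<^sup>2"
        by (simp add: mb_def power_mult_distrib algebra_simps)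
      show ?thesis using 1 2 3 abs_triangle_ineq[of "(- s * Th1 T t) * ps x" "(s * Theta T t * c1)\<^sup>2 * p2a x"] by linarith
    qed
    have MW: "n2 (\<lambda>x. mc s t x * WW s t x) \<le> (mb * y\<^sup>2) * (E0 * M1)"
    proof -
      have "n2 (\<lambda>x. mc s t x * WW s t x) \<le> (mb * y\<^sup>2) * n2 (WW s t)" by (rule n2_bdd_mult[OF WL mm mbd])
      also have "\<dots> \<le> (mb * y\<^sup>2) * (E0 * M1)" using W mb0 by (intro mult_left_mono) auto
      finally show ?thesis .
    qed
    have e2: "E0\<^sup>2 = exp (- (2 * (s * d)) * y)" by (simp add: E0_def power2_eq_square flip: exp_add)
    have y2: "1 \<le> y\<^sup>2" using y by simp
    have "ip (PP s t) (PP s t) \<le> (E0 * (al * y))\<^sup>2" "0 \<le> ip (PP s t) (PP s t)"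
      unfolding n2_sq[symmetric] using P n2_nonneg by (auto intro: power_mono)
    then have t1: "\<bar>ip (PP s t) (PP s t) / 2\<bar> \<le> (al\<^sup>2 / 2) * (y\<^sup>2 * E0\<^sup>2)" by (simp add: power_mult_distrib mult_ac)
    have "ip (SS s t) (SS s t) \<le> (E0 * M3)\<^sup>2" "0 \<le> ip (SS s t) (SS s t)"
      unfolding n2_sq[symmetric] using S n2_nonneg by (auto intro: power_mono)
    then have "\<bar>ip (SS s t) (SS s t) / 2\<bar> \<le> (M3\<^sup>2 / 2) * (1 * E0\<^sup>2)" by (simp add: power_mult_distrib mult_ac)
    also have "\<dots> \<le> (M3\<^sup>2 / 2) * (y\<^sup>2 * E0\<^sup>2)" using y2 by (intro mult_left_mono mult_right_mono) auto
    finally have "\<bar>lam * (ip (SS s t) (SS s t) / 2)\<bar> \<le> \<bar>lam\<bar> * ((M3\<^sup>2 / 2) * (y\<^sup>2 * E0\<^sup>2))"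
      unfolding abs_mult[of lam] by (intro mult_left_mono) auto
    then have t2: "\<bar>lam * (ip (SS s t) (SS s t) / 2)\<bar> \<le> (\<bar>lam\<bar> * (M3\<^sup>2 / 2)) * (y\<^sup>2 * E0\<^sup>2)" by (simp only: mult.assoc)
    have "\<bar>ip (\<lambda>x. mc s t x * WW s t x) (WW s t)\<bar> \<le> n2 (\<lambda>x. mc s t x * WW s t x) * n2 (WW s t)"
      by (rule Cauchy_Schwarz_L2[OF L2_bdd_mult[OF WL mm mbd] WL])
    also have "\<dots> \<le> ((mb * y\<^sup>2) * (E0 * M1)) * (E0 * M1)"
      using MW W mb0 E0 M1(1) by (intro mult_mono n2_nonneg) auto
    finally have t3: "\<bar>ip (\<lambda>x. mc s t x * WW s t x) (WW s t) / 2\<bar> \<le> (mb * M1\<^sup>2 / 2) * (y\<^sup>2 * E0\<^sup>2)"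
      by (simp add: power2_eq_square mult_ac)
    have "\<bar>En s t\<bar> \<le> (al\<^sup>2 / 2) * (y\<^sup>2 * E0\<^sup>2) + (\<bar>lam\<bar> * (M3\<^sup>2 / 2)) * (y\<^sup>2 * E0\<^sup>2) + (mb * M1\<^sup>2 / 2) * (y\<^sup>2 * E0\<^sup>2)"
      using t1 t2 t3 unfolding En_def by linarith
    also have "\<dots> = K * (y\<^sup>2 * E0\<^sup>2)" by (simp only: K_def distrib_right)
    finally show "\<bar>En s t\<bar> \<le> K * ((Theta T t)\<^sup>2 * exp (- (2 * (s * d)) * Theta T t))"
      unfolding e2 y_def .
  qed
qed

lemma energy_limit:
  assumes s: "s > 0"
  shows "(En s \<longlongrightarrow> 0) (at_right 0)" "(En s \<longlongrightarrow> 0) (at_left T)"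
proof -
  obtain K \<delta> where d: "\<delta> > 0" and K: "\<And>t. 0 < t \<Longrightarrow> t < T \<Longrightarrow> Theta T t \<ge> 1 \<Longrightarrow>
    \<bar>En s t\<bar> \<le> K * ((Theta T t)\<^sup>2 * exp (- \<delta> * Theta T t))"
    using energy_bound[OF s] by blast
  have lim: "((\<lambda>t. K * ((Theta T t)\<^sup>2 * exp (- \<delta> * Theta T t))) \<longlongrightarrow> 0) F" if "filterlim (Theta T) at_top F" for F
    by (rule tendsto_mult_right_zero[OF filterlim_compose[OF square_exp_decay[OF d] that]])
  have in0: "eventually (\<lambda>t. 0 < t \<and> t < T) (at_right 0)"
    using T unfolding eventually_at_right_field by (intro exI[of _ T]) auto
  have inT: "eventually (\<lambda>t. 0 < t \<and> t < T) (at_left T)"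
    using T unfolding eventually_at_left_field by (intro exI[of _ 0]) auto
  have big: "eventually (\<lambda>t. Theta T t \<ge> 1) F" if "filterlim (Theta T) at_top F" for F
    using that unfolding filterlim_at_top by blast
  show "(En s \<longlongrightarrow> 0) (at_right 0)"
  proof (rule Lim_null_comparison[OF _ lim[OF Theta_at_top(1)[OF T]]])
    show "\<forall>\<^sub>F t in at_right 0. norm (En s t) \<le> K * ((Theta T t)\<^sup>2 * exp (- \<delta> * Theta T t))"
      using in0 big[OF Theta_at_top(1)[OF T]] by eventually_elim (use K in auto)
  qed
  show "(En s \<longlongrightarrow> 0) (at_left T)"
  proof (rule Lim_null_comparison[OF _ lim[OF Theta_at_top(2)[OF T]]])
    show "\<forall>\<^sub>F t in at_left T. norm (En s t) \<le> K * ((Theta T t)\<^sup>2 * exp (- \<delta> * Theta T t))"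
      using inT big[OF Theta_at_top(2)[OF T]] by eventually_elim (use K in auto)
  qed
qed

text \<open>Integrate over \<open>{p..q}\<close> inside (0,T), where the energy is absolutely
  continuous, and let p tend to 0 and q to T. Both boundary energies vanish in the limit, so
  \<open>Gn\<close> leaves no trace.\<close>

lemma energy_inequality:
  fixes f g :: "real \<Rightarrow> real"
  assumes s: "s > 0" and f: "integrable (lebesgue_on {0<..<T}) f" and g: "integrable (lebesgue_on {0<..<T}) g"
    and f0: "\<And>t. t \<in> {0<..<T} \<Longrightarrow> 0 \<le> g t"
    and le: "AE t in lebesgue_on {0<..<T}. f t + Gn s t \<le> g t"
  shows "(LINT t|lebesgue_on {0<..<T}. f t) \<le> (LINT t|lebesgue_on {0<..<T}. g t)"
proof -
  have fa: "f absolutely_integrable_on {0..T}" and ga: "g absolutely_integrable_on {0..T}"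
    using f g by (simp_all add: integrable_Ioo_iff)
  have step: "integral {p..q} f \<le> integral {p..q} g + En s p - En s q" if pq: "0 < p" "p \<le> q" "q < T" for p q
  proof -
    note fi = abs_int_sub_int[OF fa less_imp_le[OF pq(1)] less_imp_le[OF pq(3)]]
      and gi = abs_int_sub_int[OF ga less_imp_le[OF pq(1)] less_imp_le[OF pq(3)]]
    have "- En s p + integral {p..q} (\<lambda>t. f t - g t) \<le> - En s q"
    proof (rule ac_on_lower[OF ac_on_minus[OF energy_ac[OF pq(1,3)]] pq(2) integrable_diff[OF fi gi]])
      show "AE t in lebesgue_on {p<..<q}. f t - g t \<le> - Gn s t"
        using AE_sub_Ioo[OF le less_imp_le[OF pq(1)] less_imp_le[OF pq(3)]] by eventually_elim simp
    qed
    then show ?thesis using Henstock_Kurzweil_Integration.integral_diff[OF fi gi] by simp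
  qed
  have acf: "ac_on 0 T (\<lambda>x. 0 + integral {0..x} f) f" by (rule ac_on_integral[OF fa])
  have acg: "ac_on 0 T (\<lambda>x. 0 + integral {0..x} g) g" by (rule ac_on_integral[OF ga])
  have "integral {0..T} f \<le> integral {0..T} g + e" if e: "e > 0" for e
  proof -
    \<comment> \<open>Six errors: the energies at p and q, and the missing ends of the integrals of
      f and of g.\<close>
    define \<epsilon> where "\<epsilon> = e / 6"
    have eps: "\<epsilon> > 0" using e by (simp add: \<epsilon>_def)
    obtain d1 where d1: "d1 > 0" "\<And>x y. x \<in> {0..T} \<Longrightarrow> y \<in> {0..T} \<Longrightarrow> \<bar>x - y\<bar> < d1 \<Longrightarrow>
        \<bar>(0 + integral {0..x} f) - (0 + integral {0..y} f)\<bar> < \<epsilon>"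
      using unif_cont_Icc[OF ac_on_cont[OF acf] eps] by blast
    obtain d2 where d2: "d2 > 0" "\<And>x y. x \<in> {0..T} \<Longrightarrow> y \<in> {0..T} \<Longrightarrow> \<bar>x - y\<bar> < d2 \<Longrightarrow>
        \<bar>(0 + integral {0..x} g) - (0 + integral {0..y} g)\<bar> < \<epsilon>"
      using unif_cont_Icc[OF ac_on_cont[OF acg] eps] by blast
    have "eventually (\<lambda>t. \<bar>En s t\<bar> < \<epsilon>) (at_right 0)"
      using tendstoD[OF energy_limit(1)[OF s] eps] by (simp add: dist_real_def)
    then obtain b0 where b0: "b0 > 0" "\<And>t. 0 < t \<Longrightarrow> t < b0 \<Longrightarrow> \<bar>En s t\<bar> < \<epsilon>"
      unfolding eventually_at_right_field by blast
    have "eventually (\<lambda>t. \<bar>En s t\<bar> < \<epsilon>) (at_left T)"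
      using tendstoD[OF energy_limit(2)[OF s] eps] by (simp add: dist_real_def)
    then obtain b1 where b1: "b1 < T" "\<And>t. b1 < t \<Longrightarrow> t < T \<Longrightarrow> \<bar>En s t\<bar> < \<epsilon>"
      unfolding eventually_at_left_field by blast
    define p where "p = min (min d1 d2) (min b0 T) / 2"
    define q where "q = T - min (min d1 d2) (min (T - b1) T) / 2"
    have p: "0 < p" "p < d1" "p < d2" "p < b0" "p \<le> T / 2"
      using d1(1) d2(1) b0(1) T unfolding p_def by (auto simp: min_def)
    have q: "q < T" "T - q < d1" "T - q < d2" "b1 < q" "T / 2 \<le> q"
      using d1(1) d2(1) b1(1) T unfolding q_def by (auto simp: min_def field_simps)
    have pq: "p \<le> q" using p q by linarith
    have mem: "p \<in> {0..T}" "q \<in> {0..T}" "0 \<in> {0..T}" "T \<in> {0..T}" using p q T by auto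
    have "\<bar>En s p\<bar> < \<epsilon>" "\<bar>En s q\<bar> < \<epsilon>" using b0(2) b1(2) p q by auto
    moreover have "\<bar>(0 + integral {0..p} f) - (0 + integral {0..0} f)\<bar> < \<epsilon>" by (rule d1(2)[OF mem(1,3)]) (use p in auto)
    moreover have "\<bar>(0 + integral {0..q} f) - (0 + integral {0..T} f)\<bar> < \<epsilon>" by (rule d1(2)[OF mem(2,4)]) (use q in auto)
    moreover have "\<bar>(0 + integral {0..p} g) - (0 + integral {0..0} g)\<bar> < \<epsilon>" by (rule d2(2)[OF mem(1,3)]) (use p in auto)
    moreover have "\<bar>(0 + integral {0..q} g) - (0 + integral {0..T} g)\<bar> < \<epsilon>" by (rule d2(2)[OF mem(2,4)]) (use q in auto)
    moreover have "integral {p..q} f = (0 + integral {0..q} f) - (0 + integral {0..p} f)"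
      by (rule ac_on_diff[OF acf]) (use p q pq in auto)
    moreover have "integral {p..q} g = (0 + integral {0..q} g) - (0 + integral {0..p} g)"
      by (rule ac_on_diff[OF acg]) (use p q pq in auto)
    moreover have "integral {0..0} f = 0" "integral {0..0} g = 0" by simp_all
    moreover note step[OF p(1) pq q(1)]
    ultimately show ?thesis unfolding \<epsilon>_def by linarith
  qed
  then have "integral {0..T} f \<le> integral {0..T} g" by (rule field_le_epsilon)
  then show ?thesis by (simp add: lint_Ioo[OF f] lint_Ioo[OF g])
qed

end

section \<open>The Carleman estimate\<close>

text \<open>From k y \<le> exp (k y). It makes Theta e^{2 s phi} bounded in time at each fixed x, as
  the boundary integrals require.\<close>

lemma times_exp_bounded:
  fixes k y z :: real
  assumes "0 < k" "0 < y" "z \<le> - (k * y)"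
  shows "\<bar>y * exp z\<bar> \<le> 1 / k"
proof -
  have "k * y \<le> exp (k * y)" using exp_ge_add_one_self[of "k * y"] by linarith
  then have "y * exp (- (k * y)) \<le> 1 / k" using assms(1) by (simp add: exp_minus field_simps)
  moreover have "y * exp z \<le> y * exp (- (k * y))" using assms by simp
  moreover have "\<bar>y * exp z\<bar> = y * exp z" using assms(2) by simp
  ultimately show ?thesis by linarith
qed

context coeffs
begin

text \<open>The flux F and a y agree almost everywhere, and both are continuous on [0, x0/2] and on
  [(x0 + 1)/2, 1], which stay away from x0. So they agree at the end points, and the boundary values
  of v_x are given by bounded functionals of v.\<close>

lemma boundary_flux:
  assumes u: "u \<in> X2" and y: "has_weak_deriv u y" "continuous_on ({0..1} - {x0}) y"
  shows "AE x in I01. y x = wderiv u x" "a 1 * y 1 = trace1 u" "a 0 * y 0 = trace0 u"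
proof -
  show ae: "AE x in I01. y x = wderiv u x" using wderiv_AE[OF y(1)] by eventually_elim simp
  obtain F where F: "ac_on 0 1 F (flux_deriv a u)" "AE x in I01. F x = a x * wderiv u x" "F 1 = trace1 u" "F 0 = trace0 u"
    using flux_rep[OF u] by blast
  define D where "D x = F x - a x * y x" for x
  have D0: "AE x in I01. D x = 0" using F(2) ae by eventually_elim (simp add: D_def)
  have Dc: "continuous_on {p..q} D" if "{p..q} \<subseteq> {0..1} - {x0}" for p q
    unfolding D_def using that
    by (intro continuous_intros continuous_on_subset[OF ac_on_cont[OF F(1)]] continuous_on_subset[OF a_cont]
        continuous_on_subset[OF y(2)]) auto
  have "D 1 = 0"
    by (rule AE_zero_imp_zero[where p = "(x0 + 1) / 2" and q = 1])
      (use x0 in \<open>auto intro!: AE_sub_Ioo[OF D0] Dc\<close>)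
  moreover have "D 0 = 0"
    by (rule AE_zero_imp_zero[where p = 0 and q = "x0 / 2"])
      (use x0 in \<open>auto intro!: AE_sub_Ioo[OF D0] Dc\<close>)
  ultimately show "a 1 * y 1 = trace1 u" "a 0 * y 0 = trace0 u" using F(3,4) by (simp_all add: D_def)
qed

lemma exp_phi: "exp (2 * s * phi T a x0 c1 c2 t x) = (exp (s * Theta T t * ps x))\<^sup>2"
  by (simp add: phi_def power2_eq_square flip: exp_add)

abbreviation "weighted_energy s t u y \<equiv> (LINT x|I01.
    (s * Theta T t * a x * (y x)\<^sup>2 + s ^ 3 * Theta T t ^ 3 * ((x - x0)\<^sup>2 / a x) * (u x)\<^sup>2)
    * exp (2 * s * phi T a x0 c1 c2 t x))"

abbreviation "boundary_term s t y1 y0 \<equiv>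
    a 1 * Theta T t * exp (2 * s * phi T a x0 c1 c2 t 1) * (1 - x0) * (y1)\<^sup>2
    - a 0 * Theta T t * exp (2 * s * phi T a x0 c1 c2 t 0) * (0 - x0) * (y0)\<^sup>2"

text \<open>At x = 0 the factor x - x0 is negative and the bracket enters with a minus sign, so both
  ends contribute positively.\<close>

lemma boundary_term_nonneg: "t \<in> {0<..<T} \<Longrightarrow> 0 \<le> boundary_term s t y1 y0"
  using a_nonneg[of 0] a_nonneg[of 1] x0 Theta_pos[of t T]
  by (simp add: mult_nonpos_nonneg mult_nonneg_nonpos)

end

context solution
begin

text \<open>The locale \<open>slice\<close> is entered at one good time with \<open>vt'\<close> as
  time derivative, so that the estimate for w becomes one for v with the energy derivative
  \<open>Gn\<close> kept apart.\<close>

lemma pointwise_estimate: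
  assumes s: "s > 0" and t: "t \<in> {0<..<T}" and X2: "v t \<in> X2" and vt: "vt' t = vt t"
    and e: "AE x in I01. vt t x + flux_deriv a (v t) x + lam / b x * v t x = h (t, x)"
    and y: "has_weak_deriv (v t) y" "continuous_on ({0..1} - {x0}) y"
    and PB: "\<And>x. x \<in> {0..1} \<Longrightarrow> \<bar>ps x\<bar> \<le> PB"
    and large: "(4 * T ^ 7 + 28 * T ^ 6) * PB + 4 * c1 * (4 * T ^ 7 + 28 * T ^ 6) \<le> \<kappa> * c1\<^sup>2 * s"
  shows "\<kappa> / 2 / (2 / c1 + 1 / c1 ^ 3) * weighted_energy s t (v t) y + Gn s t
    \<le> (LINT x|I01. (h (t, x))\<^sup>2 * exp (2 * s * phi T a x0 c1 c2 t x)) / 2 + s * c1 * boundary_term s t (y 1) (y 0)"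
proof -
  have tt: "0 < t" "t < T" "t \<in> {0..T}" using t by auto
  have e': "AE x in I01. vt' t x + flux_deriv a (v t) x + lam / b x * v t x = h (t, x)"
    unfolding vt by (rule e)
  interpret sl: slice a b x0 K1 lam \<beta> \<kappa> c1 c2 T s "Theta T t" "Th1 T t" "v t" "vt' t" "\<lambda>x. h (t, x)"
    by unfold_locales (rule s Theta_pos[OF tt(1,2)] v_XH[OF tt(3)] X2 v_cont[OF tt(3)] vt'_XH e')+
  note f = boundary_flux[OF X2 y]
  have a1: "a 1 > 0" "a 0 > 0" using a_pos[of 1] a_pos[of 0] x0 by auto
  have y1: "trace1 (v t) = a 1 * y 1" "trace0 (v t) = a 0 * y 0" using f by simp_all
  define C where "C = 2 / c1 + 1 / c1 ^ 3"
  have C: "C > 0" using c1 by (simp add: C_def add_pos_pos)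
  define X where "X = sl.kk * Aint sl.W' + sl.kk ^ 3 * Bint sl.W"
  have "weighted_energy s t (v t) y \<le> C * X"
    unfolding exp_phi C_def X_def by (rule sl.weighted_bound[OF f(1)])
  then have "\<kappa> / 2 / C * weighted_energy s t (v t) y \<le> \<kappa> / 2 / C * (C * X)"
    using kappa C by (intro mult_left_mono) auto
  also have "\<dots> = \<kappa> / 2 * X" using C by simp
  finally have w: "\<kappa> / 2 / C * weighted_energy s t (v t) y \<le> \<kappa> / 2 * X" .
  have bt: "s * c1 * boundary_term s t (y 1) (y 0)
      = sl.kk * ((1 - x0) * (sl.ww 1 * trace1 (v t))\<^sup>2 / a 1 + x0 * (sl.ww 0 * trace0 (v t))\<^sup>2 / a 0)"
    unfolding exp_phi y1 using a1 by (simp add: power2_eq_square field_simps)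
  have "Gn s t + \<kappa> / 2 * X \<le> (LINT x|I01. (h (t, x))\<^sup>2 * exp (2 * s * phi T a x0 c1 c2 t x)) / 2
      + s * c1 * boundary_term s t (y 1) (y 0)"
    unfolding bt unfolding exp_phi X_def Gn_def
    by (rule sl.absorbed_estimate[OF Theta_bounds(1)[OF T tt(1,2)] Theta_bounds(2)[OF T tt(1,2)] PB large])
  then show ?thesis using w unfolding C_def by linarith
qed

lemma Theta_exp_measurable:
  assumes "c \<in> {0..1}"
  shows "(\<lambda>t. Theta T t * exp (2 * s * phi T a x0 c1 c2 t c)) \<in> borel_measurable (lebesgue_on {0<..<T})"
  unfolding phi_def Theta_def
  by (rule continuous_imp_measurable_on_sets_lebesgue) (auto intro!: continuous_intros)

text \<open>The functional l is bounded on \<open>H2ab\<close> and v is square integrable in time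
  with values there; the time weight is bounded by \<open>1 / (2 * s * d)\<close>.\<close>

lemma boundary_integrable:
  assumes s: "s > 0" and l: "blf X2 N2 l" and c: "c \<in> {0..1}"
  shows "integrable (lebesgue_on {0<..<T}) (\<lambda>t. (Theta T t * exp (2 * s * phi T a x0 c1 c2 t c)) * (l (v t))\<^sup>2)"
proof -
  obtain d where d: "d > 0" "\<And>x. x \<in> {0..1} \<Longrightarrow> ps x \<le> - d" using psi_neg by blast
  note i = bochner_L2_blf_sq[OF l v2 T]
  note [measurable] = borel_measurable_integrable[OF i] Theta_exp_measurable[OF c, of s]
  show ?thesis
  proof (rule Bochner_Integration.integrable_bound)
    show "integrable (lebesgue_on {0<..<T}) (\<lambda>t. (1 / (2 * s * d)) * (l (v t))\<^sup>2)" using i by simp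
    show "AE t in lebesgue_on {0<..<T}. norm (Theta T t * exp (2 * s * phi T a x0 c1 c2 t c) * (l (v t))\<^sup>2)
        \<le> norm ((1 / (2 * s * d)) * (l (v t))\<^sup>2)"
    proof (intro AE_I2)
      fix t assume "t \<in> space (lebesgue_on {0<..<T})"
      then have "Theta T t > 0" using Theta_pos[of t T] by simp
      moreover have "2 * s * phi T a x0 c1 c2 t c \<le> - ((2 * s * d) * Theta T t)"
      proof -
        have "(2 * s * Theta T t) * ps c \<le> (2 * s * Theta T t) * (- d)"
          using d(2)[OF c] s \<open>Theta T t > 0\<close> by (intro mult_left_mono) auto
        then show ?thesis by (simp add: phi_def mult_ac)
      qed
      ultimately have "\<bar>Theta T t * exp (2 * s * phi T a x0 c1 c2 t c)\<bar> \<le> 1 / (2 * s * d)"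
        using s d by (intro times_exp_bounded) auto
      then have "\<bar>Theta T t * exp (2 * s * phi T a x0 c1 c2 t c)\<bar> * (l (v t))\<^sup>2 \<le> (1 / (2 * s * d)) * (l (v t))\<^sup>2"
        by (intro mult_right_mono) auto
      moreover have "norm ((1 / (2 * s * d)) * (l (v t))\<^sup>2) = (1 / (2 * s * d)) * (l (v t))\<^sup>2"
        using s d by simp
      moreover have "norm (Theta T t * exp (2 * s * phi T a x0 c1 c2 t c) * (l (v t))\<^sup>2)
          = \<bar>Theta T t * exp (2 * s * phi T a x0 c1 c2 t c)\<bar> * (l (v t))\<^sup>2"
        by (simp add: abs_mult)
      ultimately show "norm (Theta T t * exp (2 * s * phi T a x0 c1 c2 t c) * (l (v t))\<^sup>2)
        \<le> norm ((1 / (2 * s * d)) * (l (v t))\<^sup>2)" by linarith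
    qed
  qed measurable
qed

abbreviation "Q \<equiv> {0<..<T} \<times> {0<..<1::real}"

lemma carleman_estimate:
  assumes s: "s > 0" and hL: "h \<in> L2 Q" and sd: "space_deriv T x0 v vx"
    and PB: "\<And>x. x \<in> {0..1} \<Longrightarrow> \<bar>ps x\<bar> \<le> PB"
    and large: "(4 * T ^ 7 + 28 * T ^ 6) * PB + 4 * c1 * (4 * T ^ 7 + 28 * T ^ 6) \<le> \<kappa> * c1\<^sup>2 * s"
  defines "C \<equiv> 2 * (2 / c1 + 1 / c1 ^ 3) / \<kappa>"
  shows "(LINT (t, x)|lebesgue_on Q.
         (s * Theta T t * a x * (vx t x)\<^sup>2
          + s ^ 3 * Theta T t ^ 3 * ((x - x0)\<^sup>2 / a x) * (v t x)\<^sup>2)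
         * exp (2 * s * phi T a x0 c1 c2 t x))
      \<le> C * ((LINT (t, x)|lebesgue_on Q. (h (t, x))\<^sup>2 * exp (2 * s * phi T a x0 c1 c2 t x))
             + s * c1 * (LINT t|lebesgue_on {0<..<T}. boundary_term s t (vx t 1) (vx t 0)))"
    (is "integral\<^sup>L _ ?f \<le> C * (integral\<^sup>L _ ?g + s * c1 * (LINT t|?M. ?b t))")
proof -
  have C: "C > 0" using c1 kappa by (simp add: C_def add_pos_pos)
  have b0: "0 \<le> ?b t" if "t \<in> {0<..<T}" for t by (rule boundary_term_nonneg[OF that])
  have g0: "0 \<le> integral\<^sup>L (lebesgue_on Q) ?g" by (rule Bochner_Integration.integral_nonneg) auto
  have B0: "0 \<le> (LINT t|?M. ?b t)" by (rule Bochner_Integration.integral_nonneg) (use b0 in simp)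
  show ?thesis
  proof (cases "integrable (lebesgue_on Q) ?f")
    \<comment> \<open>The integral of a function that is not integrable is 0 by convention, and the
      right side is nonnegative.\<close>
    case False
    then have "integral\<^sup>L (lebesgue_on Q) ?f = 0" by (rule not_integrable_integral_eq)
    then show ?thesis using C g0 B0 s c1 by simp
  next
    case fi: True
    have bor: "{0<..<T} \<in> sets borel" "{0<..<1::real} \<in> sets borel" by auto
    have gi: "integrable (lebesgue_on Q) ?g"
    proof (rule Bochner_Integration.integrable_bound)
      show h2: "integrable (lebesgue_on Q) (\<lambda>z. (h z)\<^sup>2)" using hL by (simp add: L2_def)
      have "continuous_on Q (\<lambda>z. exp (2 * s * (Theta T (fst z) * ps (snd z))))"
        unfolding Theta_def
        by (intro continuous_intros continuous_on_compose2[OF psi_cont]) auto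
      then have e: "(\<lambda>z. exp (2 * s * (Theta T (fst z) * ps (snd z)))) \<in> borel_measurable (lebesgue_on Q)"
        by (rule continuous_imp_measurable_on_sets_lebesgue) (simp add: open_Times borel_open)
      have "(\<lambda>z. (h z)\<^sup>2 * exp (2 * s * (Theta T (fst z) * ps (snd z)))) \<in> borel_measurable (lebesgue_on Q)"
        by (intro borel_measurable_times e borel_measurable_integrable[OF h2])
      then show "?g \<in> borel_measurable (lebesgue_on Q)" by (simp add: phi_def case_prod_beta')
      show "AE z in lebesgue_on Q. norm (?g z) \<le> norm ((h z)\<^sup>2)"
      proof (intro AE_I2)
        fix z assume "z \<in> space (lebesgue_on Q)"
        then obtain t x where z: "z = (t, x)" "0 < t" "t < T" "0 < x" "x < 1" by (cases z) auto
        obtain d where d: "d > 0" "\<And>x. x \<in> {0..1} \<Longrightarrow> ps x \<le> - d" using psi_neg by blast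
        have "ps x \<le> 0" using d(1) d(2)[of x] z by auto
        then have "2 * s * phi T a x0 c1 c2 t x \<le> 0"
          using s Theta_pos[OF z(2,3)] by (simp add: phi_def mult_nonneg_nonpos)
        then have "exp (2 * s * phi T a x0 c1 c2 t x) \<le> 1" by simp
        then show "norm (?g z) \<le> norm ((h z)\<^sup>2)" unfolding z(1) by (simp add: mult_left_le)
      qed
    qed
    note Ff = Fubini_lebesgue_on[OF bor fi] and Fg = Fubini_lebesgue_on[OF bor gi]
    define LI where "LI t = weighted_energy s t (v t) (vx t)" for t
    define HI where "HI t = (LINT x|I01. (h (t, x))\<^sup>2 * exp (2 * s * phi T a x0 c1 c2 t x))" for t
    have LI: "integrable ?M LI" "integral\<^sup>L (lebesgue_on Q) ?f = (LINT t|?M. LI t)"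
      using Ff(2,3) by (simp_all add: LI_def[abs_def])
    have HI: "integrable ?M HI" "integral\<^sup>L (lebesgue_on Q) ?g = (LINT t|?M. HI t)"
      using Fg(2,3) by (simp_all add: HI_def[abs_def])
    have v2X: "AE t in ?M. v t \<in> X2"
      by (rule strongly_measurable_AE_in[of T X2 N2]) (use v2 in \<open>simp add: bochner_L2_def\<close>)
    have ae: "AE t in ?M. t \<in> {0<..<T} \<and> v t \<in> X2 \<and> vt' t = vt t \<and>
        (AE x in I01. vt t x + flux_deriv a (v t) x + lam / b x * v t x = h (t, x)) \<and>
        has_weak_deriv (v t) (vx t) \<and> continuous_on ({0..1} - {x0}) (vx t)"
      using v2X vt'_AE eqn sd[unfolded space_deriv_def] AE_space[of ?M]
      by eventually_elim simp
    have a1: "a 1 > 0" "a 0 > 0" using a_pos[of 1] a_pos[of 0] x0 by auto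
    \<comment> \<open>The boundary term rewritten through the traces. Measurability in t of the end
      point values of vx is not given, whereas bounded functionals of v are measurable, and
      completeness transfers this to the boundary term.\<close>
    define BI where "BI t = (1 - x0) / a 1 * ((Theta T t * exp (2 * s * phi T a x0 c1 c2 t 1)) * (trace1 (v t))\<^sup>2)
        + x0 / a 0 * ((Theta T t * exp (2 * s * phi T a x0 c1 c2 t 0)) * (trace0 (v t))\<^sup>2)" for t
    have BIi: "integrable ?M BI"
      unfolding BI_def
      by (intro Bochner_Integration.integrable_add integrable_mult_right boundary_integrable[OF s] blf_traces) auto
    have bBI: "AE t in ?M. ?b t = BI t"
      using ae
    proof eventually_elim
      case (elim t)
      then have "trace1 (v t) = a 1 * vx t 1" "trace0 (v t) = a 0 * vx t 0"
        using boundary_flux[of "v t" "vx t"] by auto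
      then show ?case unfolding BI_def using a1 by (simp add: power2_eq_square field_simps)
    qed
    have bm: "?b \<in> borel_measurable ?M"
      by (rule measurable_lebesgue_AE[OF borel_measurable_integrable[OF BIi] bBI]) auto
    have bi: "integrable ?M ?b"
      using integrable_cong_AE[OF bm borel_measurable_integrable[OF BIi] bBI] BIi by simp
    have "(LINT t|?M. (1 / C) * LI t) \<le> (LINT t|?M. HI t / 2 + s * c1 * ?b t)"
    proof (rule energy_inequality[OF s])
      show "integrable ?M (\<lambda>t. (1 / C) * LI t)" using LI(1) by simp
      show "integrable ?M (\<lambda>t. HI t / 2 + s * c1 * ?b t)"
        by (intro Bochner_Integration.integrable_add integrable_mult_right bi integrable_divide HI(1))
      fix t assume t: "t \<in> {0<..<T}"
      have "0 \<le> HI t" unfolding HI_def by (rule Bochner_Integration.integral_nonneg) simp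
      moreover have "0 \<le> s * c1 * ?b t" using s c1 b0[OF t] by (intro mult_nonneg_nonneg) auto
      ultimately show "0 \<le> HI t / 2 + s * c1 * ?b t" by simp
    next
      show "AE t in ?M. (1 / C) * LI t + Gn s t \<le> HI t / 2 + s * c1 * ?b t"
        using ae
      proof eventually_elim
        case (elim t)
        have "1 / C = \<kappa> / 2 / (2 / c1 + 1 / c1 ^ 3)" by (simp add: C_def)
        then show ?case
          unfolding LI_def HI_def using pointwise_estimate[OF s _ _ _ _ _ _ PB large, of t "vx t"] elim by simp
      qed
    qed
    also have "\<dots> = (LINT t|?M. HI t) / 2 + s * c1 * (LINT t|?M. ?b t)"
      using HI(1) bi by (subst Bochner_Integration.integral_add) (auto simp only: integrable_mult_right integrable_divide integral_mult_right_zero integral_divide_zero)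
    also have "\<dots> \<le> (LINT t|?M. HI t) + s * c1 * (LINT t|?M. ?b t)"
      using g0 HI(2) by simp
    finally have "(1 / C) * (LINT t|?M. LI t) \<le> (LINT t|?M. HI t) + s * c1 * (LINT t|?M. ?b t)" by simp
    then have "C * ((1 / C) * (LINT t|?M. LI t)) \<le> C * ((LINT t|?M. HI t) + s * c1 * (LINT t|?M. ?b t))"
      using C by (intro mult_left_mono) auto
    moreover have "C * ((1 / C) * (LINT t|?M. LI t)) = (LINT t|?M. LI t)" using C by simp
    ultimately show ?thesis unfolding LI(2) HI(2) by linarith
  qed
qed

end

section \<open>Reduction of the Carleman hypothesis to the locale \<open>coeffs\<close>, and the
  final estimate\<close>

lemma degenerate_W11:
  assumes "WWD a b x0 K1 K2 \<or> WSD a b x0 K1 K2 \<or> SWD a b x0 K1 K2 \<or> SSD a b x0 K1 K2"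
  shows "degenerate a b x0 K1 K2" "a \<in> W11" "b \<in> W11" "0 < K2"
  using assms by (auto simp: WWD_def WSD_def SWD_def SSD_def W11_def W1inf_def)

lemma carleman_coeffs:
  assumes T: "T > 0" and hyp: "carleman_hyp a b lam x0 K1 K2" and K1: "K1 < 2"
    and c: "c1 > 0" "c2 > (SUP x\<in>{0..1}. psi_int a x0 x)"
  obtains \<beta> \<kappa> where "coeffs a b x0 K1 lam \<beta> \<kappa> c1 c2 T"
proof -
  have b: "basic_hyp a b lam x0 K1 K2"
    and bsign: "lam < 0 \<Longrightarrow> AE x in lebesgue_on {0..1}. (x - x0) * wderiv b x \<ge> 0"
    using hyp by (auto simp: carleman_hyp_def)
  have "WWD a b x0 K1 K2 \<or> WSD a b x0 K1 K2 \<or> SWD a b x0 K1 K2 \<or> SSD a b x0 K1 K2"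
    using b by (auto simp: basic_hyp_def)
  note d = degenerate_W11[OF this]
  have deg: "continuous_on {0..1} a" "continuous_on {0..1} b" "0 < x0" "x0 < 1" "a x0 = 0" "b x0 = 0"
    "\<And>x. x \<in> {0..1} \<Longrightarrow> x \<noteq> x0 \<Longrightarrow> 0 < a x" "\<And>x. x \<in> {0..1} \<Longrightarrow> x \<noteq> x0 \<Longrightarrow> 0 < b x"
    "AE x in I01. (x - x0) * wderiv a x \<le> K1 * a x" "AE x in I01. (x - x0) * wderiv b x \<le> K2 * b x"
    using d(1) by (auto simp: degenerate_def AE_Icc_Ioo)
  have ac: "ac_on 0 1 a (wderiv a)" "ac_on 0 1 b (wderiv b)"
    using d(2,3) wderiv_weak by (auto simp: W11_def intro!: weak_deriv_continuous_ac deg)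
  have co: "coeffs a b x0 K1 lam \<beta> \<kappa> c1 c2 T"
    if "AE x in I01. lam * ((x - x0) * wderiv b x) \<le> \<beta> * b x" "lam \<noteq> 0" "0 < \<kappa>" "\<kappa> \<le> 2 - K1"
      "\<And>u. u \<in> H1ab a b \<Longrightarrow> \<beta> * (LINT x|I01. (u x)\<^sup>2 / b x) \<le> (2 - K1 - \<kappa>) * (LINT x|I01. a x * (wderiv u x)\<^sup>2)"
    for \<beta> \<kappa>
    by unfold_locales (use that deg ac K1 c T in auto)
  show thesis
  proof (cases "lam < 0")
    case True
    have "AE x in I01. lam * ((x - x0) * wderiv b x) \<le> 0 * b x"
      using bsign[OF True, unfolded AE_Icc_Ioo]
    proof eventually_elim
      case (elim x)
      then show ?case using True by (simp add: mult_nonpos_nonneg)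
    qed
    \<comment> \<open>For lam < 0 the sign of (x - x0) b' makes the singular contribution
      favourable: \<open>\<beta>\<close> = 0, no Hardy inequality is spent, and all of 2 - K1
      remains.\<close>
    then show thesis by (intro that[OF co[of 0 "2 - K1"]]) (use True K1 in auto)
  next
    case False
    then obtain Cs where K: "K1 + K2 \<le> 2" and Cs: "best_hardy_constant a b Cs" "0 < lam" "lam < 1 / Cs"
      using b by (auto simp: basic_hyp_def)
    \<comment> \<open>Positivity of the best constant follows from 0 < lam < 1/Cs; this also
      excludes Cs = 0, for which 1/Cs would be 0.\<close>
    have "0 < 1 / Cs" using Cs by linarith
    then have Cp: "Cs > 0" by (simp add: zero_less_divide_iff)
    have lC: "lam * Cs < 1" using Cs(3) Cp by (simp add: field_simps)
    have hc: "\<And>u. u \<in> H1ab a b \<Longrightarrow> (LINT x|I01. (u x)\<^sup>2 / b x) \<le> Cs * (LINT x|I01. a x * (wderiv u x)\<^sup>2)"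
      using Cs(1) by (simp add: best_hardy_constant_def hardy_constant_def)
    \<comment> \<open>With \<open>\<beta>\<close> = lam K2 the singular term costs at most lam K2 Cs
      times the gradient term. Since K2 \<le> 2 - K1, this is at most the fraction lam Cs < 1 of 2 -
      K1, and \<open>\<kappa>\<close> is the rest.\<close>
    define \<kappa> where "\<kappa> = (1 - lam * Cs) * (2 - K1)"
    have "coeffs a b x0 K1 lam (lam * K2) \<kappa> c1 c2 T"
    proof (rule co)
      show "AE x in I01. lam * ((x - x0) * wderiv b x) \<le> lam * K2 * b x"
        using deg(10)
      proof eventually_elim
        case (elim x)
        then have "lam * ((x - x0) * wderiv b x) \<le> lam * (K2 * b x)" using Cs(2) by (intro mult_left_mono) auto
        then show ?case by simp
      qed
      show "lam \<noteq> 0" "0 < \<kappa>" using Cs(2) lC K1 by (auto simp: \<kappa>_def)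
      have "(1 - lam * Cs) * (2 - K1) \<le> 1 * (2 - K1)"
        using Cs(2) Cp K1 by (intro mult_right_mono) auto
      then show "\<kappa> \<le> 2 - K1" by (simp add: \<kappa>_def)
      fix u assume u: "u \<in> H1ab a b"
      define A where "A = (LINT x|I01. a x * (wderiv u x)\<^sup>2)"
      have an: "0 \<le> a x" if "x \<in> {0..1}" for x using deg(5) deg(7)[OF that] by (cases "x = x0") auto
      have A0: "0 \<le> A" unfolding A_def by (rule Bochner_Integration.integral_nonneg) (use an in auto)
      have "(lam * K2) * (LINT x|I01. (u x)\<^sup>2 / b x) \<le> (lam * K2) * (Cs * A)"
        using hc[OF u] Cs(2) d(4) unfolding A_def by (intro mult_left_mono) auto
      also have "\<dots> = K2 * (lam * Cs * A)" by simp
      also have "\<dots> \<le> (2 - K1) * (lam * Cs * A)"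
        using K Cs(2) Cp A0 by (intro mult_right_mono) auto
      also have "\<dots> = (2 - K1 - \<kappa>) * A" by (simp add: \<kappa>_def algebra_simps)
      finally show "lam * K2 * (LINT x|I01. (u x)\<^sup>2 / b x) \<le> (2 - K1 - \<kappa>) * (LINT x|I01. a x * (wderiv u x)\<^sup>2)"
        by (simp add: A_def)
    qed
    then show thesis by (rule that)
  qed
qed

theorem theorem3p1:
  fixes a b :: "real \<Rightarrow> real" and T lam x0 K1 K2 c1 c2 :: real
  assumes "T > 0"
    and "carleman_hyp a b lam x0 K1 K2"
    and "K1 < 2"
    and "c1 > 0"
    and "c2 > (SUP x\<in>{0..1}. psi_int a x0 x)"
  shows "\<exists>C>0. \<exists>s0>0. \<forall>h \<in> L2 ({0<..<T} \<times> {0<..<1}). \<forall>vT v vx.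
    v \<in> V_space T a b lam \<and> solves T a b lam h vT v \<and> space_deriv T x0 v vx \<longrightarrow>
    (\<forall>s\<ge>s0.
      (LINT (t, x)|lebesgue_on ({0<..<T} \<times> {0<..<1}).
         (s * Theta T t * a x * (vx t x)\<^sup>2
          + s ^ 3 * Theta T t ^ 3 * ((x - x0)\<^sup>2 / a x) * (v t x)\<^sup>2)
         * exp (2 * s * phi T a x0 c1 c2 t x))
      \<le> C * ((LINT (t, x)|lebesgue_on ({0<..<T} \<times> {0<..<1}).
                (h (t, x))\<^sup>2 * exp (2 * s * phi T a x0 c1 c2 t x))
             + s * c1 * (LINT t|lebesgue_on {0<..<T}.
                 a 1 * Theta T t * exp (2 * s * phi T a x0 c1 c2 t 1) * (1 - x0) * (vx t 1)\<^sup>2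
                 - a 0 * Theta T t * exp (2 * s * phi T a x0 c1 c2 t 0) * (0 - x0) * (vx t 0)\<^sup>2)))"
proof -
  obtain \<beta> \<kappa> where co: "coeffs a b x0 K1 lam \<beta> \<kappa> c1 c2 T"
    using carleman_coeffs[OF assms] by blast
  interpret coeffs a b x0 K1 lam \<beta> \<kappa> c1 c2 T by (rule co)
  obtain PB where PB: "PB > 0" "\<And>x. x \<in> {0..1} \<Longrightarrow> \<bar>ps x\<bar> \<le> PB" using psi_bound by blast
  define c where "c = 4 * T ^ 7 + 28 * T ^ 6"
  have c: "c > 0" using T by (simp add: c_def add_pos_pos)
  \<comment> \<open>The value of s at which the absorption condition holds with equality. It depends
    only on T, the weight and the coefficients, so it can be chosen before h and v.\<close>
  define s0 where "s0 = (c * PB + 4 * c1 * c) / (\<kappa> * c1\<^sup>2)"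
  have s0: "s0 > 0" unfolding s0_def using c PB(1) c1 kappa by (simp add: add_pos_pos)
  define C where "C = 2 * (2 / c1 + 1 / c1 ^ 3) / \<kappa>"
  have C: "C > 0" using c1 kappa by (simp add: C_def add_pos_pos)
  show ?thesis
  proof (rule exI[of _ C], rule conjI[OF C], rule exI[of _ s0], rule conjI[OF s0], intro ballI allI impI)
    fix h vT v vx s
    assume hL: "h \<in> L2 ({0<..<T} \<times> {0<..<1})"
      and H: "v \<in> V_space T a b lam \<and> solves T a b lam h vT v \<and> space_deriv T x0 v vx"
      and s: "s0 \<le> s"
    obtain vt where vt: "vt \<in> bochner_L2 T XH NH" "weak_time_deriv T XH NH v vt"
      "AE t in lebesgue_on {0<..<T}. AE x in I01. vt t x + flux_deriv a (v t) x + lam / b x * v t x = h (t, x)"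
      using H unfolding solves_def by blast
    interpret solution a b x0 K1 lam \<beta> \<kappa> c1 c2 T h v vt
      by unfold_locales (use H vt in \<open>auto simp: V_space_def bochner_H1_def solves_def\<close>)
    have "c * PB + 4 * c1 * c = \<kappa> * c1\<^sup>2 * s0" using kappa c1 by (simp add: s0_def)
    also have "\<dots> \<le> \<kappa> * c1\<^sup>2 * s" using s kappa c1 by (intro mult_left_mono) auto
    finally have large: "(4 * T ^ 7 + 28 * T ^ 6) * PB + 4 * c1 * (4 * T ^ 7 + 28 * T ^ 6) \<le> \<kappa> * c1\<^sup>2 * s"
      by (simp add: c_def)
    have "s > 0" using s s0 by linarith
    from carleman_estimate[OF this hL _ PB(2) large, of vx] H
    show "(LINT (t, x)|lebesgue_on ({0<..<T} \<times> {0<..<1}).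
         (s * Theta T t * a x * (vx t x)\<^sup>2
          + s ^ 3 * Theta T t ^ 3 * ((x - x0)\<^sup>2 / a x) * (v t x)\<^sup>2)
         * exp (2 * s * phi T a x0 c1 c2 t x))
      \<le> C * ((LINT (t, x)|lebesgue_on ({0<..<T} \<times> {0<..<1}).
                (h (t, x))\<^sup>2 * exp (2 * s * phi T a x0 c1 c2 t x))
             + s * c1 * (LINT t|lebesgue_on {0<..<T}.
                 a 1 * Theta T t * exp (2 * s * phi T a x0 c1 c2 t 1) * (1 - x0) * (vx t 1)\<^sup>2
                 - a 0 * Theta T t * exp (2 * s * phi T a x0 c1 c2 t 0) * (0 - x0) * (vx t 0)\<^sup>2))"
      unfolding C_def by blast
  qed
qed

end
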